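(* Let $n\ge1$, $0<p,q\le\infty$ and $s\in\mathbb R$ with $p\neq q$. Then the Triebel-Lizorkin space $\mathscr F_{pq}^s(\mathbb R^n)$ is not a classical interpolation space of any pair of Besov spaces. That is, in both of the usual formulations: (a) (categorical) there are no interpolation functor $\mathfrak F:\mathfrak C_2\to\mathfrak C_1$ and $0<p_0,p_1,q_0,q_1\le\infty$, $s_0,s_1\in\mathbb R$ such that $\mathscr F_{pq}^s(\mathbb R^n)=\mathfrak F\big(\mathscr B_{p_0q_0}^{s_0}(\mathbb R^n),\mathscr B_{p_1q_1}^{s_1}(\mathbb R^n)\big)$; (b) (set-theoretical) there are no $0<p_0,p_1,q_0,q_1\le\infty$ and $s_0,s_1\in\mathbb R$ such that $\mathscr F_{pq}^s(\mathbb R^n)$ is a set-theoretical interpolation space of $\big(\mathscr B_{p_0q_0}^{s_0}(\mathbb R^n),\mathscr B_{p_1q_1}^{s_1}(\mathbb R^n)\big)$.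
   Context: Function spaces. The Fourier transform is $\hat f(\xi)=\int f(x)e^{-2\pi i x\cdot\xi}\,dx$. A Littlewood-Paley family is a sequence $\phi=(\phi_j)_{j=0}^\infty$ of Schwartz functions on $\mathbb R^n$ such that $\operatorname{supp}\hat\phi_0\subset B(0,2)$ (open ball), $\hat\phi_0\equiv1$ in a neighborhood of $\overline{B(0,1)}$, and $\hat\phi_j(\xi)=\hat\phi_0(2^{-j}\xi)-\hat\phi_0(2^{1-j}\xi)$ for $j\ge1$. For $0<p,q\le\infty$ and $s\in\mathbb R$ (usual modifications when an exponent is $\infty$): $$\|f\|_{\mathscr B_{pq}^s(\phi)}:=\Big(\sum_{j=0}^\infty 2^{jsq}\|\phi_j\ast f\|_{L^p(\mathbb R^n)}^q\Big)^{1/q},$$ $$\|f\|_{\mathscr F_{pq}^s(\phi)}:=\Big(\int_{\mathbb R^n}\Big(\sum_{j=0}^\infty|2^{js}\phi_j\ast f(x)|^q\Big)^{p/q}dx\Big)^{1/p}\quad(p<\infty),$$ $$\|f\|_{\mathscr F_{\infty q}^s(\phi)}:=\sup_{x\in\mathbb R^n,\,J\in\mathbb Z}2^{Jn/q}\big\|(2^{js}\phi_j\ast f)_{j=\max(J,0)}^\infty\big\|_{L^q(B(x,2^{-J});\ell^q)}.$$ For $\mathscr A\in\{\mathscr B,\mathscr F\}$, $\mathscr A_{pq}^s(\mathbb R^n)=\{f\in\mathscr S'(\mathbb R^n):\|f\|_{\mathscr A_{pq}^s(\phi)}<\infty\}$; different choices of $\phi$ give equivalent (quasi-)norms. Interpolation.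 $\mathfrak C_1$ is the category of complex quasi-Banach spaces with bounded linear maps as morphisms. A pair $(X_0,X_1)$ of quasi-Banach spaces is compatible if the sum space $X_0+X_1$ is a well-defined quasi-Banach space (for Besov spaces, the sum is taken inside $\mathscr S'(\mathbb R^n)$). $\mathfrak C_2$ is the category whose objects are compatible pairs and whose morphisms $(X_0,X_1)\to(Y_0,Y_1)$ are the bounded linear maps $T:X_0+X_1\to Y_0+Y_1$ such that $T|_{X_i}:X_i\to Y_i$ is bounded linear for $i=0,1$ (called admissible operators). An interpolation functor is a functor $\mathfrak F:\mathfrak C_2\to\mathfrak C_1$ such that (1) for every compatible pair, $X_0\cap X_1\subseteq\mathfrak F(X_0,X_1)\subseteq X_0+X_1$ with both inclusions being (continuous) embeddings; (2) for every morphism $T:(X_0,X_1)\to(Y_0,Y_1)$ of $\mathfrak C_2$, $\mathfrak F(T)=T|_{\mathfrak F(X_0,X_1)}$. A quasi-Banach space $X$ is a set-theoretical interpolation space of a compatible pair $(X_0,X_1)$ if $X_0\cap X_1\subseteq X\subseteq X_0+X_1$ with both inclusions being (continuous) embeddings, and for every admissible operator $T$ from $(X_0,X_1)$ to itself, $T|_X:X\to X$ is bounded. *)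

theory Defs
  imports "HOL-Analysis.Analysis" "HOL-Probability.Essential_Supremum" "HOL-Algebra.Module"
    "HOL-Library.FuncSet"
begin

section \<open>Quasi-Banach spaces and interpolation\<close>

definition complex_ring :: "complex ring" where
  "complex_ring = \<lparr>carrier = UNIV, mult = (*), one = 1, zero = 0, add = (+)\<rparr>"

text \<open>The fields \<open>mult\<close> and \<open>one\<close> that \<^type>\<open>module_ext\<close> inherits from
  the record of rings carry no information; no axiom below mentions them.\<close>

record 'u qspace = "(complex, 'u) module" +
  qnorm :: "'u \<Rightarrow> real"

definition quasi_banach :: "'u qspace \<Rightarrow> bool" where
  "quasi_banach X \<longleftrightarrow>
     module complex_ring X \<and>
     (\<forall>x\<in>carrier X. 0 \<le> qnorm X x \<and> (qnorm X x = 0 \<longleftrightarrow> x = \<zero>\<^bsub>X\<^esub>)) \<and>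
     (\<forall>c. \<forall>x\<in>carrier X. qnorm X (c \<odot>\<^bsub>X\<^esub> x) = cmod c * qnorm X x) \<and>
     (\<exists>K. \<forall>x\<in>carrier X. \<forall>y\<in>carrier X. qnorm X (x \<oplus>\<^bsub>X\<^esub> y) \<le> K * (qnorm X x + qnorm X y)) \<and>
     (\<forall>\<sigma>::nat \<Rightarrow> 'u. range \<sigma> \<subseteq> carrier X \<and>
          (\<forall>e>0. \<exists>N. \<forall>k\<ge>N. \<forall>m\<ge>N. qnorm X (\<sigma> k \<ominus>\<^bsub>X\<^esub> \<sigma> m) < e) \<longrightarrow>
        (\<exists>l\<in>carrier X. (\<lambda>k. qnorm X (\<sigma> k \<ominus>\<^bsub>X\<^esub> l)) \<longlonglongrightarrow> 0))"

definition linear_subspace ::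
    "(complex, 'u, 'm) module_scheme \<Rightarrow> (complex, 'u, 'k) module_scheme \<Rightarrow> bool" where
  "linear_subspace X V \<longleftrightarrow>
     carrier X \<subseteq> carrier V \<and> \<zero>\<^bsub>X\<^esub> = \<zero>\<^bsub>V\<^esub> \<and>
     (\<forall>x\<in>carrier X. \<forall>y\<in>carrier X. x \<oplus>\<^bsub>X\<^esub> y = x \<oplus>\<^bsub>V\<^esub> y) \<and>
     (\<forall>c. \<forall>x\<in>carrier X. c \<odot>\<^bsub>X\<^esub> x = c \<odot>\<^bsub>V\<^esub> x)"

definition continuously_embedded :: "'u qspace \<Rightarrow> 'u qspace \<Rightarrow> bool" where
  "continuously_embedded X Y \<longleftrightarrow>
     linear_subspace X Y \<and> (\<exists>C. \<forall>x\<in>carrier X. qnorm Y x \<le> C * qnorm X x)"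

text \<open>Equality of (quasi-)normed spaces in the sense usual for function spaces: the same vector
  space with equivalent quasi-norms.\<close>

definition same_space :: "'u qspace \<Rightarrow> 'u qspace \<Rightarrow> bool" where
  "same_space X Y \<longleftrightarrow> continuously_embedded X Y \<and> continuously_embedded Y X"

definition bounded_op :: "'u qspace \<Rightarrow> 'u qspace \<Rightarrow> ('u \<Rightarrow> 'u) \<Rightarrow> bool" where
  "bounded_op X Y T \<longleftrightarrow>
     T \<in> carrier X \<rightarrow> carrier Y \<and>
     (\<forall>x\<in>carrier X. \<forall>y\<in>carrier X. T (x \<oplus>\<^bsub>X\<^esub> y) = T x \<oplus>\<^bsub>Y\<^esub> T y) \<and>
     (\<forall>c. \<forall>x\<in>carrier X. T (c \<odot>\<^bsub>X\<^esub> x) = c \<odot>\<^bsub>Y\<^esub> T x) \<and>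
     (\<exists>C. \<forall>x\<in>carrier X. qnorm Y (T x) \<le> C * qnorm X x)"

definition normed_subspace ::
    "(complex, 'u, 'm) module_scheme \<Rightarrow> 'u set \<Rightarrow> ('u \<Rightarrow> real) \<Rightarrow> 'u qspace" where
  "normed_subspace V A N =
     \<lparr>carrier = A, mult = mult V, one = one V, zero = zero V, add = add V, smult = smult V,
      qnorm = N\<rparr>"

text \<open>A pair carries the vector space in which the sum of its two members is formed.\<close>

record 'u qpair =
  ambient :: "(complex, 'u) module"
  space0 :: "'u qspace"
  space1 :: "'u qspace"

definition sum_space :: "'u qpair \<Rightarrow> 'u qspace" where
  "sum_space P = normed_subspace (ambient P)
     {x \<oplus>\<^bsub>ambient P\<^esub> y | x y. x \<in> carrier (space0 P) \<and> y \<in> carrier (space1 P)}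
     (\<lambda>z. Inf {qnorm (space0 P) x + qnorm (space1 P) y | x y.
        x \<in> carrier (space0 P) \<and> y \<in> carrier (space1 P) \<and> z = x \<oplus>\<^bsub>ambient P\<^esub> y})"

definition inter_space :: "'u qpair \<Rightarrow> 'u qspace" where
  "inter_space P = normed_subspace (ambient P)
     (carrier (space0 P) \<inter> carrier (space1 P))
     (\<lambda>z. max (qnorm (space0 P) z) (qnorm (space1 P) z))"

definition compatible :: "'u qpair \<Rightarrow> bool" where
  "compatible P \<longleftrightarrow>
     module complex_ring (ambient P) \<and>
     quasi_banach (space0 P) \<and> linear_subspace (space0 P) (ambient P) \<and>
     quasi_banach (space1 P) \<and> linear_subspace (space1 P) (ambient P) \<and>
     quasi_banach (sum_space P)"

definition admissible :: "'u qpair \<Rightarrow> 'u qpair \<Rightarrow> ('u \<Rightarrow> 'u) \<Rightarrow> bool" where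
  "admissible P Q T \<longleftrightarrow>
     bounded_op (sum_space P) (sum_space Q) T \<and>
     bounded_op (space0 P) (space0 Q) T \<and> bounded_op (space1 P) (space1 Q) T"

text \<open>The two categories, with objects whose points lie in an arbitrary type \<open>'u\<close>. Since a HOL
  function has no domain of its own, morphisms are extensional: two of them that agree on their
  domain are equal.\<close>

definition C1_hom :: "'u qspace \<Rightarrow> 'u qspace \<Rightarrow> ('u \<Rightarrow> 'u) set" where
  "C1_hom X Y = {T \<in> extensional (carrier X). bounded_op X Y T}"

definition C2_hom :: "'u qpair \<Rightarrow> 'u qpair \<Rightarrow> ('u \<Rightarrow> 'u) set" where
  "C2_hom P Q = {T \<in> extensional (carrier (sum_space P)). admissible P Q T}"

definition interpolation_functor ::
    "('u qpair \<Rightarrow> 'u qspace) \<Rightarrow> ('u qpair \<Rightarrow> 'u qpair \<Rightarrow> ('u \<Rightarrow> 'u) \<Rightarrow> 'u \<Rightarrow> 'u) \<Rightarrow> bool" where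
  "interpolation_functor Fo Fm \<longleftrightarrow>
     (\<forall>P. compatible P \<longrightarrow> quasi_banach (Fo P)) \<and>
     (\<forall>P Q. compatible P \<and> compatible Q \<longrightarrow>
        (\<forall>T\<in>C2_hom P Q. Fm P Q T \<in> C1_hom (Fo P) (Fo Q))) \<and>
     (\<forall>P. compatible P \<longrightarrow>
        Fm P P (\<lambda>x\<in>carrier (sum_space P). x) = (\<lambda>x\<in>carrier (Fo P). x)) \<and>
     (\<forall>P Q R. compatible P \<and> compatible Q \<and> compatible R \<longrightarrow>
        (\<forall>T\<in>C2_hom P Q. \<forall>S\<in>C2_hom Q R.
           Fm P R (compose (carrier (sum_space P)) S T) =
           compose (carrier (Fo P)) (Fm Q R S) (Fm P Q T))) \<and>
     (\<forall>P. compatible P \<longrightarrow>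
        continuously_embedded (inter_space P) (Fo P) \<and>
        continuously_embedded (Fo P) (sum_space P)) \<and>
     (\<forall>P Q. compatible P \<and> compatible Q \<longrightarrow>
        (\<forall>T\<in>C2_hom P Q. Fm P Q T = restrict T (carrier (Fo P))))"

definition set_interpolation_space :: "'u qspace \<Rightarrow> 'u qpair \<Rightarrow> bool" where
  "set_interpolation_space X P \<longleftrightarrow>
     quasi_banach X \<and> compatible P \<and>
     continuously_embedded (inter_space P) X \<and> continuously_embedded X (sum_space P) \<and>
     (\<forall>T. admissible P P T \<longrightarrow> bounded_op X X T)"

text \<open>Copies of spaces along an injective map into another type.\<close>

definition image_module ::
    "('v \<Rightarrow> 'u) \<Rightarrow> (complex, 'v, 'm) module_scheme \<Rightarrow> (complex, 'u) module" where
  "image_module \<iota> V = (let \<kappa> = inv_into (carrier V) \<iota> in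
     \<lparr>carrier = \<iota> ` carrier V,
      mult = (\<lambda>a b. \<iota> (\<kappa> a \<otimes>\<^bsub>V\<^esub> \<kappa> b)), one = \<iota> \<one>\<^bsub>V\<^esub>,
      zero = \<iota> \<zero>\<^bsub>V\<^esub>, add = (\<lambda>a b. \<iota> (\<kappa> a \<oplus>\<^bsub>V\<^esub> \<kappa> b)),
      smult = (\<lambda>c a. \<iota> (c \<odot>\<^bsub>V\<^esub> \<kappa> a))\<rparr>)"

definition image_space :: "('v \<Rightarrow> 'u) \<Rightarrow> 'v qspace \<Rightarrow> 'u qspace" where
  "image_space \<iota> X = normed_subspace (image_module \<iota> X) (\<iota> ` carrier X)
     (\<lambda>a. qnorm X (inv_into (carrier X) \<iota> a))"

definition image_pair :: "('v \<Rightarrow> 'u) \<Rightarrow> 'v qpair \<Rightarrow> 'u qpair" where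
  "image_pair \<iota> P =
     \<lparr>ambient = image_module \<iota> (ambient P),
      space0 = image_space \<iota> (space0 P), space1 = image_space \<iota> (space1 P)\<rparr>"


section \<open>Schwartz functions and tempered distributions\<close>

primrec iter_partial :: "'n list \<Rightarrow> (real^'n \<Rightarrow> complex) \<Rightarrow> real^'n \<Rightarrow> complex" where
  "iter_partial [] f = f"
| "iter_partial (i # is) f =
     (\<lambda>x. frechet_derivative (iter_partial is f) (at x) (axis i 1))"

definition schwartz :: "(real^'n \<Rightarrow> complex) set" where
  "schwartz = {f. \<forall>is. (\<forall>x. iter_partial is f differentiable (at x)) \<and>
     (\<forall>k::nat. bounded (range (\<lambda>x. (1 + norm x) ^ k *\<^sub>R iter_partial is f x)))}"

text \<open>Seminorms, increasing in \<open>N\<close>, that generate the usual topology of \<^const>\<open>schwartz\<close>.\<close>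

definition schwartz_seminorm :: "nat \<Rightarrow> (real^'n \<Rightarrow> complex) \<Rightarrow> real" where
  "schwartz_seminorm N f =
     (SUP (is, x)\<in>{is. length is \<le> N} \<times> UNIV. (1 + norm x) ^ N * cmod (iter_partial is f x))"

type_synonym 'n functional = "(real^'n \<Rightarrow> complex) \<Rightarrow> complex"

text \<open>Continuous linear functionals on \<^const>\<open>schwartz\<close>. Requiring the value \<open>0\<close> off
  \<^const>\<open>schwartz\<close> makes equality of functionals the equality of distributions.\<close>

definition tempered :: "'n::finite functional set" where
  "tempered = {u. (\<forall>f. f \<notin> schwartz \<longrightarrow> u f = 0) \<and>
     (\<forall>f\<in>schwartz. \<forall>g\<in>schwartz. u (\<lambda>x. f x + g x) = u f + u g) \<and>
     (\<forall>c. \<forall>f\<in>schwartz. u (\<lambda>x. c * f x) = c * u f) \<and>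
     (\<exists>C N. \<forall>f\<in>schwartz. cmod (u f) \<le> C * schwartz_seminorm N f)}"

definition tempered_module :: "(complex, 'n::finite functional) module" where
  "tempered_module =
     \<lparr>carrier = tempered, mult = undefined, one = undefined,
      zero = (\<lambda>f. 0), add = (\<lambda>u v f. u f + v f), smult = (\<lambda>c u f. c * u f)\<rparr>"

definition fourier :: "(real^'n \<Rightarrow> complex) \<Rightarrow> real^'n \<Rightarrow> complex" where
  "fourier f \<xi> = (LINT x|lborel. f x * exp (- 2 * pi * \<i> * complex_of_real (x \<bullet> \<xi>)))"

definition convol :: "(real^'n \<Rightarrow> complex) \<Rightarrow> 'n functional \<Rightarrow> real^'n \<Rightarrow> complex" where
  "convol g u x = u (\<lambda>y. g (x - y))"


section \<open>Besov and Triebel-Lizorkin spaces\<close>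

definition littlewood_paley :: "(nat \<Rightarrow> real^'n \<Rightarrow> complex) \<Rightarrow> bool" where
  "littlewood_paley \<phi> \<longleftrightarrow>
     (\<forall>j. \<phi> j \<in> schwartz) \<and>
     closure {\<xi>. fourier (\<phi> 0) \<xi> \<noteq> 0} \<subseteq> ball 0 2 \<and>
     (\<exists>U. open U \<and> cball 0 1 \<subseteq> U \<and> (\<forall>\<xi>\<in>U. fourier (\<phi> 0) \<xi> = 1)) \<and>
     (\<forall>j\<ge>1. \<forall>\<xi>. fourier (\<phi> j) \<xi> =
        fourier (\<phi> 0) ((2 powr - real j) *\<^sub>R \<xi>) - fourier (\<phi> 0) ((2 powr (1 - real j)) *\<^sub>R \<xi>))"

text \<open>Powers with a real exponent \<open>r > 0\<close>.\<close>

definition ennpow :: "ennreal \<Rightarrow> real \<Rightarrow> ennreal" where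
  "ennpow a r = (if a = \<infinity> then \<infinity> else ennreal (enn2real a powr r))"

definition lq_norm :: "ennreal \<Rightarrow> (nat \<Rightarrow> ennreal) \<Rightarrow> ennreal" where
  "lq_norm q a =
     (if q = \<infinity> then (SUP j. a j)
      else ennpow (\<Sum>j. ennpow (a j) (enn2real q)) (1 / enn2real q))"

definition Lp_norm :: "ennreal \<Rightarrow> 'a measure \<Rightarrow> ('a \<Rightarrow> ennreal) \<Rightarrow> ennreal" where
  "Lp_norm p M g =
     (if p = \<infinity> then esssup M g
      else ennpow (\<integral>\<^sup>+x. ennpow (g x) (enn2real p) \<partial>M) (1 / enn2real p))"

definition lp_term ::
    "(nat \<Rightarrow> real^'n \<Rightarrow> complex) \<Rightarrow> real \<Rightarrow> 'n functional \<Rightarrow> nat \<Rightarrow> real^'n \<Rightarrow> ennreal" where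
  "lp_term \<phi> s f j x = ennreal (2 powr (real j * s) * cmod (convol (\<phi> j) f x))"

definition besov_norm ::
    "(nat \<Rightarrow> real^'n \<Rightarrow> complex) \<Rightarrow> ennreal \<Rightarrow> ennreal \<Rightarrow> real \<Rightarrow> 'n functional \<Rightarrow> ennreal" where
  "besov_norm \<phi> p q s f =
     lq_norm q (\<lambda>j. ennreal (2 powr (real j * s)) *
       Lp_norm p lborel (\<lambda>x. ennreal (cmod (convol (\<phi> j) f x))))"

text \<open>In the case \<open>p = \<infinity>\<close>, the exponent \<open>J n / q\<close> is \<open>0\<close> for \<open>q = \<infinity>\<close>, because
  \<^term>\<open>enn2real \<infinity> = 0\<close> and division by zero yields zero.\<close>

definition triebel_lizorkin_norm ::
    "(nat \<Rightarrow> real^'n \<Rightarrow> complex) \<Rightarrow> ennreal \<Rightarrow> ennreal \<Rightarrow> real \<Rightarrow> 'n functional \<Rightarrow> ennreal" where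
  "triebel_lizorkin_norm \<phi> p q s f =
     (if p = \<infinity> then
        (SUP (x, J)\<in>(UNIV :: (real^'n) set) \<times> (UNIV :: int set).
           ennreal (2 powr (real_of_int J * real CARD('n) / enn2real q)) *
           Lp_norm q (restrict_space lborel (ball x (2 powr - real_of_int J)))
             (\<lambda>y. lq_norm q (\<lambda>j. if max J 0 \<le> int j then lp_term \<phi> s f j y else 0)))
      else Lp_norm p lborel (\<lambda>x. lq_norm q (\<lambda>j. lp_term \<phi> s f j x)))"

definition besov_space ::
    "(nat \<Rightarrow> real^'n \<Rightarrow> complex) \<Rightarrow> ennreal \<Rightarrow> ennreal \<Rightarrow> real \<Rightarrow> 'n functional qspace" where
  "besov_space \<phi> p q s = normed_subspace tempered_module
     {f \<in> tempered. besov_norm \<phi> p q s f < \<infinity>} (\<lambda>f. enn2real (besov_norm \<phi> p q s f))"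

definition triebel_lizorkin_space ::
    "(nat \<Rightarrow> real^'n \<Rightarrow> complex) \<Rightarrow> ennreal \<Rightarrow> ennreal \<Rightarrow> real \<Rightarrow> 'n functional qspace" where
  "triebel_lizorkin_space \<phi> p q s = normed_subspace tempered_module
     {f \<in> tempered. triebel_lizorkin_norm \<phi> p q s f < \<infinity>}
     (\<lambda>f. enn2real (triebel_lizorkin_norm \<phi> p q s f))"

definition besov_pair ::
    "(nat \<Rightarrow> real^'n \<Rightarrow> complex) \<Rightarrow> ennreal \<Rightarrow> ennreal \<Rightarrow> real \<Rightarrow>
     ennreal \<Rightarrow> ennreal \<Rightarrow> real \<Rightarrow> 'n functional qpair" where
  "besov_pair \<phi> p0 q0 s0 p1 q1 s1 =
     \<lparr>ambient = tempered_module,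
      space0 = besov_space \<phi> p0 q0 s0, space1 = besov_space \<phi> p1 q1 s1\<rparr>"

end

theory Submission
  imports Defs "HOL-Probability.Characteristic_Functions" "HOL-Library.Function_Algebras"
begin

text \<open>Fix a unit vector \<open>e\<close>. The linear operator that translates the part of a distribution with
  frequencies near \<open>2 ^ j *\<^sub>R e\<close> by \<open>j *\<^sub>R e\<close> is bounded on every Besov space, because a Besov quasi-norm
  only sees the \<open>L\<^sup>p\<close> quasi-norms of the single dyadic pieces. A Triebel-Lizorkin quasi-norm sees how
  the pieces overlap. For \<open>N\<close> dyadic pieces with the same profile it is of size
  \<open>N powr (1 / q)\<close> if they sit at the same place and of size \<open>N powr (1 / p)\<close> if they are spread along
  the line spanned by \<open>e\<close>. The operator spreads pieces that were gathered, and gathers pieces spread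
  in the opposite direction; one of the two is unbounded when \<open>p \<noteq> q\<close>.

  The categorical version needs more: the Besov pair must be an object of the category, so
  that the Besov spaces and their sum have to be complete. Completeness follows from the continuous
  embedding into the tempered distributions, whose proof for exponents below \<open>1\<close> rests on Peetre's
  maximal inequality.\<close>

section \<open>Rapidly decreasing functions and the Fourier transform\<close>

text \<open>Two exact coincidences shape the argument. The transform of \<open>\<phi> 0\<close> is 1
  near \<open>e\<close> and 0 near \<open>2 *\<^sub>R e\<close>, so on a small ball around
  \<open>e\<close>, scaled by \<open>2 ^ k\<close> with k >= 1, exactly one member of the family has
  a nonzero transform, and it equals 1: dyadic blocks of the operator and of the test functions are
  computed, not estimated. The test waves are modulated but never dilated, so all have the same
  modulus, and unit spacing already makes their overlaps summable. Translating by j units multiplies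
  a Schwartz seminorm by a power of 1 + j, while the piece of a Schwartz function near frequency 2^j
  is exponentially small in j; hence the operator is defined on all tempered distributions, thus on
  both spaces of a pair and on their sum at once. The obstacle is the boundedness of convolution in
  Lp below exponent 1, false in general; it holds for a dyadic block because the block reproduces
  itself under a kernel of its own frequency scale. A functor acts on spaces with points in a type
  \<open>'u\<close>; the Besov pair enters through an injection, along which structure and operator
  are transported.\<close>

lemma lborel_integral_affine:
  fixes f :: "'a::euclidean_space \<Rightarrow> 'b::{banach, second_countable_topology}"
  assumes "c \<noteq> 0" and [measurable]: "f \<in> borel_measurable borel"
  shows "(LINT x|lborel. f x) = \<bar>c\<bar> ^ DIM('a) *\<^sub>R (LINT x|lborel. f (t + c *\<^sub>R x))"
  by (subst lborel_affine[OF assms(1), of t]) (simp add: integral_density integral_distr)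

lemma lborel_integrable_affine:
  fixes f :: "'a::euclidean_space \<Rightarrow> 'b::{banach, second_countable_topology}"
  assumes c: "c \<noteq> 0" and [measurable]: "f \<in> borel_measurable borel"
    and int: "integrable lborel f"
  shows "integrable lborel (\<lambda>x. f (t + c *\<^sub>R x))"
proof -
  have "integrable (density (distr lborel borel (\<lambda>x. t + c *\<^sub>R x)) (\<lambda>_. ennreal (\<bar>c\<bar>^DIM('a)))) f"
    using int lborel_affine[OF c, of t] by (simp add: ennreal_power)
  then show ?thesis
    using c integrable_scaleR_right[of "1 / \<bar>c\<bar> ^ DIM('a)" lborel "\<lambda>x. \<bar>c\<bar> ^ DIM('a) *\<^sub>R f (t + c *\<^sub>R x)"]
    by (subst (asm) integrable_density) (simp_all add: integrable_distr_eq)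
qed

lemma lborel_nn_integral_affine:
  fixes f :: "'a::euclidean_space \<Rightarrow> ennreal"
  assumes "c \<noteq> 0" and [measurable]: "f \<in> borel_measurable borel"
  shows "(\<integral>\<^sup>+x. f x \<partial>lborel) = ennreal (\<bar>c\<bar> ^ DIM('a)) * (\<integral>\<^sup>+x. f (t + c *\<^sub>R x) \<partial>lborel)"
  by (subst lborel_affine[OF assms(1), of t])
    (simp add: nn_integral_density nn_integral_distr nn_integral_cmult ennreal_power)

text \<open>The exponent is the dimension n plus 2: the shell between m and m + 1 lies in a ball of
  measure of order (m + 1)^n, which leaves a summable inverse square, and along a line the weight
  still decays quadratically.\<close>

definition wt :: "'a::euclidean_space \<Rightarrow> real" where
  "wt x = inverse ((1 + norm x) ^ (DIM('a) + 2))"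

lemma wt_pos: "0 < wt x"
proof -
  have "0 < 1 + norm x" by (simp add: add_pos_nonneg)
  then show ?thesis by (simp add: wt_def)
qed

lemma wt_le_1: "wt x \<le> 1"
  unfolding wt_def by (rule inverse_le_1_iff[THEN iffD2]) (rule disjI2, rule one_le_power, simp)

lemma wt_continuous: "continuous_on S wt"
  unfolding wt_def by (intro continuous_intros) (auto simp: add_nonneg_eq_0_iff)

lemma wt_measurable [measurable]: "wt \<in> borel_measurable borel"
  using wt_continuous[of UNIV] by (rule borel_measurable_continuous_onI)

text \<open>Sum over the shells \<open>m \<le> norm x < m + 1\<close>.\<close>

lemma wt_integrable: "integrable lborel (wt :: 'a::euclidean_space \<Rightarrow> real)"
proof -
  let ?n = "DIM('a)"
  define u where "u = measure lborel (ball (0::'a) 1)"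
  have [simp]: "emeasure lborel (ball (0::'a) (real m + 1)) = ennreal (u * (real m + 1) ^ ?n)" for m :: nat
    unfolding u_def using content_ball_conv_unit_ball[of "real m + 1" "0::'a"]
    by (subst emeasure_eq_measure2) (auto simp: fmeasurable_def mult.commute intro!: emeasure_lborel_ball_finite[unfolded infinity_ennreal_def])
  have u0: "0 \<le> u" by (simp add: u_def)
  define F where "F = (\<lambda>m (x::'a). ennreal (inverse ((1 + real m) ^ (?n + 2))) * indicator (ball 0 (real m + 1)) x)"
  have "(\<integral>\<^sup>+x. ennreal (wt (x::'a)) \<partial>lborel)
      \<le> (\<integral>\<^sup>+x. (\<Sum>m. F m x) \<partial>lborel)"
  proof (rule nn_integral_mono)
    fix x :: 'a
    define m where "m = nat \<lfloor>norm x\<rfloor>"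
    have m: "real m \<le> norm x" "norm x < real m + 1"
      unfolding m_def by (simp_all)
    have "wt x \<le> inverse ((1 + real m) ^ (?n + 2))"
      unfolding wt_def using m by (intro le_imp_inverse_le power_mono) auto
    then have "ennreal (wt x) \<le> F m x"
      using m by (simp add: ennreal_leI F_def)
    also have "\<dots> = (\<Sum>k\<in>{m}. F k x)"
      by simp
    also have "\<dots> \<le> (\<Sum>k. F k x)"
      by (rule sum_le_suminf) auto
    finally show "ennreal (wt x) \<le> (\<Sum>k. F k x)" .
  qed
  also have "\<dots> = (\<Sum>m. \<integral>\<^sup>+x. F m x \<partial>lborel)"
    unfolding F_def by (intro nn_integral_suminf borel_measurable_times_ennreal borel_measurable_const borel_measurable_indicator) simp
  also have "\<dots> = (\<Sum>m. ennreal (inverse ((1 + real m) ^ (?n + 2))) * ennreal (u * (real m + 1) ^ ?n))"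
    unfolding F_def by (subst nn_integral_cmult_indicator) auto
  also have "\<dots> = (\<Sum>m. ennreal (u * inverse ((real (Suc m))\<^sup>2)))"
  proof (rule arg_cong[where f=suminf], rule ext)
    fix m :: nat
    have "inverse ((1 + real m) ^ (?n + 2)) * (u * (real m + 1) ^ ?n) = u * inverse ((real (Suc m))\<^sup>2)"
    proof -
      have "inverse (P ^ (?n + 2)) * (u * P ^ ?n) = u * inverse (P\<^sup>2)" if "0 < P" for P :: real
        using that by (simp add: power_add power2_eq_square field_simps)
      from this[of "1 + real m"] show ?thesis by (simp add: add.commute)
    qed
    then show "ennreal (inverse ((1 + real m) ^ (?n + 2))) * ennreal (u * (real m + 1) ^ ?n) = ennreal (u * inverse ((real (Suc m))\<^sup>2))"
      using u0 by (metis ennreal_mult' ennreal_mult'' mult_nonneg_nonneg zero_le_power add_nonneg_nonneg of_nat_0_le_iff zero_le_one)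
  qed
  also have "\<dots> < \<infinity>"
  proof -
    have "summable (\<lambda>m. u * inverse ((real (Suc m))\<^sup>2))"
      using inverse_power_summable[of 2, where 'a=real] by (intro summable_mult) (simp add: summable_Suc_iff[of "\<lambda>n. inverse ((real n)^2)"] del: of_nat_Suc)
    then show ?thesis
      using u0 by (subst suminf_ennreal2) auto
  qed
  finally show ?thesis
    by (intro integrableI_bounded) (auto simp: wt_pos less_imp_le)
qed

text \<open>The triangle inequality plus a nonnegative product term. This submultiplicativity moves
  polynomial weights through every convolution and translation below.\<close>

lemma one_plus_norm_triangle: "1 + norm (x::'a::real_normed_vector) \<le> (1 + norm (x - y)) * (1 + norm y)"
proof -
  have "norm x \<le> norm (x - y) + norm y" using norm_triangle_ineq[of "x - y" y] by simp
  then show ?thesis using mult_nonneg_nonneg[OF norm_ge_zero norm_ge_zero, of "x - y" y]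
    unfolding distrib_left distrib_right by linarith
qed

text \<open>Decay without smoothness: enough for integrability, Fubini, convolution and injectivity
  of the Fourier transform, and stable under these operations without any differentiation.\<close>

definition rapid :: "('a::euclidean_space \<Rightarrow> complex) \<Rightarrow> bool" where
  "rapid f \<longleftrightarrow> continuous_on UNIV f \<and> (\<forall>k::nat. \<exists>C. \<forall>x. (1 + norm x) ^ k * cmod (f x) \<le> C)"

lemma rapid_continuous: "rapid f \<Longrightarrow> continuous_on S f"
  by (auto simp: rapid_def intro: continuous_on_subset)

lemma rapid_measurable: "rapid f \<Longrightarrow> f \<in> borel_measurable borel"
  by (auto simp: rapid_def intro: borel_measurable_continuous_onI)

lemma rapid_bound:
  assumes "rapid f"
  obtains C where "0 < C" "\<And>x. (1 + norm x) ^ k * cmod (f x) \<le> C"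
proof -
  obtain C where "\<forall>x. (1 + norm x) ^ k * cmod (f x) \<le> C" using assms by (auto simp: rapid_def)
  then have "(1 + norm x) ^ k * cmod (f x) \<le> max C 1" for x by (simp add: max.coboundedI1)
  then show ?thesis using that[of "max C 1"] by auto
qed

lemma rapid_le_wt:
  fixes f :: "'a::euclidean_space \<Rightarrow> complex"
  assumes "rapid f"
  obtains C where "0 < C" "\<And>x. (1 + norm x) ^ k * cmod (f x) \<le> C * wt x"
proof -
  obtain C where C: "0 < C" "\<And>x. (1 + norm x) ^ (DIM('a) + 2 + k) * cmod (f x) \<le> C"
    using rapid_bound[OF assms] by blast
  have "(1 + norm x) ^ k * cmod (f x) \<le> C * wt x" for x
  proof -
    have "0 < (1 + norm x) ^ (DIM('a) + 2)" by (simp add: add_pos_nonneg)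
    then show ?thesis using C(2)[of x]
      by (simp add: wt_def power_add pos_le_divide_eq divide_inverse[symmetric] mult_ac del: power_Suc add_2_eq_Suc' add_2_eq_Suc)
  qed
  then show ?thesis using that C by blast
qed

lemma rapid_bounded:
  assumes "rapid f" obtains C where "0 < C" "\<And>x. cmod (f x) \<le> C"
  using rapid_bound[OF assms, of 0] by auto

lemma rapid_integrable_weight:
  assumes "rapid f"
  shows "integrable lborel (\<lambda>x. (1 + norm x) ^ k * cmod (f x))"
proof -
  obtain C where C: "0 < C" "\<And>x. (1 + norm x) ^ k * cmod (f x) \<le> C * wt x"
    using rapid_le_wt[OF assms] by blast
  have [measurable]: "f \<in> borel_measurable borel" using assms by (rule rapid_measurable)
  show ?thesis
    by (rule Bochner_Integration.integrable_bound[OF integrable_mult_right[OF wt_integrable, of C]])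
      (use C in \<open>auto intro!: AE_I2 simp: abs_mult wt_pos less_imp_le abs_of_pos\<close>)
qed

lemma rapid_integrable: "rapid f \<Longrightarrow> integrable lborel f"
  using rapid_integrable_weight[of f 0] by (simp add: integrable_norm_iff rapid_measurable)

lemma rapid_mult_bounded:
  assumes "rapid f" "continuous_on UNIV g" "\<And>x. cmod (g x) \<le> B"
  shows "rapid (\<lambda>x. g x * f x)"
  unfolding rapid_def
proof (intro conjI allI)
  show "continuous_on UNIV (\<lambda>x. g x * f x)"
    using assms by (intro continuous_intros) (auto simp: rapid_continuous)
  fix k
  obtain C where C: "0 < C" "\<And>x. (1 + norm x) ^ k * cmod (f x) \<le> C"
    using rapid_bound[OF assms(1)] by blast
  have "(1 + norm x) ^ k * cmod (g x * f x) \<le> B * C" for x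
  proof -
    have "cmod (g x) * ((1 + norm x) ^ k * cmod (f x)) \<le> B * C"
      using C assms(3)[of x] by (intro mult_mono) (auto intro: order_trans[OF norm_ge_zero])
    then show ?thesis by (simp add: norm_mult mult_ac)
  qed
  then show "\<exists>C. \<forall>x. (1 + norm x) ^ k * cmod (g x * f x) \<le> C" by blast
qed

lemma rapid_cmult: "rapid f \<Longrightarrow> rapid (\<lambda>x. c * f x)"
  using rapid_mult_bounded[of f "\<lambda>_. c" "cmod c"] by (simp add: continuous_intros)

lemma rapid_zero: "rapid (\<lambda>x. 0)"
  by (auto simp: rapid_def)

lemma rapid_add:
  assumes "rapid f" "rapid g" shows "rapid (\<lambda>x. f x + g x)"
  unfolding rapid_def
proof (intro conjI allI)
  show "continuous_on UNIV (\<lambda>x. f x + g x)"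
    using assms by (intro continuous_intros) (auto simp: rapid_continuous)
  fix k
  obtain C where C: "0 < C" "\<And>x. (1 + norm x) ^ k * cmod (f x) \<le> C"
    using rapid_bound[OF assms(1)] by blast
  obtain D where D: "0 < D" "\<And>x. (1 + norm x) ^ k * cmod (g x) \<le> D"
    using rapid_bound[OF assms(2)] by blast
  have "(1 + norm x) ^ k * cmod (f x + g x) \<le> C + D" for x
  proof -
    have "(1 + norm x) ^ k * cmod (f x + g x) \<le> (1 + norm x) ^ k * (cmod (f x) + cmod (g x))"
      by (intro mult_left_mono norm_triangle_ineq) simp
    then show ?thesis using C(2)[of x] D(2)[of x] by (simp add: distrib_left)
  qed
  then show "\<exists>C. \<forall>x. (1 + norm x) ^ k * cmod (f x + g x) \<le> C" by blast
qed

lemma rapid_diff: "rapid f \<Longrightarrow> rapid g \<Longrightarrow> rapid (\<lambda>x. f x - g x)"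
  using rapid_add[of f "\<lambda>x. - 1 * g x"] rapid_cmult[of g "-1"] by simp

lemma rapid_sum: "(\<And>i. i \<in> I \<Longrightarrow> rapid (f i)) \<Longrightarrow> rapid (\<lambda>x. \<Sum>i\<in>I. f i x)"
  by (induction I rule: infinite_finite_induct) (auto simp: rapid_zero intro: rapid_add)

lemma rapid_affine:
  assumes "rapid f" and c: "c \<noteq> 0" shows "rapid (\<lambda>x. f (t + c *\<^sub>R x))"
  unfolding rapid_def
proof (intro conjI allI)
  show "continuous_on UNIV (\<lambda>x. f (t + c *\<^sub>R x))"
    using assms(1) by (intro continuous_on_compose2[OF rapid_continuous[OF assms(1), of UNIV]] continuous_intros) auto
  fix k
  obtain C where C: "0 < C" "\<And>x. (1 + norm x) ^ k * cmod (f x) \<le> C"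
    using rapid_bound[OF assms(1)] by blast
  \<comment> \<open>The maximum undoes the dilation whether it expands or contracts;
    \<open>1 + norm t\<close> undoes the translation.\<close>
  define A where "A = max 1 (1 / \<bar>c\<bar>) * (1 + norm t)"
  have A: "1 + norm x \<le> A * (1 + norm (t + c *\<^sub>R x))" for x
  proof -
    have m: "1 / \<bar>c\<bar> \<le> max 1 (1 / \<bar>c\<bar>)" "1 \<le> max 1 (1 / \<bar>c\<bar>)" by auto
    have "norm x = (1 / \<bar>c\<bar>) * norm (c *\<^sub>R x)" using c by simp
    also have "\<dots> \<le> max 1 (1 / \<bar>c\<bar>) * norm (c *\<^sub>R x)" by (intro mult_right_mono) auto
    finally have "1 + norm x \<le> max 1 (1 / \<bar>c\<bar>) * (1 + norm (c *\<^sub>R x))"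
      using m by (simp add: distrib_left)
    also have "\<dots> \<le> max 1 (1 / \<bar>c\<bar>) * ((1 + norm (c *\<^sub>R x - (- t))) * (1 + norm (- t)))"
      by (intro mult_left_mono one_plus_norm_triangle) auto
    finally show ?thesis by (simp add: A_def mult_ac add.commute)
  qed
  have A0: "0 \<le> A" by (auto simp: A_def max_def)
  have "(1 + norm x) ^ k * cmod (f (t + c *\<^sub>R x)) \<le> A ^ k * C" for x
  proof -
    have "(1 + norm x) ^ k \<le> (A * (1 + norm (t + c *\<^sub>R x))) ^ k"
      by (intro power_mono A) simp
    then have "(1 + norm x) ^ k * cmod (f (t + c *\<^sub>R x)) \<le> (A * (1 + norm (t + c *\<^sub>R x))) ^ k * cmod (f (t + c *\<^sub>R x))"
      by (rule mult_right_mono) simp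
    also have "\<dots> = A ^ k * ((1 + norm (t + c *\<^sub>R x)) ^ k * cmod (f (t + c *\<^sub>R x)))"
      by (simp add: power_mult_distrib)
    also have "\<dots> \<le> A ^ k * C" using A0 by (intro mult_left_mono C) auto
    finally show ?thesis .
  qed
  then show "\<exists>C. \<forall>x. (1 + norm x) ^ k * cmod (f (t + c *\<^sub>R x)) \<le> C" by blast
qed

lemma rapid_uminus: "rapid f \<Longrightarrow> rapid (\<lambda>x. f (- x))"
  using rapid_affine[of f "-1" 0] by simp

lemma rapid_shift: "rapid f \<Longrightarrow> rapid (\<lambda>x. f (x - t))"
  using rapid_affine[of f 1 "-t"] by simp

lemma rapid_reflect: "rapid f \<Longrightarrow> rapid (\<lambda>x. f (t - x))"
  using rapid_affine[of f "-1" t] by simp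

lemma lborel_integral_shift:
  fixes f :: "'a::euclidean_space \<Rightarrow> 'b::{banach, second_countable_topology}"
  assumes "f \<in> borel_measurable borel"
  shows "(LINT x|lborel. f (x - t)) = (LINT x|lborel. f x)"
  using lborel_integral_affine[of 1 f "-t"] assms by simp

lemma lborel_integral_reflect:
  fixes f :: "'a::euclidean_space \<Rightarrow> 'b::{banach, second_countable_topology}"
  assumes "f \<in> borel_measurable borel"
  shows "(LINT x|lborel. f (t - x)) = (LINT x|lborel. f x)"
  using lborel_integral_affine[of "-1" f t] assms by simp

text \<open>Joint continuity supplies measurability on the product, and \<open>v\<close> bounds the
  inner integrals of the modulus: these are the two hypotheses of Fubini's theorem.\<close>

lemma continuous_Fubini:
  fixes f :: "'a::euclidean_space \<Rightarrow> 'b::euclidean_space \<Rightarrow> complex"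
  assumes cont: "continuous_on UNIV (\<lambda>z. f (fst z) (snd z))"
    and int: "\<And>y. integrable lborel (f y)"
    and dom: "\<And>y. (LINT x|lborel. cmod (f y x)) \<le> v y" and v: "integrable lborel v"
  shows "(LINT x|lborel. LINT y|lborel. f y x) = (LINT y|lborel. LINT x|lborel. f y x)"
proof -
  have m: "(\<lambda>z. f (fst z) (snd z)) \<in> borel_measurable (lborel \<Otimes>\<^sub>M lborel)"
    using borel_measurable_continuous_onI[OF cont] by (simp add: lborel_prod)
  have m2: "(\<lambda>(y, x). f y x) \<in> borel_measurable (lborel \<Otimes>\<^sub>M lborel)"
    using m by (simp add: case_prod_beta')
  have [measurable]: "(\<lambda>z. f (fst z) (snd z)) \<in> borel_measurable (borel \<Otimes>\<^sub>M borel)"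
    using borel_measurable_continuous_onI[OF cont] by (simp add: borel_prod)
  have "integrable (lborel \<Otimes>\<^sub>M lborel) (\<lambda>(y, x). f y x)"
  proof (rule lborel_pair.Fubini_integrable[OF m2])
    have "(\<lambda>y. LINT x|lborel. cmod (case (y, x) of (y, x) \<Rightarrow> f y x)) \<in> borel_measurable lborel"
      using m by (intro lborel.borel_measurable_lebesgue_integral) (auto simp: case_prod_beta')
    then show "integrable lborel (\<lambda>y. LINT x|lborel. cmod (case (y, x) of (y, x) \<Rightarrow> f y x))"
      by (rule Bochner_Integration.integrable_bound[OF v])
        (use dom in \<open>auto intro!: AE_I2 order_trans[OF dom abs_ge_self]\<close>)
  qed (use int in auto)
  from lborel_pair.Fubini_integral[OF this] show ?thesis .
qed

definition cnv :: "('a::euclidean_space \<Rightarrow> complex) \<Rightarrow> ('a \<Rightarrow> complex) \<Rightarrow> 'a \<Rightarrow> complex" where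
  "cnv a g x = (LINT y|lborel. a y * g (x - y))"

lemma cnv_integrable:
  assumes "rapid a" "continuous_on UNIV g" "\<And>x. cmod (g x) \<le> B"
  shows "integrable lborel (\<lambda>y. a y * g (x - y))"
proof -
  have "rapid (\<lambda>y. g (x - y) * a y)"
    using assms by (intro rapid_mult_bounded) (auto intro!: continuous_intros continuous_on_compose2[of UNIV g])
  from rapid_integrable[OF this] show ?thesis by (simp add: mult.commute)
qed

lemma cnv_commute:
  assumes "rapid a" "rapid b" shows "cnv a b x = cnv b a x"
proof -
  have "(\<lambda>y. a y * b (x - y)) \<in> borel_measurable borel"
    using rapid_measurable[OF assms(1)] rapid_measurable[OF rapid_reflect[OF assms(2)]] by measurable
  from lborel_integral_reflect[OF this, of x] show ?thesis
    by (simp add: cnv_def mult.commute)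
qed

text \<open>The weight at \<open>x\<close> splits into weights at \<open>x - y\<close> and
  \<open>y\<close>; the decay of \<open>b\<close> absorbs the first, the integrability of
  \<open>a\<close> the second. Continuity is dominated convergence with dominant
  \<open>B * cmod (a y)\<close>.\<close>

lemma cnv_rapid:
  fixes a :: "'a::euclidean_space \<Rightarrow> complex"
  assumes a: "rapid a" and b: "rapid b" shows "rapid (cnv a b)"
  unfolding rapid_def
proof (intro conjI allI)
  obtain B where B: "0 < B" "\<And>x. cmod (b x) \<le> B" using rapid_bounded[OF b] by blast
  have bc: "continuous_on UNIV b" using b by (rule rapid_continuous)
  have [measurable]: "a \<in> borel_measurable borel" "b \<in> borel_measurable borel"
    using a b by (auto simp: rapid_measurable)
  show "continuous_on UNIV (cnv a b)"
    unfolding cnv_def continuous_on_sequentially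
  proof (intro allI ballI impI)
    fix u :: "nat \<Rightarrow> 'a" and x
    assume "x \<in> UNIV" and u: "(\<forall>n. u n \<in> UNIV) \<and> u \<longlonglongrightarrow> x"
    have "(\<lambda>n. LINT y|lborel. a y * b (u n - y)) \<longlonglongrightarrow> (LINT y|lborel. a y * b (x - y))"
    proof (rule integral_dominated_convergence[where w="\<lambda>y. B * cmod (a y)"])
      show "AE y in lborel. (\<lambda>n. a y * b (u n - y)) \<longlonglongrightarrow> a y * b (x - y)"
        using u by (intro AE_I2 tendsto_intros continuous_on_tendsto_compose[OF bc]) auto
      show "integrable lborel (\<lambda>y. B * cmod (a y))" using rapid_integrable[OF a] by simp
      show "AE y in lborel. cmod (a y * b (u n - y)) \<le> B * cmod (a y)" for n
        using B by (auto simp: norm_mult mult.commute[of B] intro!: AE_I2 mult_left_mono)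
    qed auto
    then show "((\<lambda>x. LINT y|lborel. a y * b (x - y)) \<circ> u) \<longlonglongrightarrow> (LINT y|lborel. a y * b (x - y))"
      by (simp add: o_def)
  qed
  fix k
  obtain C where C: "0 < C" "\<And>x. (1 + norm x) ^ k * cmod (b x) \<le> C" using rapid_bound[OF b] by blast
  have "(1 + norm x) ^ k * cmod (cnv a b x) \<le> (LINT y|lborel. C * ((1 + norm y) ^ k * cmod (a y)))" for x
  proof -
    have "cmod (cnv a b x) \<le> (LINT y|lborel. cmod (a y * b (x - y)))"
      unfolding cnv_def by (rule integral_norm_bound)
    then have "(1 + norm x) ^ k * cmod (cnv a b x) \<le> (1 + norm x) ^ k * (LINT y|lborel. cmod (a y * b (x - y)))"
      by (rule mult_left_mono) simp
    also have "\<dots> = (LINT y|lborel. (1 + norm x) ^ k * cmod (a y * b (x - y)))" by simp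
    also have "\<dots> \<le> (LINT y|lborel. C * ((1 + norm y) ^ k * cmod (a y)))"
    proof (rule integral_mono)
      show "integrable lborel (\<lambda>y. (1 + norm x) ^ k * cmod (a y * b (x - y)))"
        using cnv_integrable[OF a bc B(2)] by simp
      show "integrable lborel (\<lambda>y. C * ((1 + norm y) ^ k * cmod (a y)))"
        using rapid_integrable_weight[OF a] by simp
      fix y
      have "(1 + norm x) ^ k \<le> ((1 + norm (x - y)) * (1 + norm y)) ^ k"
        by (intro power_mono one_plus_norm_triangle) simp
      then have "(1 + norm x) ^ k * cmod (a y * b (x - y)) \<le> ((1 + norm (x - y)) * (1 + norm y)) ^ k * cmod (a y * b (x - y))"
        by (rule mult_right_mono) simp
      also have "\<dots> = ((1 + norm (x - y)) ^ k * cmod (b (x - y))) * ((1 + norm y) ^ k * cmod (a y))"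
        by (simp add: norm_mult power_mult_distrib)
      also have "\<dots> \<le> C * ((1 + norm y) ^ k * cmod (a y))"
        by (intro mult_right_mono C) simp
      finally show "(1 + norm x) ^ k * cmod (a y * b (x - y)) \<le> C * ((1 + norm y) ^ k * cmod (a y))" .
    qed
    finally show ?thesis .
  qed
  then show "\<exists>C. \<forall>x. (1 + norm x) ^ k * cmod (cnv a b x) \<le> C" by blast
qed


section \<open>Gaussian integrals\<close>

lemma lborel_integral_prod:
  fixes k :: "'a::euclidean_space \<Rightarrow> real \<Rightarrow> complex"
  assumes k: "\<And>b. b \<in> Basis \<Longrightarrow> integrable lborel (k b)"
  shows "(LINT x|lborel. (\<Prod>b\<in>(Basis::'a set). k b (x \<bullet> b))) = (\<Prod>b\<in>Basis. LINT t|lborel. k b t)"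
proof -
  interpret P: product_sigma_finite "\<lambda>_::'a. lborel :: real measure" ..
  have [measurable]: "b \<in> Basis \<Longrightarrow> k b \<in> borel_measurable borel" for b
    using borel_measurable_integrable[OF k] by simp
  have "(LINT x|lborel. (\<Prod>b\<in>(Basis::'a set). k b (x \<bullet> b))) =
      (LINT f|Pi\<^sub>M Basis (\<lambda>_. lborel). (\<Prod>b\<in>(Basis::'a set). k b ((\<Sum>b\<in>Basis. f b *\<^sub>R b) \<bullet> b)))"
    by (subst lborel_eq, subst integral_distr) measurable
  also have "\<dots> = (LINT f|Pi\<^sub>M Basis (\<lambda>_. lborel). (\<Prod>b\<in>(Basis::'a set). k b (f b)))"
    by (intro Bochner_Integration.integral_cong prod.cong) auto
  also have "\<dots> = (\<Prod>b\<in>Basis. LINT t|lborel. k b t)"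
    by (rule P.product_integral_prod) (auto simp: k)
  finally show ?thesis .
qed

text \<open>Up to the factor \<open>sqrt (2 * pi)\<close> the integrand is the standard normal
  density times a character, so the value is the characteristic function of the normal law.\<close>

lemma gaussian_integral_1:
  shows "integrable lborel (\<lambda>x::real. complex_of_real (exp (- x\<^sup>2 / 2)) * exp (\<i> * complex_of_real (t * x)))"
    and "(LINT x|lborel. complex_of_real (exp (- x\<^sup>2 / 2)) * exp (\<i> * complex_of_real (t * x))) =
      complex_of_real (sqrt (2 * pi) * exp (- t\<^sup>2 / 2))"
proof -
  have d: "complex_of_real (exp (- x\<^sup>2 / 2)) * exp (\<i> * complex_of_real (t * x))
      = complex_of_real (sqrt (2 * pi)) * (std_normal_density x *\<^sub>R iexp (t * x))" for x :: real
    by (simp add: normal_density_def scaleR_conv_of_real field_simps flip: of_real_mult)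
  have "integrable lborel (\<lambda>x. std_normal_density x *\<^sub>R iexp (t * x))"
    by (rule Bochner_Integration.integrable_bound[of _ std_normal_density])
      (auto intro!: AE_I2 integrable_normal_density)
  then show "integrable lborel (\<lambda>x::real. complex_of_real (exp (- x\<^sup>2 / 2)) * exp (\<i> * complex_of_real (t * x)))"
    unfolding d by (rule integrable_mult_right)
  have "(LINT x|lborel. std_normal_density x *\<^sub>R iexp (t * x)) = complex_of_real (exp (- t\<^sup>2 / 2))"
    using fun_cong[OF char_std_normal_distribution, of t]
    by (simp add: char_def integral_density mult.commute)
  then show "(LINT x|lborel. complex_of_real (exp (- x\<^sup>2 / 2)) * exp (\<i> * complex_of_real (t * x))) =
      complex_of_real (sqrt (2 * pi) * exp (- t\<^sup>2 / 2))"
    unfolding d integral_mult_right_zero by simp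
qed

lemma gaussian_integral:
  fixes v :: "'a::euclidean_space"
  shows "(LINT x|lborel. complex_of_real (exp (- (norm x)\<^sup>2 / 2)) * exp (\<i> * complex_of_real (v \<bullet> x))) =
      complex_of_real (sqrt (2 * pi) ^ DIM('a) * exp (- (norm v)\<^sup>2 / 2))"
proof -
  let ?k = "\<lambda>b x. complex_of_real (exp (- x\<^sup>2 / 2)) * exp (\<i> * complex_of_real ((v \<bullet> b) * x))"
  have sq: "- (norm x)\<^sup>2 / 2 = (\<Sum>b\<in>Basis. - (x \<bullet> b)\<^sup>2 / 2)" for x :: 'a
    unfolding power2_norm_eq_inner by (subst euclidean_inner) (simp add: sum_divide_distrib sum_negf power2_eq_square)
  have "(\<Prod>b\<in>Basis. ?k b (x \<bullet> b)) = complex_of_real (exp (- (norm x)\<^sup>2 / 2)) * exp (\<i> * complex_of_real (v \<bullet> x))" for x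
    unfolding sq by (subst euclidean_inner[of v x]) (simp add: prod.distrib exp_sum sum_distrib_left)
  then have "(LINT x|lborel. complex_of_real (exp (- (norm x)\<^sup>2 / 2)) * exp (\<i> * complex_of_real (v \<bullet> x))) =
      (\<Prod>b\<in>Basis. LINT t|lborel. ?k b t)"
    using lborel_integral_prod[of ?k] gaussian_integral_1(1) by simp
  also have "\<dots> = (\<Prod>b\<in>(Basis::'a set). complex_of_real (sqrt (2 * pi) * exp (- (v \<bullet> b)\<^sup>2 / 2)))"
    by (simp only: gaussian_integral_1(2))
  also have "\<dots> = complex_of_real (sqrt (2 * pi) ^ DIM('a) * exp (- (norm v)\<^sup>2 / 2))"
    unfolding sq by (simp add: prod.distrib exp_sum)
  finally show ?thesis .
qed

text \<open>A function that is not integrable has Bochner integral 0 by convention, so the nonzero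
  value found in \<open>gaussian_integral\<close> at frequency 0 already forces
  integrability.\<close>

lemma gaussian_integrable: "integrable lborel (\<lambda>x::'a::euclidean_space. exp (- (norm x)\<^sup>2 / 2))"
proof -
  have "(LINT x|lborel. complex_of_real (exp (- (norm (x::'a))\<^sup>2 / 2))) \<noteq> 0"
    using gaussian_integral[of "0::'a"] by simp
  then have "integrable lborel (\<lambda>x::'a. complex_of_real (exp (- (norm x)\<^sup>2 / 2)))"
    using not_integrable_integral_eq by blast
  then show ?thesis
    using integrable_Re by fastforce
qed

section \<open>Calculus of the Fourier transform and its injectivity\<close>

lemma cmod_exp_fourier [simp]:
  "cmod (exp (- 2 * pi * \<i> * complex_of_real t)) = 1" "cmod (exp (- (2 * pi * \<i> * complex_of_real t))) = 1"
  "cmod (exp (2 * pi * \<i> * complex_of_real t)) = 1"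
  by (simp_all add: norm_exp_eq_Re)

lemma rapid_modulate:
  "rapid f \<Longrightarrow> rapid (\<lambda>x. exp (- 2 * pi * \<i> * complex_of_real (x \<bullet> \<xi>)) * f x)"
  by (rule rapid_mult_bounded[where B=1]) (auto intro!: continuous_intros)

lemma fourier_integrable:
  assumes "rapid f" shows "integrable lborel (\<lambda>x. f x * exp (- 2 * pi * \<i> * complex_of_real (x \<bullet> \<xi>)))"
  using rapid_integrable[OF rapid_modulate[OF assms]] by (simp add: mult.commute)

lemma fourier_diff: "rapid f \<Longrightarrow> rapid g \<Longrightarrow> fourier (\<lambda>x. f x - g x) \<xi> = fourier f \<xi> - fourier g \<xi>"
  unfolding fourier_def left_diff_distrib
  by (intro Bochner_Integration.integral_diff fourier_integrable)

lemma fourier_sum: "(\<And>i. i \<in> I \<Longrightarrow> rapid (f i)) \<Longrightarrow> fourier (\<lambda>x. \<Sum>i\<in>I. f i x) \<xi> = (\<Sum>i\<in>I. fourier (f i) \<xi>)"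
  unfolding fourier_def sum_distrib_right
  by (intro Bochner_Integration.integral_sum fourier_integrable)

lemma fourier_cmult: "fourier (\<lambda>x. c * f x) \<xi> = c * fourier f \<xi>"
  by (simp add: fourier_def mult.assoc)

lemma fourier_dilate:
  fixes f :: "real^'n \<Rightarrow> complex"
  assumes f: "rapid f" and c: "c \<noteq> 0"
  shows "fourier (\<lambda>x. complex_of_real (\<bar>c\<bar> ^ CARD('n)) * f (c *\<^sub>R x)) \<xi> = fourier f ((1 / c) *\<^sub>R \<xi>)"
proof -
  have [measurable]: "f \<in> borel_measurable borel" using f by (rule rapid_measurable)
  have "fourier f ((1 / c) *\<^sub>R \<xi>) = \<bar>c\<bar> ^ CARD('n) *\<^sub>R
      (LINT x|lborel. f (0 + c *\<^sub>R x) * exp (- 2 * pi * \<i> * complex_of_real ((0 + c *\<^sub>R x) \<bullet> ((1 / c) *\<^sub>R \<xi>))))"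
    unfolding fourier_def
    by (subst lborel_integral_affine[OF c, of _ 0]) simp_all
  then show ?thesis
    using c unfolding fourier_def by (simp add: mult.assoc) (simp add: scaleR_conv_of_real)
qed

lemma fourier_shift:
  fixes f :: "real^'n \<Rightarrow> complex"
  assumes f: "rapid f"
  shows "fourier (\<lambda>x. f (x - t)) \<xi> = exp (- 2 * pi * \<i> * complex_of_real (t \<bullet> \<xi>)) * fourier f \<xi>"
proof -
  have "fourier (\<lambda>x. f (x - t)) \<xi> = (LINT x|lborel. (\<lambda>z. f z * exp (- 2 * pi * \<i> * complex_of_real ((z + t) \<bullet> \<xi>))) (x - t))"
    by (simp add: fourier_def)
  also have "\<dots> = (LINT x|lborel. f x * exp (- 2 * pi * \<i> * complex_of_real ((x + t) \<bullet> \<xi>)))"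
    by (rule lborel_integral_shift) (use rapid_measurable[OF f] in measurable)
  also have "\<dots> = (LINT x|lborel. exp (- 2 * pi * \<i> * complex_of_real (t \<bullet> \<xi>)) * (f x * exp (- 2 * pi * \<i> * complex_of_real (x \<bullet> \<xi>))))"
    by (rule Bochner_Integration.integral_cong) (simp_all add: inner_add_left distrib_left exp_add[symmetric] exp_minus_inverse field_simps flip: exp_add)
  finally show ?thesis by (simp add: fourier_def)
qed

lemma fourier_uminus:
  fixes f :: "real^'n \<Rightarrow> complex"
  assumes f: "rapid f" shows "fourier (\<lambda>x. f (- x)) \<xi> = fourier f (- \<xi>)"
  using fourier_dilate[OF f, of "-1" \<xi>] by simp

lemma fourier_modulate:
  "fourier (\<lambda>x. exp (2 * pi * \<i> * complex_of_real (x \<bullet> v)) * f x) \<xi> = fourier f (\<xi> - v)"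
  unfolding fourier_def
  by (rule Bochner_Integration.integral_cong)
    (simp_all add: inner_diff_right right_diff_distrib exp_diff exp_minus field_simps)

lemma fourier_cnv:
  fixes a b :: "real^'n \<Rightarrow> complex"
  assumes a: "rapid a" and b: "rapid b"
  shows "fourier (cnv a b) \<xi> = fourier a \<xi> * fourier b \<xi>"
proof -
  let ?e = "\<lambda>x. exp (- 2 * pi * \<i> * complex_of_real (x \<bullet> \<xi>))"
  have [measurable]: "a \<in> borel_measurable borel" "b \<in> borel_measurable borel"
    using a b by (auto simp: rapid_measurable)
  have "fourier (cnv a b) \<xi> = (LINT x|lborel. LINT y|lborel. a y * b (x - y) * ?e x)"
    unfolding fourier_def cnv_def by simp
  also have "\<dots> = (LINT y|lborel. LINT x|lborel. a y * b (x - y) * ?e x)"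
  proof (rule continuous_Fubini)
    show "continuous_on UNIV (\<lambda>z. a (fst z) * b (snd z - fst z) * ?e (snd z))"
      by (intro continuous_intros continuous_on_compose2[OF rapid_continuous[OF a, of UNIV]]
          continuous_on_compose2[OF rapid_continuous[OF b, of UNIV]]) auto
    show "integrable lborel (\<lambda>x. a y * b (x - y) * ?e x)" for y
      using integrable_mult_right[OF fourier_integrable[OF rapid_shift[OF b]], of "a y"] by (simp add: mult_ac)
    show "(LINT x|lborel. cmod (a y * b (x - y) * ?e x)) \<le> cmod (a y) * (LINT x|lborel. cmod (b x))" for y
      using lborel_integral_shift[of "\<lambda>x. cmod (b x)" y] by (simp add: norm_mult)
    show "integrable lborel (\<lambda>y. cmod (a y) * (LINT x|lborel. cmod (b x)))"
      using rapid_integrable[OF a] by simp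
  qed
  also have "\<dots> = (LINT y|lborel. a y * fourier (\<lambda>x. b (x - y)) \<xi>)"
    by (simp add: fourier_def mult.assoc)
  also have "\<dots> = (LINT y|lborel. a y * ?e y * fourier b \<xi>)"
    by (simp add: fourier_shift[OF b] mult.assoc)
  finally show ?thesis by (simp add: fourier_def)
qed

text \<open>A vanishing Fourier transform, tested against the Gaussians of width \<open>1 / \<tau>\<close>, makes the
  Gaussian averages of \<open>f\<close> at scale \<open>\<tau>\<close> vanish.\<close>

lemma fourier_eq_0:
  fixes f :: "real^'n \<Rightarrow> complex"
  assumes f: "rapid f" and F: "\<And>\<xi>. fourier f \<xi> = 0"
  shows "f x = 0"
proof -
  define G where "G = (\<lambda>v::real^'n. exp (- (norm v)\<^sup>2 / 2))"
  have G_int: "integrable lborel G" unfolding G_def by (rule gaussian_integrable)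
  have G_cont: "continuous_on UNIV G" unfolding G_def by (intro continuous_intros) auto
  have [measurable]: "f \<in> borel_measurable borel" "G \<in> borel_measurable borel"
    using f G_cont by (auto simp: rapid_measurable borel_measurable_continuous_onI)
  obtain B where B: "0 < B" "\<And>x. cmod (f x) \<le> B" using rapid_bounded[OF f] by blast
  have avg: "(LINT z|lborel. f (x + \<tau> *\<^sub>R z) * G z) = 0" if \<tau>: "0 < \<tau>" for \<tau>
  proof -
    \<comment> \<open>With this dilation of the frequency Gaussian, its transform is a Gaussian of
      width exactly \<open>\<tau>\<close> centred at \<open>x\<close>.\<close>
    let ?d = "2 * pi * \<tau>"
    let ?f = "\<lambda>y \<xi>. f y * exp (- 2 * pi * \<i> * complex_of_real ((y - x) \<bullet> \<xi>)) * G (?d *\<^sub>R \<xi>)"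
    have Gd: "integrable lborel (\<lambda>\<xi>. G (?d *\<^sub>R \<xi>))"
      using lborel_integrable_affine[of ?d G 0] G_int \<tau> by simp
    have inner: "(LINT \<xi>|lborel. ?f y \<xi>) = f y * complex_of_real (sqrt (2 * pi) ^ CARD('n) / ?d ^ CARD('n) * G ((1 / \<tau>) *\<^sub>R (y - x)))" for y
    proof -
      let ?h = "\<lambda>w. complex_of_real (G w) * exp (\<i> * complex_of_real (((1 / \<tau>) *\<^sub>R (x - y)) \<bullet> w))"
      have "complex_of_real (?d ^ CARD('n)) * (LINT \<xi>|lborel. ?h (0 + ?d *\<^sub>R \<xi>)) = (LINT w|lborel. ?h w)"
        by (subst lborel_integral_affine[of ?d ?h 0]) (use \<tau> in \<open>simp_all add: scaleR_conv_of_real\<close>)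
      also have "\<dots> = complex_of_real (sqrt (2 * pi) ^ CARD('n) * G ((1 / \<tau>) *\<^sub>R (x - y)))"
        using gaussian_integral[of "(1 / \<tau>) *\<^sub>R (x - y)"] by (simp add: G_def)
      also have "G ((1 / \<tau>) *\<^sub>R (x - y)) = G ((1 / \<tau>) *\<^sub>R (y - x))"
        by (simp add: G_def norm_minus_commute)
      finally have I: "(LINT \<xi>|lborel. ?h (0 + ?d *\<^sub>R \<xi>)) = complex_of_real (sqrt (2 * pi) ^ CARD('n) / ?d ^ CARD('n) * G ((1 / \<tau>) *\<^sub>R (y - x)))"
        using \<tau> by (simp add: divide_simps mult_ac)
      have "((1 / \<tau>) *\<^sub>R (x - y)) \<bullet> (0 + ?d *\<^sub>R \<xi>) = - (2 * pi) * ((y - x) \<bullet> \<xi>)" for \<xi>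
        using \<tau> by (simp add: inner_diff_left field_simps)
      then have "?f y \<xi> = f y * ?h (0 + ?d *\<^sub>R \<xi>)" for \<xi>
        by (simp add: mult_ac)
      then have "(LINT \<xi>|lborel. ?f y \<xi>) = f y * (LINT \<xi>|lborel. ?h (0 + ?d *\<^sub>R \<xi>))"
        by (simp only: integral_mult_right_zero)
      then show ?thesis unfolding I .
    qed
    have "0 = (LINT \<xi>|lborel. fourier f \<xi> * (exp (2 * pi * \<i> * complex_of_real (x \<bullet> \<xi>)) * G (?d *\<^sub>R \<xi>)))"
      by (simp add: F)
    also have "\<dots> = (LINT \<xi>|lborel. LINT y|lborel. ?f y \<xi>)"
      unfolding fourier_def integral_mult_left_zero[symmetric]
      by (intro Bochner_Integration.integral_cong refl)
        (simp add: inner_diff_left right_diff_distrib exp_diff exp_minus field_simps)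
    also have "\<dots> = (LINT y|lborel. LINT \<xi>|lborel. ?f y \<xi>)"
    proof (rule continuous_Fubini)
      show "continuous_on UNIV (\<lambda>z. ?f (fst z) (snd z))"
        by (intro continuous_intros continuous_on_compose2[OF rapid_continuous[OF f, of UNIV]]
            continuous_on_compose2[OF G_cont]) auto
      show "integrable lborel (?f y)" for y
        by (rule Bochner_Integration.integrable_bound[OF integrable_mult_right[OF Gd, of "cmod (f y)"]])
          (auto simp: norm_mult intro!: AE_I2)
      show "(LINT \<xi>|lborel. cmod (?f y \<xi>)) \<le> cmod (f y) * (LINT \<xi>|lborel. G (?d *\<^sub>R \<xi>))" for y
        by (simp add: norm_mult G_def)
      show "integrable lborel (\<lambda>y. cmod (f y) * (LINT \<xi>|lborel. G (?d *\<^sub>R \<xi>)))"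
        using rapid_integrable[OF f] by simp
    qed
    also have "\<dots> = complex_of_real (sqrt (2 * pi) ^ CARD('n) / ?d ^ CARD('n)) * (LINT y|lborel. f y * G ((1 / \<tau>) *\<^sub>R (y - x)))"
      unfolding inner by (subst integral_mult_right_zero[symmetric]) (simp add: mult_ac)
    finally have "(LINT y|lborel. f y * G ((1 / \<tau>) *\<^sub>R (y - x))) = 0"
      using \<tau> by simp
    then show ?thesis
      by (subst (asm) lborel_integral_affine[of \<tau> _ x]) (use \<tau> in auto)
  qed
  \<comment> \<open>Along the widths 1/(n + 1) the averages, all zero, converge to
    \<open>f x\<close> times the total mass of the Gaussian, which is not zero.\<close>
  have "(\<lambda>n. LINT z|lborel. f (x + (1 / real (Suc n)) *\<^sub>R z) * G z) \<longlonglongrightarrow> (LINT z|lborel. f x * G z)"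
  proof (rule integral_dominated_convergence[where w="\<lambda>z. B * G z"])
    have "(\<lambda>n. x + (1 / real (Suc n)) *\<^sub>R z) \<longlonglongrightarrow> x + 0 *\<^sub>R z" for z
      using LIMSEQ_inverse_real_of_nat by (intro tendsto_intros) (simp add: inverse_eq_divide)
    then have "(\<lambda>n. f (x + (1 / real (Suc n)) *\<^sub>R z)) \<longlonglongrightarrow> f x" for z
      using continuous_on_tendsto_compose[OF rapid_continuous[OF f, of UNIV], of _ x] by auto
    then show "AE z in lborel. (\<lambda>n. f (x + (1 / real (Suc n)) *\<^sub>R z) * G z) \<longlonglongrightarrow> f x * G z"
      by (intro AE_I2 tendsto_intros)
    show "AE z in lborel. cmod (f (x + (1 / real (Suc n)) *\<^sub>R z) * G z) \<le> B * G z" for n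
      using B by (auto simp: norm_mult G_def intro!: AE_I2 mult_right_mono)
  qed (use G_int in auto)
  then have "(LINT z|lborel. f x * complex_of_real (G z)) = 0"
    using avg by (simp add: LIMSEQ_const_iff)
  then have "f x * complex_of_real (LINT z|lborel. G z) = 0"
    by simp
  moreover have "(LINT z|lborel. G z) \<noteq> 0"
    using gaussian_integral[of "0::real^'n"] by (auto simp: G_def)
  ultimately show ?thesis by simp
qed

text \<open>The working tool for convolution identities: since \<open>fourier_cnv\<close> turns
  convolution into a product, each identity becomes a pointwise comparison of supports and values on
  the frequency side.\<close>

lemma fourier_inject:
  fixes f g :: "real^'n \<Rightarrow> complex"
  assumes "rapid f" "rapid g" "\<And>\<xi>. fourier f \<xi> = fourier g \<xi>"
  shows "f = g"
proof
  fix x show "f x = g x"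
    using fourier_eq_0[OF rapid_diff[OF assms(1,2)], of x] by (simp add: fourier_diff assms)
qed

section \<open>Quasi-norms of extended real functions\<close>

lemma ennpow_ennreal: "0 \<le> x \<Longrightarrow> ennpow (ennreal x) r = ennreal (x powr r)"
  by (simp add: ennpow_def)

lemma ennpow_0 [simp]: "ennpow 0 r = 0"
  by (simp add: ennpow_def)

lemma ennpow_top [simp]: "ennpow top_class.top r = top_class.top"
  by (simp add: ennpow_def)

lemma ennpow_mono:
  assumes "a \<le> b" "0 < r" shows "ennpow a r \<le> ennpow b r"
proof (cases "b = \<infinity>")
  case False
  then have "a \<noteq> \<infinity>" using assms(1) by (auto simp: top_unique)
  moreover have "enn2real a \<le> enn2real b" using assms(1) False by (intro enn2real_mono) (auto simp: less_top)
  ultimately show ?thesis using False assms(2)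
    by (simp add: ennpow_def powr_mono2 ennreal_leI)
qed simp

lemma ennpow_ennpow: "0 < r \<Longrightarrow> ennpow (ennpow a r) (1 / r) = a" "0 < r \<Longrightarrow> ennpow (ennpow a (1 / r)) r = a"
  by (cases a rule: ennreal_cases; simp add: ennpow_ennreal powr_powr)+

lemma ennpow_le_iff:
  assumes r: "0 < r" shows "ennpow a r \<le> b \<longleftrightarrow> a \<le> ennpow b (1 / r)"
proof
  assume "ennpow a r \<le> b"
  then have "ennpow (ennpow a r) (1 / r) \<le> ennpow b (1 / r)" by (rule ennpow_mono) (simp add: r)
  then show "a \<le> ennpow b (1 / r)" unfolding ennpow_ennpow(1)[OF r] .
next
  assume "a \<le> ennpow b (1 / r)"
  then have "ennpow a r \<le> ennpow (ennpow b (1 / r)) r" by (rule ennpow_mono) (rule r)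
  then show "ennpow a r \<le> b" unfolding ennpow_ennpow(2)[OF r] .
qed

text \<open>The delicate case is an infinite factor, since zero times infinity is zero in
  \<open>ennreal\<close>; the power preserves both being zero and being infinite, so the two sides
  degenerate together.\<close>

lemma ennpow_mult:
  assumes "0 < r" shows "ennpow (a * b) r = ennpow a r * ennpow b r"
proof (cases "a = \<infinity> \<or> b = \<infinity>")
  case True
  have nz0: "ennpow c r \<noteq> 0" if "c \<noteq> 0" for c
  proof
    assume "ennpow c r = 0"
    then have "ennpow (ennpow c r) (1 / r) = 0" by (simp only: ennpow_0)
    with that show False by (simp only: ennpow_ennpow(1)[OF assms])
  qed
  have nz: "ennpow a r = 0 \<longleftrightarrow> a = 0" "ennpow b r = 0 \<longleftrightarrow> b = 0"
    using nz0[of a] nz0[of b] by fastforce+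
  show ?thesis
  proof (cases "a = 0 \<or> b = 0")
    case False
    then have "a * b = top_class.top" "ennpow a r * ennpow b r = top_class.top"
      using True nz unfolding ennreal_mult_eq_top_iff by auto
    then show ?thesis by simp
  next
    case True
    then show ?thesis by (rule disjE) (simp_all only: ennpow_0 mult_zero_left mult_zero_right)
  qed
next
  case False
  define x y where "x = enn2real a" "y = enn2real b"
  have ab: "a = ennreal x" "b = ennreal y" and xy: "0 \<le> x" "0 \<le> y"
    unfolding x_y_def using False by (auto simp: ennreal_enn2real_if)
  have "ennpow (a * b) r = ennpow (ennreal (x * y)) r"
    by (simp only: ennreal_mult[OF xy] ab)
  also have "\<dots> = ennreal (x powr r * y powr r)"
    using xy by (subst ennpow_ennreal) (simp_all add: powr_mult)
  also have "\<dots> = ennreal (x powr r) * ennreal (y powr r)"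
    by (rule ennreal_mult) simp_all
  finally show ?thesis using xy by (simp only: ennpow_ennreal ab)
qed

text \<open>Bounding the sum by twice the maximum treats exponents above and below 1 alike, at the
  price of a constant; this is why only quasi-norms appear.\<close>

lemma ennpow_add_le:
  assumes "0 < r" shows "ennpow (a + b) r \<le> ennreal (2 powr r) * (ennpow a r + ennpow b r)"
proof -
  have "a + b \<le> 2 * max a b"
    unfolding mult_2 by (intro add_mono max.cobounded1 max.cobounded2)
  then have "ennpow (a + b) r \<le> ennpow (2 * max a b) r"
    using assms by (rule ennpow_mono)
  also have "\<dots> = ennreal (2 powr r) * ennpow (max a b) r"
    using ennpow_ennreal[of 2 r] by (simp add: ennpow_mult assms)
  also have "ennpow (max a b) r \<le> ennpow a r + ennpow b r"
    by (cases "a \<le> b") (simp_all add: max_def add_increasing add_increasing2)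
  finally show ?thesis by (simp add: mult_left_mono)
qed

lemma ennpow_measurable [measurable (raw)]:
  assumes [measurable]: "f \<in> borel_measurable M"
  shows "(\<lambda>x. ennpow (f x) r) \<in> borel_measurable M"
proof -
  have "f -` {\<infinity>} \<inter> space M \<in> sets M" by (rule measurable_sets[OF assms]) simp
  moreover have "f -` {\<infinity>} \<inter> space M = {x \<in> space M. f x = \<infinity>}" by auto
  moreover have "(\<lambda>x. ennreal (enn2real (f x) powr r)) \<in> borel_measurable M" by measurable
  ultimately show ?thesis
    unfolding ennpow_def by (intro measurable_If) simp_all
qed

text \<open>The power is an order isomorphism with inverse the power \<open>1 / r\<close>, so strict
  lower bounds, which characterize a limit inferior, can be moved through it.\<close>

lemma ennpow_le_liminf:
  fixes F :: "nat \<Rightarrow> ennreal"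
  assumes "a \<le> liminf F" "0 < r" shows "ennpow a r \<le> liminf (\<lambda>i. ennpow (F i) r)"
  unfolding le_Liminf_iff
proof (intro allI impI)
  fix c assume "c < ennpow a r"
  then have "ennpow c (1 / r) < a"
    using ennpow_le_iff[OF assms(2), of a c] by (simp add: not_le[symmetric])
  then have "\<forall>\<^sub>F i in sequentially. ennpow c (1 / r) < F i"
    using assms(1) le_Liminf_iff by blast
  then show "\<forall>\<^sub>F i in sequentially. c < ennpow (F i) r"
    by eventually_elim (use ennpow_le_iff[OF assms(2)] in \<open>simp add: not_le[symmetric]\<close>)
qed

lemma Lp_norm_mono:
  assumes "0 < p" "f \<in> borel_measurable M" "\<And>x. x \<in> space M \<Longrightarrow> f x \<le> g x"
  shows "Lp_norm p M f \<le> Lp_norm p M g"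
proof (cases "p = \<infinity>")
  case True
  have "esssup M f \<le> esssup M g" by (rule esssup_AE_mono) (use assms in auto)
  then show ?thesis using True by (simp add: Lp_norm_def)
next
  case False
  then have "0 < enn2real p" using assms(1) by (simp add: enn2real_positive_iff less_top)
  with assms(3) have "ennpow (\<integral>\<^sup>+x. ennpow (f x) (enn2real p) \<partial>M) (1 / enn2real p)
      \<le> ennpow (\<integral>\<^sup>+x. ennpow (g x) (enn2real p) \<partial>M) (1 / enn2real p)"
    by (intro ennpow_mono nn_integral_mono) simp_all
  then show ?thesis using False by (simp add: Lp_norm_def)
qed

lemma Lp_norm_cmult_le:
  assumes p: "0 < p" and [measurable]: "f \<in> borel_measurable M"
  shows "Lp_norm p M (\<lambda>x. c * f x) \<le> c * Lp_norm p M f"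
proof (cases "p = \<infinity>")
  case True
  have "AE x in M. c * f x \<le> c * esssup M f"
    using esssup_AE[of f M] by eventually_elim (rule mult_left_mono, auto)
  then show ?thesis using True by (simp add: Lp_norm_def esssup_I)
next
  case False
  then have "0 < enn2real p" using p by (simp add: enn2real_positive_iff less_top)
  then show ?thesis using False
    by (simp add: Lp_norm_def ennpow_mult nn_integral_cmult ennpow_ennpow)
qed

text \<open>For a finite exponent, \<open>ennpow_add_le\<close> is applied once under the integral
  and once to the outer root. The constant depends on the exponent alone, so it is uniform over all
  dyadic levels.\<close>

lemma Lp_norm_add_le:
  assumes p: "0 < p"
  obtains K where "0 < K"
    "\<And>(M :: 'a measure) f g. f \<in> borel_measurable M \<Longrightarrow> g \<in> borel_measurable M \<Longrightarrow>
      Lp_norm p M (\<lambda>x. f x + g x) \<le> ennreal K * (Lp_norm p M f + Lp_norm p M g)"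
proof (cases "p = \<infinity>")
  case True
  have le: "Lp_norm p M (\<lambda>x. f x + g x) \<le> ennreal 1 * (Lp_norm p M f + Lp_norm p M g)"
    if [measurable]: "f \<in> borel_measurable M" "g \<in> borel_measurable M" for M :: "'a measure" and f g
  proof -
    have "AE x in M. f x + g x \<le> esssup M f + esssup M g"
      using esssup_AE[of f M] esssup_AE[of g M] by eventually_elim (rule add_mono)
    then show ?thesis using True by (simp add: Lp_norm_def esssup_I)
  qed
  show ?thesis by (rule that[OF _ le]) simp_all
next
  case False
  define r where "r = enn2real p"
  have r: "0 < r" using p False by (simp add: r_def enn2real_positive_iff less_top)
  have le: "Lp_norm p M (\<lambda>x. f x + g x) \<le> ennreal (2 * 2 powr (1 / r)) * (Lp_norm p M f + Lp_norm p M g)"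
    if [measurable]: "f \<in> borel_measurable M" "g \<in> borel_measurable M" for M :: "'a measure" and f g
  proof -
    have "(\<integral>\<^sup>+x. ennpow (f x + g x) r \<partial>M) \<le> (\<integral>\<^sup>+x. ennreal (2 powr r) * (ennpow (f x) r + ennpow (g x) r) \<partial>M)"
      by (intro nn_integral_mono ennpow_add_le r)
    also have "\<dots> = ennreal (2 powr r) * ((\<integral>\<^sup>+x. ennpow (f x) r \<partial>M) + (\<integral>\<^sup>+x. ennpow (g x) r \<partial>M))"
      by (subst nn_integral_cmult) (auto simp: nn_integral_add)
    finally have "ennpow (\<integral>\<^sup>+x. ennpow (f x + g x) r \<partial>M) (1 / r)
        \<le> ennpow (ennreal (2 powr r) * ((\<integral>\<^sup>+x. ennpow (f x) r \<partial>M) + (\<integral>\<^sup>+x. ennpow (g x) r \<partial>M))) (1 / r)"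
      using r by (intro ennpow_mono) auto
    also have "\<dots> = 2 * ennpow ((\<integral>\<^sup>+x. ennpow (f x) r \<partial>M) + (\<integral>\<^sup>+x. ennpow (g x) r \<partial>M)) (1 / r)"
      using r by (simp add: ennpow_mult ennpow_ennreal powr_powr)
    also have "\<dots> \<le> 2 * (ennreal (2 powr (1 / r)) * (ennpow (\<integral>\<^sup>+x. ennpow (f x) r \<partial>M) (1 / r) + ennpow (\<integral>\<^sup>+x. ennpow (g x) r \<partial>M) (1 / r)))"
      using r by (intro mult_left_mono ennpow_add_le) auto
    also have "\<dots> = ennreal (2 * 2 powr (1 / r)) * (ennpow (\<integral>\<^sup>+x. ennpow (f x) r \<partial>M) (1 / r) + ennpow (\<integral>\<^sup>+x. ennpow (g x) r \<partial>M) (1 / r))"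
      by (subst ennreal_mult) (simp_all add: mult.assoc)
    finally show ?thesis using False by (simp add: Lp_norm_def r_def)
  qed
  show ?thesis by (rule that[OF _ le]) simp_all
qed

text \<open>Lets the lemmas on \<open>Lp_norm\<close> serve both layers of a Besov quasi-norm, the
  inner one in space and the outer one over levels.\<close>

lemma lq_norm_eq_Lp_norm:
  assumes "0 < q" shows "lq_norm q a = Lp_norm q (count_space UNIV) a"
proof (cases "q = \<infinity>")
  case True
  have "esssup (count_space UNIV) a \<le> (SUP j. a j)"
    by (rule esssup_I) (auto simp: AE_count_space intro: SUP_upper)
  moreover have "(SUP j. a j) \<le> esssup (count_space UNIV) a"
    using esssup_AE[of a "count_space UNIV"] by (auto simp: AE_count_space intro: SUP_least)
  ultimately show ?thesis using True by (simp add: lq_norm_def Lp_norm_def antisym)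
qed (simp add: lq_norm_def Lp_norm_def nn_integral_count_space_nat)

lemma lq_norm_ge:
  assumes "0 < q" shows "a j \<le> lq_norm q a"
proof (cases "q = \<infinity>")
  case True then show ?thesis by (simp add: lq_norm_def SUP_upper)
next
  case False
  then have q: "0 < enn2real q" using assms by (simp add: enn2real_positive_iff less_top)
  have "ennpow (a j) (enn2real q) \<le> (\<Sum>j. ennpow (a j) (enn2real q))"
    using sum_le_suminf[OF summableI, of "{j}" "\<lambda>j. ennpow (a j) (enn2real q)"] by simp
  then show ?thesis using False q by (simp add: lq_norm_def ennpow_le_iff)
qed

section \<open>Schwartz functions\<close>

lemma schwartz_differentiable: "f \<in> schwartz \<Longrightarrow> iter_partial is f differentiable (at x)"
  by (simp add: schwartz_def)

lemma schwartz_differentiable': "f \<in> schwartz \<Longrightarrow> f differentiable (at x)"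
  using schwartz_differentiable[of f "[]"] by simp

lemma iter_partial_append: "iter_partial (is @ js) f = iter_partial is (iter_partial js f)"
  by (induction "is") auto

lemma iter_partial_schwartz: "f \<in> schwartz \<Longrightarrow> iter_partial js f \<in> schwartz"
  by (auto simp: schwartz_def iter_partial_append[symmetric])

lemma schwartz_bound:
  assumes "f \<in> schwartz" obtains C where "\<And>x. (1 + norm x) ^ k * cmod (iter_partial is f x) \<le> C"
proof -
  have "bounded (range (\<lambda>x. (1 + norm x) ^ k *\<^sub>R iter_partial is f x))"
    using assms unfolding schwartz_def by blast
  then obtain C where "\<And>x. norm ((1 + norm x) ^ k *\<^sub>R iter_partial is f x) \<le> C"
    unfolding bounded_iff by blast
  then have "(1 + norm x) ^ k * cmod (iter_partial is f x) \<le> C" for x by simp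
  then show ?thesis by (rule that)
qed

lemma schwartzI:
  assumes "\<And>is x. iter_partial is f differentiable (at x)"
    and "\<And>is k. \<exists>C. \<forall>x. (1 + norm x) ^ k * cmod (iter_partial is f x) \<le> C"
  shows "f \<in> schwartz"
  unfolding schwartz_def bounded_iff using assms by fastforce

lemma schwartz_rapid:
  assumes "f \<in> schwartz" shows "rapid f"
  unfolding rapid_def
proof (intro conjI allI)
  show "continuous_on UNIV f"
    using schwartz_differentiable'[OF assms]
    by (simp add: continuous_on_eq_continuous_at differentiable_imp_continuous_within)
  fix k
  obtain C where "\<And>x. (1 + norm x) ^ k * cmod (iter_partial [] f x) \<le> C"
    using schwartz_bound[OF assms] by blast
  then show "\<exists>C. \<forall>x. (1 + norm x) ^ k * cmod (f x) \<le> C" by auto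
qed

lemma has_derivative_partials:
  fixes f :: "real^'n \<Rightarrow> complex"
  assumes "f differentiable (at x)"
  shows "(f has_derivative (\<lambda>h. \<Sum>i\<in>UNIV. (h $ i) *\<^sub>R iter_partial [i] f x)) (at x)"
proof -
  let ?D = "frechet_derivative f (at x)"
  have D: "(f has_derivative ?D) (at x)" using assms frechet_derivative_works by blast
  then interpret bounded_linear ?D by (rule has_derivative_bounded_linear)
  have "?D h = (\<Sum>i\<in>UNIV. (h $ i) *\<^sub>R iter_partial [i] f x)" for h
  proof -
    have "?D h = ?D (\<Sum>i\<in>UNIV. (h $ i) *s axis i 1)" by (simp only: basis_expansion)
    also have "\<dots> = (\<Sum>i\<in>UNIV. (h $ i) *\<^sub>R ?D (axis i 1))" by (simp add: sum scaleR scalar_mult_eq_scaleR)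
    finally show ?thesis by simp
  qed
  then have "?D = (\<lambda>h. \<Sum>i\<in>UNIV. (h $ i) *\<^sub>R iter_partial [i] f x)" by (rule ext)
  with D show ?thesis by (simp only:)
qed

lemma iter_partial_single_eq:
  fixes f :: "real^'n \<Rightarrow> complex"
  assumes "(f has_derivative (\<lambda>h. \<Sum>i\<in>UNIV. (h $ i) *\<^sub>R c i)) (at x)"
  shows "iter_partial [i] f x = c i"
proof -
  have "iter_partial [i] f x = (\<Sum>j\<in>UNIV. (axis i 1 $ j) *\<^sub>R c j)"
    using frechet_derivative_at[OF assms, symmetric] by simp
  also have "\<dots> = (\<Sum>j\<in>UNIV. if j = i then c j else 0)"
    by (intro sum.cong) (auto simp: axis_def)
  finally show ?thesis by simp
qed

lemma onorm_partials_le: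
  fixes c :: "'n::finite \<Rightarrow> complex"
  assumes "\<And>i. cmod (c i) \<le> B"
  shows "onorm (\<lambda>h::real^'n. \<Sum>i\<in>UNIV. (h $ i) *\<^sub>R c i) \<le> real CARD('n) * B"
proof (rule onorm_le)
  fix h :: "real^'n"
  have "norm (\<Sum>i\<in>UNIV. (h $ i) *\<^sub>R c i) \<le> (\<Sum>i\<in>(UNIV::'n set). norm h * B)"
    by (intro order_trans[OF norm_sum] sum_mono) (use assms component_le_norm_cart in \<open>auto intro!: mult_mono\<close>)
  then show "norm (\<Sum>i\<in>UNIV. (h $ i) *\<^sub>R c i) \<le> real CARD('n) * B * norm h" by (simp add: mult_ac)
qed

lemma partials_mean_value:
  fixes f :: "real^'n \<Rightarrow> complex"
  assumes d: "\<And>x. f differentiable (at x)"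
    and B: "\<And>t i. t \<in> {0..1} \<Longrightarrow> cmod (iter_partial [i] f (x + t *\<^sub>R h)) \<le> B"
  shows "cmod (f (x + h) - f x) \<le> real CARD('n) * B * norm h"
proof -
  let ?G = "(\<lambda>t. x + t *\<^sub>R h) ` {0..1}"
  have "norm (f (x + h) - f x) \<le> norm h * (real CARD('n) * B)"
  proof (rule differentiable_bound_segment[where G="?G"])
    fix t :: real assume "t \<in> {0..1}"
    then show "onorm (\<lambda>k. \<Sum>i\<in>UNIV. (k $ i) *\<^sub>R iter_partial [i] f (x + t *\<^sub>R h)) \<le> real CARD('n) * B"
      by (intro onorm_partials_le B)
  qed (use has_derivative_partials[OF d] in \<open>auto intro: has_derivative_at_withinI\<close>)
  then show ?thesis by (simp add: mult_ac)
qed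

text \<open>The mean value bound is used twice: bounded second partials make the first partials
  Lipschitz, and this controls the deviation of the function from its linearization. Uniformity in
  \<open>x\<close> is the point, since the estimate is integrated against a kernel later.\<close>

lemma schwartz_taylor:
  fixes g :: "real^'n \<Rightarrow> complex"
  assumes g: "g \<in> schwartz"
  obtains C where "0 \<le> C"
    "\<And>x h. cmod (g (x + h) - g x - (\<Sum>i\<in>UNIV. (h $ i) *\<^sub>R iter_partial [i] g x)) \<le> C * (norm h)\<^sup>2"
proof -
  let ?n = "real CARD('n)"
  have ex: "\<exists>C. \<forall>x. cmod (iter_partial [j, i] g x) \<le> C" for i j
  proof -
    obtain C where "\<And>x. (1 + norm x) ^ 0 * cmod (iter_partial [j, i] g x) \<le> C"
      using schwartz_bound[OF g] by blast
    then show "\<exists>C. \<forall>x. cmod (iter_partial [j, i] g x) \<le> C" by auto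
  qed
  define C where "C i j = (SOME C. \<forall>x. cmod (iter_partial [j, i] g x) \<le> C)" for i j
  have C: "cmod (iter_partial [j, i] g x) \<le> C i j" for i j x
    unfolding C_def using someI_ex[OF ex, of j i] by blast
  define B where "B = (\<Sum>i\<in>UNIV. \<Sum>j\<in>UNIV. \<bar>C i j\<bar>)"
  have B: "cmod (iter_partial [j, i] g x) \<le> B" for i j x
  proof -
    have "cmod (iter_partial [j, i] g x) \<le> \<bar>C i j\<bar>" using C[of j i x] by (rule order_trans) simp
    also have "\<dots> \<le> (\<Sum>j\<in>UNIV. \<bar>C i j\<bar>)" by (rule member_le_sum) auto
    also have "\<dots> \<le> B" unfolding B_def by (rule member_le_sum) (auto intro: sum_nonneg)
    finally show ?thesis .
  qed
  have B0: "0 \<le> B" by (simp add: B_def sum_nonneg)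
  have lip: "cmod (iter_partial [i] g y - iter_partial [i] g x) \<le> ?n * B * norm (y - x)" for i x y
    using partials_mean_value[of "iter_partial [i] g" x "y - x" B] B schwartz_differentiable[OF g, of "[i]"]
    by (simp flip: iter_partial_append)
  have "cmod (g (x + h) - g x - (\<Sum>i\<in>UNIV. (h $ i) *\<^sub>R iter_partial [i] g x)) \<le> (?n * (?n * B)) * (norm h)\<^sup>2" for x h
  proof -
    let ?G = "(\<lambda>t. x + t *\<^sub>R h) ` {0..1}"
    let ?g' = "\<lambda>y k. \<Sum>i\<in>UNIV. (k $ i) *\<^sub>R iter_partial [i] g y"
    have "norm (g (x + h) - g x - ?g' x ((x + h) - x)) \<le> norm ((x + h) - x) * (?n * (?n * B * norm h))"
    proof (rule differentiable_bound_linearization[where S="?G"])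
      fix y assume y: "y \<in> ?G"
      then have "norm (y - x) \<le> norm h" by (auto simp: mult_left_le_one_le)
      then have "?n * B * norm (y - x) \<le> ?n * B * norm h" using B0 by (intro mult_left_mono) auto
      then have "cmod (iter_partial [i] g y - iter_partial [i] g x) \<le> ?n * B * norm h" for i
        using lip[of i y x] by linarith
      then have "onorm (\<lambda>k. \<Sum>i\<in>UNIV. (k $ i) *\<^sub>R (iter_partial [i] g y - iter_partial [i] g x)) \<le> ?n * (?n * B * norm h)"
        by (rule onorm_partials_le)
      then show "onorm (?g' y - ?g' x) \<le> ?n * (?n * B * norm h)"
        by (simp add: fun_diff_def scaleR_diff_right sum_subtractf)
    next
      show "x \<in> ?G" using imageI[of 0 "{0..1}" "\<lambda>t. x + t *\<^sub>R h"] by simp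
      show "(g has_derivative ?g' y) (at y within ?G)" for y
        by (rule has_derivative_at_withinI[OF has_derivative_partials[OF schwartz_differentiable'[OF g]]])
      show "x + t *\<^sub>R (x + h - x) \<in> ?G" if "t \<in> {0..1}" for t
        unfolding add_diff_cancel_left' using that by (rule imageI)
    qed
    then show ?thesis unfolding add_diff_cancel_left' power2_eq_square by (simp only: mult_ac)
  qed
  then show ?thesis using that[of "?n * (?n * B)"] B0 by simp
qed

text \<open>\<open>\<rho>\<close> is either the identity or a simple function approximating it.\<close>

definition cnvr :: "('a::euclidean_space \<Rightarrow> 'a) \<Rightarrow> ('a \<Rightarrow> complex) \<Rightarrow> ('a \<Rightarrow> complex) \<Rightarrow> 'a \<Rightarrow> complex" where
  "cnvr \<rho> b g x = (LINT y|lborel. b y * g (x - \<rho> y))"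

lemma cmod_integral_le:
  fixes f :: "'a \<Rightarrow> complex"
  assumes "integrable M g" "\<And>x. cmod (f x) \<le> g x"
  shows "cmod (LINT x|M. f x) \<le> (LINT x|M. g x)"
  by (rule order_trans[OF integral_norm_bound integral_mono'])
    (use assms in \<open>auto intro: order_trans[OF norm_ge_zero]\<close>)

lemma cnvr_integrable:
  fixes \<rho> :: "'a::euclidean_space \<Rightarrow> 'a"
  assumes b: "rapid b" and g: "continuous_on UNIV g" "\<And>x. cmod (g x) \<le> B"
    and [measurable]: "\<rho> \<in> borel_measurable borel"
  shows "integrable lborel (\<lambda>y. b y * g (x - \<rho> y))"
proof (rule Bochner_Integration.integrable_bound)
  show "integrable lborel (\<lambda>y. B * cmod (b y))" using rapid_integrable[OF b] by simp
  have [measurable]: "b \<in> borel_measurable borel" "g \<in> borel_measurable borel"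
    using b g by (auto simp: rapid_measurable borel_measurable_continuous_onI)
  show "(\<lambda>y. b y * g (x - \<rho> y)) \<in> borel_measurable lborel" by measurable
  have "cmod (b y) * cmod (g (x - \<rho> y)) \<le> cmod (b y) * B" for y by (intro mult_left_mono g) auto
  then show "AE y in lborel. norm (b y * g (x - \<rho> y)) \<le> norm (B * cmod (b y))"
    using order_trans[OF norm_ge_zero g(2)] by (auto simp: norm_mult mult.commute intro!: AE_I2)
qed

lemma cnvr_integrable_schwartz:
  fixes g :: "real^'n \<Rightarrow> complex" and \<rho> :: "real^'n \<Rightarrow> real^'n"
  assumes "rapid b" "g \<in> schwartz" "\<rho> \<in> borel_measurable borel"
  shows "integrable lborel (\<lambda>y. b y * g (x - \<rho> y))"
proof -
  obtain B where "\<And>x. cmod (g x) \<le> B" using rapid_bounded[OF schwartz_rapid[OF assms(2)]] by blast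
  from cnvr_integrable[OF assms(1) rapid_continuous[OF schwartz_rapid[OF assms(2)]] this assms(3)]
  show ?thesis .
qed

text \<open>The uniform Taylor remainder of \<open>g\<close> integrates against
  \<open>cmod (b y)\<close>, so the remainder of the convolution is again quadratic in the
  increment. The argument uses \<open>\<rho>\<close> only through the point at which
  \<open>g\<close> is expanded, so mere measurability of it suffices.\<close>

lemma cnvr_has_derivative:
  fixes g :: "real^'n \<Rightarrow> complex"
  assumes b: "rapid b" and g: "g \<in> schwartz" and \<rho>: "\<rho> \<in> borel_measurable borel"
  shows "(cnvr \<rho> b g has_derivative (\<lambda>h. \<Sum>i\<in>UNIV. (h $ i) *\<^sub>R cnvr \<rho> b (iter_partial [i] g) x)) (at x)"
proof -
  obtain C where C: "0 \<le> C"
    "\<And>x h. cmod (g (x + h) - g x - (\<Sum>i\<in>UNIV. (h $ i) *\<^sub>R iter_partial [i] g x)) \<le> C * (norm h)\<^sup>2"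
    using schwartz_taylor[OF g] by blast
  define I where "I = (LINT y|lborel. cmod (b y))"
  let ?L = "\<lambda>h. \<Sum>i\<in>UNIV. (h $ i) *\<^sub>R cnvr \<rho> b (iter_partial [i] g) x"
  have bi: "integrable lborel (\<lambda>y. cmod (b y))" using rapid_integrable[OF b] by simp
  have int: "integrable lborel (\<lambda>y. b y * iter_partial is g (x - \<rho> y))" for "is" x
    by (intro cnvr_integrable_schwartz b \<rho> iter_partial_schwartz g)
  have key: "cmod (cnvr \<rho> b g z - cnvr \<rho> b g x - ?L (z - x)) \<le> C * I * (norm (z - x))\<^sup>2" for z
  proof -
    let ?h = "z - x"
    let ?T = "\<lambda>y. b y * (g ((x - \<rho> y) + ?h) - g (x - \<rho> y) - (\<Sum>i\<in>UNIV. (?h $ i) *\<^sub>R iter_partial [i] g (x - \<rho> y)))"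
    have T: "?T y = b y * g (z - \<rho> y) - b y * g (x - \<rho> y) - (\<Sum>i\<in>UNIV. (?h $ i) *\<^sub>R (b y * iter_partial [i] g (x - \<rho> y)))" for y
      by (simp add: right_diff_distrib sum_distrib_left algebra_simps)
    have i0: "integrable lborel (\<lambda>y. b y * g (z - \<rho> y))" for z using int[of "[]" z] by simp
    have si: "integrable lborel (\<lambda>y. \<Sum>i\<in>UNIV. (?h $ i) *\<^sub>R (b y * iter_partial [i] g (x - \<rho> y)))"
      by (intro Bochner_Integration.integrable_sum integrable_scaleR_right int)
    have "cnvr \<rho> b g z - cnvr \<rho> b g x - ?L ?h = (LINT y|lborel. ?T y)"
    proof -
      have "(LINT y|lborel. ?T y) = (LINT y|lborel. b y * g (z - \<rho> y) - b y * g (x - \<rho> y))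
          - (LINT y|lborel. (\<Sum>i\<in>UNIV. (?h $ i) *\<^sub>R (b y * iter_partial [i] g (x - \<rho> y))))"
        unfolding T by (rule Bochner_Integration.integral_diff[OF Bochner_Integration.integrable_diff[OF i0 i0] si])
      moreover have "(LINT y|lborel. b y * g (z - \<rho> y) - b y * g (x - \<rho> y)) = cnvr \<rho> b g z - cnvr \<rho> b g x"
        unfolding cnvr_def by (rule Bochner_Integration.integral_diff[OF i0 i0])
      moreover have "(LINT y|lborel. (\<Sum>i\<in>UNIV. (?h $ i) *\<^sub>R (b y * iter_partial [i] g (x - \<rho> y)))) = ?L ?h"
        unfolding cnvr_def
        by (subst Bochner_Integration.integral_sum) (simp_all only: integral_scaleR_right integrable_scaleR_right int)
      ultimately show ?thesis by (simp only:)
    qed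
    also have "cmod \<dots> \<le> (LINT y|lborel. C * (norm ?h)\<^sup>2 * cmod (b y))"
    proof (rule cmod_integral_le)
      show "integrable lborel (\<lambda>y. C * (norm ?h)\<^sup>2 * cmod (b y))" using bi by simp
      show "norm (?T y) \<le> C * (norm ?h)\<^sup>2 * cmod (b y)" for y
        unfolding norm_mult using mult_left_mono[OF C(2)[of "x - \<rho> y" ?h], of "cmod (b y)"] by (simp add: mult_ac)
    qed
    also have "\<dots> = C * I * (norm ?h)\<^sup>2" by (simp add: I_def mult_ac)
    finally show ?thesis .
  qed
  show ?thesis
  proof (rule has_derivativeI_sandwich[where e=1 and H="\<lambda>z. C * I * norm (z - x)"])
    show "bounded_linear ?L"
      by (intro bounded_linear_sum bounded_linear_compose[OF bounded_linear_scaleR_left bounded_linear_vec_nth])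
    show "((\<lambda>z. C * I * norm (z - x)) \<longlongrightarrow> 0) (at x)"
      by (rule tendsto_eq_intros refl | simp)+
    fix z assume "z \<noteq> x"
    then show "norm (cnvr \<rho> b g z - cnvr \<rho> b g x - ?L (z - x)) / norm (z - x) \<le> C * I * norm (z - x)"
      using key[of z] by (simp add: pos_divide_le_eq power2_eq_square mult.assoc)
  qed simp
qed

lemma iter_partial_cnvr:
  fixes g :: "real^'n \<Rightarrow> complex"
  assumes "rapid b" "g \<in> schwartz" "\<rho> \<in> borel_measurable borel"
  shows "iter_partial is (cnvr \<rho> b g) = cnvr \<rho> b (iter_partial is g)"
proof (induction "is")
  case (Cons i "is")
  have "iter_partial (i # is) (cnvr \<rho> b g) = iter_partial [i] (cnvr \<rho> b (iter_partial is g))"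
    using Cons by simp
  also have "\<dots> = cnvr \<rho> b (iter_partial [i] (iter_partial is g))"
    using iter_partial_single_eq[OF cnvr_has_derivative[OF assms(1) iter_partial_schwartz[OF assms(2)] assms(3)]]
    by blast
  finally show ?case by simp
qed simp

text \<open>The factor 2 in the bound on \<open>\<rho>\<close> is the one delivered by the standard
  sequence of simple functions converging to the identity.\<close>

lemma cnvr_bound:
  assumes b: "rapid b" and [measurable]: "\<rho> \<in> borel_measurable borel" and \<rho>: "\<And>y. norm (\<rho> y) \<le> 2 * norm y"
    and g: "g \<in> borel_measurable borel" "\<And>x. (1 + norm x) ^ k * cmod (g x) \<le> C"
  shows "(1 + norm x) ^ k * cmod (cnvr \<rho> b g x) \<le> C * (LINT y|lborel. (1 + 2 * norm y) ^ k * cmod (b y))"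
proof -
  have bi: "integrable lborel (\<lambda>y. (1 + 2 * norm y) ^ k * cmod (b y))"
  proof (rule Bochner_Integration.integrable_bound[OF integrable_mult_right[OF rapid_integrable_weight[OF b, of k], of "2 ^ k"]])
    have [measurable]: "b \<in> borel_measurable borel" using b by (rule rapid_measurable)
    show "(\<lambda>y. (1 + 2 * norm y) ^ k * cmod (b y)) \<in> borel_measurable lborel" by measurable
    have "(1 + 2 * norm y) ^ k \<le> (2 * (1 + norm y)) ^ k" for y :: 'a by (intro power_mono) auto
    then have "(1 + 2 * norm y) ^ k * cmod (b y) \<le> 2 ^ k * ((1 + norm y) ^ k * cmod (b y))" for y
      using mult_right_mono[of _ _ "cmod (b y)"] by (fastforce simp only: power_mult_distrib mult.assoc[symmetric] norm_ge_zero)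
    then show "AE y in lborel. norm ((1 + 2 * norm y) ^ k * cmod (b y)) \<le> norm (2 ^ k * ((1 + norm y) ^ k * cmod (b y)))"
      by (auto intro!: AE_I2 simp: abs_mult)
  qed
  have "(1 + norm x) ^ k * cmod (cnvr \<rho> b g x) = cmod (LINT y|lborel. ((1 + norm x) ^ k) *\<^sub>R (b y * g (x - \<rho> y)))"
    by (simp add: cnvr_def)
  also have "\<dots> \<le> (LINT y|lborel. C * ((1 + 2 * norm y) ^ k * cmod (b y)))"
  proof (rule cmod_integral_le)
      show "integrable lborel (\<lambda>y. C * ((1 + 2 * norm y) ^ k * cmod (b y)))" using bi by simp
      fix y
      have "1 + norm x \<le> (1 + norm (x - \<rho> y)) * (1 + 2 * norm y)"
        by (rule order_trans[OF one_plus_norm_triangle[of x "\<rho> y"]]) (intro mult_left_mono, use \<rho> in auto)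
      then have "(1 + norm x) ^ k \<le> ((1 + norm (x - \<rho> y)) * (1 + 2 * norm y)) ^ k"
        by (rule power_mono) simp
      then have "(1 + norm x) ^ k * cmod (b y * g (x - \<rho> y)) \<le> ((1 + norm (x - \<rho> y)) * (1 + 2 * norm y)) ^ k * cmod (b y * g (x - \<rho> y))"
        by (rule mult_right_mono) simp
      also have "\<dots> = ((1 + norm (x - \<rho> y)) ^ k * cmod (g (x - \<rho> y))) * ((1 + 2 * norm y) ^ k * cmod (b y))"
        by (simp add: norm_mult power_mult_distrib)
      also have "\<dots> \<le> C * ((1 + 2 * norm y) ^ k * cmod (b y))"
        by (intro mult_right_mono g) simp
      finally show "norm (((1 + norm x) ^ k) *\<^sub>R (b y * g (x - \<rho> y))) \<le> C * ((1 + 2 * norm y) ^ k * cmod (b y))"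
        by simp
  qed
  also have "\<dots> = C * (LINT y|lborel. (1 + 2 * norm y) ^ k * cmod (b y))" by simp
  finally show ?thesis .
qed

lemma cnvr_schwartz:
  fixes g :: "real^'n \<Rightarrow> complex"
  assumes b: "rapid b" and g: "g \<in> schwartz" and \<rho>: "\<rho> \<in> borel_measurable borel" "\<And>y. norm (\<rho> y) \<le> 2 * norm y"
  shows "cnvr \<rho> b g \<in> schwartz"
proof (rule schwartzI)
  fix "is" :: "'n list" and x :: "real^'n"
  show "iter_partial is (cnvr \<rho> b g) differentiable (at x)"
    unfolding iter_partial_cnvr[OF b g \<rho>(1)] differentiable_def
    using cnvr_has_derivative[OF b iter_partial_schwartz[OF g] \<rho>(1)] by blast
  fix k
  obtain C where "\<And>x. (1 + norm x) ^ k * cmod (iter_partial is g x) \<le> C" using schwartz_bound[OF g] by blast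
  from cnvr_bound[OF b \<rho> _ this] show "\<exists>C. \<forall>x. (1 + norm x) ^ k * cmod (iter_partial is (cnvr \<rho> b g) x) \<le> C"
    unfolding iter_partial_cnvr[OF b g \<rho>(1)]
    using rapid_measurable[OF schwartz_rapid[OF iter_partial_schwartz[OF g]]] by blast
qed

lemma cnv_eq_cnvr: "cnv = cnvr (\<lambda>y. y)"
  by (intro ext) (simp add: cnv_def cnvr_def)

lemma cnv_schwartz: "rapid b \<Longrightarrow> g \<in> schwartz \<Longrightarrow> cnv b g \<in> schwartz"
  unfolding cnv_eq_cnvr by (rule cnvr_schwartz) auto

lemma iter_partial_cnv: "rapid b \<Longrightarrow> g \<in> schwartz \<Longrightarrow> iter_partial is (cnv b g) = cnv b (iter_partial is g)"
  unfolding cnv_eq_cnvr by (rule iter_partial_cnvr) auto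

section \<open>Closure of the Schwartz space under linear operations and affine
  substitutions\<close>

lemma iter_partial_add:
  assumes "f \<in> schwartz" "g \<in> schwartz"
  shows "iter_partial is (\<lambda>x. f x + g x) = (\<lambda>x. iter_partial is f x + iter_partial is g x)"
proof (induction "is")
  case (Cons i "is")
  show ?case
  proof
    fix x
    have "((\<lambda>x. iter_partial is f x + iter_partial is g x) has_derivative
      (\<lambda>h. frechet_derivative (iter_partial is f) (at x) h + frechet_derivative (iter_partial is g) (at x) h)) (at x)"
      using schwartz_differentiable[OF assms(1), of "is" x] schwartz_differentiable[OF assms(2), of "is" x]
      by (intro has_derivative_add) (simp_all add: frechet_derivative_works)
    from frechet_derivative_at[OF this, symmetric]
    show "iter_partial (i # is) (\<lambda>x. f x + g x) x = iter_partial (i # is) f x + iter_partial (i # is) g x"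
      using Cons by simp
  qed
qed simp

lemma iter_partial_cmult:
  assumes "f \<in> schwartz"
  shows "iter_partial is (\<lambda>x. c * f x) = (\<lambda>x. c * iter_partial is f x)"
proof (induction "is")
  case (Cons i "is")
  show ?case
  proof
    fix x
    have "((\<lambda>x. c * iter_partial is f x) has_derivative
      (\<lambda>h. c * frechet_derivative (iter_partial is f) (at x) h)) (at x)"
      using schwartz_differentiable[OF assms(1), of "is" x]
      by (intro has_derivative_mult_right) (simp_all add: frechet_derivative_works)
    from frechet_derivative_at[OF this, symmetric]
    show "iter_partial (i # is) (\<lambda>x. c * f x) x = c * iter_partial (i # is) f x"
      using Cons by simp
  qed
qed simp

lemma iter_partial_affine:
  fixes f :: "real^'n \<Rightarrow> complex"
  assumes "f \<in> schwartz"
  shows "iter_partial is (\<lambda>x. f (t + c *\<^sub>R x)) = (\<lambda>x. complex_of_real (c ^ length is) * iter_partial is f (t + c *\<^sub>R x))"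
proof (induction "is")
  case (Cons i "is")
  show ?case
  proof
    fix x
    let ?D = "frechet_derivative (iter_partial is f) (at (t + c *\<^sub>R x))"
    have D: "(iter_partial is f has_derivative ?D) (at (t + c *\<^sub>R x))"
      using schwartz_differentiable[OF assms] frechet_derivative_works by blast
    then interpret bounded_linear ?D by (rule has_derivative_bounded_linear)
    have "((\<lambda>x. t + c *\<^sub>R x) has_derivative (\<lambda>h. c *\<^sub>R h)) (at x)"
      by (auto intro!: derivative_eq_intros)
    from has_derivative_compose[OF this, of "iter_partial is f" ?D]
    have "((\<lambda>x. complex_of_real (c ^ length is) * iter_partial is f (t + c *\<^sub>R x)) has_derivative
      (\<lambda>h. complex_of_real (c ^ length is) * ?D (c *\<^sub>R h))) (at x)"
      using D by (intro has_derivative_mult_right) (simp add: o_def)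
    from frechet_derivative_at[OF this, symmetric]
    show "iter_partial (i # is) (\<lambda>x. f (t + c *\<^sub>R x)) x = complex_of_real (c ^ length (i # is)) * iter_partial (i # is) f (t + c *\<^sub>R x)"
      using Cons by (simp add: scaleR) (simp add: scaleR_conv_of_real)
  qed
qed simp

lemma schwartz_add: assumes "f \<in> schwartz" "g \<in> schwartz" shows "(\<lambda>x. f x + g x) \<in> schwartz"
proof (rule schwartzI)
  show "iter_partial is (\<lambda>x. f x + g x) differentiable (at x)" for "is" x
    unfolding iter_partial_add[OF assms] by (intro differentiable_add schwartz_differentiable assms)
  show "\<exists>C. \<forall>x. (1 + norm x) ^ k * cmod (iter_partial is (\<lambda>x. f x + g x) x) \<le> C" for "is" k
    unfolding iter_partial_add[OF assms]
    using rapid_add[OF assms[THEN iter_partial_schwartz, THEN schwartz_rapid]] unfolding rapid_def by blast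
qed

lemma schwartz_cmult: assumes "f \<in> schwartz" shows "(\<lambda>x. c * f x) \<in> schwartz"
proof (rule schwartzI)
  show "iter_partial is (\<lambda>x. c * f x) differentiable (at x)" for "is" x
    unfolding iter_partial_cmult[OF assms] by (intro differentiable_mult differentiable_const schwartz_differentiable assms)
  show "\<exists>C. \<forall>x. (1 + norm x) ^ k * cmod (iter_partial is (\<lambda>x. c * f x) x) \<le> C" for "is" k
    unfolding iter_partial_cmult[OF assms]
    using rapid_cmult[OF assms[THEN iter_partial_schwartz, THEN schwartz_rapid]] unfolding rapid_def by blast
qed

lemma schwartz_zero: "(\<lambda>x. 0) \<in> schwartz"
proof -
  have "iter_partial is (\<lambda>x. 0) = (\<lambda>x. 0)" for "is" :: "'a list"
    by (induction "is") (auto simp: frechet_derivative_const)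
  then show ?thesis by (intro schwartzI) auto
qed

lemma schwartz_diff: "f \<in> schwartz \<Longrightarrow> g \<in> schwartz \<Longrightarrow> (\<lambda>x. f x - g x) \<in> schwartz"
  using schwartz_add[OF _ schwartz_cmult, of f g "-1"] by simp

lemma iter_partial_diff:
  assumes "f \<in> schwartz" "g \<in> schwartz"
  shows "iter_partial is (\<lambda>x. f x - g x) = (\<lambda>x. iter_partial is f x - iter_partial is g x)"
  using iter_partial_add[OF assms(1) schwartz_cmult[OF assms(2)], of "is" "-1"]
    iter_partial_cmult[OF assms(2), of "is" "-1"] by simp

lemma schwartz_sum: "(\<And>i. i \<in> I \<Longrightarrow> f i \<in> schwartz) \<Longrightarrow> (\<lambda>x. \<Sum>i\<in>I. f i x) \<in> schwartz"
  by (induction I rule: infinite_finite_induct) (auto simp: schwartz_zero intro: schwartz_add)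

lemma schwartz_affine: assumes f: "f \<in> schwartz" and c: "c \<noteq> 0" shows "(\<lambda>x. f (t + c *\<^sub>R x)) \<in> schwartz"
proof (rule schwartzI)
  show "iter_partial is (\<lambda>x. f (t + c *\<^sub>R x)) differentiable (at x)" for "is" x
    unfolding iter_partial_affine[OF f]
  proof (intro differentiable_mult differentiable_const)
    have "iter_partial is f \<circ> (\<lambda>x. t + c *\<^sub>R x) differentiable (at x)"
      by (intro differentiable_chain_at schwartz_differentiable f) (auto intro!: derivative_intros)
    then show "(\<lambda>x. iter_partial is f (t + c *\<^sub>R x)) differentiable (at x)" by (simp add: o_def)
  qed
  show "\<exists>C. \<forall>x. (1 + norm x) ^ k * cmod (iter_partial is (\<lambda>x. f (t + c *\<^sub>R x)) x) \<le> C" for "is" k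
    unfolding iter_partial_affine[OF f]
    using rapid_cmult[OF rapid_affine[OF schwartz_rapid[OF iter_partial_schwartz[OF f]] c]] unfolding rapid_def by blast
qed

lemma schwartz_shift: "f \<in> schwartz \<Longrightarrow> (\<lambda>x. f (x - y)) \<in> schwartz"
  using schwartz_affine[of f 1 "-y"] by simp

lemma schwartz_reflect: "f \<in> schwartz \<Longrightarrow> (\<lambda>x. f (y - x)) \<in> schwartz"
  using schwartz_affine[of f "-1" y] by simp

lemma iter_partial_shift: "f \<in> schwartz \<Longrightarrow> iter_partial is (\<lambda>x. f (x - y)) = (\<lambda>x. iter_partial is f (x - y))"
  using iter_partial_affine[of f "is" "-y" 1] by simp

section \<open>Seminorm estimates for translations and convolutions\<close>

lemma schwartz_seminorm_bdd:
  fixes f :: "real^'n \<Rightarrow> complex"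
  assumes f: "f \<in> schwartz"
  shows "bdd_above ((\<lambda>(is, x). (1 + norm x) ^ N * cmod (iter_partial is f x)) ` ({is. length is \<le> N} \<times> UNIV))"
proof -
  have "\<exists>C. \<forall>x. (1 + norm x) ^ N * cmod (iter_partial is f x) \<le> C" for "is"
    using schwartz_bound[OF f] by metis
  then obtain C where C: "\<And>is x. (1 + norm x) ^ N * cmod (iter_partial is f x) \<le> C is" by metis
  \<comment> \<open>Only finitely many derivatives enter, so the sum of their individual bounds is a
    common one; without boundedness the real supremum would carry no information.\<close>
  have fin: "finite {is :: 'n list. length is \<le> N}"
    using finite_lists_length_le[of "UNIV :: 'n set" N] by simp
  show ?thesis
  proof (rule bdd_aboveI2)
    fix p :: "'n list \<times> (real^'n)"
    assume "p \<in> {is. length is \<le> N} \<times> UNIV"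
    then obtain "is" x where p: "p = (is, x)" "length is \<le> N" by auto
    have "(1 + norm x) ^ N * cmod (iter_partial is f x) \<le> \<bar>C is\<bar>" using C[of x "is"] by linarith
    also have "\<dots> \<le> (\<Sum>is\<in>{is. length is \<le> N}. \<bar>C is\<bar>)" using p fin by (intro member_le_sum) auto
    finally show "(case p of (is, x) \<Rightarrow> (1 + norm x) ^ N * cmod (iter_partial is f x)) \<le> (\<Sum>is\<in>{is. length is \<le> N}. \<bar>C is\<bar>)"
      using p by simp
  qed
qed

lemma schwartz_seminorm_ge:
  assumes f: "f \<in> schwartz" and "length is \<le> N"
  shows "(1 + norm x) ^ N * cmod (iter_partial is f x) \<le> schwartz_seminorm N f"
  unfolding schwartz_seminorm_def
  using cSUP_upper[OF _ schwartz_seminorm_bdd[OF f, of N], of "(is, x)"] assms(2) by simp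

lemma schwartz_seminorm_least:
  assumes "\<And>is x. length is \<le> N \<Longrightarrow> (1 + norm x) ^ N * cmod (iter_partial is f x) \<le> B"
  shows "schwartz_seminorm N f \<le> B"
  unfolding schwartz_seminorm_def
  by (rule cSUP_least) (use assms in \<open>auto intro!: exI[of _ "[]"]\<close>)

lemma schwartz_seminorm_nonneg: "f \<in> schwartz \<Longrightarrow> 0 \<le> schwartz_seminorm N f"
  by (rule order_trans[OF _ schwartz_seminorm_ge[of f "[]" N 0]]) auto

lemma schwartz_seminorm_mono:
  assumes f: "f \<in> schwartz" and "M \<le> N" shows "schwartz_seminorm M f \<le> schwartz_seminorm N f"
proof (rule schwartz_seminorm_least)
  fix "is" :: "'a list" and x :: "real^'a"
  assume l: "length is \<le> M"
  have "(1 + norm x) ^ M * cmod (iter_partial is f x) \<le> (1 + norm x) ^ N * cmod (iter_partial is f x)"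
    using assms by (intro mult_right_mono power_increasing) auto
  also have "\<dots> \<le> schwartz_seminorm N f" using l assms by (intro schwartz_seminorm_ge) auto
  finally show "(1 + norm x) ^ M * cmod (iter_partial is f x) \<le> schwartz_seminorm N f" .
qed

lemma schwartz_seminorm_shift:
  assumes f: "f \<in> schwartz"
  shows "schwartz_seminorm N (\<lambda>x. f (x - y)) \<le> (1 + norm y) ^ N * schwartz_seminorm N f"
proof (rule schwartz_seminorm_least)
  fix "is" :: "'a list" and x :: "real^'a"
  assume l: "length is \<le> N"
  have "(1 + norm x) ^ N \<le> ((1 + norm (x - y)) * (1 + norm y)) ^ N"
    by (intro power_mono one_plus_norm_triangle) simp
  then have "(1 + norm x) ^ N * cmod (iter_partial is f (x - y)) \<le> ((1 + norm (x - y)) * (1 + norm y)) ^ N * cmod (iter_partial is f (x - y))"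
    by (rule mult_right_mono) simp
  also have "\<dots> = (1 + norm y) ^ N * ((1 + norm (x - y)) ^ N * cmod (iter_partial is f (x - y)))"
    by (simp add: power_mult_distrib)
  also have "\<dots> \<le> (1 + norm y) ^ N * schwartz_seminorm N f"
    by (intro mult_left_mono schwartz_seminorm_ge f l) simp
  finally show "(1 + norm x) ^ N * cmod (iter_partial is (\<lambda>x. f (x - y)) x) \<le> (1 + norm y) ^ N * schwartz_seminorm N f"
    by (simp add: iter_partial_shift[OF f])
qed

text \<open>The mean value theorem on the segment between the two arguments costs one derivative,
  whence \<open>Suc N\<close>. An intermediate point has the form \<open>x - w\<close> with
  \<open>norm w\<close> at most \<open>norm y + norm z\<close>, which gives the weight
  factor.\<close>

lemma schwartz_shift_diff_pointwise:
  fixes f :: "real^'n \<Rightarrow> complex"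
  assumes f: "f \<in> schwartz" and l: "length is \<le> N"
  shows "(1 + norm x) ^ N * cmod (iter_partial is f (x - y) - iter_partial is f (x - z))
    \<le> real CARD('n) * norm (y - z) * (1 + norm y + norm z) ^ N * schwartz_seminorm (Suc N) f"
proof -
  let ?S = "schwartz_seminorm (Suc N) f" and ?P = "(1 + norm x) ^ N"
  have P: "0 < ?P" by (simp add: add_pos_nonneg)
  let ?B = "(1 + norm y + norm z) ^ N * ?S / ?P"
  have "cmod (iter_partial is f ((x - z) + (z - y)) - iter_partial is f (x - z)) \<le> real CARD('n) * ?B * norm (z - y)"
  proof (rule partials_mean_value)
    fix t :: real and i assume t: "t \<in> {0..1}"
    define w where "w = (1 - t) *\<^sub>R z + t *\<^sub>R y"
    have xw: "x - z + t *\<^sub>R (z - y) = x - w" by (simp add: w_def algebra_simps)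
    have "norm w \<le> (1 - t) * norm z + t * norm y"
      unfolding w_def using t by (intro order_trans[OF norm_triangle_ineq]) auto
    also have "\<dots> \<le> norm z + norm y"
      using t by (intro add_mono) (auto simp: mult_left_le_one_le)
    finally have w: "norm w \<le> norm y + norm z" by simp
    have "1 + norm x \<le> (1 + norm (x - w)) * (1 + norm y + norm z)"
      by (rule order_trans[OF one_plus_norm_triangle[of x w]]) (intro mult_left_mono, use w in auto)
    then have "?P \<le> ((1 + norm (x - w)) * (1 + norm y + norm z)) ^ N" by (rule power_mono) simp
    then have "?P * cmod (iter_partial (i # is) f (x - w)) \<le> ((1 + norm (x - w)) * (1 + norm y + norm z)) ^ N * cmod (iter_partial (i # is) f (x - w))"
      by (rule mult_right_mono) simp
    also have "\<dots> = (1 + norm y + norm z) ^ N * ((1 + norm (x - w)) ^ N * cmod (iter_partial (i # is) f (x - w)))"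
      by (simp add: power_mult_distrib)
    also have "(1 + norm (x - w)) ^ N * cmod (iter_partial (i # is) f (x - w)) \<le> (1 + norm (x - w)) ^ Suc N * cmod (iter_partial (i # is) f (x - w))"
      by (intro mult_right_mono power_increasing) auto
    also have "\<dots> \<le> ?S" using l by (intro schwartz_seminorm_ge f) simp
    finally have "?P * cmod (iter_partial (i # is) f (x - w)) \<le> (1 + norm y + norm z) ^ N * ?S"
      by (simp add: mult_left_mono)
    then show "cmod (iter_partial [i] (iter_partial is f) (x - z + t *\<^sub>R (z - y))) \<le> ?B"
      unfolding xw using P by (simp add: pos_le_divide_eq mult.commute)
  qed (rule schwartz_differentiable[OF f])
  then have "?P * cmod (iter_partial is f (x - y) - iter_partial is f (x - z)) \<le> ?P * (real CARD('n) * ?B * norm (z - y))"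
    using P by (intro mult_left_mono) auto
  also have "\<dots> = real CARD('n) * norm (y - z) * (1 + norm y + norm z) ^ N * ?S"
  proof -
    have "p * (c * (A / p) * d) = c * d * A" if "0 < p" for p c A d :: real
      using that by simp
    from this[OF P] show ?thesis by (simp only: norm_minus_commute[of z y] mult.assoc)
  qed
  finally show ?thesis .
qed

lemma schwartz_seminorm_shift_diff:
  fixes f :: "real^'n \<Rightarrow> complex"
  assumes f: "f \<in> schwartz"
  shows "schwartz_seminorm N (\<lambda>x. f (x - y) - f (x - z))
    \<le> real CARD('n) * norm (y - z) * (1 + norm y + norm z) ^ N * schwartz_seminorm (Suc N) f"
  by (rule schwartz_seminorm_least)
    (simp add: iter_partial_diff schwartz_shift f iter_partial_shift schwartz_shift_diff_pointwise)

text \<open>All derivatives fall on \<open>g\<close>, so the kernel enters only through a weighted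
  L1 integral and need not be smooth.\<close>

lemma schwartz_seminorm_cnv:
  fixes g :: "real^'n \<Rightarrow> complex"
  assumes b: "rapid b" and g: "g \<in> schwartz"
  shows "schwartz_seminorm N (cnv b g) \<le> (LINT y|lborel. (1 + norm y) ^ N * cmod (b y)) * schwartz_seminorm N g"
proof (rule schwartz_seminorm_least)
  fix "is" :: "'n list" and x :: "real^'n"
  assume l: "length is \<le> N"
  let ?g = "iter_partial is g" and ?S = "schwartz_seminorm N g"
  have "(1 + norm x) ^ N * cmod (cnv b ?g x) = cmod (LINT y|lborel. ((1 + norm x) ^ N) *\<^sub>R (b y * ?g (x - y)))"
    by (simp add: cnv_def)
  also have "\<dots> \<le> (LINT y|lborel. ((1 + norm y) ^ N * cmod (b y)) * ?S)"
  proof (rule cmod_integral_le)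
    show "integrable lborel (\<lambda>y. ((1 + norm y) ^ N * cmod (b y)) * ?S)"
      using rapid_integrable_weight[OF b] by simp
    fix y
    have "(1 + norm x) ^ N \<le> ((1 + norm (x - y)) * (1 + norm y)) ^ N"
      by (intro power_mono one_plus_norm_triangle) simp
    then have "(1 + norm x) ^ N * cmod (b y * ?g (x - y)) \<le> ((1 + norm (x - y)) * (1 + norm y)) ^ N * cmod (b y * ?g (x - y))"
      by (rule mult_right_mono) simp
    also have "\<dots> = ((1 + norm y) ^ N * cmod (b y)) * ((1 + norm (x - y)) ^ N * cmod (?g (x - y)))"
      by (simp add: norm_mult power_mult_distrib)
    also have "\<dots> \<le> ((1 + norm y) ^ N * cmod (b y)) * ?S"
      by (intro mult_left_mono schwartz_seminorm_ge g l) simp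
    finally show "norm ((1 + norm x) ^ N *\<^sub>R (b y * ?g (x - y))) \<le> ((1 + norm y) ^ N * cmod (b y)) * ?S"
      by simp
  qed
  finally show "(1 + norm x) ^ N * cmod (iter_partial is (cnv b g) x) \<le> (LINT y|lborel. (1 + norm y) ^ N * cmod (b y)) * ?S"
    by (simp add: iter_partial_cnv[OF b g])
qed

text \<open>As the kernel has total integral 1, the difference is an average of increments
  \<open>g x - g (x - y)\<close>; each is of first order in \<open>y\<close>, which brings out the
  first absolute moment of the kernel.\<close>

lemma schwartz_seminorm_cnv_diff:
  fixes g :: "real^'n \<Rightarrow> complex"
  assumes b: "rapid b" and g: "g \<in> schwartz" and b1: "(LINT y|lborel. b y) = 1"
  shows "schwartz_seminorm N (\<lambda>x. g x - cnv b g x)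
    \<le> real CARD('n) * (LINT y|lborel. norm y * (1 + norm y) ^ N * cmod (b y)) * schwartz_seminorm (Suc N) g"
proof (rule schwartz_seminorm_least)
  fix "is" :: "'n list" and x :: "real^'n"
  assume l: "length is \<le> N"
  let ?g = "iter_partial is g" and ?S = "schwartz_seminorm (Suc N) g"
  have i: "integrable lborel (\<lambda>y. b y * ?g (x - y))"
    by (intro cnvr_integrable_schwartz[where \<rho>="\<lambda>y. y"] b iter_partial_schwartz g) simp
  have i': "integrable lborel (\<lambda>y. b y * ?g x)"
    using rapid_integrable[OF b] by simp
  have [measurable]: "b \<in> borel_measurable borel" using b by (rule rapid_measurable)
  have "?g x - cnv b ?g x = (LINT y|lborel. b y * (?g (x - 0) - ?g (x - y)))"
    using i i' b1 by (simp add: cnv_def right_diff_distrib)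
  then have "(1 + norm x) ^ N * cmod (?g x - cnv b ?g x) = cmod (LINT y|lborel. ((1 + norm x) ^ N) *\<^sub>R (b y * (?g (x - 0) - ?g (x - y))))"
    by simp
  also have "\<dots> \<le> (LINT y|lborel. real CARD('n) * (norm y * (1 + norm y) ^ N * cmod (b y)) * ?S)"
  proof (rule cmod_integral_le)
    have "integrable lborel (\<lambda>y. norm y * (1 + norm y) ^ N * cmod (b y))"
      by (rule Bochner_Integration.integrable_bound[OF rapid_integrable_weight[OF b, of "Suc N"]])
        (auto intro!: AE_I2 mult_right_mono simp: abs_mult)
    then show "integrable lborel (\<lambda>y. real CARD('n) * (norm y * (1 + norm y) ^ N * cmod (b y)) * ?S)" by simp
    fix y
    have "cmod (b y) * ((1 + norm x) ^ N * cmod (?g (x - 0) - ?g (x - y))) \<le> cmod (b y) * (real CARD('n) * norm (0 - y) * (1 + norm (0 :: real^'n) + norm y) ^ N * ?S)"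
      by (intro mult_left_mono schwartz_shift_diff_pointwise g l) simp
    then show "norm ((1 + norm x) ^ N *\<^sub>R (b y * (?g (x - 0) - ?g (x - y)))) \<le> real CARD('n) * (norm y * (1 + norm y) ^ N * cmod (b y)) * ?S"
      by (simp add: norm_mult mult_ac)
  qed
  finally show "(1 + norm x) ^ N * cmod (iter_partial is (\<lambda>x. g x - cnv b g x) x)
      \<le> real CARD('n) * (LINT y|lborel. norm y * (1 + norm y) ^ N * cmod (b y)) * ?S"
    by (simp add: iter_partial_diff cnv_schwartz b g iter_partial_cnv)
qed

section \<open>Dilations that keep the integral fixed\<close>

definition dil :: "real \<Rightarrow> (real^'n \<Rightarrow> complex) \<Rightarrow> real^'n \<Rightarrow> complex" where
  "dil R a x = complex_of_real (R ^ CARD('n)) * a (R *\<^sub>R x)"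

lemma rapid_dil: "rapid a \<Longrightarrow> 0 < R \<Longrightarrow> rapid (dil R a)"
  unfolding dil_def using rapid_cmult[OF rapid_affine[of a R 0]] by simp

lemma schwartz_dil: "a \<in> schwartz \<Longrightarrow> 0 < R \<Longrightarrow> dil R a \<in> schwartz"
  unfolding dil_def[abs_def] using schwartz_cmult[OF schwartz_affine[of a R 0]] by simp

lemma fourier_dil: "rapid a \<Longrightarrow> 0 < R \<Longrightarrow> fourier (dil R a) \<xi> = fourier a ((1 / R) *\<^sub>R \<xi>)"
  unfolding dil_def[abs_def] using fourier_dilate[of a R \<xi>] by simp

lemma dil_integral:
  fixes a :: "real^'n \<Rightarrow> complex" and w :: "real^'n \<Rightarrow> real"
  assumes a: "rapid a" and R: "0 < R" and [measurable]: "w \<in> borel_measurable borel"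
  shows "(LINT y|lborel. w (R *\<^sub>R y) * cmod (dil R a y)) = (LINT y|lborel. w y * cmod (a y))"
proof -
  have [measurable]: "a \<in> borel_measurable borel" using a by (rule rapid_measurable)
  show ?thesis
    using R by (subst (2) lborel_integral_affine[of R _ 0])
      (simp_all add: dil_def norm_mult norm_power mult_ac flip: integral_mult_right_zero)
qed

text \<open>Dilation by \<open>R\<close> at least 1 concentrates mass towards the origin, where the
  weight is smaller; hence a bound uniform in \<open>R\<close>.\<close>

lemma dil_integral_weight_le:
  assumes a: "rapid a" and R: "1 \<le> R"
  shows "(LINT y|lborel. (1 + norm y) ^ N * cmod (dil R a y)) \<le> (LINT y|lborel. (1 + norm y) ^ N * cmod (a y))"
proof -
  have "(LINT y|lborel. (1 + norm y) ^ N * cmod (dil R a y)) \<le> (LINT y|lborel. (1 + norm (R *\<^sub>R y)) ^ N * cmod (dil R a y))"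
  proof (rule integral_mono)
    show "integrable lborel (\<lambda>y. (1 + norm y) ^ N * cmod (dil R a y))"
      using R by (intro rapid_integrable_weight rapid_dil a) simp
    show "integrable lborel (\<lambda>y. (1 + norm (R *\<^sub>R y)) ^ N * cmod (dil R a y))"
    proof (rule Bochner_Integration.integrable_bound[OF integrable_mult_right[OF rapid_integrable_weight[OF rapid_dil[OF a], of R N], of "R ^ N"]])
      have "(1 + R * norm y) ^ N \<le> (R * (1 + norm y)) ^ N" for y :: "real^'a"
        using R by (intro power_mono) (auto simp: distrib_left)
      then show "AE y in lborel. norm ((1 + norm (R *\<^sub>R y)) ^ N * cmod (dil R a y)) \<le> norm (R ^ N * ((1 + norm y) ^ N * cmod (dil R a y)))"
        using R by (auto intro!: AE_I2 mult_right_mono simp: abs_mult power_mult_distrib simp flip: mult.assoc)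
      show "(\<lambda>y. (1 + norm (R *\<^sub>R y)) ^ N * cmod (dil R a y)) \<in> borel_measurable lborel"
        using rapid_measurable[OF rapid_dil[OF a], of R] R by simp
    qed (use R in simp)
    show "(1 + norm y) ^ N * cmod (dil R a y) \<le> (1 + norm (R *\<^sub>R y)) ^ N * cmod (dil R a y)" for y
      using R mult_right_mono[OF R norm_ge_zero[of y]] by (intro mult_right_mono power_mono) auto
  qed
  also have "\<dots> = (LINT y|lborel. (1 + norm y) ^ N * cmod (a y))"
    using dil_integral[OF a, of R "\<lambda>y. (1 + norm y) ^ N"] R by simp
  finally show ?thesis .
qed

text \<open>The mass sits at distance of order 1/R, so the first moment gains this factor. Together
  with \<open>schwartz_seminorm_cnv_diff\<close> it yields the convergence rate of the approximate
  identity.\<close>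

lemma dil_integral_moment_le:
  assumes a: "rapid a" and R: "1 \<le> R"
  shows "(LINT y|lborel. norm y * (1 + norm y) ^ N * cmod (dil R a y)) \<le> (LINT y|lborel. (1 + norm y) ^ Suc N * cmod (a y)) / R"
proof -
  have *: "(LINT y|lborel. norm y * (1 + norm y) ^ N * cmod (dil R a y)) \<le> (LINT y|lborel. (1 / R) * ((1 + norm (R *\<^sub>R y)) ^ Suc N * cmod (dil R a y)))"
  proof (rule integral_mono_AE')
    have "integrable lborel (\<lambda>y. (1 + norm (R *\<^sub>R y)) ^ Suc N * cmod (dil R a y))"
    proof (rule Bochner_Integration.integrable_bound[OF integrable_mult_right[OF rapid_integrable_weight[OF rapid_dil[OF a], of R "Suc N"], of "R ^ Suc N"]])
      have "(1 + R * norm y) ^ Suc N \<le> (R * (1 + norm y)) ^ Suc N" for y :: "real^'a"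
        using R by (intro power_mono) (auto simp: distrib_left)
      then show "AE y in lborel. norm ((1 + norm (R *\<^sub>R y)) ^ Suc N * cmod (dil R a y)) \<le> norm (R ^ Suc N * ((1 + norm y) ^ Suc N * cmod (dil R a y)))"
        using R by (auto intro!: AE_I2 mult_right_mono simp: abs_mult power_mult_distrib simp flip: mult.assoc simp del: power_Suc)
      show "(\<lambda>y. (1 + norm (R *\<^sub>R y)) ^ Suc N * cmod (dil R a y)) \<in> borel_measurable lborel"
        using rapid_measurable[OF rapid_dil[OF a], of R] R by simp
    qed (use R in simp)
    then show "integrable lborel (\<lambda>y. (1 / R) * ((1 + norm (R *\<^sub>R y)) ^ Suc N * cmod (dil R a y)))" by simp
    have "norm y * (1 + norm y) ^ N * cmod (dil R a y) \<le> (1 / R) * ((1 + norm (R *\<^sub>R y)) ^ Suc N * cmod (dil R a y))" for y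
    proof -
      have 1: "norm y \<le> (1 / R) * (1 + norm (R *\<^sub>R y))" using R by (simp add: field_simps)
      have 2: "(1 + norm y) ^ N \<le> (1 + norm (R *\<^sub>R y)) ^ N"
        using R mult_right_mono[OF R norm_ge_zero[of y]] by (intro power_mono) auto
      have "norm y * (1 + norm y) ^ N \<le> ((1 / R) * (1 + norm (R *\<^sub>R y))) * (1 + norm (R *\<^sub>R y)) ^ N"
        using 1 2 R by (intro mult_mono) auto
      from mult_right_mono[OF this, of "cmod (dil R a y)"] show ?thesis by (simp add: mult_ac)
    qed
    then show "AE y in lborel. norm y * (1 + norm y) ^ N * cmod (dil R a y) \<le> (1 / R) * ((1 + norm (R *\<^sub>R y)) ^ Suc N * cmod (dil R a y))"
      by simp
  qed (use R in auto)
  also have "\<dots> = (1 / R) * (LINT y|lborel. (1 + norm (R *\<^sub>R y)) ^ Suc N * cmod (dil R a y))"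
    by (rule integral_mult_right_zero)
  also have "(LINT y|lborel. (1 + norm (R *\<^sub>R y)) ^ Suc N * cmod (dil R a y)) = (LINT y|lborel. (1 + norm y) ^ Suc N * cmod (a y))"
    using dil_integral[OF a, of R "\<lambda>y. (1 + norm y) ^ Suc N"] R by simp
  finally show ?thesis by simp
qed

section \<open>Tempered distributions and dyadic pieces\<close>

lemma temperedD:
  assumes "u \<in> tempered"
  shows "f \<notin> schwartz \<Longrightarrow> u f = 0"
    and "f \<in> schwartz \<Longrightarrow> g \<in> schwartz \<Longrightarrow> u (\<lambda>x. f x + g x) = u f + u g"
    and "f \<in> schwartz \<Longrightarrow> u (\<lambda>x. c * f x) = c * u f"
  using assms by (auto simp: tempered_def)

lemma tempered_bound:
  assumes "u \<in> tempered"
  obtains C N where "0 \<le> C" "\<And>f. f \<in> schwartz \<Longrightarrow> cmod (u f) \<le> C * schwartz_seminorm N f"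
proof -
  obtain C N where C: "\<forall>f\<in>schwartz. cmod (u f) \<le> C * schwartz_seminorm N f"
    using assms by (auto simp: tempered_def)
  have "cmod (u f) \<le> \<bar>C\<bar> * schwartz_seminorm N f" if "f \<in> schwartz" for f
    using C that mult_right_mono[OF abs_ge_self schwartz_seminorm_nonneg[OF that], of C] by (blast intro: order_trans)
  then show ?thesis using that[of "\<bar>C\<bar>" N] by simp
qed

lemma tempered_zero: "u \<in> tempered \<Longrightarrow> u (\<lambda>x. 0) = 0"
  using temperedD(3)[of u "\<lambda>x. 0" 0] by (simp add: schwartz_zero)

lemma tempered_diff:
  assumes "u \<in> tempered" "f \<in> schwartz" "g \<in> schwartz"
  shows "u (\<lambda>x. f x - g x) = u f - u g"
  using temperedD(2)[OF assms(1,2) schwartz_cmult[OF assms(3)], of "-1"]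
    temperedD(3)[OF assms(1,3), of "-1"] by simp

lemma tempered_sum:
  assumes u: "u \<in> tempered" and f: "\<And>i. i \<in> I \<Longrightarrow> f i \<in> schwartz"
  shows "u (\<lambda>x. \<Sum>i\<in>I. c i * f i x) = (\<Sum>i\<in>I. c i * u (f i))"
  using f
proof (induction I rule: infinite_finite_induct)
  case (insert i I)
  then show ?case
    using temperedD(2)[OF u schwartz_cmult[of "f i" "c i"] schwartz_sum[of I "\<lambda>i x. c i * f i x"]]
    by (simp add: temperedD(3)[OF u] schwartz_cmult)
qed (auto simp: tempered_zero[OF u])

text \<open>A simple translation parameter takes finitely many values, so the integral is a finite
  linear combination, the only kind of sum that linearity of a distribution can handle
  directly.\<close>

lemma integral_simple_compose:
  fixes b F :: "_ \<Rightarrow> complex"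
  assumes r: "simple_function lborel r" and b: "integrable lborel b"
  shows "(LINT y|lborel. b y * F (r y)) = (\<Sum>z\<in>range r. (LINT y|lborel. indicator (r -` {z}) y *\<^sub>R b y) * F z)"
proof -
  have fin: "finite (range r)" using r by (simp add: simple_function_def)
  have m: "r -` {z} \<in> sets lborel" if "z \<in> range r" for z
    using r that by (auto simp: simple_function_def)
  have "b y * F (r y) = (\<Sum>z\<in>range r. (indicator (r -` {z}) y *\<^sub>R b y) * F z)" for y
  proof -
    have "(\<Sum>z\<in>range r. (indicator (r -` {z}) y *\<^sub>R b y) * F z) = (\<Sum>z\<in>range r. if z = r y then b y * F z else 0)"
      by (intro sum.cong) (auto simp: indicator_def)
    then show ?thesis using fin by simp
  qed
  then have "(LINT y|lborel. b y * F (r y)) = (LINT y|lborel. (\<Sum>z\<in>range r. (indicator (r -` {z}) y *\<^sub>R b y) * F z))"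
    by simp
  also have "\<dots> = (\<Sum>z\<in>range r. LINT y|lborel. (indicator (r -` {z}) y *\<^sub>R b y) * F z)"
    by (intro Bochner_Integration.integral_sum integrable_mult_left integrable_mult_indicator m b)
  finally show ?thesis by (simp only: integral_mult_left_zero)
qed

text \<open>Translation is locally Lipschitz in its parameter when measured in the seminorm
  \<open>N\<close>, by \<open>schwartz_seminorm_shift_diff\<close>, and this seminorm controls
  \<open>u\<close>.\<close>

lemma tempered_translates_continuous:
  fixes a :: "real^'n \<Rightarrow> complex"
  assumes u: "u \<in> tempered" and a: "a \<in> schwartz"
  shows "continuous_on UNIV (\<lambda>y. u (\<lambda>x. a (x - y)))"
  unfolding continuous_on_sequentially
proof (intro allI ballI impI)
  fix s :: "nat \<Rightarrow> real^'n" and y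
  assume "y \<in> UNIV" and s: "(\<forall>n. s n \<in> UNIV) \<and> s \<longlonglongrightarrow> y"
  obtain C N where C: "0 \<le> C" "\<And>f. f \<in> schwartz \<Longrightarrow> cmod (u f) \<le> C * schwartz_seminorm N f"
    using tempered_bound[OF u] by blast
  have "(\<lambda>n. u (\<lambda>x. a (x - s n)) - u (\<lambda>x. a (x - y))) \<longlonglongrightarrow> 0"
  proof (rule Lim_null_comparison)
    show "\<forall>\<^sub>F n in sequentially. cmod (u (\<lambda>x. a (x - s n)) - u (\<lambda>x. a (x - y)))
        \<le> C * (real CARD('n) * norm (s n - y) * (1 + norm (s n) + norm y) ^ N * schwartz_seminorm (Suc N) a)"
      using C by (auto simp: tempered_diff[OF u, symmetric] a schwartz_shift
          intro!: always_eventually order_trans[OF C(2)] mult_left_mono schwartz_seminorm_shift_diff schwartz_diff)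
    have "(\<lambda>n. C * (real CARD('n) * norm (s n - y) * (1 + norm (s n) + norm y) ^ N * schwartz_seminorm (Suc N) a))
        \<longlonglongrightarrow> C * (real CARD('n) * norm (y - y) * (1 + norm y + norm y) ^ N * schwartz_seminorm (Suc N) a)"
      using s by (intro tendsto_intros) auto
    then show "(\<lambda>n. C * (real CARD('n) * norm (s n - y) * (1 + norm (s n) + norm y) ^ N * schwartz_seminorm (Suc N) a)) \<longlonglongrightarrow> 0"
      by simp
  qed
  then show "((\<lambda>y. u (\<lambda>x. a (x - y))) \<circ> s) \<longlonglongrightarrow> u (\<lambda>x. a (x - y))"
    by (simp add: LIM_zero_cancel o_def)
qed

lemma tempered_translates_growth:
  assumes u: "u \<in> tempered" and a: "a \<in> schwartz"
  obtains A N where "0 \<le> A" "\<And>y. cmod (u (\<lambda>x. a (x - y))) \<le> A * (1 + norm y) ^ N"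
proof -
  obtain C N where C: "0 \<le> C" "\<And>f. f \<in> schwartz \<Longrightarrow> cmod (u f) \<le> C * schwartz_seminorm N f"
    using tempered_bound[OF u] by blast
  have "cmod (u (\<lambda>x. a (x - y))) \<le> (C * schwartz_seminorm N a) * (1 + norm y) ^ N" for y
    using order_trans[OF C(2)[OF schwartz_shift[OF a]] mult_left_mono[OF schwartz_seminorm_shift[OF a] C(1)], of y]
    by (simp add: mult_ac)
  then show ?thesis using that[of "C * schwartz_seminorm N a" N] C(1) schwartz_seminorm_nonneg[OF a] by simp
qed

text \<open>A tempered distribution commutes with the integral of translates: true for simple functions
  in place of the translation parameter, and both sides converge as these approximate it.\<close>

lemma tempered_cnv:
  fixes a b :: "real^'n \<Rightarrow> complex"
  assumes u: "u \<in> tempered" and a: "a \<in> schwartz" and b: "rapid b"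
  shows "u (cnv b a) = (LINT y|lborel. b y * u (\<lambda>x. a (x - y)))"
proof -
  define F where "F y = u (\<lambda>x. a (x - y))" for y
  let ?n = "real CARD('n)"
  obtain C N where C: "0 \<le> C" "\<And>f. f \<in> schwartz \<Longrightarrow> cmod (u f) \<le> C * schwartz_seminorm N f"
    using tempered_bound[OF u] by blast
  have "(\<lambda>x. x) \<in> borel_measurable (lborel :: (real^'n) measure)" by simp
  from borel_measurable_implies_sequence_metric[OF this, of 0]
  obtain r :: "nat \<Rightarrow> real^'n \<Rightarrow> real^'n" where r: "\<And>i. simple_function lborel (r i)"
    "\<And>x. (\<lambda>i. r i x) \<longlonglongrightarrow> x" "\<And>i x. norm (r i x) \<le> 2 * norm x"
    by auto
  have rm [measurable]: "r i \<in> borel_measurable borel" for i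
    using borel_measurable_simple_function[OF r(1)] by simp
  have bm [measurable]: "b \<in> borel_measurable borel" using b by (rule rapid_measurable)
  have bi: "integrable lborel b" using b by (rule rapid_integrable)
  have Fc: "continuous_on UNIV F" unfolding F_def by (rule tempered_translates_continuous[OF u a])
  then have Fm [measurable]: "F \<in> borel_measurable borel" by (rule borel_measurable_continuous_onI)
  define A where "A i = cnvr (r i) b a" for i
  have A: "A i \<in> schwartz" for i unfolding A_def using r(3) by (intro cnvr_schwartz a b rm)
  have cA: "cnv b a \<in> schwartz" by (intro cnv_schwartz a b)
  have uA: "u (A i) = (LINT y|lborel. b y * F (r i y))" for i
  proof -
    have "A i = (\<lambda>x. \<Sum>z\<in>range (r i). (LINT y|lborel. indicator (r i -` {z}) y *\<^sub>R b y) * a (x - z))"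
      unfolding A_def cnvr_def by (intro ext integral_simple_compose[OF r(1) bi])
    then have "u (A i) = (\<Sum>z\<in>range (r i). (LINT y|lborel. indicator (r i -` {z}) y *\<^sub>R b y) * F z)"
      using tempered_sum[OF u schwartz_shift[OF a]] by (simp add: F_def)
    then show ?thesis using integral_simple_compose[OF r(1) bi, of F] by simp
  qed
  obtain G M where G: "0 \<le> G" "\<And>y. cmod (F y) \<le> G * (1 + norm y) ^ M"
    using tempered_translates_growth[OF u a] unfolding F_def by blast
  have lim1: "(\<lambda>i. u (A i)) \<longlonglongrightarrow> (LINT y|lborel. b y * F y)"
    unfolding uA
  proof (rule integral_dominated_convergence[where w="\<lambda>y. G * 2 ^ M * ((1 + norm y) ^ M * cmod (b y))"])
    show "integrable lborel (\<lambda>y. G * 2 ^ M * ((1 + norm y) ^ M * cmod (b y)))"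
      using rapid_integrable_weight[OF b] by simp
    show "AE y in lborel. (\<lambda>i. b y * F (r i y)) \<longlonglongrightarrow> b y * F y"
      by (intro AE_I2 tendsto_intros continuous_on_tendsto_compose[OF Fc r(2)]) auto
    show "AE y in lborel. norm (b y * F (r i y)) \<le> G * 2 ^ M * ((1 + norm y) ^ M * cmod (b y))" for i
    proof (intro AE_I2)
      fix y
      have "(1 + norm (r i y)) ^ M \<le> (2 * (1 + norm y)) ^ M" using r(3)[of i y] by (intro power_mono) auto
      then have "cmod (F (r i y)) \<le> G * (2 * (1 + norm y)) ^ M"
        using G by (blast intro: order_trans mult_left_mono)
      then have "cmod (b y) * cmod (F (r i y)) \<le> cmod (b y) * (G * (2 * (1 + norm y)) ^ M)"
        by (rule mult_left_mono) simp
      then show "norm (b y * F (r i y)) \<le> G * 2 ^ M * ((1 + norm y) ^ M * cmod (b y))"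
        by (simp only: norm_mult power_mult_distrib mult_ac)
    qed
  qed measurable
  \<comment> \<open>The integrand that \<open>schwartz_shift_diff_pointwise\<close> produces when
    the parameter \<open>y\<close> is replaced by \<open>r i y\<close>. It tends to 0 pointwise and
    has an integrable dominant, so the two convolutions become close in the seminorm that bounds
    \<open>u\<close>.\<close>
  define J where "J i y = norm (r i y - y) * (1 + norm (r i y) + norm y) ^ N * cmod (b y)" for i y
  have J_le: "J i y \<le> 3 ^ Suc N * ((1 + norm y) ^ Suc N * cmod (b y))" for i y
  proof -
    have "norm (r i y - y) \<le> 3 * (1 + norm y)"
      using norm_triangle_ineq4[of "r i y" y] r(3)[of i y] by simp
    moreover have "(1 + norm (r i y) + norm y) ^ N \<le> (3 * (1 + norm y)) ^ N"
      using r(3)[of i y] by (intro power_mono) auto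
    ultimately have "norm (r i y - y) * (1 + norm (r i y) + norm y) ^ N \<le> (3 * (1 + norm y)) * (3 * (1 + norm y)) ^ N"
      by (intro mult_mono) auto
    from mult_right_mono[OF this norm_ge_zero, of "b y"] show ?thesis
      unfolding J_def by (simp only: power_mult_distrib power_Suc mult_ac)
  qed
  have J_dom: "integrable lborel (\<lambda>y. 3 ^ Suc N * ((1 + norm y) ^ Suc N * cmod (b y)))"
    using rapid_integrable_weight[OF b] by (rule integrable_mult_right)
  have J_int: "integrable lborel (J i)" for i
  proof (rule Bochner_Integration.integrable_bound[OF J_dom])
    show "J i \<in> borel_measurable lborel" unfolding J_def by measurable
    show "AE y in lborel. norm (J i y) \<le> norm (3 ^ Suc N * ((1 + norm y) ^ Suc N * cmod (b y)))"
      using J_le[of i] by (intro AE_I2) (simp add: J_def abs_mult)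
  qed
  have J0: "(\<lambda>i. LINT y|lborel. J i y) \<longlonglongrightarrow> (LINT y|(lborel :: (real^'n) measure). (0::real))"
  proof (rule integral_dominated_convergence[OF _ _ J_dom])
    have "(\<lambda>i. J i y) \<longlonglongrightarrow> norm (y - y) * (1 + norm y + norm y) ^ N * cmod (b y)" for y
      unfolding J_def by (intro tendsto_intros r(2))
    then show "AE y in lborel. (\<lambda>i. J i y) \<longlonglongrightarrow> 0" by simp
    show "AE y in lborel. norm (J i y) \<le> 3 ^ Suc N * ((1 + norm y) ^ Suc N * cmod (b y))" for i
      using J_le[of i] by (intro AE_I2) (simp add: J_def abs_mult)
    show "J i \<in> borel_measurable lborel" for i using J_int by (rule borel_measurable_integrable)
  qed simp
  have sn: "schwartz_seminorm N (\<lambda>x. A i x - cnv b a x) \<le> ?n * schwartz_seminorm (Suc N) a * (LINT y|lborel. J i y)" for i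
  proof (rule schwartz_seminorm_least)
    fix "is" :: "'n list" and x :: "real^'n"
    assume l: "length is \<le> N"
    let ?a = "iter_partial is a" and ?S = "schwartz_seminorm (Suc N) a"
    have i1: "integrable lborel (\<lambda>y. b y * ?a (x - r i y))"
      by (intro cnvr_integrable_schwartz b iter_partial_schwartz a rm)
    have i2: "integrable lborel (\<lambda>y. b y * ?a (x - y))"
      by (intro cnvr_integrable_schwartz[where \<rho>="\<lambda>y. y"] b iter_partial_schwartz a) simp
    have "iter_partial is (\<lambda>x. A i x - cnv b a x) x = cnvr (r i) b ?a x - cnv b ?a x"
      by (simp only: iter_partial_diff[OF A cA])
        (simp only: A_def iter_partial_cnvr[OF b a rm] iter_partial_cnv[OF b a])
    also have "\<dots> = (LINT y|lborel. b y * (?a (x - r i y) - ?a (x - y)))"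
      using i1 i2 by (simp add: cnvr_def cnv_def right_diff_distrib)
    finally have "(1 + norm x) ^ N * cmod (iter_partial is (\<lambda>x. A i x - cnv b a x) x)
        = cmod (LINT y|lborel. (1 + norm x) ^ N *\<^sub>R (b y * (?a (x - r i y) - ?a (x - y))))"
      by simp
    also have "\<dots> \<le> (LINT y|lborel. ?n * ?S * J i y)"
    proof (rule cmod_integral_le)
      show "integrable lborel (\<lambda>y. ?n * ?S * J i y)" using J_int by (rule integrable_mult_right)
      fix y
      have "cmod (b y) * ((1 + norm x) ^ N * cmod (?a (x - r i y) - ?a (x - y)))
          \<le> cmod (b y) * (?n * norm (r i y - y) * (1 + norm (r i y) + norm y) ^ N * ?S)"
        by (intro mult_left_mono schwartz_shift_diff_pointwise a l) simp
      then show "cmod ((1 + norm x) ^ N *\<^sub>R (b y * (?a (x - r i y) - ?a (x - y)))) \<le> ?n * ?S * J i y"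
        by (simp add: J_def norm_mult mult_ac)
    qed
    finally show "(1 + norm x) ^ N * cmod (iter_partial is (\<lambda>x. A i x - cnv b a x) x) \<le> ?n * ?S * (LINT y|lborel. J i y)"
      by simp
  qed
  have "(\<lambda>i. u (A i) - u (cnv b a)) \<longlonglongrightarrow> 0"
  proof (rule Lim_null_comparison)
    show "\<forall>\<^sub>F i in sequentially. cmod (u (A i) - u (cnv b a)) \<le> C * (?n * schwartz_seminorm (Suc N) a * (LINT y|lborel. J i y))"
      using order_trans[OF C(2)[OF schwartz_diff[OF A cA]] mult_left_mono[OF sn C(1)]]
      by (simp add: tempered_diff[OF u A cA])
    show "(\<lambda>i. C * (?n * schwartz_seminorm (Suc N) a * (LINT y|lborel. J i y))) \<longlonglongrightarrow> 0"
      using J0 by (intro tendsto_mult_right_zero) simp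
  qed
  then have "(\<lambda>i. u (A i)) \<longlonglongrightarrow> u (cnv b a)" by (rule LIM_zero_cancel)
  from LIMSEQ_unique[OF this lim1] show ?thesis by (simp add: F_def)
qed

lemma schwartz_uminus: "f \<in> schwartz \<Longrightarrow> (\<lambda>x. f (- x)) \<in> schwartz"
  using schwartz_reflect[of f 0] by simp

lemma convol_continuous: "u \<in> tempered \<Longrightarrow> g \<in> schwartz \<Longrightarrow> continuous_on UNIV (convol g u)"
  using tempered_translates_continuous[OF _ schwartz_uminus, of u g]
  by (simp add: convol_def[abs_def])

lemma convol_measurable: "u \<in> tempered \<Longrightarrow> g \<in> schwartz \<Longrightarrow> convol g u \<in> borel_measurable borel"
  by (intro borel_measurable_continuous_onI convol_continuous)

lemma convol_growth:
  assumes "u \<in> tempered" "g \<in> schwartz"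
  obtains A N where "0 \<le> A" "\<And>y. cmod (convol g u y) \<le> A * (1 + norm y) ^ N"
proof -
  obtain A N where "0 \<le> A" "\<And>y. cmod (u (\<lambda>x. (\<lambda>z. g (- z)) (x - y))) \<le> A * (1 + norm y) ^ N"
    using tempered_translates_growth[OF assms(1) schwartz_uminus[OF assms(2)]] by blast
  then show ?thesis by (intro that[of A N]) (simp_all add: convol_def)
qed

lemma tempered_convol_integral:
  assumes "u \<in> tempered" "g \<in> schwartz" "rapid b"
  shows "u (\<lambda>z. LINT y|lborel. b y * g (y - z)) = (LINT y|lborel. b y * convol g u y)"
  using tempered_cnv[OF assms(1) schwartz_uminus[OF assms(2)] assms(3)]
  by (simp add: cnv_def[abs_def] convol_def)

lemma convol_add:
  "u \<in> tempered \<Longrightarrow> convol g (\<lambda>f. u f + v f) = (\<lambda>x. convol g u x + convol g v x)"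
  "convol g (\<lambda>f. c * u f) = (\<lambda>x. c * convol g u x)"
  by (simp_all add: convol_def[abs_def])

section \<open>Frequency supports and reproducing kernels of a Littlewood-Paley family\<close>

locale lp_family =
  fixes \<phi> :: "nat \<Rightarrow> real^'n \<Rightarrow> complex"
  assumes lp: "littlewood_paley \<phi>"
begin

lemma phi_schwartz: "\<phi> j \<in> schwartz"
  using lp by (simp add: littlewood_paley_def)

lemma phi_rapid: "rapid (\<phi> j)"
  by (rule schwartz_rapid[OF phi_schwartz])

lemma fourier_phi_0_eq_1: "norm \<xi> \<le> 1 \<Longrightarrow> fourier (\<phi> 0) \<xi> = 1"
  using lp unfolding littlewood_paley_def by (auto simp: subset_iff)

lemma fourier_phi_0_eq_0: "2 \<le> norm \<xi> \<Longrightarrow> fourier (\<phi> 0) \<xi> = 0"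
  using lp closure_subset[of "{\<xi>. fourier (\<phi> 0) \<xi> \<noteq> 0}"]
  unfolding littlewood_paley_def by (force simp: subset_iff)

lemma fourier_phi:
  assumes "1 \<le> j"
  shows "fourier (\<phi> j) \<xi> = fourier (\<phi> 0) ((1 / 2 ^ j) *\<^sub>R \<xi>) - fourier (\<phi> 0) ((2 / 2 ^ j) *\<^sub>R \<xi>)"
proof -
  have "2 powr - real j = 1 / 2 ^ j" "2 powr (1 - real j) = 2 / 2 ^ j"
    by (simp_all add: powr_diff powr_realpow powr_minus inverse_eq_divide)
  then show ?thesis using lp assms unfolding littlewood_paley_def by simp
qed

lemma fourier_phi_high:
  assumes "2 ^ Suc j \<le> norm \<xi>" shows "fourier (\<phi> j) \<xi> = 0"
proof (cases "j = 0")
  case False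
  have "(2::real) ^ j \<le> 2 ^ Suc j" by simp
  then have "2 ^ j \<le> norm \<xi>" using assms by linarith
  then have "2 \<le> norm ((1 / 2 ^ j) *\<^sub>R \<xi>)" "2 \<le> norm ((2 / 2 ^ j) *\<^sub>R \<xi>)"
    using assms by (simp_all add: field_simps)
  then show ?thesis using False by (simp add: fourier_phi fourier_phi_0_eq_0)
qed (use assms in \<open>simp add: fourier_phi_0_eq_0\<close>)

lemma fourier_phi_low:
  assumes "1 \<le> j" "2 * norm \<xi> \<le> 2 ^ j" shows "fourier (\<phi> j) \<xi> = 0"
proof -
  have "norm \<xi> \<le> 2 ^ j" using assms(2) norm_ge_zero[of \<xi>] by linarith
  then have "norm ((1 / 2 ^ j) *\<^sub>R \<xi>) \<le> 1" "norm ((2 / 2 ^ j) *\<^sub>R \<xi>) \<le> 1"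
    using assms(2) by (simp_all add: field_simps)
  then show ?thesis using assms(1) by (simp add: fourier_phi fourier_phi_0_eq_1)
qed

text \<open>The partial sum of the family up to level \<open>k\<close> in closed form
  (\<open>eta_eq_sum\<close>): a low-pass kernel whose transform is 1 up to frequency 2^k.\<close>

definition eta :: "nat \<Rightarrow> real^'n \<Rightarrow> complex" where "eta k = dil (2 ^ k) (\<phi> 0)"

lemma eta_schwartz: "eta k \<in> schwartz"
  unfolding eta_def by (intro schwartz_dil phi_schwartz) simp

lemma eta_rapid: "rapid (eta k)"
  by (rule schwartz_rapid[OF eta_schwartz])

lemma fourier_eta: "fourier (eta k) \<xi> = fourier (\<phi> 0) ((1 / 2 ^ k) *\<^sub>R \<xi>)"
  unfolding eta_def by (intro fourier_dil phi_rapid) simp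

lemma fourier_eta_eq_1: "norm \<xi> \<le> 2 ^ k \<Longrightarrow> fourier (eta k) \<xi> = 1"
  unfolding fourier_eta by (rule fourier_phi_0_eq_1) simp

lemma fourier_eta_eq_0: "2 ^ Suc k \<le> norm \<xi> \<Longrightarrow> fourier (eta k) \<xi> = 0"
  unfolding fourier_eta by (rule fourier_phi_0_eq_0) (simp add: field_simps)

text \<open>One level higher than \<open>j\<close>: the transform of \<open>eta (Suc j)\<close> is 1
  for frequencies up to 2^(j+1), outside of which that of \<open>\<phi> j\<close> vanishes.\<close>

lemma cnv_eta_phi: "cnv (eta (Suc j)) (\<phi> j) = \<phi> j"
proof (rule fourier_inject)
  fix \<xi> :: "real^'n"
  show "fourier (cnv (eta (Suc j)) (\<phi> j)) \<xi> = fourier (\<phi> j) \<xi>"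
    unfolding fourier_cnv[OF eta_rapid phi_rapid]
    by (cases "norm \<xi> \<le> 2 ^ Suc j") (auto simp: fourier_eta_eq_1 fourier_phi_high)
qed (intro cnv_rapid eta_rapid phi_rapid)+

text \<open>The differences that define the transforms telescope.\<close>

lemma eta_eq_sum: "eta k = (\<lambda>x. \<Sum>j\<le>k. \<phi> j x)"
proof (rule fourier_inject)
  fix \<xi> :: "real^'n"
  have "fourier (\<lambda>x. \<Sum>j\<le>k. \<phi> j x) \<xi> = (\<Sum>j\<le>k. fourier (\<phi> j) \<xi>)"
    by (intro fourier_sum phi_rapid)
  also have "\<dots> = fourier (\<phi> 0) ((1 / 2 ^ k) *\<^sub>R \<xi>)"
    by (induction k) (simp_all add: fourier_phi)
  finally show "fourier (eta k) \<xi> = fourier (\<lambda>x. \<Sum>j\<le>k. \<phi> j x) \<xi>"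
    by (simp add: fourier_eta)
qed (intro eta_rapid rapid_sum phi_rapid)+

lemma integral_eta: "(LINT y|lborel. eta k y) = 1"
  using fourier_eta_eq_1[of 0 k] by (simp add: fourier_def)

text \<open>The source of all pointwise control of a block: it equals its own average against a
  rapidly decreasing kernel of scale 2^-j, so it cannot oscillate faster than that scale.\<close>

lemma convol_phi_reproducing:
  assumes u: "u \<in> tempered"
  shows "convol (\<phi> j) u x = (LINT y|lborel. eta (Suc j) (x - y) * convol (\<phi> j) u y)"
proof -
  have "\<phi> j (x - z) = (LINT y|lborel. eta (Suc j) (x - y) * \<phi> j (y - z))" for z
  proof -
    have "\<phi> j (x - z) = (LINT w|lborel. eta (Suc j) w * \<phi> j (x - z - w))"
      using fun_cong[OF cnv_eta_phi, of j "x - z"] by (simp add: cnv_def)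
    also have "\<dots> = (LINT y|lborel. eta (Suc j) (x - y) * \<phi> j (x - z - (x - y)))"
      using rapid_measurable[OF eta_rapid, of "Suc j"] rapid_measurable[OF rapid_reflect[OF phi_rapid], of j "x - z"]
      by (intro lborel_integral_reflect[symmetric]) measurable
    finally show ?thesis by simp
  qed
  then have "convol (\<phi> j) u x = u (\<lambda>z. LINT y|lborel. eta (Suc j) (x - y) * \<phi> j (y - z))"
    by (simp add: convol_def)
  also have "\<dots> = (LINT y|lborel. eta (Suc j) (x - y) * convol (\<phi> j) u y)"
    by (intro tempered_convol_integral u phi_schwartz rapid_reflect eta_rapid)
  finally show ?thesis .
qed

end

section \<open>Peetre's maximal inequality\<close>

lemma one_plus_norm_pos [simp]: "0 < 1 + norm (x :: 'a::real_normed_vector)"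
  by (simp add: add_pos_nonneg)

lemma one_plus_norm_neq_0 [simp]: "1 + norm (x :: 'a::real_normed_vector) \<noteq> 0"
  using one_plus_norm_pos[of x] by (simp del: one_plus_norm_pos)

lemma wt_0 [simp]: "wt 0 = 1"
  by (simp add: wt_def)

lemma wt_eq_powr: "wt (x::'a::euclidean_space) = (1 + norm x) powr (- (real DIM('a) + 2))"
proof -
  have "real DIM('a) + 2 = real (DIM('a) + 2)" by simp
  then show ?thesis unfolding wt_def powr_minus by (simp only: powr_realpow[OF one_plus_norm_pos])
qed

lemma one_plus_norm_add: "1 + norm (x + y) \<le> (1 + norm x) * (1 + norm (y :: 'a::real_normed_vector))"
  using one_plus_norm_triangle[of "x + y" y] by simp

lemma powr_neg_norm_mult_le:
  assumes "0 \<le> M"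
  shows "(1 + norm x) powr (- M) * (1 + norm y) powr (- M) \<le> (1 + norm (x + y :: 'a::real_normed_vector)) powr (- M)"
proof -
  have "((1 + norm x) * (1 + norm y)) powr (- M) \<le> (1 + norm (x + y)) powr (- M)"
    using assms by (intro powr_mono2' one_plus_norm_add) auto
  then show ?thesis by (simp add: powr_mult)
qed

lemma wt_mult_le: "wt x * wt y \<le> wt (x + y)"
  unfolding wt_eq_powr by (rule powr_neg_norm_mult_le) simp

lemma wt_scale_integral:
  fixes y :: "'a::euclidean_space"
  assumes R: "0 < R"
  shows "R ^ DIM('a) * (LINT z|lborel. wt (R *\<^sub>R (y - z))) = (LINT z|lborel. wt (z::'a))"
    and "integrable lborel (\<lambda>z. wt (R *\<^sub>R (y - z)))"
    and "ennreal (R ^ DIM('a)) * (\<integral>\<^sup>+z. ennreal (wt (R *\<^sub>R (y - z))) \<partial>lborel) = (\<integral>\<^sup>+z. ennreal (wt (z::'a)) \<partial>lborel)"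
    and "ennreal (R ^ DIM('a)) * (\<integral>\<^sup>+z. ennreal (wt (R *\<^sub>R (z - y))) \<partial>lborel) = (\<integral>\<^sup>+z. ennreal (wt (z::'a)) \<partial>lborel)"
proof -
  have e: "R *\<^sub>R (y - z) = R *\<^sub>R y + (- R) *\<^sub>R z" for z by (simp add: scaleR_diff_right)
  have e': "R *\<^sub>R (z - y) = - (R *\<^sub>R y) + R *\<^sub>R z" for z by (simp add: scaleR_diff_right)
  show "R ^ DIM('a) * (LINT z|lborel. wt (R *\<^sub>R (y - z))) = (LINT z|lborel. wt (z::'a))"
    unfolding e using lborel_integral_affine[of "- R" wt "R *\<^sub>R y"] R by simp
  show "integrable lborel (\<lambda>z. wt (R *\<^sub>R (y - z)))"
    unfolding e using lborel_integrable_affine[OF _ wt_measurable wt_integrable, of "- R" "R *\<^sub>R y"] R by simp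
  show "ennreal (R ^ DIM('a)) * (\<integral>\<^sup>+z. ennreal (wt (R *\<^sub>R (y - z))) \<partial>lborel) = (\<integral>\<^sup>+z. ennreal (wt (z::'a)) \<partial>lborel)"
    unfolding e using lborel_nn_integral_affine[of "- R" "\<lambda>z. ennreal (wt z)" "R *\<^sub>R y"] R by simp
  show "ennreal (R ^ DIM('a)) * (\<integral>\<^sup>+z. ennreal (wt (R *\<^sub>R (z - y))) \<partial>lborel) = (\<integral>\<^sup>+z. ennreal (wt (z::'a)) \<partial>lborel)"
    unfolding e' using lborel_nn_integral_affine[of R "\<lambda>z. ennreal (wt z)" "- (R *\<^sub>R y)"] R by simp
qed

text \<open>If the bound failed at one point it would fail on a whole ball, which has positive
  measure.\<close>

lemma AE_le_continuous:
  fixes h :: "'a::euclidean_space \<Rightarrow> real"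
  assumes ae: "AE x in lborel. h x \<le> B" and c: "continuous_on UNIV h"
  shows "h x \<le> B"
proof (rule ccontr)
  assume x: "\<not> h x \<le> B"
  have "open (h -` {B<..} \<inter> UNIV)" by (rule continuous_on_open_vimage[OF open_UNIV, THEN iffD1, rule_format, OF c]) simp
  then have o: "open {y. B < h y}" by (simp add: vimage_def)
  have "x \<in> {y. B < h y}" using x by simp
  with o obtain e where e: "0 < e" "ball x e \<subseteq> {y. B < h y}" by (rule openE)
  have "{y. B < h y} \<in> null_sets lborel" using ae o by (subst (asm) AE_iff_null) (auto simp: not_le)
  then have "ball x e \<in> null_sets lborel" by (rule null_sets_subset[OF _ _ e(2)]) simp
  then have "emeasure lborel (ball x e) = 0" by auto
  then have "measure lborel (ball x e) = 0" by (simp add: measure_def)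
  then show False using content_ball_eq_0_iff[of x e] e(1) by simp
qed

context lp_family
begin

abbreviation blk :: "nat \<Rightarrow> 'n functional \<Rightarrow> real^'n \<Rightarrow> complex" where "blk j u \<equiv> convol (\<phi> j) u"

lemma blk_continuous: "u \<in> tempered \<Longrightarrow> continuous_on S (blk j u)"
  by (rule continuous_on_subset[OF convol_continuous[OF _ phi_schwartz]]) auto

lemma blk_measurable: "u \<in> tempered \<Longrightarrow> blk j u \<in> borel_measurable borel"
  by (rule convol_measurable[OF _ phi_schwartz])

text \<open>All these kernels are dilates of \<open>\<phi> 0\<close>, so one decay constant serves
  every level; the factor \<open>2 ^ (j * CARD('n))\<close> is the normalization of the dilation,
  and the extra doubling in \<open>Suc j\<close> goes into the constant.\<close>

lemma eta_decay:
  assumes M: "0 \<le> M"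
  obtains D where "0 < D"
    "\<And>j w. cmod (eta (Suc j) w) \<le> D * 2 ^ (j * CARD('n)) * (1 + norm (2 ^ j *\<^sub>R w)) powr (- M)"
proof -
  define k where "k = nat \<lceil>M\<rceil>"
  have k: "M \<le> real k" using M by (simp add: k_def)
  obtain C where C: "0 < C" "\<And>x. (1 + norm x) ^ k * cmod (\<phi> 0 x) \<le> C"
    using rapid_bound[OF phi_rapid] by blast
  have "cmod (eta (Suc j) w) \<le> (C * 2 ^ CARD('n)) * 2 ^ (j * CARD('n)) * (1 + norm (2 ^ j *\<^sub>R w)) powr (- M)" for j w
  proof -
    let ?v = "2 ^ Suc j *\<^sub>R w" and ?p = "1 + norm (2 ^ j *\<^sub>R w)"
    have p: "0 < ?p" by (rule one_plus_norm_pos)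
    have "norm (2 ^ j *\<^sub>R w) \<le> norm ?v" by simp
    then have "?p ^ k \<le> (1 + norm ?v) ^ k" by (intro power_mono) auto
    then have "?p ^ k * cmod (\<phi> 0 ?v) \<le> (1 + norm ?v) ^ k * cmod (\<phi> 0 ?v)" by (rule mult_right_mono) simp
    also have "\<dots> \<le> C" by (rule C)
    finally have "?p powr real k * cmod (\<phi> 0 ?v) \<le> C" by (simp only: powr_realpow[OF p])
    moreover have "?p powr M \<le> ?p powr real k" using k by (intro powr_mono) auto
    ultimately have "?p powr M * cmod (\<phi> 0 ?v) \<le> C"
      using mult_right_mono[of "?p powr M" "?p powr real k" "cmod (\<phi> 0 ?v)"] by simp
    then have le: "cmod (\<phi> 0 ?v) \<le> C * ?p powr (- M)"
      using p by (simp add: powr_minus field_simps)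
    have "cmod (eta (Suc j) w) = (2 ^ Suc j) ^ CARD('n) * cmod (\<phi> 0 ?v)"
      by (simp add: eta_def dil_def norm_mult norm_power)
    also have "\<dots> \<le> (2 ^ Suc j) ^ CARD('n) * (C * ?p powr (- M))"
      by (rule mult_left_mono[OF le]) simp
    also have "(2 ^ Suc j) ^ CARD('n) = (2::real) ^ CARD('n) * 2 ^ (j * CARD('n))"
      by (simp add: power_mult_distrib power_mult)
    finally show ?thesis by (simp only: mult_ac)
  qed
  then show ?thesis using C(1) by (intro that[of "C * 2 ^ CARD('n)"]) auto
qed

definition pk :: "nat \<Rightarrow> real \<Rightarrow> 'n functional \<Rightarrow> real^'n \<Rightarrow> real^'n \<Rightarrow> real" where
  "pk j r u x z = cmod (blk j u z) powr r * wt (2 ^ j *\<^sub>R (x - z))"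

text \<open>After multiplication by 2^(j n), a weighted average at scale 2^-j of the r-th power of
  the block around \<open>x\<close>. It takes the place of a maximal function and, being a
  convolution, can be integrated in \<open>x\<close> by Fubini's theorem.\<close>

definition PI :: "nat \<Rightarrow> real \<Rightarrow> 'n functional \<Rightarrow> real^'n \<Rightarrow> real" where
  "PI j r u x = (LINT z|lborel. pk j r u x z)"

lemma pk_nonneg: "0 \<le> pk j r u x z"
  by (simp add: pk_def wt_pos less_imp_le)

lemma PI_nonneg: "0 \<le> PI j r u x"
  unfolding PI_def by (rule Bochner_Integration.integral_nonneg) (rule pk_nonneg)

lemma pk_measurable: "u \<in> tempered \<Longrightarrow> pk j r u x \<in> borel_measurable borel"
  unfolding pk_def[abs_def] using blk_measurable[of u j] by measurable

text \<open>Moving the base point costs one factor \<open>wt\<close>, by \<open>wt_mult_le\<close>.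
  Finiteness at one point therefore gives finiteness at all points, with polynomial control.\<close>

lemma pk_shift:
  assumes u: "u \<in> tempered" and int: "integrable lborel (pk j r u x)"
  shows "integrable lborel (pk j r u y)" "PI j r u y * wt (2 ^ j *\<^sub>R (x - y)) \<le> PI j r u x"
proof -
  let ?w = "wt (2 ^ j *\<^sub>R (x - y))"
  have w: "0 < ?w" by (rule wt_pos)
  have le: "pk j r u y z * ?w \<le> pk j r u x z" for z
  proof -
    have "wt (2 ^ j *\<^sub>R (y - z)) * ?w \<le> wt (2 ^ j *\<^sub>R (y - z) + 2 ^ j *\<^sub>R (x - y))" by (rule wt_mult_le)
    also have "2 ^ j *\<^sub>R (y - z) + 2 ^ j *\<^sub>R (x - y) = 2 ^ j *\<^sub>R (x - z)" by (simp add: algebra_simps)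
    finally have "wt (2 ^ j *\<^sub>R (y - z)) * ?w \<le> wt (2 ^ j *\<^sub>R (x - z))" .
    then show ?thesis unfolding pk_def mult.assoc by (rule mult_left_mono) simp
  qed
  have "integrable lborel (\<lambda>z. pk j r u y z * ?w)"
  proof (rule Bochner_Integration.integrable_bound[OF int])
    show "(\<lambda>z. pk j r u y z * ?w) \<in> borel_measurable lborel" using pk_measurable[OF u] by simp
    show "AE z in lborel. norm (pk j r u y z * ?w) \<le> norm (pk j r u x z)"
      using le w by (intro AE_I2) (simp add: abs_mult pk_nonneg abs_of_pos)
  qed
  then have "integrable lborel (\<lambda>z. (pk j r u y z * ?w) * (1 / ?w))" by (rule integrable_mult_left)
  then show i: "integrable lborel (pk j r u y)" using w by simp
  have "PI j r u y * ?w = (LINT z|lborel. pk j r u y z * ?w)" by (simp add: PI_def)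
  also have "\<dots> \<le> PI j r u x" unfolding PI_def using i int le by (intro integral_mono) auto
  finally show "PI j r u y * ?w \<le> PI j r u x" .
qed

lemma blk_reproducing_bound:
  assumes u: "u \<in> tempered" and int: "integrable lborel G"
    and G: "\<And>z. cmod (eta (Suc j) (y - z)) * cmod (blk j u z) \<le> G z"
  shows "cmod (blk j u y) \<le> (LINT z|lborel. G z)"
  by (subst convol_phi_reproducing[OF u]) (rule cmod_integral_le[OF int], simp add: norm_mult G)

text \<open>The supremum \<open>H\<close> is bounded by \<open>D * H powr (1 - r)\<close> times the integral; being finite, it can be
  cancelled.\<close>

lemma peetre_pass:
  assumes u: "u \<in> tempered" and r: "0 < r" "r \<le> 1" and M: "0 \<le> M" "real CARD('n) + 2 \<le> M * r"
    and D: "0 \<le> D" "\<And>w. cmod (eta (Suc j) w) \<le> D * (1 + norm (2 ^ j *\<^sub>R w)) powr (- M)"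
    and B: "\<And>z. cmod (blk j u z) * (1 + norm (2 ^ j *\<^sub>R (x - z))) powr (- M) \<le> B"
    and int: "integrable lborel (pk j r u x)"
  shows "(cmod (blk j u y) * (1 + norm (2 ^ j *\<^sub>R (x - y))) powr (- M)) powr r \<le> D * PI j r u x"
proof -
  define v where "v z = (1 + norm (2 ^ j *\<^sub>R (x - z))) powr (- M)" for z
  define g where "g z = cmod (blk j u z) * v z" for z
  define H where "H = (SUP z. g z)"
  have v0: "0 < v z" for z unfolding v_def using one_plus_norm_pos by (simp del: norm_scaleR)
  have g0: "0 \<le> g z" for z using v0[of z] by (simp add: g_def)
  have gH: "g z \<le> H" for z
    unfolding H_def by (rule cSUP_upper) (use B in \<open>auto simp: g_def v_def bdd_above_def\<close>)
  have H0: "0 \<le> H" using g0[of 0] gH[of 0] by simp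
  \<comment> \<open>This is where \<open>M * r\<close> must reach the exponent of \<open>wt\<close>:
    the r-th power of the supremum's weight then passes into the integral.\<close>
  have vr: "v z powr r \<le> wt (2 ^ j *\<^sub>R (x - z))" for z
    unfolding v_def powr_powr wt_eq_powr using M by (intro powr_mono) auto
  have gr: "g z \<le> H powr (1 - r) * pk j r u x z" for z
  proof (cases "g z = 0")
    case True then show ?thesis by (simp add: pk_nonneg)
  next
    case False
    then have "g z = g z powr (1 - r) * g z powr r" using g0[of z] by (simp flip: powr_add)
    also have "\<dots> \<le> H powr (1 - r) * (cmod (blk j u z) powr r * wt (2 ^ j *\<^sub>R (x - z)))"
    proof (rule mult_mono)
      show "g z powr (1 - r) \<le> H powr (1 - r)" using r g0 gH by (intro powr_mono2) auto
      show "g z powr r \<le> cmod (blk j u z) powr r * wt (2 ^ j *\<^sub>R (x - z))"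
        unfolding g_def using v0[of z] vr[of z] by (simp add: powr_mult mult_left_mono)
    qed simp_all
    finally show ?thesis by (simp add: pk_def)
  qed
  have est: "g y \<le> D * H powr (1 - r) * PI j r u x" for y
  proof -
    have "cmod (blk j u y) \<le> (LINT z|lborel. (D * H powr (1 - r) / v y) * pk j r u x z)"
    proof (rule blk_reproducing_bound[OF u])
      show "integrable lborel (\<lambda>z. (D * H powr (1 - r) / v y) * pk j r u x z)"
        using int by (rule integrable_mult_right)
      fix z
      have "v y * (1 + norm (2 ^ j *\<^sub>R (y - z))) powr (- M) \<le> (1 + norm (2 ^ j *\<^sub>R (x - y) + 2 ^ j *\<^sub>R (y - z))) powr (- M)"
        unfolding v_def by (rule powr_neg_norm_mult_le[OF M(1)])
      also have "2 ^ j *\<^sub>R (x - y) + 2 ^ j *\<^sub>R (y - z) = 2 ^ j *\<^sub>R (x - z)" by (simp add: algebra_simps)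
      finally have vv: "v y * (1 + norm (2 ^ j *\<^sub>R (y - z))) powr (- M) \<le> v z" by (simp only: v_def)
      have "v y * (cmod (eta (Suc j) (y - z)) * cmod (blk j u z))
          \<le> v y * ((D * (1 + norm (2 ^ j *\<^sub>R (y - z))) powr (- M)) * cmod (blk j u z))"
        using v0[of y] by (intro mult_left_mono mult_right_mono D) auto
      also have "\<dots> = D * (v y * (1 + norm (2 ^ j *\<^sub>R (y - z))) powr (- M)) * cmod (blk j u z)" by (simp only: mult_ac)
      also have "\<dots> \<le> D * v z * cmod (blk j u z)"
        using D(1) vv by (intro mult_right_mono mult_left_mono) auto
      also have "\<dots> = D * g z" by (simp add: g_def)
      also have "\<dots> \<le> D * (H powr (1 - r) * pk j r u x z)" using D(1) gr by (intro mult_left_mono) auto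
      finally show "cmod (eta (Suc j) (y - z)) * cmod (blk j u z) \<le> (D * H powr (1 - r) / v y) * pk j r u x z"
        using v0[of y] by (simp add: field_simps)
    qed
    also have "\<dots> = (D * H powr (1 - r) / v y) * PI j r u x" by (simp add: PI_def)
    finally show ?thesis using v0[of y] by (simp add: g_def field_simps)
  qed
  have "H \<le> D * H powr (1 - r) * PI j r u x"
    unfolding H_def by (rule cSUP_least) (use est in \<open>auto simp: H_def\<close>)
  then have Hr: "H powr r \<le> D * PI j r u x" if "H \<noteq> 0"
  proof -
    have "0 < H" using that H0 by simp
    have "H powr (1 - r) * H powr r = H" using \<open>0 < H\<close> by (simp flip: powr_add)
    also have "\<dots> \<le> H powr (1 - r) * (D * PI j r u x)" using \<open>H \<le> _\<close> by (simp only: mult_ac)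
    finally show ?thesis using \<open>0 < H\<close> by simp
  qed
  have "g y powr r \<le> H powr r" using r g0 gH by (intro powr_mono2) auto
  also have "\<dots> \<le> D * PI j r u x"
    using Hr D(1) PI_nonneg[of j r u x] by (cases "H = 0") auto
  finally show ?thesis by (simp add: g_def v_def)
qed

text \<open>\<open>peetre_pass\<close> needs a finite supremum beforehand. The growth of a tempered
  distribution yields it only for a weight exponent depending on the distribution, and so would the
  resulting constant. Hence two passes: the first, with such an exponent, proves that the supremum
  for the fixed exponent \<open>M\<close> is finite; the second, with \<open>M\<close>, gives a
  constant that depends on neither \<open>j\<close> nor \<open>u\<close>.\<close>

lemma peetre_small:
  assumes r: "0 < r" "r \<le> 1"
  obtains C where "0 < C"
    "\<And>j u x y. u \<in> tempered \<Longrightarrow> integrable lborel (pk j r u x) \<Longrightarrow>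
      cmod (blk j u y) powr r * wt (2 ^ j *\<^sub>R (x - y)) \<le> C * 2 ^ (j * CARD('n)) * PI j r u x"
proof -
  define M where "M = (real CARD('n) + 2) / r"
  have M: "0 \<le> M" "M * r = real CARD('n) + 2" using r by (simp_all add: M_def)
  obtain D where D: "0 < D"
    "\<And>j w. cmod (eta (Suc j) w) \<le> D * 2 ^ (j * CARD('n)) * (1 + norm (2 ^ j *\<^sub>R w)) powr (- M)"
    using eta_decay[OF M(1)] by blast
  have wt_M: "((1 + norm v) powr (- M)) powr r = wt v" for v :: "real^'n"
  proof -
    have "- M * r = - (real DIM(real^'n) + 2)" using M(2) by simp
    moreover have "((1 + norm v) powr (- M)) powr r = (1 + norm v) powr (- M * r)"
      by (simp add: powr_powr)
    ultimately show ?thesis by (simp only: wt_eq_powr)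
  qed
  have "cmod (blk j u y) powr r * wt (2 ^ j *\<^sub>R (x - y)) \<le> D * 2 ^ (j * CARD('n)) * PI j r u x"
    if u: "u \<in> tempered" and int: "integrable lborel (pk j r u x)" for j u x y
  proof -
    obtain A N where A: "0 \<le> A" "\<And>y. cmod (blk j u y) \<le> A * (1 + norm y) ^ N"
      using convol_growth[OF u phi_schwartz] by blast
    \<comment> \<open>Large enough for the weight to beat the polynomial growth of this particular
      block.\<close>
    define M' where "M' = max M (real N)"
    have M': "0 \<le> M'" "real CARD('n) + 2 \<le> M' * r" "real N \<le> M'"
      using M r mult_right_mono[of M M' r] by (auto simp: M'_def)
    obtain D' where D': "0 < D'"
      "\<And>j w. cmod (eta (Suc j) w) \<le> D' * 2 ^ (j * CARD('n)) * (1 + norm (2 ^ j *\<^sub>R w)) powr (- M')"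
      using eta_decay[OF M'(1)] by blast
    \<comment> \<open>Here \<open>D'\<close> depends on \<open>u\<close> through the growth order
      \<open>N\<close>, so this bound is used for nothing but the finiteness required by the second
      pass.\<close>
    have first: "cmod (blk j u z) powr r \<le> D' * 2 ^ (j * CARD('n)) * PI j r u z" for z
    proof -
      have "(cmod (blk j u z) * (1 + norm (2 ^ j *\<^sub>R (z - z))) powr (- M')) powr r \<le> (D' * 2 ^ (j * CARD('n))) * PI j r u z"
      proof (rule peetre_pass[OF u r M'(1,2)])
        show "integrable lborel (pk j r u z)" by (rule pk_shift[OF u int])
        fix w
        have p: "1 \<le> 1 + norm (2 ^ j *\<^sub>R (z - w))" by simp
        have "norm (w - z) \<le> 2 ^ j * norm (z - w)"
          using mult_right_mono[of 1 "2 ^ j" "norm (z - w)"] by (simp add: norm_minus_commute)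
        then have "1 + norm w \<le> (1 + norm (2 ^ j *\<^sub>R (z - w))) * (1 + norm z)"
          by (intro order_trans[OF one_plus_norm_triangle[of w z]] mult_right_mono) auto
        then have "(1 + norm w) ^ N \<le> ((1 + norm (2 ^ j *\<^sub>R (z - w))) * (1 + norm z)) ^ N"
          by (rule power_mono) simp
        also have "\<dots> = (1 + norm (2 ^ j *\<^sub>R (z - w))) powr real N * (1 + norm z) ^ N"
          by (simp only: power_mult_distrib powr_realpow[OF one_plus_norm_pos])
        also have "\<dots> \<le> (1 + norm (2 ^ j *\<^sub>R (z - w))) powr M' * (1 + norm z) ^ N"
          using M'(3) p by (intro mult_right_mono powr_mono) auto
        finally have "cmod (blk j u w) \<le> A * ((1 + norm (2 ^ j *\<^sub>R (z - w))) powr M' * (1 + norm z) ^ N)"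
          using A by (blast intro: order_trans mult_left_mono)
        then have "cmod (blk j u w) * (1 + norm (2 ^ j *\<^sub>R (z - w))) powr (- M')
            \<le> A * ((1 + norm (2 ^ j *\<^sub>R (z - w))) powr M' * (1 + norm z) ^ N) * (1 + norm (2 ^ j *\<^sub>R (z - w))) powr (- M')"
          by (rule mult_right_mono) simp
        also have "\<dots> = A * (1 + norm z) ^ N"
          using one_plus_norm_pos[of "2 ^ j *\<^sub>R (z - w)"] by (simp add: powr_minus)
        finally show "cmod (blk j u w) * (1 + norm (2 ^ j *\<^sub>R (z - w))) powr (- M') \<le> A * (1 + norm z) ^ N" .
      qed (use D' in auto)
      then show ?thesis by simp
    qed
    define E where "E = D' * 2 ^ (j * CARD('n)) * PI j r u x"
    have "(cmod (blk j u y) * (1 + norm (2 ^ j *\<^sub>R (x - y))) powr (- M)) powr r \<le> (D * 2 ^ (j * CARD('n))) * PI j r u x"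
    proof (rule peetre_pass[OF u r M(1)])
      fix z
      let ?g = "cmod (blk j u z) * (1 + norm (2 ^ j *\<^sub>R (x - z))) powr (- M)"
      have "?g powr r = cmod (blk j u z) powr r * wt (2 ^ j *\<^sub>R (x - z))"
        by (simp only: powr_mult wt_M)
      also have "\<dots> \<le> (D' * 2 ^ (j * CARD('n)) * PI j r u z) * wt (2 ^ j *\<^sub>R (x - z))"
        by (intro mult_right_mono first less_imp_le wt_pos)
      also have "\<dots> = (D' * 2 ^ (j * CARD('n))) * (PI j r u z * wt (2 ^ j *\<^sub>R (x - z)))"
        by (simp only: mult_ac)
      also have "\<dots> \<le> E"
        unfolding E_def using D'(1) by (intro mult_left_mono pk_shift(2)[OF u int]) auto
      finally have "(?g powr r) powr (1 / r) \<le> E powr (1 / r)" using r by (intro powr_mono2) auto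
      then show "?g \<le> E powr (1 / r)" using r by (simp add: powr_powr)
    qed (use D M int in auto)
    then show ?thesis by (simp only: powr_mult wt_M)
  qed
  then show ?thesis using D(1) that by blast
qed

text \<open>Argue by contradiction at one point. If the block were too large there, split its values
  elsewhere at a fixed fraction \<open>t\<close> of that value: the part below \<open>t\<close> and
  the part above it, measured by r-th powers, together reproduce at most half of the value.\<close>

lemma peetre_large:
  assumes r: "1 \<le> r"
  obtains C where "0 < C"
    "\<And>j u x y. u \<in> tempered \<Longrightarrow> integrable lborel (pk j r u x) \<Longrightarrow>
      cmod (blk j u y) powr r * wt (2 ^ j *\<^sub>R (x - y)) \<le> C * 2 ^ (j * CARD('n)) * PI j r u x"
proof -
  obtain D where D: "0 < D"
    "\<And>j w. cmod (eta (Suc j) w) \<le> D * 2 ^ (j * CARD('n)) * (1 + norm (2 ^ j *\<^sub>R w)) powr (- (real CARD('n) + 2))"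
    using eta_decay[of "real CARD('n) + 2"] by auto
  have D': "cmod (eta (Suc j) w) \<le> D * 2 ^ (j * CARD('n)) * wt (2 ^ j *\<^sub>R w)" for j w
    using D(2)[of j w] by (simp add: wt_eq_powr)
  define W where "W = (LINT z|lborel. wt (z::real^'n))"
  have W0: "0 \<le> W" unfolding W_def by (rule Bochner_Integration.integral_nonneg) (simp add: wt_pos less_imp_le)
  \<comment> \<open>\<open>W\<close> comes from the values below the threshold, 1 from those above,
    \<open>D\<close> from the kernel; the factor 2 leaves the half that contradicts
    reproduction.\<close>
  define C' where "C' = 2 * D * (W + 1)"
  have C': "0 < C'" using D(1) W0 by (simp add: C'_def)
  have base: "cmod (blk j u y) powr r \<le> C' powr r * (2 ^ (j * CARD('n)) * PI j r u y)"
    if u: "u \<in> tempered" and int: "integrable lborel (pk j r u y)" for j u y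
  proof (rule ccontr)
    assume neg: "\<not> ?thesis"
    let ?R = "2 ^ (j * CARD('n)) :: real"
    define t where "t = cmod (blk j u y) / C'"
    have P0: "0 \<le> ?R * PI j r u y" using PI_nonneg[of j r u y] by simp
    have "blk j u y \<noteq> 0"
    proof
      assume "blk j u y = 0"
      then have "cmod (blk j u y) powr r = 0" by simp
      also have "0 \<le> C' powr r * (?R * PI j r u y)" using P0 by (rule mult_nonneg_nonneg[rotated]) simp
      finally show False using neg by simp
    qed
    then have t0: "0 < t" using C' by (simp add: t_def)
    have "C' powr r * (?R * PI j r u y) < C' powr r * t powr r"
      using neg C' t0 by (simp add: t_def powr_divide not_le)
    then have tr: "?R * PI j r u y \<le> t powr r" using C' by simp
    \<comment> \<open>Above \<open>t\<close>, the power \<open>a powr (1 - r)\<close> is decreasing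
      in \<open>a\<close> because \<open>r\<close> is at least 1, so it is at most
      \<open>t powr (1 - r)\<close>.\<close>
    have key: "a \<le> t + t powr (1 - r) * a powr r" if "0 \<le> a" for a
    proof (cases "a \<le> t")
      case True
      have "0 \<le> t powr (1 - r) * a powr r" by simp
      with True show ?thesis by linarith
    next
      case False
      then have "a = a powr (1 - r) * a powr r" using t0 by (simp flip: powr_add)
      also have "\<dots> \<le> t powr (1 - r) * a powr r"
        using False t0 r by (intro mult_right_mono powr_mono2') auto
      finally show ?thesis using t0 by linarith
    qed
    let ?G = "\<lambda>z. D * ?R * t * wt (2 ^ j *\<^sub>R (y - z)) + D * ?R * t powr (1 - r) * pk j r u y z"
    have wi: "integrable lborel (\<lambda>z. wt (2 ^ j *\<^sub>R (y - z)))" by (rule wt_scale_integral) simp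
    have "cmod (blk j u y) \<le> (LINT z|lborel. ?G z)"
    proof (rule blk_reproducing_bound[OF u])
      show "integrable lborel ?G"
        by (intro Bochner_Integration.integrable_add integrable_mult_right wi int)
      fix z
      have "cmod (eta (Suc j) (y - z)) * cmod (blk j u z)
          \<le> (D * ?R * wt (2 ^ j *\<^sub>R (y - z))) * (t + t powr (1 - r) * cmod (blk j u z) powr r)"
        by (intro mult_mono D' key) (use D(1) wt_pos[of "2 ^ j *\<^sub>R (y - z)"] in auto)
      also have "\<dots> = ?G z" by (simp add: pk_def algebra_simps)
      finally show "cmod (eta (Suc j) (y - z)) * cmod (blk j u z) \<le> ?G z" .
    qed
    also have "\<dots> = (LINT z|lborel. D * ?R * t * wt (2 ^ j *\<^sub>R (y - z))) + (LINT z|lborel. D * ?R * t powr (1 - r) * pk j r u y z)"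
      by (intro Bochner_Integration.integral_add integrable_mult_right wi int)
    also have "\<dots> = D * t * (?R * (LINT z|lborel. wt (2 ^ j *\<^sub>R (y - z)))) + D * t powr (1 - r) * (?R * PI j r u y)"
      unfolding integral_mult_right_zero PI_def by (simp only: mult_ac)
    also have "?R * (LINT z|lborel. wt (2 ^ j *\<^sub>R (y - z))) = W"
      using wt_scale_integral(1)[of "2 ^ j" y] by (simp add: W_def power_mult)
    also have "D * t * W + D * t powr (1 - r) * (?R * PI j r u y) \<le> D * t * W + D * t powr (1 - r) * t powr r"
      using tr D(1) by (intro add_left_mono mult_left_mono) auto
    also have "\<dots> = D * (W + 1) * t" using t0 by (simp add: algebra_simps flip: powr_add)
    also have "\<dots> = cmod (blk j u y) / 2"
    proof -
      have "D * (W + 1) = C' / 2" by (simp add: C'_def)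
      then have "D * (W + 1) * (cmod (blk j u y) / C') = C' / 2 * (cmod (blk j u y) / C')" by (simp only:)
      also have "\<dots> = cmod (blk j u y) / 2" using C' by simp
      finally show ?thesis unfolding t_def C'_def .
    qed
    finally show False using \<open>blk j u y \<noteq> 0\<close> by simp
  qed
  have "cmod (blk j u y) powr r * wt (2 ^ j *\<^sub>R (x - y)) \<le> (C' powr r) * 2 ^ (j * CARD('n)) * PI j r u x"
    if u: "u \<in> tempered" and int: "integrable lborel (pk j r u x)" for j u x y
  proof -
    have "cmod (blk j u y) powr r * wt (2 ^ j *\<^sub>R (x - y)) \<le> (C' powr r * (2 ^ (j * CARD('n)) * PI j r u y)) * wt (2 ^ j *\<^sub>R (x - y))"
      by (intro mult_right_mono base u pk_shift(1)[OF u int] less_imp_le wt_pos)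
    also have "\<dots> = (C' powr r * 2 ^ (j * CARD('n))) * (PI j r u y * wt (2 ^ j *\<^sub>R (x - y)))"
      by (simp only: mult_ac)
    also have "\<dots> \<le> (C' powr r * 2 ^ (j * CARD('n))) * PI j r u x"
      by (intro mult_left_mono pk_shift(2)[OF u int]) simp
    finally show ?thesis .
  qed
  then show ?thesis using C' by (intro that[of "C' powr r"]) auto
qed

lemma peetre:
  assumes r: "0 < r"
  obtains C where "0 < C"
    "\<And>j u x y. u \<in> tempered \<Longrightarrow> integrable lborel (pk j r u x) \<Longrightarrow>
      cmod (blk j u y) powr r * wt (2 ^ j *\<^sub>R (x - y)) \<le> C * 2 ^ (j * CARD('n)) * PI j r u x"
proof (cases "r \<le> 1")
  case True
  show thesis by (rule peetre_small[OF r True]) (rule that)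
next
  case False
  then have "1 \<le> r" by simp
  show thesis by (rule peetre_large[OF \<open>1 \<le> r\<close>]) (rule that)
qed

end

section \<open>Convolution estimates for all positive exponents\<close>

context lp_family
begin

lemma dil_reflect_integral:
  fixes \<theta> :: "real^'n \<Rightarrow> complex"
  assumes "rapid \<theta>"
  shows "(LINT y|lborel. cmod (dil (2 ^ j) \<theta> (x - y)) * (1 + norm (2 ^ j *\<^sub>R (x - y))) ^ k) = (LINT y|lborel. (1 + norm y) ^ k * cmod (\<theta> y))"
    and "integrable lborel (\<lambda>y. cmod (dil (2 ^ j) \<theta> (x - y)) * (1 + norm (2 ^ j *\<^sub>R (x - y))) ^ k)"
proof -
  let ?f = "\<lambda>y. cmod (dil (2 ^ j) \<theta> y) * (1 + norm (2 ^ j *\<^sub>R y)) ^ k"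
  have r: "rapid (dil (2 ^ j) \<theta>)" by (intro rapid_dil assms) simp
  have [measurable]: "dil (2 ^ j) \<theta> \<in> borel_measurable borel" by (rule rapid_measurable[OF r])
  have "(LINT y|lborel. ?f (x - y)) = (LINT y|lborel. ?f y)"
    by (rule lborel_integral_reflect) measurable
  also have "\<dots> = (LINT y|lborel. (1 + norm (2 ^ j *\<^sub>R y)) ^ k * cmod (dil (2 ^ j) \<theta> y))"
    by (simp only: mult.commute)
  also have "\<dots> = (LINT y|lborel. (1 + norm y) ^ k * cmod (\<theta> y))"
    using dil_integral[OF assms, of "2 ^ j" "\<lambda>v. (1 + norm v) ^ k"] by simp
  finally show "(LINT y|lborel. ?f (x - y)) = (LINT y|lborel. (1 + norm y) ^ k * cmod (\<theta> y))" .
  have "integrable lborel ?f"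
  proof (rule Bochner_Integration.integrable_bound[OF integrable_mult_right[OF rapid_integrable_weight[OF r, of k], of "(2 ^ j) ^ k"]])
    have le: "(1 + norm (2 ^ j *\<^sub>R y)) ^ k \<le> (2 ^ j) ^ k * (1 + norm y) ^ k" for y :: "real^'n"
      unfolding power_mult_distrib[symmetric] by (intro power_mono) (auto simp: distrib_left)
    have "?f y \<le> (2 ^ j) ^ k * ((1 + norm y) ^ k * cmod (dil (2 ^ j) \<theta> y))" for y
      using mult_left_mono[OF le[of y] norm_ge_zero[of "dil (2 ^ j) \<theta> y"]] by (simp only: mult_ac)
    then show "AE y in lborel. norm (?f y) \<le> norm ((2 ^ j) ^ k * ((1 + norm y) ^ k * cmod (dil (2 ^ j) \<theta> y)))"
      by (intro AE_I2) (simp add: abs_mult)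
  qed measurable
  then have "integrable lborel (\<lambda>y. ?f (x + (- 1) *\<^sub>R y))"
    by (rule lborel_integrable_affine[rotated 2]) (simp, measurable)
  then show "integrable lborel (\<lambda>y. ?f (x - y))" by simp
qed

lemma conv_measurable:
  assumes "rapid \<theta>" "u \<in> tempered"
  shows "(\<lambda>x. LINT y|lborel. dil (2 ^ j) \<theta> (x - y) * blk j u y) \<in> borel_measurable borel"
proof -
  have "rapid (dil (2 ^ j) \<theta>)" by (intro rapid_dil assms) simp
  then have [measurable]: "dil (2 ^ j) \<theta> \<in> borel_measurable borel" by (rule rapid_measurable)
  have [measurable]: "blk j u \<in> borel_measurable borel" by (rule blk_measurable[OF assms(2)])
  have "(\<lambda>x. LINT y|lborel. dil (2 ^ j) \<theta> (x - y) * blk j u y) \<in> borel_measurable lborel"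
    by (rule lborel.borel_measurable_lebesgue_integral) measurable
  then show ?thesis by simp
qed

text \<open>Peetre's inequality says that around \<open>x\<close> the block grows at most
  polynomially in units of 2^-j, with a size read off from \<open>PI j r u x\<close>; the kernel,
  rapidly decreasing in the same units, absorbs that growth.\<close>

lemma conv_pointwise:
  assumes r: "0 < r" and \<theta>: "rapid \<theta>"
  obtains C where "0 < C"
    "\<And>j u x. u \<in> tempered \<Longrightarrow> integrable lborel (pk j r u x) \<Longrightarrow>
      cmod (LINT y|lborel. dil (2 ^ j) \<theta> (x - y) * blk j u y) powr r \<le> C * 2 ^ (j * CARD('n)) * PI j r u x"
proof -
  obtain C where C: "0 < C"
    "\<And>j u x y. u \<in> tempered \<Longrightarrow> integrable lborel (pk j r u x) \<Longrightarrow>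
      cmod (blk j u y) powr r * wt (2 ^ j *\<^sub>R (x - y)) \<le> C * 2 ^ (j * CARD('n)) * PI j r u x"
    using peetre[OF r] by blast
  \<comment> \<open>The r-th root turns the weight exponent n + 2 into (n + 2) / r, rounded up to
    fit the natural powers in the estimates for rapidly decreasing functions.\<close>
  define k where "k = nat \<lceil>(real CARD('n) + 2) / r\<rceil>"
  have k: "(real CARD('n) + 2) / r \<le> real k" using r by (simp add: k_def)
  define c where "c = (LINT y|lborel. (1 + norm y) ^ k * cmod (\<theta> y))"
  have c0: "0 \<le> c" unfolding c_def by (rule Bochner_Integration.integral_nonneg) simp
  have "cmod (LINT y|lborel. dil (2 ^ j) \<theta> (x - y) * blk j u y) powr r \<le> (C * (c + 1) powr r) * 2 ^ (j * CARD('n)) * PI j r u x"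
    if u: "u \<in> tempered" and int: "integrable lborel (pk j r u x)" for j u x
  proof -
    define E where "E = C * 2 ^ (j * CARD('n)) * PI j r u x"
    have E0: "0 \<le> E" using C(1) PI_nonneg by (simp add: E_def)
    let ?p = "\<lambda>y. 1 + norm (2 ^ j *\<^sub>R (x - y))"
    have h: "cmod (blk j u y) \<le> E powr (1 / r) * ?p y ^ k" for y
    proof -
      have "cmod (blk j u y) powr r * wt (2 ^ j *\<^sub>R (x - y)) \<le> E"
        unfolding E_def by (rule C(2)[OF u int])
      then have "cmod (blk j u y) powr r \<le> E * ?p y ^ (CARD('n) + 2)"
        using one_plus_norm_pos[of "2 ^ j *\<^sub>R (x - y)"] unfolding wt_def by (simp add: field_simps del: power_Suc one_plus_norm_pos)
      also have "\<dots> = E * ?p y powr (real CARD('n) + 2)"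
      proof -
        have "real CARD('n) + 2 = real (CARD('n) + 2)" by simp
        then show ?thesis by (simp only: powr_realpow[OF one_plus_norm_pos])
      qed
      finally have "(cmod (blk j u y) powr r) powr (1 / r) \<le> (E * ?p y powr (real CARD('n) + 2)) powr (1 / r)"
        using r by (intro powr_mono2) auto
      then have "cmod (blk j u y) \<le> E powr (1 / r) * ?p y powr ((real CARD('n) + 2) / r)"
        using r E0 by (simp add: powr_powr powr_mult)
      also have "\<dots> \<le> E powr (1 / r) * ?p y powr real k"
        using k by (intro mult_left_mono powr_mono) auto
      also have "?p y powr real k = ?p y ^ k" by (rule powr_realpow) (rule one_plus_norm_pos)
      finally show ?thesis .
    qed
    have "cmod (LINT y|lborel. dil (2 ^ j) \<theta> (x - y) * blk j u y)
        \<le> (LINT y|lborel. E powr (1 / r) * (cmod (dil (2 ^ j) \<theta> (x - y)) * ?p y ^ k))"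
    proof (rule cmod_integral_le)
      show "integrable lborel (\<lambda>y. E powr (1 / r) * (cmod (dil (2 ^ j) \<theta> (x - y)) * ?p y ^ k))"
        by (intro integrable_mult_right dil_reflect_integral \<theta>)
      fix y
      have "cmod (dil (2 ^ j) \<theta> (x - y)) * cmod (blk j u y) \<le> cmod (dil (2 ^ j) \<theta> (x - y)) * (E powr (1 / r) * ?p y ^ k)"
        by (rule mult_left_mono[OF h]) simp
      then show "cmod (dil (2 ^ j) \<theta> (x - y) * blk j u y) \<le> E powr (1 / r) * (cmod (dil (2 ^ j) \<theta> (x - y)) * ?p y ^ k)"
        by (simp only: norm_mult mult_ac)
    qed
    also have "\<dots> = E powr (1 / r) * c"
      unfolding integral_mult_right_zero c_def by (simp only: dil_reflect_integral(1)[OF \<theta>])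
    also have "\<dots> \<le> E powr (1 / r) * (c + 1)" by (intro mult_left_mono) auto
    finally have "cmod (LINT y|lborel. dil (2 ^ j) \<theta> (x - y) * blk j u y) powr r \<le> (E powr (1 / r) * (c + 1)) powr r"
      using r by (intro powr_mono2) auto
    also have "\<dots> = E * (c + 1) powr r"
      using r E0 c0 by (simp add: powr_mult powr_powr)
    finally show ?thesis by (simp only: E_def mult_ac)
  qed
  then show ?thesis using C(1) c0 by (intro that[of "C * (c + 1) powr r"]) auto
qed

lemma Lp_blk_finite:
  assumes "p \<noteq> \<infinity>"
  shows "Lp_norm p lborel (\<lambda>x. ennreal (cmod (f x))) = ennpow (\<integral>\<^sup>+x. ennreal (cmod (f x) powr enn2real p) \<partial>lborel) (1 / enn2real p)"
  using assms by (simp add: Lp_norm_def ennpow_ennreal)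

text \<open>Blocks are continuous, so the essential supremum bounds every single value.\<close>

lemma blk_le_Linf:
  assumes u: "u \<in> tempered"
  shows "ennreal (cmod (blk j u x)) \<le> Lp_norm \<infinity> lborel (\<lambda>x. ennreal (cmod (blk j u x)))"
proof (cases "Lp_norm \<infinity> lborel (\<lambda>x. ennreal (cmod (blk j u x)))")
  case (real E)
  have "AE x in lborel. ennreal (cmod (blk j u x)) \<le> ennreal E"
    using esssup_AE[of "\<lambda>x. ennreal (cmod (blk j u x))" lborel] real by (simp add: Lp_norm_def)
  then have "AE x in lborel. cmod (blk j u x) \<le> E" using real(1) by simp
  then have "cmod (blk j u x) \<le> E"
    by (rule AE_le_continuous) (intro continuous_intros blk_continuous u)
  then show ?thesis using real by simp
qed simp

text \<open>A form of Young's inequality for blocks, valid for all positive exponents. For finite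
  \<open>p\<close> take \<open>r = p\<close> in \<open>conv_pointwise\<close> and integrate in
  \<open>x\<close>: the integral of the dilated weight cancels the factor 2^(j n), so the constant
  does not depend on the level.\<close>

lemma conv_Lp:
  assumes p: "0 < p" and \<theta>: "rapid \<theta>"
  obtains C where "0 < C"
    "\<And>j u. u \<in> tempered \<Longrightarrow>
      Lp_norm p lborel (\<lambda>x. ennreal (cmod (LINT y|lborel. dil (2 ^ j) \<theta> (x - y) * blk j u y)))
      \<le> ennreal C * Lp_norm p lborel (\<lambda>x. ennreal (cmod (blk j u x)))"
proof (cases "p = \<infinity>")
  case True
  define c where "c = (LINT y|lborel. (1 + norm y) ^ 0 * cmod (\<theta> y))"
  have c0: "0 \<le> c" unfolding c_def by (rule Bochner_Integration.integral_nonneg) simp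
  have "Lp_norm p lborel (\<lambda>x. ennreal (cmod (LINT y|lborel. dil (2 ^ j) \<theta> (x - y) * blk j u y)))
      \<le> ennreal (c + 1) * Lp_norm p lborel (\<lambda>x. ennreal (cmod (blk j u x)))" if u: "u \<in> tempered" for j u
  proof (cases "Lp_norm p lborel (\<lambda>x. ennreal (cmod (blk j u x)))")
    case (real E)
    have h: "cmod (blk j u y) \<le> E" for y
      using blk_le_Linf[OF u, of j y] real True by simp
    have "cmod (LINT y|lborel. dil (2 ^ j) \<theta> (x - y) * blk j u y) \<le> (c + 1) * E" for x
    proof -
      have "cmod (LINT y|lborel. dil (2 ^ j) \<theta> (x - y) * blk j u y)
          \<le> (LINT y|lborel. E * (cmod (dil (2 ^ j) \<theta> (x - y)) * (1 + norm (2 ^ j *\<^sub>R (x - y))) ^ 0))"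
      proof (rule cmod_integral_le)
        show "integrable lborel (\<lambda>y. E * (cmod (dil (2 ^ j) \<theta> (x - y)) * (1 + norm (2 ^ j *\<^sub>R (x - y))) ^ 0))"
          by (intro integrable_mult_right dil_reflect_integral \<theta>)
        show "cmod (dil (2 ^ j) \<theta> (x - y) * blk j u y) \<le> E * (cmod (dil (2 ^ j) \<theta> (x - y)) * (1 + norm (2 ^ j *\<^sub>R (x - y))) ^ 0)" for y
          using mult_left_mono[OF h[of y] norm_ge_zero[of "dil (2 ^ j) \<theta> (x - y)"]] by (simp add: norm_mult mult.commute)
      qed
      also have "\<dots> = E * c"
        unfolding integral_mult_right_zero c_def by (simp only: dil_reflect_integral(1)[OF \<theta>])
      also have "\<dots> \<le> (c + 1) * E" using real(1) by (simp add: algebra_simps)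
      finally show ?thesis .
    qed
    then have "esssup lborel (\<lambda>x. ennreal (cmod (LINT y|lborel. dil (2 ^ j) \<theta> (x - y) * blk j u y))) \<le> ennreal ((c + 1) * E)"
    proof (intro esssup_I AE_I2 ennreal_leI)
      have "(\<lambda>x. ennreal (cmod (g x))) \<in> borel_measurable lborel" if "g \<in> borel_measurable borel" for g :: "real^'n \<Rightarrow> complex"
        using that by measurable
      from this[OF conv_measurable[OF \<theta> u, of j]]
      show "(\<lambda>x. ennreal (cmod (LINT y|lborel. dil (2 ^ j) \<theta> (x - y) * blk j u y))) \<in> borel_measurable lborel" .
    qed
    then show ?thesis using True real c0 by (simp add: Lp_norm_def ennreal_mult)
  next
    case top
    then show ?thesis using c0 by (simp add: ennreal_mult_top)
  qed
  then show ?thesis using c0 by (intro that[of "c + 1"]) auto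
next
  case False
  define r where "r = enn2real p"
  have r: "0 < r" using p False by (simp add: r_def enn2real_positive_iff less_top)
  obtain C where C: "0 < C"
    "\<And>j u x. u \<in> tempered \<Longrightarrow> integrable lborel (pk j r u x) \<Longrightarrow>
      cmod (LINT y|lborel. dil (2 ^ j) \<theta> (x - y) * blk j u y) powr r \<le> C * 2 ^ (j * CARD('n)) * PI j r u x"
    using conv_pointwise[OF r \<theta>] by blast
  define W where "W = (LINT z|lborel. wt (z::real^'n))"
  have W0: "0 \<le> W" unfolding W_def by (rule Bochner_Integration.integral_nonneg) (simp add: wt_pos less_imp_le)
  have W: "(\<integral>\<^sup>+z. ennreal (wt (z::real^'n)) \<partial>lborel) = ennreal W"
    unfolding W_def by (rule nn_integral_eq_integral[OF wt_integrable]) (simp add: wt_pos less_imp_le)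
  have "Lp_norm p lborel (\<lambda>x. ennreal (cmod (LINT y|lborel. dil (2 ^ j) \<theta> (x - y) * blk j u y)))
      \<le> ennreal ((C * (W + 1)) powr (1 / r)) * Lp_norm p lborel (\<lambda>x. ennreal (cmod (blk j u x)))" if u: "u \<in> tempered" for j u
  proof -
    let ?c = "\<lambda>x. LINT y|lborel. dil (2 ^ j) \<theta> (x - y) * blk j u y"
    let ?R = "2 ^ (j * CARD('n)) :: real"
    have [measurable]: "blk j u \<in> borel_measurable borel" by (rule blk_measurable[OF u])
    have pt: "ennreal (cmod (?c x) powr r) \<le> ennreal (C * ?R) * (\<integral>\<^sup>+z. ennreal (pk j r u x z) \<partial>lborel)" for x
    proof (cases "integrable lborel (pk j r u x)")
      case True
      have "ennreal (cmod (?c x) powr r) \<le> ennreal (C * ?R * PI j r u x)"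
        by (rule ennreal_leI[OF C(2)[OF u True]])
      also have "\<dots> = ennreal (C * ?R) * ennreal (PI j r u x)"
        using C(1) PI_nonneg by (intro ennreal_mult) auto
      also have "ennreal (PI j r u x) = (\<integral>\<^sup>+z. ennreal (pk j r u x z) \<partial>lborel)"
        unfolding PI_def by (rule nn_integral_eq_integral[OF True, symmetric]) (simp add: pk_nonneg)
      finally show ?thesis .
    next
      case False
      \<comment> \<open>Where the average diverges, the pointwise bound holds trivially, its
        right-hand side being infinite.\<close>
      then have "(\<integral>\<^sup>+z. ennreal (pk j r u x z) \<partial>lborel) = \<infinity>"
        using pk_measurable[OF u, of j r x] by (subst (asm) integrable_iff_bounded) (auto simp: pk_nonneg not_less top_unique)
      then show ?thesis using C(1) by (simp add: ennreal_mult_top)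
    qed
    have "(\<integral>\<^sup>+x. ennreal (cmod (?c x) powr r) \<partial>lborel) \<le> (\<integral>\<^sup>+x. ennreal (C * ?R) * (\<integral>\<^sup>+z. ennreal (pk j r u x z) \<partial>lborel) \<partial>lborel)"
      by (rule nn_integral_mono[OF pt])
    also have "\<dots> = ennreal (C * ?R) * (\<integral>\<^sup>+x. \<integral>\<^sup>+z. ennreal (pk j r u x z) \<partial>lborel \<partial>lborel)"
      unfolding pk_def by (rule nn_integral_cmult) measurable
    also have "(\<integral>\<^sup>+x. \<integral>\<^sup>+z. ennreal (pk j r u x z) \<partial>lborel \<partial>lborel) = (\<integral>\<^sup>+z. \<integral>\<^sup>+x. ennreal (pk j r u x z) \<partial>lborel \<partial>lborel)"
      unfolding pk_def by (rule lborel_pair.Fubini') measurable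
    also have "\<dots> = (\<integral>\<^sup>+z. ennreal (cmod (blk j u z) powr r) * (\<integral>\<^sup>+x. ennreal (wt (2 ^ j *\<^sub>R (x - z))) \<partial>lborel) \<partial>lborel)"
      unfolding pk_def by (subst nn_integral_cmult[symmetric]) (simp_all add: ennreal_mult wt_pos less_imp_le)
    also have "ennreal (C * ?R) * \<dots> = (\<integral>\<^sup>+z. ennreal (C * ?R) * (ennreal (cmod (blk j u z) powr r) * (\<integral>\<^sup>+x. ennreal (wt (2 ^ j *\<^sub>R (x - z))) \<partial>lborel)) \<partial>lborel)"
      by (rule nn_integral_cmult[symmetric]) measurable
    also have "\<dots> = (\<integral>\<^sup>+z. ennreal (C * W) * ennreal (cmod (blk j u z) powr r) \<partial>lborel)"
    proof (rule nn_integral_cong)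
      fix z :: "real^'n"
      have "ennreal ?R * (\<integral>\<^sup>+x. ennreal (wt (2 ^ j *\<^sub>R (x - z))) \<partial>lborel) = ennreal W"
        using wt_scale_integral(4)[of "2 ^ j" z] by (simp add: W power_mult)
      then show "ennreal (C * ?R) * (ennreal (cmod (blk j u z) powr r) * (\<integral>\<^sup>+x. ennreal (wt (2 ^ j *\<^sub>R (x - z))) \<partial>lborel))
          = ennreal (C * W) * ennreal (cmod (blk j u z) powr r)"
        using C(1) W0 by (simp add: ennreal_mult mult_ac)
    qed
    also have "\<dots> = ennreal (C * W) * (\<integral>\<^sup>+z. ennreal (cmod (blk j u z) powr r) \<partial>lborel)"
      by (rule nn_integral_cmult) measurable
    also have "\<dots> \<le> ennreal (C * (W + 1)) * (\<integral>\<^sup>+z. ennreal (cmod (blk j u z) powr r) \<partial>lborel)"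
      using C(1) by (intro mult_right_mono ennreal_leI) auto
    finally have "ennpow (\<integral>\<^sup>+x. ennreal (cmod (?c x) powr r) \<partial>lborel) (1 / r)
        \<le> ennpow (ennreal (C * (W + 1)) * (\<integral>\<^sup>+z. ennreal (cmod (blk j u z) powr r) \<partial>lborel)) (1 / r)"
      using r by (intro ennpow_mono) auto
    also have "\<dots> = ennpow (ennreal (C * (W + 1))) (1 / r) * ennpow (\<integral>\<^sup>+z. ennreal (cmod (blk j u z) powr r) \<partial>lborel) (1 / r)"
      using r by (intro ennpow_mult) auto
    also have "ennpow (ennreal (C * (W + 1))) (1 / r) = ennreal ((C * (W + 1)) powr (1 / r))"
      using C(1) W0 by (intro ennpow_ennreal) auto
    finally show ?thesis unfolding Lp_blk_finite[OF False] r_def .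
  qed
  then show ?thesis using C(1) W0 by (intro that[of "(C * (W + 1)) powr (1 / r)"]) auto
qed

text \<open>Nikolskii's inequality.\<close>

lemma blk_sup_le_Lp:
  assumes p: "0 < p"
  obtains C a where "0 < C" "0 \<le> a"
    "\<And>j u x. u \<in> tempered \<Longrightarrow>
      ennreal (cmod (blk j u x)) \<le> ennreal (C * 2 powr (a * real j)) * Lp_norm p lborel (\<lambda>x. ennreal (cmod (blk j u x)))"
proof (cases "p = \<infinity>")
  case True
  show ?thesis
  proof (rule that[of 1 0])
    show "ennreal (cmod (blk j u x)) \<le> ennreal (1 * 2 powr (0 * real j)) * Lp_norm p lborel (\<lambda>x. ennreal (cmod (blk j u x)))"
      if "u \<in> tempered" for j u x
      using blk_le_Linf[OF that, of j x] True by simp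
  qed simp_all
next
  case False
  define r where "r = enn2real p"
  have r: "0 < r" using p False by (simp add: r_def enn2real_positive_iff less_top)
  obtain C where C: "0 < C"
    "\<And>j u x y. u \<in> tempered \<Longrightarrow> integrable lborel (pk j r u x) \<Longrightarrow>
      cmod (blk j u y) powr r * wt (2 ^ j *\<^sub>R (x - y)) \<le> C * 2 ^ (j * CARD('n)) * PI j r u x"
    using peetre[OF r] by blast
  \<comment> \<open>The r-th root of the factor 2^(j n) in Peetre's inequality.\<close>
  define a where "a = real CARD('n) / r"
  have "ennreal (cmod (blk j u x)) \<le> ennreal (C powr (1 / r) * 2 powr (a * real j)) * Lp_norm p lborel (\<lambda>x. ennreal (cmod (blk j u x)))"
    if u: "u \<in> tempered" for j u x
  proof (cases "integrable lborel (\<lambda>z. cmod (blk j u z) powr r)")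
    case True
    define S where "S = (LINT z|lborel. cmod (blk j u z) powr r)"
    have S0: "0 \<le> S" unfolding S_def by (rule Bochner_Integration.integral_nonneg) simp
    have le: "pk j r u x z \<le> cmod (blk j u z) powr r" for z
      unfolding pk_def using wt_le_1 by (intro mult_left_le) auto
    have int: "integrable lborel (pk j r u x)"
      using le pk_measurable[OF u, of j r x]
      by (intro Bochner_Integration.integrable_bound[OF True]) (auto simp: pk_nonneg intro!: AE_I2)
    have PI: "PI j r u x \<le> S"
      unfolding PI_def S_def by (rule integral_mono[OF int True le])
    have "cmod (blk j u x) powr r \<le> C * 2 ^ (j * CARD('n)) * PI j r u x"
      using C(2)[OF u int, of x] by simp
    also have "\<dots> \<le> C * 2 ^ (j * CARD('n)) * S" using PI C(1) by (intro mult_left_mono) auto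
    finally have "(cmod (blk j u x) powr r) powr (1 / r) \<le> (C * 2 ^ (j * CARD('n)) * S) powr (1 / r)"
      using r by (intro powr_mono2) auto
    also have "\<dots> = C powr (1 / r) * 2 powr (a * real j) * S powr (1 / r)"
    proof -
      have "(2 ^ (j * CARD('n))) powr (1 / r) = (2::real) powr (a * real j)"
        by (simp add: a_def powr_powr mult_ac flip: powr_realpow)
      then show ?thesis using C(1) S0 by (simp add: powr_mult)
    qed
    finally have fin: "cmod (blk j u x) \<le> C powr (1 / r) * 2 powr (a * real j) * S powr (1 / r)"
      using r by (simp add: powr_powr)
    have "(\<integral>\<^sup>+z. ennreal (cmod (blk j u z) powr r) \<partial>lborel) = ennreal S"
      unfolding S_def by (rule nn_integral_eq_integral[OF True]) simp
    then have "Lp_norm p lborel (\<lambda>x. ennreal (cmod (blk j u x))) = ennreal (S powr (1 / r))"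
      using S0 by (simp add: Lp_blk_finite[OF False] ennpow_ennreal flip: r_def)
    then show ?thesis using ennreal_leI[OF fin] by (simp add: ennreal_mult)
  next
    case F: False
    then have "(\<integral>\<^sup>+z. ennreal (cmod (blk j u z) powr r) \<partial>lborel) = \<infinity>"
      using blk_measurable[OF u, of j] by (subst (asm) integrable_iff_bounded) (auto simp: not_less top_unique)
    then have "Lp_norm p lborel (\<lambda>x. ennreal (cmod (blk j u x))) = \<infinity>"
      by (simp add: Lp_blk_finite[OF False] flip: r_def)
    then show ?thesis using C(1) by (simp add: ennreal_mult_top)
  qed
  then show ?thesis using C(1) r by (intro that[of "C powr (1 / r)" a]) (auto simp: a_def)
qed

end

section \<open>Besov quasi-norms\<close>

text \<open>Fatou's lemma for every exponent; for the exponent infinity, countably many exceptional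
  null sets are united first.\<close>

lemma Lp_norm_liminf:
  assumes p: "0 < p" and [measurable]: "\<And>i. F i \<in> borel_measurable M" "f \<in> borel_measurable M"
    and lim: "\<And>x. x \<in> space M \<Longrightarrow> f x \<le> liminf (\<lambda>i. F i x)"
  shows "Lp_norm p M f \<le> liminf (\<lambda>i. Lp_norm p M (F i))"
proof (cases "p = \<infinity>")
  case True
  have "AE x in M. \<forall>i. F i x \<le> esssup M (F i)"
    unfolding AE_all_countable by (intro allI esssup_AE)
  then have "AE x in M. f x \<le> liminf (\<lambda>i. esssup M (F i))"
    using AE_space
  proof eventually_elim
    case (elim x)
    have "liminf (\<lambda>i. F i x) \<le> liminf (\<lambda>i. esssup M (F i))"
      using elim by (intro Liminf_mono) auto
    then show ?case using lim[of x] elim by auto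
  qed
  then show ?thesis using True by (simp add: Lp_norm_def esssup_I)
next
  case False
  define r where "r = enn2real p"
  have r: "0 < r" using p False by (simp add: r_def enn2real_positive_iff less_top)
  have "(\<integral>\<^sup>+x. ennpow (f x) r \<partial>M) \<le> (\<integral>\<^sup>+x. liminf (\<lambda>i. ennpow (F i x) r) \<partial>M)"
    by (intro nn_integral_mono ennpow_le_liminf lim r)
  also have "\<dots> \<le> liminf (\<lambda>i. \<integral>\<^sup>+x. ennpow (F i x) r \<partial>M)"
    by (rule nn_integral_liminf) measurable
  finally have "ennpow (\<integral>\<^sup>+x. ennpow (f x) r \<partial>M) (1 / r) \<le> liminf (\<lambda>i. ennpow (\<integral>\<^sup>+x. ennpow (F i x) r \<partial>M) (1 / r))"
    using r by (intro ennpow_le_liminf) auto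
  then show ?thesis using False by (simp add: Lp_norm_def flip: r_def)
qed

text \<open>The inequality of \<open>Lp_norm_cmult_le\<close>, used for the factor and for its
  reciprocal.\<close>

lemma Lp_norm_cmult:
  assumes p: "0 < p" and f: "f \<in> borel_measurable M" and c: "0 < c"
  shows "Lp_norm p M (\<lambda>x. ennreal c * f x) = ennreal c * Lp_norm p M f"
proof (rule antisym)
  show "Lp_norm p M (\<lambda>x. ennreal c * f x) \<le> ennreal c * Lp_norm p M f" by (rule Lp_norm_cmult_le[OF p f])
  have e: "ennreal c * ennreal (1 / c) = 1" "ennreal (1 / c) * ennreal c = 1"
    using c by (simp_all flip: ennreal_mult)
  have "ennreal c * Lp_norm p M f = ennreal c * Lp_norm p M (\<lambda>x. ennreal (1 / c) * (ennreal c * f x))"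
    by (simp only: mult.assoc[symmetric] e mult_1)
  also have "\<dots> \<le> ennreal c * (ennreal (1 / c) * Lp_norm p M (\<lambda>x. ennreal c * f x))"
    using f by (intro mult_left_mono Lp_norm_cmult_le p) auto
  also have "\<dots> = Lp_norm p M (\<lambda>x. ennreal c * f x)"
    by (simp only: mult.assoc[symmetric] e mult_1)
  finally show "ennreal c * Lp_norm p M f \<le> Lp_norm p M (\<lambda>x. ennreal c * f x)" .
qed

lemma schwartz_le_wt:
  fixes g :: "real^'n \<Rightarrow> complex"
  assumes "g \<in> schwartz" shows "cmod (g y) \<le> schwartz_seminorm (CARD('n) + 2) g * wt y"
  using schwartz_seminorm_ge[OF assms, of "[]" "CARD('n) + 2" y] one_plus_norm_pos[of y]
  by (simp add: wt_def field_simps del: power_Suc one_plus_norm_pos add_2_eq_Suc')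

context lp_family
begin

text \<open>Reflected kernels are the adjoints: by \<open>tempered_cnv_phit\<close>, pairing the
  block of \<open>u\<close> with \<open>g\<close> means applying \<open>u\<close> to
  \<open>cnv (phit j) g\<close>.\<close>

definition phit :: "nat \<Rightarrow> real^'n \<Rightarrow> complex" where "phit j x = \<phi> j (- x)"
definition etat :: "nat \<Rightarrow> real^'n \<Rightarrow> complex" where "etat k x = eta k (- x)"

lemma phit_schwartz: "phit j \<in> schwartz"
  unfolding phit_def[abs_def] by (intro schwartz_uminus phi_schwartz)

lemma phit_rapid: "rapid (phit j)"
  by (rule schwartz_rapid[OF phit_schwartz])

lemma etat_eq_dil: "etat k = dil (2 ^ k) (phit 0)"
  by (simp add: etat_def[abs_def] eta_def dil_def[abs_def] phit_def)

lemma etat_rapid: "rapid (etat k)"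
  unfolding etat_eq_dil by (intro rapid_dil phit_rapid) simp

lemma fourier_phit: "fourier (phit j) \<xi> = fourier (\<phi> j) (- \<xi>)"
  unfolding phit_def[abs_def] by (rule fourier_uminus[OF phi_rapid])

lemma fourier_etat: "fourier (etat k) \<xi> = fourier (eta k) (- \<xi>)"
  unfolding etat_def[abs_def] by (rule fourier_uminus[OF eta_rapid])

lemma integral_etat: "(LINT y|lborel. etat k y) = 1"
  using lborel_integral_reflect[OF rapid_measurable[OF eta_rapid], of k 0] integral_eta by (simp add: etat_def)

text \<open>The low-pass kernel at level \<open>k\<close> has integral 1 and first moment of order
  2^-k; the price of this gain is one order of the seminorm.\<close>

lemma etat_approx:
  obtains C where "0 < C"
    "\<And>k g. g \<in> schwartz \<Longrightarrow> schwartz_seminorm N (\<lambda>x. g x - cnv (etat k) g x) \<le> C * (1 / 2) ^ k * schwartz_seminorm (Suc N) g"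
proof -
  define c where "c = (LINT y|lborel. (1 + norm y) ^ Suc N * cmod (phit 0 y))"
  have c0: "0 \<le> c" unfolding c_def by (rule Bochner_Integration.integral_nonneg) simp
  let ?n = "real CARD('n)"
  have "schwartz_seminorm N (\<lambda>x. g x - cnv (etat k) g x) \<le> (?n * (c + 1)) * (1 / 2) ^ k * schwartz_seminorm (Suc N) g"
    if g: "g \<in> schwartz" for k g
  proof -
    have "(LINT y|lborel. norm y * (1 + norm y) ^ N * cmod (etat k y)) \<le> c / 2 ^ k"
      unfolding etat_eq_dil c_def by (rule dil_integral_moment_le[OF phit_rapid]) simp
    also have "\<dots> \<le> (c + 1) * (1 / 2) ^ k" by (simp add: power_divide divide_right_mono)
    finally have I: "(LINT y|lborel. norm y * (1 + norm y) ^ N * cmod (etat k y)) \<le> (c + 1) * (1 / 2) ^ k" .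
    have "schwartz_seminorm N (\<lambda>x. g x - cnv (etat k) g x)
        \<le> ?n * (LINT y|lborel. norm y * (1 + norm y) ^ N * cmod (etat k y)) * schwartz_seminorm (Suc N) g"
      by (rule schwartz_seminorm_cnv_diff[OF etat_rapid g integral_etat])
    also have "\<dots> \<le> ?n * ((c + 1) * (1 / 2) ^ k) * schwartz_seminorm (Suc N) g"
      using I by (intro mult_right_mono mult_left_mono schwartz_seminorm_nonneg g) auto
    finally show ?thesis by (simp only: mult_ac)
  qed
  then show ?thesis using c0 by (intro that[of "?n * (c + 1)"]) auto
qed

text \<open>Up to frequency 2^(k+1) the kernel \<open>a\<close> has no spectrum, beyond it
  \<open>etat k\<close> has none, so removing the low-pass part of \<open>g\<close> is invisible to
  \<open>a\<close>.\<close>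

lemma cnv_high_frequency:
  assumes a: "rapid a" and g: "g \<in> schwartz"
    and a0: "\<And>\<xi>. 2 * norm \<xi> \<le> 2 ^ (k + 2) \<Longrightarrow> fourier a \<xi> = 0"
  shows "cnv a (\<lambda>x. g x - cnv (etat k) g x) = cnv a g"
proof -
  have r: "rapid g" "rapid (cnv (etat k) g)" "rapid (\<lambda>x. g x - cnv (etat k) g x)"
    using g by (auto intro!: schwartz_rapid schwartz_diff cnv_schwartz etat_rapid)
  show ?thesis
  proof (rule fourier_inject)
    fix \<xi> :: "real^'n"
    have z: "fourier a \<xi> * fourier (etat k) \<xi> = 0"
    proof (cases "2 * norm \<xi> \<le> 2 ^ (k + 2)")
      case False
      then have "2 ^ Suc k \<le> norm (- \<xi>)" by simp
      then show ?thesis by (simp add: fourier_etat fourier_eta_eq_0)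
    qed (simp add: a0)
    have "fourier (cnv a (\<lambda>x. g x - cnv (etat k) g x)) \<xi> = fourier a \<xi> * fourier g \<xi> - (fourier a \<xi> * fourier (etat k) \<xi>) * fourier g \<xi>"
      by (simp add: fourier_cnv[OF a r(3)] fourier_diff[OF r(1,2)] fourier_cnv[OF etat_rapid r(1)] algebra_simps)
    then show "fourier (cnv a (\<lambda>x. g x - cnv (etat k) g x)) \<xi> = fourier (cnv a g) \<xi>"
      using z by (simp add: fourier_cnv[OF a r(1)])
  qed (intro cnv_rapid a r)+
qed

text \<open>Replace \<open>g\<close> by its high-pass part: the block of level \<open>j\<close> does
  not notice, yet the new function is smaller by a factor of order 2^-j.\<close>

lemma high_frequency_step:
  obtains C where "0 < C"
    "\<And>j g. g \<in> schwartz \<Longrightarrow> \<exists>g'\<in>schwartz. cnv (phit j) g' = cnv (phit j) g \<and>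
      schwartz_seminorm N g' \<le> C * (1 / 2) ^ j * schwartz_seminorm (Suc N) g"
proof -
  obtain C where C: "0 < C"
    "\<And>k g. g \<in> schwartz \<Longrightarrow> schwartz_seminorm N (\<lambda>x. g x - cnv (etat k) g x) \<le> C * (1 / 2) ^ k * schwartz_seminorm (Suc N) g"
    using etat_approx by blast
  \<comment> \<open>The cutoff sits two levels below \<open>j\<close>, which costs 2^2 = 4; the
    summand 2 makes the claim trivial at the levels 0 and 1, where there is no room for a
    cutoff.\<close>
  have "\<exists>g'\<in>schwartz. cnv (phit j) g' = cnv (phit j) g \<and> schwartz_seminorm N g' \<le> (4 * C + 2) * (1 / 2) ^ j * schwartz_seminorm (Suc N) g"
    if g: "g \<in> schwartz" for j g
  proof (cases "j < 2")
    case True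
    then have "j = 0 \<or> j = 1" by auto
    then have "1 \<le> (4 * C + 2) * (1 / 2) ^ j" using C(1) by auto
    from mult_right_mono[OF this schwartz_seminorm_nonneg[OF g, of "Suc N"]]
    have "schwartz_seminorm N g \<le> (4 * C + 2) * (1 / 2) ^ j * schwartz_seminorm (Suc N) g"
      using schwartz_seminorm_mono[OF g, of N "Suc N"] by simp
    then show ?thesis using g by blast
  next
    case False
    define k where "k = j - 2"
    have j: "j = k + 2" using False by (simp add: k_def)
    let ?g = "\<lambda>x. g x - cnv (etat k) g x"
    have "?g \<in> schwartz" by (intro schwartz_diff g cnv_schwartz etat_rapid)
    moreover have "cnv (phit j) ?g = cnv (phit j) g"
      by (rule cnv_high_frequency[OF phit_rapid g]) (simp add: fourier_phit fourier_phi_low j)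
    moreover have "schwartz_seminorm N ?g \<le> (4 * C + 2) * (1 / 2) ^ j * schwartz_seminorm (Suc N) g"
    proof -
      have "schwartz_seminorm N ?g \<le> C * (1 / 2) ^ k * schwartz_seminorm (Suc N) g" by (rule C(2)[OF g])
      also have "\<dots> \<le> ((4 * C + 2) * (1 / 2) ^ j) * schwartz_seminorm (Suc N) g"
        by (intro mult_right_mono schwartz_seminorm_nonneg g) (simp add: j field_simps)
      finally show ?thesis .
    qed
    ultimately show ?thesis by blast
  qed
  then show ?thesis using C(1) by (intro that[of "4 * C + 2"]) auto
qed

text \<open>Because each step returns a Schwartz function with the same block, it can be repeated;
  \<open>M\<close> repetitions trade \<open>M\<close> orders of the seminorm for the factor 2^(-j
  M).\<close>

lemma high_frequency_decay:
  "\<exists>C>0. \<forall>j. \<forall>g\<in>schwartz. \<exists>g'\<in>schwartz. cnv (phit j) g' = cnv (phit j) g \<and>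
      schwartz_seminorm N g' \<le> C * (1 / 2) ^ (j * M) * schwartz_seminorm (N + M) g"
proof (induction M)
  case 0
  have "\<exists>g'\<in>schwartz. cnv (phit j) g' = cnv (phit j) g \<and> schwartz_seminorm N g' \<le> 1 * (1 / 2) ^ (j * 0) * schwartz_seminorm (N + 0) g"
    if "g \<in> schwartz" for j g using that by auto
  note base = this
  show ?case by (intro exI[of _ "1::real"] conjI allI ballI base) auto
next
  case (Suc M)
  then obtain C where C: "0 < C" "\<And>j g. g \<in> schwartz \<Longrightarrow> \<exists>g'\<in>schwartz. cnv (phit j) g' = cnv (phit j) g \<and>
      schwartz_seminorm N g' \<le> C * (1 / 2) ^ (j * M) * schwartz_seminorm (N + M) g"
    by blast
  obtain D where D: "0 < D" "\<And>j g. g \<in> schwartz \<Longrightarrow> \<exists>g'\<in>schwartz. cnv (phit j) g' = cnv (phit j) g \<and>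
      schwartz_seminorm (N + M) g' \<le> D * (1 / 2) ^ j * schwartz_seminorm (Suc (N + M)) g"
    using high_frequency_step by blast
  have "\<exists>g'\<in>schwartz. cnv (phit j) g' = cnv (phit j) g \<and>
      schwartz_seminorm N g' \<le> (C * D) * (1 / 2) ^ (j * Suc M) * schwartz_seminorm (N + Suc M) g"
    if g: "g \<in> schwartz" for j g
  proof -
    obtain g1 where g1: "g1 \<in> schwartz" "cnv (phit j) g1 = cnv (phit j) g"
      "schwartz_seminorm (N + M) g1 \<le> D * (1 / 2) ^ j * schwartz_seminorm (Suc (N + M)) g"
      using D(2)[OF g] by blast
    obtain g2 where g2: "g2 \<in> schwartz" "cnv (phit j) g2 = cnv (phit j) g1"
      "schwartz_seminorm N g2 \<le> C * (1 / 2) ^ (j * M) * schwartz_seminorm (N + M) g1"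
      using C(2)[OF g1(1)] by blast
    have "C * (1 / 2) ^ (j * M) * schwartz_seminorm (N + M) g1 \<le> C * (1 / 2) ^ (j * M) * (D * (1 / 2) ^ j * schwartz_seminorm (Suc (N + M)) g)"
      using C(1) by (intro mult_left_mono g1) auto
    also have "\<dots> = (C * D) * (1 / 2) ^ (j * Suc M) * schwartz_seminorm (N + Suc M) g"
      by (simp add: power_add mult_ac)
    finally have "schwartz_seminorm N g2 \<le> (C * D) * (1 / 2) ^ (j * Suc M) * schwartz_seminorm (N + Suc M) g"
      using g2(3) by (rule order_trans[rotated])
    moreover have "cnv (phit j) g2 = cnv (phit j) g" using g1(2) g2(2) by (rule trans[rotated])
    ultimately show ?thesis by (intro bexI[OF _ g2(1)] conjI)
  qed
  then show ?case using C(1) D(1) by (intro exI[of _ "C * D"]) auto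
qed

text \<open>The partial sums of the adjoint kernels form the approximate identity
  \<open>etat k\<close>, whose error on \<open>g\<close> tends to 0 in the seminorm that bounds
  \<open>u\<close>.\<close>

lemma tempered_expansion:
  assumes u: "u \<in> tempered" and g: "g \<in> schwartz"
  shows "(\<lambda>k. \<Sum>j\<le>k. u (cnv (phit j) g)) \<longlonglongrightarrow> u g"
proof -
  obtain A N where A: "0 \<le> A" "\<And>f. f \<in> schwartz \<Longrightarrow> cmod (u f) \<le> A * schwartz_seminorm N f"
    using tempered_bound[OF u] by blast
  obtain C where C: "0 < C"
    "\<And>k g. g \<in> schwartz \<Longrightarrow> schwartz_seminorm N (\<lambda>x. g x - cnv (etat k) g x) \<le> C * (1 / 2) ^ k * schwartz_seminorm (Suc N) g"
    using etat_approx by blast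
  have eg: "cnv (etat k) g \<in> schwartz" for k by (intro cnv_schwartz etat_rapid g)
  have sum: "u (cnv (etat k) g) = (\<Sum>j\<le>k. u (cnv (phit j) g))" for k
  proof -
    have "etat k y = (\<Sum>j\<le>k. phit j y)" for y
      using fun_cong[OF eta_eq_sum, of k "- y"] by (simp add: etat_def phit_def)
    moreover have "integrable lborel (\<lambda>y. phit j y * g (x - y))" for j x
      using cnvr_integrable_schwartz[OF phit_rapid g, of "\<lambda>y. y"] by simp
    ultimately have "cnv (etat k) g = (\<lambda>x. \<Sum>j\<le>k. 1 * cnv (phit j) g x)"
      by (intro ext) (simp add: cnv_def sum_distrib_right Bochner_Integration.integral_sum)
    moreover have "u (\<lambda>x. \<Sum>j\<le>k. 1 * cnv (phit j) g x) = (\<Sum>j\<le>k. 1 * u (cnv (phit j) g))"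
      by (rule tempered_sum[OF u]) (intro cnv_schwartz phit_rapid g)
    ultimately show ?thesis by simp
  qed
  have "(\<lambda>k. u g - u (cnv (etat k) g)) \<longlonglongrightarrow> 0"
  proof (rule Lim_null_comparison)
    show "\<forall>\<^sub>F k in sequentially. cmod (u g - u (cnv (etat k) g)) \<le> A * C * schwartz_seminorm (Suc N) g * (1 / 2) ^ k"
    proof (intro always_eventually allI)
      fix k
      have "cmod (u g - u (cnv (etat k) g)) \<le> A * schwartz_seminorm N (\<lambda>x. g x - cnv (etat k) g x)"
        unfolding tempered_diff[OF u g eg, symmetric] by (rule A(2)[OF schwartz_diff[OF g eg]])
      also have "\<dots> \<le> A * (C * (1 / 2) ^ k * schwartz_seminorm (Suc N) g)"
        using A(1) by (intro mult_left_mono C g)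
      finally show "cmod (u g - u (cnv (etat k) g)) \<le> A * C * schwartz_seminorm (Suc N) g * (1 / 2) ^ k"
        by (simp only: mult_ac)
    qed
    have "(\<lambda>k. (1 / 2 :: real) ^ k) \<longlonglongrightarrow> 0" by (rule LIMSEQ_power_zero) simp
    then show "(\<lambda>k. A * C * schwartz_seminorm (Suc N) g * (1 / 2) ^ k) \<longlonglongrightarrow> 0"
      by (rule tendsto_mult_right_zero)
  qed
  from tendsto_diff[OF tendsto_const[of "u g"] this] show ?thesis by (simp add: sum)
qed

lemma tempered_cnv_phit:
  assumes u: "u \<in> tempered" and g: "g \<in> schwartz"
  shows "u (cnv (phit j) g) = (LINT y|lborel. g y * blk j u y)"
proof -
  have "cnv (phit j) g = cnv g (phit j)"
    by (intro ext cnv_commute phit_rapid schwartz_rapid g)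
  then have "u (cnv (phit j) g) = (LINT y|lborel. g y * u (\<lambda>x. phit j (x - y)))"
    using tempered_cnv[OF u phit_schwartz schwartz_rapid[OF g]] by simp
  then show ?thesis by (simp add: phit_def convol_def)
qed

section \<open>Quasi-norm properties and the embedding into tempered distributions\<close>

lemma besov_norm_eq_Lp:
  assumes "0 < q"
  shows "besov_norm \<phi> p q s u = Lp_norm q (count_space UNIV)
    (\<lambda>j. ennreal (2 powr (real j * s)) * Lp_norm p lborel (\<lambda>x. ennreal (cmod (blk j u x))))"
  unfolding besov_norm_def by (rule lq_norm_eq_Lp_norm[OF assms])

lemma blk_norm_measurable [measurable]:
  assumes "u \<in> tempered" shows "(\<lambda>x. ennreal (cmod (blk j u x))) \<in> borel_measurable lborel"
  using blk_measurable[OF assms, of j] by measurable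

text \<open>The structural fact about Besov quasi-norms: only the Lp sizes of the single blocks
  matter, so a bound uniform in the level passes to every \<open>q\<close> and
  \<open>s\<close>.\<close>

lemma besov_norm_dominated:
  assumes p: "0 < p" and q: "0 < q"
    and le: "\<And>j. Lp_norm p lborel (\<lambda>x. ennreal (cmod (blk j v x))) \<le> c * Lp_norm p lborel (\<lambda>x. ennreal (cmod (blk j u x)))"
  shows "besov_norm \<phi> p q s v \<le> c * besov_norm \<phi> p q s u"
proof -
  have "besov_norm \<phi> p q s v \<le> Lp_norm q (count_space UNIV)
    (\<lambda>j. c * (ennreal (2 powr (real j * s)) * Lp_norm p lborel (\<lambda>x. ennreal (cmod (blk j u x)))))"
    unfolding besov_norm_eq_Lp[OF q]
  proof (rule Lp_norm_mono[OF q])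
    fix j
    show "ennreal (2 powr (real j * s)) * Lp_norm p lborel (\<lambda>x. ennreal (cmod (blk j v x)))
        \<le> c * (ennreal (2 powr (real j * s)) * Lp_norm p lborel (\<lambda>x. ennreal (cmod (blk j u x))))"
      using mult_left_mono[OF le[of j], of "ennreal (2 powr (real j * s))"] by (simp add: mult_ac)
  qed simp
  also have "\<dots> \<le> c * besov_norm \<phi> p q s u"
    unfolding besov_norm_eq_Lp[OF q] by (rule Lp_norm_cmult_le[OF q]) simp
  finally show ?thesis .
qed

lemma besov_norm_cmult:
  assumes p: "0 < p" and q: "0 < q" and u: "u \<in> tempered"
  shows "besov_norm \<phi> p q s (\<lambda>f. c * u f) = ennreal (cmod c) * besov_norm \<phi> p q s u"
proof -
  have le: "besov_norm \<phi> p q s (\<lambda>f. c * u f) \<le> ennreal (cmod c) * besov_norm \<phi> p q s u" if "u \<in> tempered" for c u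
  proof (rule besov_norm_dominated[OF p q])
    show "Lp_norm p lborel (\<lambda>x. ennreal (cmod (blk j (\<lambda>f. c * u f) x))) \<le> ennreal (cmod c) * Lp_norm p lborel (\<lambda>x. ennreal (cmod (blk j u x)))" for j
      using Lp_norm_cmult_le[OF p blk_norm_measurable[OF that], of "ennreal (cmod c)" j]
      by (simp add: convol_add(2) norm_mult ennreal_mult)
  qed
  have t: "(\<lambda>f. c * u f) \<in> tempered"
  proof -
    obtain A N where A: "0 \<le> A" "\<And>f. f \<in> schwartz \<Longrightarrow> cmod (u f) \<le> A * schwartz_seminorm N f"
      using tempered_bound[OF u] by blast
    have "cmod (c * u f) \<le> (cmod c * A) * schwartz_seminorm N f" if "f \<in> schwartz" for f
      using mult_left_mono[OF A(2)[OF that], of "cmod c"] by (simp add: norm_mult mult.assoc)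
    then show ?thesis using temperedD[OF u] by (auto simp: tempered_def distrib_left)
  qed
  show ?thesis
  proof (cases "c = 0")
    case True
    then show ?thesis using le[OF u, of 0] by simp
  next
    case False
    have "besov_norm \<phi> p q s u \<le> ennreal (cmod (1 / c)) * besov_norm \<phi> p q s (\<lambda>f. c * u f)"
      using le[OF t, of "1 / c"] False by (simp add: mult.assoc[symmetric])
    then have "ennreal (cmod c) * besov_norm \<phi> p q s u \<le> ennreal (cmod c) * (ennreal (cmod (1 / c)) * besov_norm \<phi> p q s (\<lambda>f. c * u f))"
      by (rule mult_left_mono) simp
    also have "\<dots> = besov_norm \<phi> p q s (\<lambda>f. c * u f)"
    proof -
      have "ennreal (cmod c) * ennreal (cmod (1 / c)) = 1"
        using False by (simp add: norm_divide flip: ennreal_mult)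
      then show ?thesis by (simp only: mult.assoc[symmetric] mult_1)
    qed
    finally show ?thesis using le[OF u, of c] by (rule antisym[rotated])
  qed
qed

lemma besov_norm_add:
  assumes p: "0 < p" and q: "0 < q"
  obtains K where "0 < K"
    "\<And>u v. u \<in> tempered \<Longrightarrow> v \<in> tempered \<Longrightarrow>
      besov_norm \<phi> p q s (\<lambda>f. u f + v f) \<le> ennreal K * (besov_norm \<phi> p q s u + besov_norm \<phi> p q s v)"
proof -
  obtain K1 where K1: "0 < K1" "\<And>(M :: (real^'n) measure) f g. f \<in> borel_measurable M \<Longrightarrow> g \<in> borel_measurable M \<Longrightarrow>
      Lp_norm p M (\<lambda>x. f x + g x) \<le> ennreal K1 * (Lp_norm p M f + Lp_norm p M g)"
    using Lp_norm_add_le[OF p] by blast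
  obtain K2 where K2: "0 < K2" "\<And>(M :: nat measure) f g. f \<in> borel_measurable M \<Longrightarrow> g \<in> borel_measurable M \<Longrightarrow>
      Lp_norm q M (\<lambda>x. f x + g x) \<le> ennreal K2 * (Lp_norm q M f + Lp_norm q M g)"
    using Lp_norm_add_le[OF q] by blast
  have "besov_norm \<phi> p q s (\<lambda>f. u f + v f) \<le> ennreal (K1 * K2) * (besov_norm \<phi> p q s u + besov_norm \<phi> p q s v)"
    if u: "u \<in> tempered" and v: "v \<in> tempered" for u v
  proof -
    let ?t = "\<lambda>u j. ennreal (2 powr (real j * s)) * Lp_norm p lborel (\<lambda>x. ennreal (cmod (blk j u x)))"
    have "besov_norm \<phi> p q s (\<lambda>f. u f + v f) \<le> Lp_norm q (count_space UNIV) (\<lambda>j. ennreal K1 * (?t u j + ?t v j))"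
      unfolding besov_norm_eq_Lp[OF q]
    proof (rule Lp_norm_mono[OF q])
      fix j
      have "Lp_norm p lborel (\<lambda>x. ennreal (cmod (blk j (\<lambda>f. u f + v f) x)))
          \<le> Lp_norm p lborel (\<lambda>x. ennreal (cmod (blk j u x)) + ennreal (cmod (blk j v x)))"
      proof (rule Lp_norm_mono[OF p])
        show "(\<lambda>x. ennreal (cmod (blk j (\<lambda>f. u f + v f) x))) \<in> borel_measurable lborel"
          unfolding convol_add(1)[OF u] using blk_measurable[OF u, of j] blk_measurable[OF v, of j] by measurable
        show "ennreal (cmod (blk j (\<lambda>f. u f + v f) x)) \<le> ennreal (cmod (blk j u x)) + ennreal (cmod (blk j v x))" for x
          unfolding convol_add(1)[OF u] by (simp add: norm_triangle_ineq ennreal_leI flip: ennreal_plus)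
      qed
      also have "\<dots> \<le> ennreal K1 * (Lp_norm p lborel (\<lambda>x. ennreal (cmod (blk j u x))) + Lp_norm p lborel (\<lambda>x. ennreal (cmod (blk j v x))))"
        by (intro K1 blk_norm_measurable u v)
      finally have "?t (\<lambda>f. u f + v f) j \<le> ennreal (2 powr (real j * s)) *
          (ennreal K1 * (Lp_norm p lborel (\<lambda>x. ennreal (cmod (blk j u x))) + Lp_norm p lborel (\<lambda>x. ennreal (cmod (blk j v x)))))"
        by (rule mult_left_mono) simp
      then show "?t (\<lambda>f. u f + v f) j \<le> ennreal K1 * (?t u j + ?t v j)"
        by (simp add: distrib_left mult_ac)
    qed simp
    also have "\<dots> \<le> ennreal K1 * Lp_norm q (count_space UNIV) (\<lambda>j. ?t u j + ?t v j)"
      by (rule Lp_norm_cmult_le[OF q]) simp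
    also have "\<dots> \<le> ennreal K1 * (ennreal K2 * (Lp_norm q (count_space UNIV) (?t u) + Lp_norm q (count_space UNIV) (?t v)))"
      by (intro mult_left_mono K2) auto
    also have "\<dots> = ennreal (K1 * K2) * (besov_norm \<phi> p q s u + besov_norm \<phi> p q s v)"
      unfolding besov_norm_eq_Lp[OF q] using K1(1) K2(1) by (simp add: ennreal_mult mult.assoc)
    finally show ?thesis .
  qed
  then show ?thesis using K1(1) K2(1) by (intro that[of "K1 * K2"]) auto
qed

text \<open>Convergence as functionals makes every block converge pointwise; Fatou's lemma then
  applies twice, in space for each block and over the levels.\<close>

lemma besov_norm_liminf:
  assumes p: "0 < p" and q: "0 < q" and U: "\<And>i. U i \<in> tempered" and u: "u \<in> tempered"
    and lim: "\<And>f. (\<lambda>i. U i f) \<longlonglongrightarrow> u f"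
  shows "besov_norm \<phi> p q s u \<le> liminf (\<lambda>i. besov_norm \<phi> p q s (U i))"
  unfolding besov_norm_eq_Lp[OF q]
proof (rule Lp_norm_liminf[OF q])
  fix j :: nat
  have c: "0 < (2::real) powr (real j * s)" by simp
  have "Lp_norm p lborel (\<lambda>x. ennreal (2 powr (real j * s)) * ennreal (cmod (blk j u x)))
      \<le> liminf (\<lambda>i. Lp_norm p lborel (\<lambda>x. ennreal (2 powr (real j * s)) * ennreal (cmod (blk j (U i) x))))"
  proof (rule Lp_norm_liminf[OF p])
    fix x :: "real^'n"
    have "(\<lambda>i. blk j (U i) x) \<longlonglongrightarrow> blk j u x" unfolding convol_def by (rule lim)
    then have "(\<lambda>i. ennreal (2 powr (real j * s) * cmod (blk j (U i) x))) \<longlonglongrightarrow> ennreal (2 powr (real j * s) * cmod (blk j u x))"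
      by (intro tendsto_intros)
    then have "(\<lambda>i. ennreal (2 powr (real j * s)) * ennreal (cmod (blk j (U i) x))) \<longlonglongrightarrow> ennreal (2 powr (real j * s)) * ennreal (cmod (blk j u x))"
      by (simp add: ennreal_mult)
    from lim_imp_Liminf[OF _ this]
    show "ennreal (2 powr (real j * s)) * ennreal (cmod (blk j u x)) \<le> liminf (\<lambda>i. ennreal (2 powr (real j * s)) * ennreal (cmod (blk j (U i) x)))"
      by simp
  qed (use blk_norm_measurable[OF U] blk_norm_measurable[OF u] in auto)
  then show "ennreal (2 powr (real j * s)) * Lp_norm p lborel (\<lambda>x. ennreal (cmod (blk j u x)))
      \<le> liminf (\<lambda>i. ennreal (2 powr (real j * s)) * Lp_norm p lborel (\<lambda>x. ennreal (cmod (blk j (U i) x))))"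
    unfolding Lp_norm_cmult[OF p blk_norm_measurable[OF u] c] Lp_norm_cmult[OF p blk_norm_measurable[OF U] c] .
qed simp_all

text \<open>A single level is dominated by the whole quasi-norm; Nikolskii's inequality turns its Lp
  size into a uniform bound at an exponential cost in \<open>j\<close>, and the smoothness shifts
  the rate by \<open>- s\<close>.\<close>

lemma besov_blk_bound:
  assumes p: "0 < p" and q: "0 < q"
  obtains C a where "0 < C"
    "\<And>j u x. u \<in> tempered \<Longrightarrow> besov_norm \<phi> p q s u < \<infinity> \<Longrightarrow>
      cmod (blk j u x) \<le> C * 2 powr (a * real j) * enn2real (besov_norm \<phi> p q s u)"
proof -
  obtain C a where C: "0 < C" "0 \<le> a" "\<And>j u x. u \<in> tempered \<Longrightarrow>
      ennreal (cmod (blk j u x)) \<le> ennreal (C * 2 powr (a * real j)) * Lp_norm p lborel (\<lambda>x. ennreal (cmod (blk j u x)))"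
    using blk_sup_le_Lp[OF p] by blast
  have "cmod (blk j u x) \<le> C * 2 powr ((a - s) * real j) * enn2real (besov_norm \<phi> p q s u)"
    if u: "u \<in> tempered" and fin: "besov_norm \<phi> p q s u < \<infinity>" for j u x
  proof -
    let ?L = "Lp_norm p lborel (\<lambda>x. ennreal (cmod (blk j u x)))"
    have "ennreal (2 powr (real j * s)) * ?L \<le> besov_norm \<phi> p q s u"
      unfolding besov_norm_def by (rule lq_norm_ge[OF q, of "\<lambda>j. ennreal (2 powr (real j * s)) * Lp_norm p lborel (\<lambda>x. ennreal (cmod (blk j u x)))"])
    also have "\<dots> = ennreal (enn2real (besov_norm \<phi> p q s u))" using fin by simp
    finally have "ennreal (2 powr (- (real j * s))) * (ennreal (2 powr (real j * s)) * ?L)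
        \<le> ennreal (2 powr (- (real j * s))) * ennreal (enn2real (besov_norm \<phi> p q s u))"
      by (rule mult_left_mono) simp
    moreover have "ennreal (2 powr (- (real j * s))) * ennreal (2 powr (real j * s)) = 1"
      by (simp flip: ennreal_mult powr_add)
    ultimately have L: "?L \<le> ennreal (2 powr (- (real j * s)) * enn2real (besov_norm \<phi> p q s u))"
      by (simp add: mult.assoc[symmetric] ennreal_mult)
    have "ennreal (cmod (blk j u x)) \<le> ennreal (C * 2 powr (a * real j)) * ?L" by (rule C(3)[OF u])
    also have "\<dots> \<le> ennreal (C * 2 powr (a * real j)) * ennreal (2 powr (- (real j * s)) * enn2real (besov_norm \<phi> p q s u))"
      by (rule mult_left_mono[OF L]) simp
    also have "\<dots> = ennreal (C * 2 powr (a * real j) * (2 powr (- (real j * s)) * enn2real (besov_norm \<phi> p q s u)))"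
      using C(1) by (intro ennreal_mult[symmetric]) auto
    also have "C * 2 powr (a * real j) * (2 powr (- (real j * s)) * enn2real (besov_norm \<phi> p q s u))
        = C * 2 powr ((a - s) * real j) * enn2real (besov_norm \<phi> p q s u)"
    proof -
      have "2 powr (a * real j) * 2 powr (- (real j * s)) = (2::real) powr ((a - s) * real j)"
        by (simp add: powr_add[symmetric] algebra_simps)
      then show ?thesis by (simp only: mult.assoc[symmetric]) (simp only: mult.assoc)
    qed
    finally show ?thesis using C(1) by (subst (asm) ennreal_le_iff) auto
  qed
  then show ?thesis using C(1) by (intro that[of C "a - s"]) auto
qed

text \<open>In the expansion over blocks, each block grows at most exponentially in its level, while
  \<open>high_frequency_decay\<close> lets the test function lose any exponential rate. Trading
  enough derivatives makes the sum over levels converge.\<close>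

lemma besov_embedding:
  assumes p: "0 < p" and q: "0 < q"
  obtains C N where "0 \<le> C"
    "\<And>u g. u \<in> tempered \<Longrightarrow> besov_norm \<phi> p q s u < \<infinity> \<Longrightarrow> g \<in> schwartz \<Longrightarrow>
      cmod (u g) \<le> C * enn2real (besov_norm \<phi> p q s u) * schwartz_seminorm N g"
proof -
  obtain C a where C: "0 < C" "\<And>j u x. u \<in> tempered \<Longrightarrow> besov_norm \<phi> p q s u < \<infinity> \<Longrightarrow>
      cmod (blk j u x) \<le> C * 2 powr (a * real j) * enn2real (besov_norm \<phi> p q s u)"
    using besov_blk_bound[OF p q] by blast
  \<comment> \<open>One order more than the blocks can grow: a geometric series of ratio 1/2
    remains.\<close>
  define M where "M = nat \<lceil>a + 1\<rceil>"
  have M: "a + 1 \<le> real M" unfolding M_def by linarith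
  let ?K = "CARD('n) + 2"
  obtain D where D: "0 < D" "\<And>j g. g \<in> schwartz \<Longrightarrow> \<exists>g'\<in>schwartz. cnv (phit j) g' = cnv (phit j) g \<and>
      schwartz_seminorm ?K g' \<le> D * (1 / 2) ^ (j * M) * schwartz_seminorm (?K + M) g"
    using high_frequency_decay[of ?K M] by blast
  define W where "W = (LINT z|lborel. wt (z::real^'n))"
  have W0: "0 \<le> W" unfolding W_def by (rule Bochner_Integration.integral_nonneg) (simp add: wt_pos less_imp_le)
  have "cmod (u g) \<le> (2 * (C * W * D)) * enn2real (besov_norm \<phi> p q s u) * schwartz_seminorm (?K + M) g"
    if u: "u \<in> tempered" and fin: "besov_norm \<phi> p q s u < \<infinity>" and g: "g \<in> schwartz" for u g
  proof -
    define B where "B = enn2real (besov_norm \<phi> p q s u)"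
    define S where "S = schwartz_seminorm (?K + M) g"
    have B0: "0 \<le> B" and S0: "0 \<le> S" by (simp_all add: B_def S_def schwartz_seminorm_nonneg[OF g])
    have summand: "cmod (u (cnv (phit j) g)) \<le> (C * W * D * B * S) * (1 / 2) ^ j" for j
    proof -
      obtain g' where g': "g' \<in> schwartz" "cnv (phit j) g' = cnv (phit j) g"
        "schwartz_seminorm ?K g' \<le> D * (1 / 2) ^ (j * M) * S"
        using D(2)[OF g, of j] unfolding S_def by blast
      let ?A = "C * 2 powr (a * real j) * B" and ?s = "schwartz_seminorm ?K g'"
      have A0: "0 \<le> ?A" using C(1) B0 by simp
      have "cmod (u (cnv (phit j) g)) = cmod (LINT y|lborel. g' y * blk j u y)"
        using tempered_cnv_phit[OF u g'(1), of j] g'(2) by simp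
      also have "\<dots> \<le> (LINT y|lborel. (?s * ?A) * wt (y :: real^'n))"
      proof (rule cmod_integral_le)
        show "integrable lborel (\<lambda>y. (?s * ?A) * wt (y :: real^'n))" by (rule integrable_mult_right[OF wt_integrable])
        fix y
        have "cmod (g' y) * cmod (blk j u y) \<le> (?s * wt y) * ?A"
          using C(2)[OF u fin] A0 unfolding B_def[symmetric]
          by (intro mult_mono schwartz_le_wt g' mult_nonneg_nonneg schwartz_seminorm_nonneg less_imp_le[OF wt_pos]) auto
        then show "cmod (g' y * blk j u y) \<le> (?s * ?A) * wt y" by (simp only: norm_mult mult_ac)
      qed
      also have "\<dots> = ?s * (?A * W)" by (simp add: W_def)
      also have "\<dots> \<le> (D * (1 / 2) ^ (j * M) * S) * (?A * W)"
        using A0 W0 by (intro mult_right_mono g') auto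
      also have "\<dots> = (C * W * D * B * S) * (2 powr (a * real j) * (1 / 2) ^ (j * M))" by (simp only: mult_ac)
      also have "\<dots> \<le> (C * W * D * B * S) * (1 / 2) ^ j"
      proof (rule mult_left_mono)
        have half: "(1 / 2 :: real) ^ m = 2 powr (- real m)" for m
          by (simp add: powr_minus powr_realpow power_one_over inverse_eq_divide)
        have "(1 / 2 :: real) ^ (j * M) = 2 powr (- (real j * real M))" "(1 / 2 :: real) ^ j = 2 powr (- real j)"
          using half[of "j * M"] half[of j] by (simp_all only: of_nat_mult)
        moreover have "a * real j + - (real j * real M) \<le> - real j"
          using mult_right_mono[OF M, of "real j"] by (simp add: algebra_simps)
        ultimately show "2 powr (a * real j) * (1 / 2) ^ (j * M) \<le> (1 / 2 :: real) ^ j"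
          by (simp only: powr_add[symmetric]) (intro powr_mono, auto)
        show "0 \<le> C * W * D * B * S" using C(1) D(1) W0 B0 S0 by simp
      qed
      finally show ?thesis .
    qed
    have "cmod (\<Sum>j\<le>k. u (cnv (phit j) g)) \<le> (C * W * D * B * S) * 2" for k
    proof -
      have "cmod (\<Sum>j\<le>k. u (cnv (phit j) g)) \<le> (\<Sum>j\<le>k. (C * W * D * B * S) * (1 / 2) ^ j)"
        by (intro order_trans[OF norm_sum] sum_mono summand)
      also have "\<dots> = (C * W * D * B * S) * (\<Sum>j\<le>k. (1 / 2) ^ j)" by (simp add: sum_distrib_left)
      also have "(\<Sum>j\<le>k. (1 / 2 :: real) ^ j) \<le> 2"
      proof -
        have "(\<Sum>j\<le>k. (1 / 2 :: real) ^ j) \<le> (\<Sum>j. (1 / 2 :: real) ^ j)"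
          by (intro sum_le_suminf summable_geometric) auto
        then show ?thesis by (simp add: suminf_geometric)
      qed
      finally show ?thesis using C(1) D(1) W0 B0 S0 by (simp add: mult_left_mono)
    qed
    then have "cmod (u g) \<le> (C * W * D * B * S) * 2"
      by (intro LIMSEQ_le_const2[OF tendsto_norm[OF tempered_expansion[OF u g]]]) auto
    then show ?thesis by (simp only: B_def S_def mult_ac)
  qed
  then show ?thesis using C(1) D(1) W0 by (intro that[of "2 * (C * W * D)" "?K + M"]) auto
qed

end

section \<open>Completeness of quasi-normed spaces and their sums\<close>

text \<open>Complex vector spaces with the group structure carried by the type. Completeness
  arguments can then use ordinary sums and differences; functionals with pointwise operations are an
  instance.\<close>

locale complex_scaling =
  fixes sc :: "complex \<Rightarrow> 'v::ab_group_add \<Rightarrow> 'v"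
  assumes sc_add_right: "sc c (x + y) = sc c x + sc c y"
    and sc_add_left: "sc (c + d) x = sc c x + sc d x"
    and sc_sc: "sc c (sc d x) = sc (c * d) x"
    and sc_1: "sc 1 x = x"
begin

lemma sc_0: "sc 0 x = 0"
  using sc_add_left[of 0 0 x] by simp

lemma sc_minus_1: "sc (- 1) x = - x"
  using sc_add_left[of "- 1" 1 x] by (simp add: sc_0 sc_1 eq_neg_iff_add_eq_0)

definition quasi_banach_on :: "'v set \<Rightarrow> ('v \<Rightarrow> real) \<Rightarrow> bool" where
  "quasi_banach_on A N \<longleftrightarrow>
     0 \<in> A \<and> (\<forall>x\<in>A. \<forall>y\<in>A. x + y \<in> A) \<and> (\<forall>c. \<forall>x\<in>A. sc c x \<in> A) \<and>
     (\<forall>x\<in>A. 0 \<le> N x \<and> (N x = 0 \<longleftrightarrow> x = 0)) \<and>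
     (\<forall>c. \<forall>x\<in>A. N (sc c x) = cmod c * N x) \<and>
     (\<exists>K. \<forall>x\<in>A. \<forall>y\<in>A. N (x + y) \<le> K * (N x + N y)) \<and>
     (\<forall>\<sigma>::nat \<Rightarrow> 'v. range \<sigma> \<subseteq> A \<and> (\<forall>e>0. \<exists>M. \<forall>k\<ge>M. \<forall>m\<ge>M. N (\<sigma> k - \<sigma> m) < e) \<longrightarrow>
       (\<exists>l\<in>A. (\<lambda>k. N (\<sigma> k - l)) \<longlonglongrightarrow> 0))"

lemma quasi_banach_onD:
  assumes "quasi_banach_on A N"
  shows "0 \<in> A" "x \<in> A \<Longrightarrow> y \<in> A \<Longrightarrow> x + y \<in> A" "x \<in> A \<Longrightarrow> sc c x \<in> A"
    "x \<in> A \<Longrightarrow> 0 \<le> N x" "x \<in> A \<Longrightarrow> N x = 0 \<longleftrightarrow> x = 0" "x \<in> A \<Longrightarrow> N (sc c x) = cmod c * N x"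
    "x \<in> A \<Longrightarrow> - x \<in> A" "x \<in> A \<Longrightarrow> y \<in> A \<Longrightarrow> x - y \<in> A" "x \<in> A \<Longrightarrow> N (- x) = N x"
proof -
  show 1: "0 \<in> A" "x \<in> A \<Longrightarrow> y \<in> A \<Longrightarrow> x + y \<in> A" "x \<in> A \<Longrightarrow> sc c x \<in> A"
    "x \<in> A \<Longrightarrow> 0 \<le> N x" "x \<in> A \<Longrightarrow> N x = 0 \<longleftrightarrow> x = 0" "x \<in> A \<Longrightarrow> N (sc c x) = cmod c * N x" for x y c
    using assms unfolding quasi_banach_on_def by simp_all
  show m: "x \<in> A \<Longrightarrow> - x \<in> A" for x
    using 1(3)[of x "- 1"] by (simp add: sc_minus_1)
  show "x \<in> A \<Longrightarrow> y \<in> A \<Longrightarrow> x - y \<in> A"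
    using 1(2)[of x "- y"] m[of y] by simp
  show "x \<in> A \<Longrightarrow> N (- x) = N x"
    using 1(6)[of x "- 1"] by (simp add: sc_minus_1)
qed

lemma quasi_banach_on_triangle:
  assumes "quasi_banach_on A N"
  obtains K where "\<And>K' x y. K \<le> K' \<Longrightarrow> x \<in> A \<Longrightarrow> y \<in> A \<Longrightarrow> N (x + y) \<le> K' * (N x + N y)"
proof -
  have "\<exists>K. \<forall>x\<in>A. \<forall>y\<in>A. N (x + y) \<le> K * (N x + N y)"
    using assms unfolding quasi_banach_on_def by (elim conjE)
  then obtain K where K: "\<forall>x\<in>A. \<forall>y\<in>A. N (x + y) \<le> K * (N x + N y)" ..
  have le: "N (x + y) \<le> K' * (N x + N y)" if "K \<le> K'" "x \<in> A" "y \<in> A" for K' x y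
  proof -
    have "N (x + y) \<le> K * (N x + N y)" using K that by blast
    also have "\<dots> \<le> K' * (N x + N y)"
      using that quasi_banach_onD(4)[OF assms] by (intro mult_right_mono add_nonneg_nonneg) auto
    finally show ?thesis .
  qed
  show ?thesis by (rule that) (rule le)
qed

lemma quasi_banach_on_complete:
  fixes \<sigma> :: "nat \<Rightarrow> 'v"
  assumes "quasi_banach_on A N" and \<sigma>: "\<And>k. \<sigma> k \<in> A"
    and cauchy: "\<And>e. 0 < e \<Longrightarrow> \<exists>M. \<forall>k\<ge>M. \<forall>m\<ge>M. N (\<sigma> k - \<sigma> m) < e"
  shows "\<exists>l\<in>A. (\<lambda>k. N (\<sigma> k - l)) \<longlonglongrightarrow> 0"
proof -
  have "\<forall>\<sigma>::nat \<Rightarrow> 'v. range \<sigma> \<subseteq> A \<and> (\<forall>e>0. \<exists>M. \<forall>k\<ge>M. \<forall>m\<ge>M. N (\<sigma> k - \<sigma> m) < e) \<longrightarrow>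
       (\<exists>l\<in>A. (\<lambda>k. N (\<sigma> k - l)) \<longlonglongrightarrow> 0)"
    using assms(1) unfolding quasi_banach_on_def by (elim conjE)
  moreover have "range \<sigma> \<subseteq> A" using \<sigma> by (simp add: image_subset_iff)
  ultimately show ?thesis using cauchy by simp
qed

text \<open>Every term split off costs a factor \<open>K\<close>, so the terms must shrink by more
  than that. With ratio q = 1/(2 K) the tail bound 2 K q^a reproduces itself: K (q^a + 2 K q^(a+1))
  = 2 K q^a.\<close>

lemma quasi_banach_on_series:
  assumes qb: "quasi_banach_on A N" and K: "1 \<le> K" "\<And>x y. x \<in> A \<Longrightarrow> y \<in> A \<Longrightarrow> N (x + y) \<le> K * (N x + N y)"
    and x: "\<And>k. x k \<in> A" "\<And>k. N (x k) \<le> (1 / (2 * K)) ^ k"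
  shows "\<exists>l\<in>A. (\<lambda>m. N ((\<Sum>k<m. x k) - l)) \<longlonglongrightarrow> 0"
proof -
  note qbD = quasi_banach_onD[OF qb]
  let ?q = "1 / (2 * K)"
  have S: "(\<Sum>k<m. x k) \<in> A" for m by (induction m) (auto intro: qbD(1) qbD(2) x)
  have tail: "N (\<Sum>i<m. x (a + i)) \<le> 2 * K * ?q ^ a \<and> (\<Sum>i<m. x (a + i)) \<in> A" for m a
  proof (induction m arbitrary: a)
    case 0
    have "N 0 = 0" using qbD(1) qbD(5)[of 0] by simp
    then show ?case using K(1) qbD(1) by simp
  next
    case (Suc m)
    have e: "(\<Sum>i<Suc m. x (a + i)) = x a + (\<Sum>i<m. x (Suc a + i))"
      by (subst sum.lessThan_Suc_shift) simp
    have "N (\<Sum>i<Suc m. x (a + i)) \<le> K * (N (x a) + N (\<Sum>i<m. x (Suc a + i)))"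
      unfolding e using Suc.IH[of "Suc a"] by (intro K(2) x) auto
    also have "\<dots> \<le> K * (?q ^ a + 2 * K * ?q ^ Suc a)"
      using Suc.IH[of "Suc a"] K(1) by (intro mult_left_mono add_mono x) auto
    also have "2 * K * ?q ^ Suc a = ?q ^ a" using K(1) by simp
    finally have "N (\<Sum>i<Suc m. x (a + i)) \<le> 2 * K * ?q ^ a" by simp
    then show ?case using Suc.IH[of "Suc a"] unfolding e by (auto intro: qbD(2) x)
  qed
  have diff: "N ((\<Sum>k<b. x k) - (\<Sum>k<a. x k)) \<le> 2 * K * ?q ^ a" if "a \<le> b" for a b
  proof -
    have "(\<Sum>k<a + m. x k) = (\<Sum>k<a. x k) + (\<Sum>i<m. x (a + i))" for m
      by (induction m) (simp_all add: add.assoc)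
    from this[of "b - a"] have "(\<Sum>k<b. x k) = (\<Sum>k<a. x k) + (\<Sum>i<b - a. x (a + i))"
      using that by simp
    then show ?thesis using tail[where m="b - a" and a=a] by simp
  qed
  have lim0: "(\<lambda>a. 2 * K * ?q ^ a) \<longlonglongrightarrow> 0"
    using K(1) by (intro tendsto_mult_right_zero LIMSEQ_power_zero) simp
  have "\<exists>M. \<forall>k\<ge>M. \<forall>m\<ge>M. N ((\<Sum>i<k. x i) - (\<Sum>i<m. x i)) < e" if e0: "0 < e" for e
  proof -
    obtain M where M: "\<And>a. M \<le> a \<Longrightarrow> 2 * K * ?q ^ a < e"
      using order_tendstoD(2)[OF lim0 e0] unfolding eventually_sequentially by blast
    have "N ((\<Sum>i<k. x i) - (\<Sum>i<m. x i)) < e" if "M \<le> k" "M \<le> m" for k m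
    proof (cases "m \<le> k")
      case True
      then show ?thesis using diff[OF True] M[OF that(2)] by linarith
    next
      case False
      have "N ((\<Sum>i<k. x i) - (\<Sum>i<m. x i)) = N (- ((\<Sum>i<m. x i) - (\<Sum>i<k. x i)))" by simp
      also have "\<dots> = N ((\<Sum>i<m. x i) - (\<Sum>i<k. x i))" by (intro qbD(9) qbD(8) S)
      finally show ?thesis using diff[of k m] M[OF that(1)] False by linarith
    qed
    then show ?thesis by blast
  qed
  then show ?thesis by (rule quasi_banach_on_complete[OF qb S])
qed

text \<open>\<open>sep\<close> says that the two topologies cannot tear a vector apart; it gives
  definiteness. For completeness, a rapidly Cauchy subsequence has increments that split into two
  summable series, one in each space.\<close>

lemma quasi_banach_on_sum:
  assumes qb0: "quasi_banach_on A0 N0" and qb1: "quasi_banach_on A1 N1"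
    and sep: "\<And>x y z. (\<And>k::nat. x k \<in> A0) \<Longrightarrow> (\<And>k. y k \<in> A1) \<Longrightarrow> (\<And>k. x k + y k = z) \<Longrightarrow>
      (\<lambda>k. N0 (x k)) \<longlonglongrightarrow> 0 \<Longrightarrow> (\<lambda>k. N1 (y k)) \<longlonglongrightarrow> 0 \<Longrightarrow> z = 0"
  shows "quasi_banach_on {x + y | x y. x \<in> A0 \<and> y \<in> A1} (\<lambda>z. Inf {N0 x + N1 y | x y. x \<in> A0 \<and> y \<in> A1 \<and> z = x + y})"
proof -
  note D0 = quasi_banach_onD[OF qb0] and D1 = quasi_banach_onD[OF qb1]
  define A where "A = {x + y | x y. x \<in> A0 \<and> y \<in> A1}"
  define N where "N z = Inf {N0 x + N1 y | x y. x \<in> A0 \<and> y \<in> A1 \<and> z = x + y}" for z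
  have bdd: "bdd_below {N0 x + N1 y | x y. x \<in> A0 \<and> y \<in> A1 \<and> z = x + y}" for z
    by (rule bdd_belowI[of _ 0]) (auto intro: add_nonneg_nonneg D0(4) D1(4))
  have N_le: "N (x + y) \<le> N0 x + N1 y" if "x \<in> A0" "y \<in> A1" for x y
    unfolding N_def by (rule cInf_lower[OF _ bdd]) (use that in blast)
  have N_ge: "B \<le> N z" if "z \<in> A" "\<And>x y. x \<in> A0 \<Longrightarrow> y \<in> A1 \<Longrightarrow> z = x + y \<Longrightarrow> B \<le> N0 x + N1 y" for z B
    unfolding N_def by (rule cInf_greatest) (use that in \<open>auto simp: A_def\<close>)
  have N0le: "0 \<le> N z" if "z \<in> A" for z
    by (rule N_ge[OF that]) (intro add_nonneg_nonneg D0(4) D1(4))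
  have decomp: "\<exists>x\<in>A0. \<exists>y\<in>A1. z = x + y \<and> N0 x + N1 y < B" if "z \<in> A" "N z < B" for z B
    using N_ge[OF that(1), of B] that(2) by (meson leI not_le)
  have A: "0 \<in> A" "\<And>z w. z \<in> A \<Longrightarrow> w \<in> A \<Longrightarrow> z + w \<in> A" "\<And>c z. z \<in> A \<Longrightarrow> sc c z \<in> A"
  proof -
    show "0 \<in> A" unfolding A_def using D0(1) D1(1) by force
    show "z + w \<in> A" if zw: "z \<in> A" "w \<in> A" for z w
    proof -
      obtain x y x' y' where "x \<in> A0" "y \<in> A1" "z = x + y" "x' \<in> A0" "y' \<in> A1" "w = x' + y'"
        using zw by (auto simp: A_def)
      then have "z + w = (x + x') + (y + y')" "x + x' \<in> A0" "y + y' \<in> A1"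
        by (auto simp: algebra_simps intro: D0(2) D1(2))
      then show ?thesis unfolding A_def by blast
    qed
    show "sc c z \<in> A" if zA: "z \<in> A" for c z
    proof -
      obtain x y where "x \<in> A0" "y \<in> A1" "z = x + y" using zA by (auto simp: A_def)
      then show ?thesis unfolding A_def using sc_add_right D0(3) D1(3) by blast
    qed
  qed
  have Am: "- z \<in> A" if "z \<in> A" for z using A(3)[OF that, of "- 1"] by (simp add: sc_minus_1)
  have Ad: "z - w \<in> A" if "z \<in> A" "w \<in> A" for z w using A(2)[OF that(1) Am[OF that(2)]] by simp
  have N_0: "N 0 = 0"
  proof -
    have "N0 0 = 0" "N1 0 = 0" using D0(5)[OF D0(1)] D1(5)[OF D1(1)] by simp_all
    then show ?thesis using N_le[OF D0(1) D1(1)] N0le[OF A(1)] by simp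
  qed
  \<comment> \<open>A vanishing infimum yields decompositions of the same vector with both parts
    tending to 0, which is the situation of \<open>sep\<close>.\<close>
  have def0: "z = 0" if z: "z \<in> A" "N z = 0" for z
  proof -
    have "\<forall>k. \<exists>p. fst p \<in> A0 \<and> snd p \<in> A1 \<and> fst p + snd p = z \<and> N0 (fst p) + N1 (snd p) < inverse (real (Suc k))"
    proof
      fix k
      have "N z < inverse (real (Suc k))" using z(2) by simp
      from decomp[OF z(1) this] obtain x y where "x \<in> A0" "y \<in> A1" "z = x + y" "N0 x + N1 y < inverse (real (Suc k))"
        by blast
      then show "\<exists>p. fst p \<in> A0 \<and> snd p \<in> A1 \<and> fst p + snd p = z \<and> N0 (fst p) + N1 (snd p) < inverse (real (Suc k))"
        by (intro exI[of _ "(x, y)"]) simp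
    qed
    from choice[OF this] obtain p where p: "\<And>k. fst (p k) \<in> A0 \<and> snd (p k) \<in> A1 \<and> fst (p k) + snd (p k) = z \<and>
      N0 (fst (p k)) + N1 (snd (p k)) < inverse (real (Suc k))" by blast
    define x y where "x k = fst (p k)" and "y k = snd (p k)" for k
    have xy: "\<And>k. x k \<in> A0" "\<And>k. y k \<in> A1" "\<And>k. x k + y k = z" "\<And>k. N0 (x k) + N1 (y k) < inverse (real (Suc k))"
      using p by (simp_all add: x_def y_def)
    have "(\<lambda>k. N0 (x k)) \<longlonglongrightarrow> 0"
    proof (rule tendsto_sandwich[OF _ _ tendsto_const LIMSEQ_inverse_real_of_nat])
      show "\<forall>\<^sub>F k in sequentially. N0 (x k) \<le> inverse (real (Suc k))"
        using xy(4) D1(4)[OF xy(2)] by (intro always_eventually allI) (smt (verit))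
    qed (simp add: D0(4) xy)
    moreover have "(\<lambda>k. N1 (y k)) \<longlonglongrightarrow> 0"
    proof (rule tendsto_sandwich[OF _ _ tendsto_const LIMSEQ_inverse_real_of_nat])
      show "\<forall>\<^sub>F k in sequentially. N1 (y k) \<le> inverse (real (Suc k))"
        using xy(4) D0(4)[OF xy(1)] by (intro always_eventually allI) (smt (verit))
    qed (simp add: D1(4) xy)
    ultimately show ?thesis using sep[of x y z] xy by blast
  qed
  \<comment> \<open>To use that \<open>N z\<close> is an infimum, the claim is rearranged into a
    lower bound for every decomposition; the reverse inequality is this one for
    \<open>1 / c\<close>. The quasi-triangle inequality below is rearranged in the same
    manner.\<close>
  have hom_le: "N (sc c z) \<le> cmod c * N z" if z: "z \<in> A" "c \<noteq> 0" for c z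
  proof -
    have "N (sc c z) / cmod c \<le> N z"
    proof (rule N_ge[OF z(1)])
      fix x y assume xy: "x \<in> A0" "y \<in> A1" "z = x + y"
      have "N (sc c z) \<le> N0 (sc c x) + N1 (sc c y)"
        unfolding xy(3) sc_add_right by (intro N_le D0(3) D1(3) xy)
      also have "\<dots> = cmod c * (N0 x + N1 y)" by (simp add: D0(6) D1(6) xy distrib_left)
      finally show "N (sc c z) / cmod c \<le> N0 x + N1 y" using z(2) by (simp add: pos_divide_le_eq mult.commute)
    qed
    then show ?thesis using z(2) by (simp add: pos_divide_le_eq mult.commute)
  qed
  have hom: "N (sc c z) = cmod c * N z" if z: "z \<in> A" for c z
  proof (cases "c = 0")
    case False
    have "N z \<le> cmod (1 / c) * N (sc c z)"
      using hom_le[OF A(3)[OF z, of c], of "1 / c"] False by (simp add: sc_sc sc_1)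
    then show ?thesis using hom_le[OF z False] False by (simp add: norm_divide field_simps)
  qed (simp add: sc_0 N_0)
  obtain K0 where K0: "\<And>K' x y. K0 \<le> K' \<Longrightarrow> x \<in> A0 \<Longrightarrow> y \<in> A0 \<Longrightarrow> N0 (x + y) \<le> K' * (N0 x + N0 y)"
    using quasi_banach_on_triangle[OF qb0] by blast
  obtain K1 where K1: "\<And>K' x y. K1 \<le> K' \<Longrightarrow> x \<in> A1 \<Longrightarrow> y \<in> A1 \<Longrightarrow> N1 (x + y) \<le> K' * (N1 x + N1 y)"
    using quasi_banach_on_triangle[OF qb1] by blast
  define K where "K = max 1 (max K0 K1)"
  have K: "1 \<le> K" "K0 \<le> K" "K1 \<le> K" by (auto simp: K_def)
  have tri: "N (z + w) \<le> K * (N z + N w)" if zw: "z \<in> A" "w \<in> A" for z w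
  proof -
    have "N (z + w) / K - N w \<le> N z"
    proof (rule N_ge[OF zw(1)])
      fix x y assume xy: "x \<in> A0" "y \<in> A1" "z = x + y"
      have "N (z + w) / K - (N0 x + N1 y) \<le> N w"
      proof (rule N_ge[OF zw(2)])
        fix x' y' assume xy': "x' \<in> A0" "y' \<in> A1" "w = x' + y'"
        have "z + w = (x + x') + (y + y')" using xy xy' by (simp add: algebra_simps)
        then have "N (z + w) \<le> N0 (x + x') + N1 (y + y')"
          using N_le[OF D0(2)[OF xy(1) xy'(1)] D1(2)[OF xy(2) xy'(2)]] by simp
        also have "\<dots> \<le> K * (N0 x + N0 x') + K * (N1 y + N1 y')"
          by (intro add_mono K0 K1 K xy xy')
        finally show "N (z + w) / K - (N0 x + N1 y) \<le> N0 x' + N1 y'"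
          using K(1) by (simp add: field_simps)
      qed
      then show "N (z + w) / K - N w \<le> N0 x + N1 y" by simp
    qed
    then show ?thesis using K(1) by (simp add: field_simps)
  qed
  have complete: "\<exists>l\<in>A. (\<lambda>k. N (\<sigma> k - l)) \<longlonglongrightarrow> 0"
    if \<sigma>: "\<And>k. \<sigma> k \<in> A" and cauchy: "\<And>e. 0 < e \<Longrightarrow> \<exists>M. \<forall>k\<ge>M. \<forall>m\<ge>M. N (\<sigma> k - \<sigma> m) < e" for \<sigma> :: "nat \<Rightarrow> 'v"
  proof -
    let ?q = "1 / (2 * K)"
    have q: "0 < ?q" "?q < 1" using K(1) by auto
    have "\<exists>M. \<forall>k\<ge>M. \<forall>m\<ge>M. N (\<sigma> k - \<sigma> m) < ?q ^ i" for i
      using q by (intro cauchy zero_less_power)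
    then have "\<forall>i. \<exists>M. \<forall>k\<ge>M. \<forall>m\<ge>M. N (\<sigma> k - \<sigma> m) < ?q ^ i" by (rule allI)
    from choice[OF this] obtain M where M: "\<And>i k m. M i \<le> k \<Longrightarrow> M i \<le> m \<Longrightarrow> N (\<sigma> k - \<sigma> m) < ?q ^ i" by blast
    \<comment> \<open>Partial sums of the thresholds form a sequence of indices that at positions
      \<open>i\<close> and \<open>Suc i\<close> both lie beyond \<open>M i\<close>.\<close>
    define r where "r i = (\<Sum>j\<le>i. M j)" for i
    have r1: "M i \<le> r i" for i by (simp add: r_def member_le_sum)
    have r: "M i \<le> r i" "M i \<le> r (Suc i)" for i
      using r1[of i] by (simp_all add: r_def)
    have "\<exists>p. fst p \<in> A0 \<and> snd p \<in> A1 \<and> \<sigma> (r (Suc i)) - \<sigma> (r i) = fst p + snd p \<and> N0 (fst p) + N1 (snd p) < ?q ^ i" for i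
    proof -
      from decomp[OF Ad[OF \<sigma> \<sigma>] M[OF r(2) r(1)]]
      obtain x y where "x \<in> A0" "y \<in> A1" "\<sigma> (r (Suc i)) - \<sigma> (r i) = x + y" "N0 x + N1 y < ?q ^ i"
        by blast
      then show ?thesis by (intro exI[of _ "(x, y)"]) simp
    qed
    then have "\<forall>i. \<exists>p. fst p \<in> A0 \<and> snd p \<in> A1 \<and> \<sigma> (r (Suc i)) - \<sigma> (r i) = fst p + snd p \<and> N0 (fst p) + N1 (snd p) < ?q ^ i"
      by (rule allI)
    from choice[OF this] obtain p where p: "\<And>i. fst (p i) \<in> A0 \<and> snd (p i) \<in> A1 \<and>
      \<sigma> (r (Suc i)) - \<sigma> (r i) = fst (p i) + snd (p i) \<and> N0 (fst (p i)) + N1 (snd (p i)) < ?q ^ i" by blast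
    define x y where "x i = fst (p i)" and "y i = snd (p i)" for i
    have xy: "\<And>i. x i \<in> A0" "\<And>i. y i \<in> A1" "\<And>i. \<sigma> (r (Suc i)) - \<sigma> (r i) = x i + y i" "\<And>i. N0 (x i) + N1 (y i) < ?q ^ i"
      using p unfolding x_def y_def by blast+
    have "N0 (x i) \<le> ?q ^ i" "N1 (y i) \<le> ?q ^ i" for i
      using xy(4)[of i] D0(4)[OF xy(1), of i] D1(4)[OF xy(2), of i] by linarith+
    then obtain X Y where X: "X \<in> A0" "(\<lambda>m. N0 ((\<Sum>k<m. x k) - X)) \<longlonglongrightarrow> 0" and Y: "Y \<in> A1" "(\<lambda>m. N1 ((\<Sum>k<m. y k) - Y)) \<longlonglongrightarrow> 0"
      using quasi_banach_on_series[OF qb0 K(1) K0[OF K(2)], of x] quasi_banach_on_series[OF qb1 K(1) K1[OF K(3)], of y] xy by blast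
    define l where "l = \<sigma> (r 0) + (X + Y)"
    have "X + Y \<in> A" using X(1) Y(1) unfolding A_def by blast
    then have l: "l \<in> A" unfolding l_def by (rule A(2)[OF \<sigma>])
    have Sx: "(\<Sum>k<m. x k) \<in> A0" for m by (induction m) (auto intro: D0(1) D0(2) xy)
    have Sy: "(\<Sum>k<m. y k) \<in> A1" for m by (induction m) (auto intro: D1(1) D1(2) xy)
    have sub: "(\<lambda>m. N (\<sigma> (r m) - l)) \<longlonglongrightarrow> 0"
    proof (rule tendsto_sandwich[OF _ _ tendsto_const])
      show "(\<lambda>m. N0 ((\<Sum>k<m. x k) - X) + N1 ((\<Sum>k<m. y k) - Y)) \<longlonglongrightarrow> 0"
        using tendsto_add[OF X(2) Y(2)] by simp
      show "\<forall>\<^sub>F m in sequentially. N (\<sigma> (r m) - l) \<le> N0 ((\<Sum>k<m. x k) - X) + N1 ((\<Sum>k<m. y k) - Y)"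
      proof (intro always_eventually allI)
        fix m
        have "\<sigma> (r m) - \<sigma> (r 0) = (\<Sum>k<m. x k + y k)"
          unfolding xy(3)[symmetric] by (rule sum_lessThan_telescope[symmetric])
        then have "\<sigma> (r m) - l = ((\<Sum>k<m. x k) - X) + ((\<Sum>k<m. y k) - Y)"
          by (simp add: l_def sum.distrib algebra_simps)
        then show "N (\<sigma> (r m) - l) \<le> N0 ((\<Sum>k<m. x k) - X) + N1 ((\<Sum>k<m. y k) - Y)"
          using N_le[OF D0(8)[OF Sx X(1)] D1(8)[OF Sy Y(1)]] by simp
      qed
    qed (simp add: N0le Ad \<sigma> l)
    have "(\<lambda>k. N (\<sigma> k - l)) \<longlonglongrightarrow> 0"
    proof (rule LIMSEQ_I)
      fix e :: real assume e: "0 < e"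
      have "0 < e / (2 * K)" using e K(1) by simp
      then have "\<forall>\<^sub>F m in sequentially. N (\<sigma> (r m) - l) < e / (2 * K)" "\<forall>\<^sub>F m in sequentially. ?q ^ m < e / (2 * K)"
        using order_tendstoD(2)[OF sub] order_tendstoD(2)[OF LIMSEQ_power_zero[of ?q]] q by auto
      then have "\<forall>\<^sub>F m in sequentially. N (\<sigma> (r m) - l) < e / (2 * K) \<and> ?q ^ m < e / (2 * K)"
        by (rule eventually_conj)
      then obtain m where m: "N (\<sigma> (r m) - l) < e / (2 * K)" "?q ^ m < e / (2 * K)"
        by (auto simp: eventually_sequentially)
      have "norm (N (\<sigma> k - l) - 0) < e" if "M m \<le> k" for k
      proof -
        have "N (\<sigma> k - l) = N ((\<sigma> k - \<sigma> (r m)) + (\<sigma> (r m) - l))" by simp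
        also have "\<dots> \<le> K * (N (\<sigma> k - \<sigma> (r m)) + N (\<sigma> (r m) - l))" by (intro tri Ad \<sigma> l)
        also have "\<dots> < K * (e / (2 * K) + e / (2 * K))"
          using M[OF that r(1)] m K(1) by (intro mult_strict_left_mono add_strict_mono) auto
        also have "\<dots> = e" using K(1) by simp
        finally show ?thesis using N0le[OF Ad[OF \<sigma> l], of k] by simp
      qed
      then show "\<exists>no. \<forall>k\<ge>no. norm (N (\<sigma> k - l) - 0) < e" by blast
    qed
    with l show ?thesis by blast
  qed
  have "quasi_banach_on A N"
    unfolding quasi_banach_on_def
  proof (intro conjI)
    show "\<forall>\<sigma>::nat \<Rightarrow> 'v. range \<sigma> \<subseteq> A \<and> (\<forall>e>0. \<exists>M. \<forall>k\<ge>M. \<forall>m\<ge>M. N (\<sigma> k - \<sigma> m) < e) \<longrightarrow> (\<exists>l\<in>A. (\<lambda>k. N (\<sigma> k - l)) \<longlonglongrightarrow> 0)"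
      using complete by (auto simp: image_subset_iff)
    show "\<exists>K. \<forall>x\<in>A. \<forall>y\<in>A. N (x + y) \<le> K * (N x + N y)" using tri by blast
    show "\<forall>x\<in>A. 0 \<le> N x \<and> (N x = 0 \<longleftrightarrow> x = 0)" using N0le def0 N_0 by blast
  qed (use A hom in blast)+
  then show ?thesis unfolding A_def N_def[abs_def] .
qed

end

section \<open>Compatibility of Besov spaces\<close>

interpretation fun_scaling: complex_scaling "\<lambda>c (u :: 'a \<Rightarrow> complex) f. c * u f"
  by unfold_locales (auto simp: fun_eq_iff algebra_simps)

lemma cring_complex_ring: "cring complex_ring"
proof (rule cringI)
  show "abelian_group complex_ring"
    by (rule abelian_groupI) (auto simp: complex_ring_def intro: exI[of _ "- _"] exI[of "\<lambda>y. y + _ = 0" "- _"])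
  show "comm_monoid complex_ring"
    by (rule comm_monoidI) (auto simp: complex_ring_def)
qed (simp add: complex_ring_def distrib_right)

lemma normed_subspace_simps:
  "carrier (normed_subspace V A N) = A" "\<zero>\<^bsub>normed_subspace V A N\<^esub> = \<zero>\<^bsub>V\<^esub>"
  "x \<oplus>\<^bsub>normed_subspace V A N\<^esub> y = x \<oplus>\<^bsub>V\<^esub> y" "c \<odot>\<^bsub>normed_subspace V A N\<^esub> x = c \<odot>\<^bsub>V\<^esub> x"
  "qnorm (normed_subspace V A N) = N"
  by (simp_all add: normed_subspace_def)

lemma tempered_module_simps:
  "carrier tempered_module = tempered" "\<zero>\<^bsub>tempered_module\<^esub> = 0" "u \<oplus>\<^bsub>tempered_module\<^esub> v = u + v"
  "c \<odot>\<^bsub>tempered_module\<^esub> u = (\<lambda>f. c * u f)"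
  by (auto simp: tempered_module_def fun_eq_iff)

text \<open>Identifies the derived record subtraction with subtraction of functions, which carries
  statements about Cauchy sequences from one formulation to the other.\<close>

lemma module_pointwise:
  assumes c: "0 \<in> carrier X" "\<And>x y. x \<in> carrier X \<Longrightarrow> y \<in> carrier X \<Longrightarrow> x + y \<in> carrier X"
    "\<And>c x. x \<in> carrier X \<Longrightarrow> (\<lambda>f. c * x f) \<in> carrier X"
    and o: "\<zero>\<^bsub>X\<^esub> = 0" "\<And>x y. x \<oplus>\<^bsub>X\<^esub> y = x + (y :: 'a \<Rightarrow> complex)" "\<And>c x. c \<odot>\<^bsub>X\<^esub> x = (\<lambda>f. c * x f)"
  shows "module complex_ring X" "\<And>x y. x \<in> carrier X \<Longrightarrow> y \<in> carrier X \<Longrightarrow> x \<ominus>\<^bsub>X\<^esub> y = x - y"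
proof -
  have m: "- x \<in> carrier X" if "x \<in> carrier X" for x
    using c(3)[OF that, of "- 1"] by (simp add: fun_Compl_def)
  have ag: "abelian_group X"
  proof (rule abelian_groupI)
    show "\<exists>y\<in>carrier X. y \<oplus>\<^bsub>X\<^esub> x = \<zero>\<^bsub>X\<^esub>" if "x \<in> carrier X" for x
      using m[OF that] by (intro bexI[of _ "- x"]) (simp_all add: o)
  qed (auto simp: o c algebra_simps)
  show "module complex_ring X"
  proof (rule moduleI[OF cring_complex_ring ag])
    show "a \<odot>\<^bsub>X\<^esub> x \<in> carrier X" if "x \<in> carrier X" for a x using c(3)[OF that] by (simp add: o)
  qed (auto simp: o complex_ring_def fun_eq_iff algebra_simps)
  show "x \<ominus>\<^bsub>X\<^esub> y = x - y" if "x \<in> carrier X" "y \<in> carrier X" for x y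
  proof -
    have "\<ominus>\<^bsub>X\<^esub> y = - y"
      by (rule abelian_group.minus_equality[OF ag]) (use that m in \<open>simp_all add: o\<close>)
    then show ?thesis by (simp add: a_minus_def o)
  qed
qed

lemma quasi_banach_normed_subspace:
  assumes "fun_scaling.quasi_banach_on A N"
  shows "quasi_banach (normed_subspace tempered_module A N)"
proof -
  let ?X = "normed_subspace tempered_module A N"
  note D = fun_scaling.quasi_banach_onD[OF assms]
  note s = normed_subspace_simps tempered_module_simps
  have m: "module complex_ring ?X"
    by (rule module_pointwise(1)) (simp_all add: s D)
  have d: "x \<ominus>\<^bsub>?X\<^esub> y = x - y" if "x \<in> A" "y \<in> A" for x y
    by (rule module_pointwise(2)) (use that in \<open>simp_all add: s D\<close>)
  obtain K where K: "\<And>K' x y. K \<le> K' \<Longrightarrow> x \<in> A \<Longrightarrow> y \<in> A \<Longrightarrow> N (x + y) \<le> K' * (N x + N y)"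
    using fun_scaling.quasi_banach_on_triangle[OF assms] by blast
  show ?thesis
    unfolding quasi_banach_def
  proof (intro conjI)
    show "\<exists>K. \<forall>x\<in>carrier ?X. \<forall>y\<in>carrier ?X. qnorm ?X (x \<oplus>\<^bsub>?X\<^esub> y) \<le> K * (qnorm ?X x + qnorm ?X y)"
      unfolding s using K by blast
    show "\<forall>\<sigma>. range \<sigma> \<subseteq> carrier ?X \<and> (\<forall>e>0. \<exists>M. \<forall>k\<ge>M. \<forall>m\<ge>M. qnorm ?X (\<sigma> k \<ominus>\<^bsub>?X\<^esub> \<sigma> m) < e) \<longrightarrow>
        (\<exists>l\<in>carrier ?X. (\<lambda>k. qnorm ?X (\<sigma> k \<ominus>\<^bsub>?X\<^esub> l)) \<longlonglongrightarrow> 0)"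
    proof (intro allI impI)
      fix \<sigma> :: "nat \<Rightarrow> _"
      assume a: "range \<sigma> \<subseteq> carrier ?X \<and> (\<forall>e>0. \<exists>M. \<forall>k\<ge>M. \<forall>m\<ge>M. qnorm ?X (\<sigma> k \<ominus>\<^bsub>?X\<^esub> \<sigma> m) < e)"
      then have \<sigma>: "\<And>k. \<sigma> k \<in> A" by (auto simp: s)
      have "\<exists>M. \<forall>k\<ge>M. \<forall>m\<ge>M. N (\<sigma> k - \<sigma> m) < e" if "0 < e" for e
        using a that by (simp add: s(5) d \<sigma>)
      from fun_scaling.quasi_banach_on_complete[OF assms \<sigma> this]
      obtain l where "l \<in> A" "(\<lambda>k. N (\<sigma> k - l)) \<longlonglongrightarrow> 0" by blast
      then show "\<exists>l\<in>carrier ?X. (\<lambda>k. qnorm ?X (\<sigma> k \<ominus>\<^bsub>?X\<^esub> l)) \<longlonglongrightarrow> 0"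
        by (intro bexI[of _ l]) (simp_all add: s(1,5) d \<sigma>)
    qed
  qed (use m D in \<open>simp_all add: s\<close>)
qed

lemma tempered_add_closed: "u \<in> tempered \<Longrightarrow> v \<in> tempered \<Longrightarrow> u + v \<in> tempered"
proof -
  assume u: "u \<in> tempered" and v: "v \<in> tempered"
  obtain A N where A: "0 \<le> A" "\<And>f. f \<in> schwartz \<Longrightarrow> cmod (u f) \<le> A * schwartz_seminorm N f"
    using tempered_bound[OF u] by blast
  obtain B M where B: "0 \<le> B" "\<And>f. f \<in> schwartz \<Longrightarrow> cmod (v f) \<le> B * schwartz_seminorm M f"
    using tempered_bound[OF v] by blast
  have "cmod ((u + v) f) \<le> (A + B) * schwartz_seminorm (max N M) f" if f: "f \<in> schwartz" for f
  proof -
    have "cmod ((u + v) f) \<le> A * schwartz_seminorm N f + B * schwartz_seminorm M f"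
      using norm_triangle_ineq[of "u f" "v f"] A(2)[OF f] B(2)[OF f] by simp
    also have "\<dots> \<le> A * schwartz_seminorm (max N M) f + B * schwartz_seminorm (max N M) f"
      by (intro add_mono mult_left_mono schwartz_seminorm_mono f A B) auto
    finally show ?thesis by (simp add: distrib_right)
  qed
  then show ?thesis
    using temperedD[OF u] temperedD[OF v] unfolding tempered_def by (auto simp: distrib_left)
qed

lemma tempered_cmult_closed: "u \<in> tempered \<Longrightarrow> (\<lambda>f. c * u f) \<in> tempered"
proof -
  assume u: "u \<in> tempered"
  obtain A N where A: "0 \<le> A" "\<And>f. f \<in> schwartz \<Longrightarrow> cmod (u f) \<le> A * schwartz_seminorm N f"
    using tempered_bound[OF u] by blast
  have "cmod (c * u f) \<le> (cmod c * A) * schwartz_seminorm N f" if "f \<in> schwartz" for f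
    using mult_left_mono[OF A(2)[OF that], of "cmod c"] by (simp add: norm_mult mult.assoc)
  then show ?thesis using temperedD[OF u] by (auto simp: tempered_def distrib_left)
qed

lemma tempered_0: "0 \<in> tempered"
proof -
  have "\<exists>C N. \<forall>f\<in>schwartz. cmod (0::complex) \<le> C * schwartz_seminorm N f" by (intro exI[of _ 0]) simp
  then show ?thesis unfolding tempered_def by simp
qed

lemma module_tempered: "module complex_ring tempered_module"
  by (rule module_pointwise(1)) (simp_all add: tempered_module_simps tempered_0 tempered_add_closed tempered_cmult_closed)

lemma tempered_minus_closed: "u \<in> tempered \<Longrightarrow> v \<in> tempered \<Longrightarrow> u - v \<in> tempered"
  using tempered_add_closed[of u "\<lambda>f. - 1 * v f"] tempered_cmult_closed[of v "- 1"]
  by (simp add: fun_diff_def plus_fun_def)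

context lp_family
begin

section \<open>Besov spaces as quasi-Banach spaces and compatible pairs\<close>

definition besov_set :: "ennreal \<Rightarrow> ennreal \<Rightarrow> real \<Rightarrow> 'n functional set" where
  "besov_set p q s = {f \<in> tempered. besov_norm \<phi> p q s f < \<infinity>}"

definition besov_qnorm :: "ennreal \<Rightarrow> ennreal \<Rightarrow> real \<Rightarrow> 'n functional \<Rightarrow> real" where
  "besov_qnorm p q s f = enn2real (besov_norm \<phi> p q s f)"

lemma besov_space_eq: "besov_space \<phi> p q s = normed_subspace tempered_module (besov_set p q s) (besov_qnorm p q s)"
  by (simp add: besov_space_def besov_set_def besov_qnorm_def[abs_def])

lemma besov_norm_add':
  assumes "0 < p" "0 < q"
  obtains K where "0 < K"
    "\<And>u v. u \<in> besov_set p q s \<Longrightarrow> v \<in> besov_set p q s \<Longrightarrow> u + v \<in> besov_set p q s \<and>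
      besov_qnorm p q s (u + v) \<le> K * (besov_qnorm p q s u + besov_qnorm p q s v)"
proof -
  obtain K where K: "0 < K"
    "\<And>u v. u \<in> tempered \<Longrightarrow> v \<in> tempered \<Longrightarrow>
      besov_norm \<phi> p q s (\<lambda>f. u f + v f) \<le> ennreal K * (besov_norm \<phi> p q s u + besov_norm \<phi> p q s v)"
    using besov_norm_add[OF assms] by blast
  have "u + v \<in> besov_set p q s \<and> besov_qnorm p q s (u + v) \<le> K * (besov_qnorm p q s u + besov_qnorm p q s v)"
    if u: "u \<in> besov_set p q s" and v: "v \<in> besov_set p q s" for u v
  proof -
    have fin: "besov_norm \<phi> p q s u < \<infinity>" "besov_norm \<phi> p q s v < \<infinity>" and t: "u \<in> tempered" "v \<in> tempered"
      using u v by (auto simp: besov_set_def)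
    have "besov_norm \<phi> p q s (u + v) \<le> ennreal K * (besov_norm \<phi> p q s u + besov_norm \<phi> p q s v)"
      using K(2)[OF t] by (simp add: plus_fun_def)
    also have "\<dots> = ennreal (K * (besov_qnorm p q s u + besov_qnorm p q s v))"
      using fin K(1) by (simp add: besov_qnorm_def ennreal_mult)
    finally have le: "besov_norm \<phi> p q s (u + v) \<le> ennreal (K * (besov_qnorm p q s u + besov_qnorm p q s v))" .
    then have "besov_norm \<phi> p q s (u + v) < \<infinity>" by (rule le_less_trans) simp
    moreover have "besov_qnorm p q s (u + v) \<le> K * (besov_qnorm p q s u + besov_qnorm p q s v)"
      unfolding besov_qnorm_def[of p q s "u + v"]
      by (rule enn2real_leI[OF _ le]) (use K(1) in \<open>simp add: besov_qnorm_def\<close>)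
    ultimately show ?thesis using tempered_add_closed[OF t] by (simp add: besov_set_def)
  qed
  then show ?thesis using that K(1) by blast
qed

lemma besov_qnorm_embedding:
  assumes "0 < p" "0 < q"
  obtains C N where "0 \<le> C"
    "\<And>u g. u \<in> besov_set p q s \<Longrightarrow> g \<in> schwartz \<Longrightarrow> cmod (u g) \<le> C * besov_qnorm p q s u * schwartz_seminorm N g"
proof -
  obtain C N where C: "0 \<le> C" "\<And>u g. u \<in> tempered \<Longrightarrow> besov_norm \<phi> p q s u < \<infinity> \<Longrightarrow> g \<in> schwartz \<Longrightarrow>
      cmod (u g) \<le> C * enn2real (besov_norm \<phi> p q s u) * schwartz_seminorm N g"
    using besov_embedding[OF assms] by blast
  show ?thesis
    by (rule that[OF C(1), of N]) (use C(2) in \<open>simp add: besov_set_def besov_qnorm_def\<close>)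
qed

lemma besov_set_cmult:
  assumes "0 < p" "0 < q" "u \<in> besov_set p q s"
  shows "(\<lambda>f. c * u f) \<in> besov_set p q s" "besov_qnorm p q s (\<lambda>f. c * u f) = cmod c * besov_qnorm p q s u"
  using assms by (simp_all add: besov_set_def besov_qnorm_def besov_norm_cmult tempered_cmult_closed
      ennreal_mult_less_top enn2real_mult)

text \<open>The embedding makes a Cauchy sequence converge on each test function and bounds the
  limit by a Schwartz seminorm; the Fatou property then upgrades this weak limit to a limit in the
  quasi-norm.\<close>

lemma besov_quasi_banach:
  assumes p: "0 < p" and q: "0 < q"
  shows "fun_scaling.quasi_banach_on (besov_set p q s) (besov_qnorm p q s)"
proof -
  let ?A = "besov_set p q s" and ?N = "besov_qnorm p q s"
  obtain K where K: "0 < K" "\<And>u v. u \<in> ?A \<Longrightarrow> v \<in> ?A \<Longrightarrow> u + v \<in> ?A \<and> ?N (u + v) \<le> K * (?N u + ?N v)"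
    using besov_norm_add'[OF p q] by blast
  obtain C N where C: "0 \<le> C" "\<And>u g. u \<in> ?A \<Longrightarrow> g \<in> schwartz \<Longrightarrow> cmod (u g) \<le> C * ?N u * schwartz_seminorm N g"
    using besov_qnorm_embedding[OF p q] by blast
  have t: "u \<in> tempered" if "u \<in> ?A" for u using that by (simp add: besov_set_def)
  have N0: "0 \<le> ?N u" for u by (simp add: besov_qnorm_def)
  have z0: "besov_norm \<phi> p q s 0 = 0"
    using besov_norm_cmult[OF p q tempered_0, where c=0 and s=s] by (simp add: zero_fun_def)
  have zA: "0 \<in> ?A" using z0 by (simp add: besov_set_def tempered_0)
  have def0: "u = 0" if u: "u \<in> ?A" "?N u = 0" for u
  proof
    fix g show "u g = 0 g"
      using C(2)[OF u(1), of g] u(2) temperedD(1)[OF t[OF u(1)], of g] by (cases "g \<in> schwartz") auto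
  qed
  have minus: "u - v \<in> ?A" if "u \<in> ?A" "v \<in> ?A" for u v
  proof -
    have "u + (\<lambda>f. - 1 * v f) \<in> ?A" using K(2)[OF that(1) besov_set_cmult(1)[OF p q that(2)]] by blast
    then show ?thesis by (simp add: plus_fun_def fun_diff_def)
  qed
  have complete: "\<exists>l\<in>?A. (\<lambda>k. ?N (\<sigma> k - l)) \<longlonglongrightarrow> 0"
    if \<sigma>: "\<And>k. \<sigma> k \<in> ?A" and cauchy: "\<And>e. 0 < e \<Longrightarrow> \<exists>M. \<forall>k\<ge>M. \<forall>m\<ge>M. ?N (\<sigma> k - \<sigma> m) < e"
    for \<sigma> :: "nat \<Rightarrow> 'n functional"
  proof -
    \<comment> \<open>The added 1 in the tolerance \<open>e / (C * ?S + 1)\<close> below keeps the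
      divisor positive when the seminorm of \<open>g\<close> or the constant is 0.\<close>
    have "convergent (\<lambda>k. \<sigma> k g)" for g
    proof (cases "g \<in> schwartz")
      case False
      then have "(\<lambda>k. \<sigma> k g) = (\<lambda>k. 0)" using temperedD(1)[OF t[OF \<sigma>]] by blast
      then show ?thesis by (simp add: convergent_const)
    next
      case True
      let ?S = "schwartz_seminorm N g"
      have S0: "0 \<le> ?S" by (rule schwartz_seminorm_nonneg[OF True])
      have "Cauchy (\<lambda>k. \<sigma> k g)"
      proof (rule metric_CauchyI)
        fix e :: real assume "0 < e"
        then have "0 < e / (C * ?S + 1)" using C(1) S0 by (simp add: add_nonneg_pos)
        then obtain M where M: "\<forall>k\<ge>M. \<forall>m\<ge>M. ?N (\<sigma> k - \<sigma> m) < e / (C * ?S + 1)" using cauchy by blast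
        have "dist (\<sigma> k g) (\<sigma> m g) < e" if "M \<le> k" "M \<le> m" for k m
        proof -
          have "dist (\<sigma> k g) (\<sigma> m g) \<le> C * ?N (\<sigma> k - \<sigma> m) * ?S"
            using C(2)[OF minus[OF \<sigma> \<sigma>] True] by (simp add: dist_norm)
          also have "\<dots> = (C * ?S) * ?N (\<sigma> k - \<sigma> m)" by simp
          also have "\<dots> \<le> (C * ?S) * (e / (C * ?S + 1))"
            using M that C(1) S0 by (intro mult_left_mono) (auto intro: less_imp_le)
          also have "\<dots> < (C * ?S + 1) * (e / (C * ?S + 1))"
            using \<open>0 < e / _\<close> by (intro mult_strict_right_mono) auto
          also have "\<dots> = e" using C(1) S0 by (simp add: add_nonneg_eq_0_iff)
          finally show ?thesis .
        qed
        then show "\<exists>M. \<forall>m\<ge>M. \<forall>n\<ge>M. dist (\<sigma> m g) (\<sigma> n g) < e" by blast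
      qed
      then show ?thesis by (simp add: Cauchy_convergent_iff)
    qed
    then have L: "(\<lambda>k. \<sigma> k g) \<longlonglongrightarrow> lim (\<lambda>k. \<sigma> k g)" for g by (simp add: convergent_LIMSEQ_iff)
    define l where "l g = lim (\<lambda>k. \<sigma> k g)" for g
    have l: "(\<lambda>k. \<sigma> k g) \<longlonglongrightarrow> l g" for g unfolding l_def by (rule L)
    obtain M1 where M1: "\<forall>k\<ge>M1. \<forall>m\<ge>M1. ?N (\<sigma> k - \<sigma> m) < 1" using cauchy[of 1] by auto
    define B where "B = K * (1 + ?N (\<sigma> M1))"
    have B: "?N (\<sigma> k) \<le> B" if "M1 \<le> k" for k
    proof -
      have "?N (\<sigma> k) = ?N ((\<sigma> k - \<sigma> M1) + \<sigma> M1)" by simp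
      also have "\<dots> \<le> K * (?N (\<sigma> k - \<sigma> M1) + ?N (\<sigma> M1))" using K(2)[OF minus[OF \<sigma> \<sigma>] \<sigma>] by blast
      also have "\<dots> \<le> B" unfolding B_def using M1 that K(1) by (intro mult_left_mono add_right_mono) (auto intro: less_imp_le)
      finally show ?thesis .
    qed
    have lt: "l \<in> tempered"
      unfolding tempered_def
    proof (intro CollectI conjI allI ballI impI)
      fix f :: "real^'n \<Rightarrow> complex" assume "f \<notin> schwartz"
      then have "(\<lambda>k. \<sigma> k f) = (\<lambda>k. 0)" using temperedD(1)[OF t[OF \<sigma>]] by blast
      then show "l f = 0" using l[of f] by (simp add: LIMSEQ_const_iff)
    next
      fix f g :: "real^'n \<Rightarrow> complex" assume fg: "f \<in> schwartz" "g \<in> schwartz"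
      have "(\<lambda>k. \<sigma> k (\<lambda>x. f x + g x)) \<longlonglongrightarrow> l f + l g"
        unfolding temperedD(2)[OF t[OF \<sigma>] fg] by (intro tendsto_add l)
      then show "l (\<lambda>x. f x + g x) = l f + l g" by (rule LIMSEQ_unique[OF l])
    next
      fix c and f :: "real^'n \<Rightarrow> complex" assume f: "f \<in> schwartz"
      have "(\<lambda>k. \<sigma> k (\<lambda>x. c * f x)) \<longlonglongrightarrow> c * l f"
        unfolding temperedD(3)[OF t[OF \<sigma>] f] by (intro tendsto_mult tendsto_const l)
      then show "l (\<lambda>x. c * f x) = c * l f" by (rule LIMSEQ_unique[OF l])
    next
      have "cmod (l f) \<le> (C * B) * schwartz_seminorm N f" if f: "f \<in> schwartz" for f
      proof (rule LIMSEQ_le_const2[OF tendsto_norm[OF l]])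
        have "cmod (\<sigma> k f) \<le> (C * B) * schwartz_seminorm N f" if "M1 \<le> k" for k
          using C(1) by (intro order_trans[OF C(2)[OF \<sigma> f]] mult_right_mono mult_left_mono B that schwartz_seminorm_nonneg f)
        then show "\<exists>M. \<forall>k\<ge>M. cmod (\<sigma> k f) \<le> (C * B) * schwartz_seminorm N f" by blast
      qed
      then show "\<exists>C N. \<forall>f\<in>schwartz. cmod (l f) \<le> C * schwartz_seminorm N f" by blast
    qed
    \<comment> \<open>The second index of the Cauchy condition is sent to infinity; lower
      semicontinuity suffices for that, and the offset \<open>M\<close> keeps the index in the
      admissible range.\<close>
    have close: "besov_norm \<phi> p q s (\<sigma> k - l) \<le> ennreal e" if M: "\<forall>k\<ge>M. \<forall>m\<ge>M. ?N (\<sigma> k - \<sigma> m) < e" "M \<le> k" for k M e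
    proof -
      have "besov_norm \<phi> p q s (\<sigma> k - l) \<le> liminf (\<lambda>m. besov_norm \<phi> p q s (\<sigma> k - \<sigma> (m + M)))"
      proof (rule besov_norm_liminf[OF p q])
        show "(\<lambda>m. (\<sigma> k - \<sigma> (m + M)) f) \<longlonglongrightarrow> (\<sigma> k - l) f" for f
          using LIMSEQ_ignore_initial_segment[OF l] by (simp add: tendsto_diff)
      qed (use tempered_minus_closed t \<sigma> lt in auto)
      also have "\<dots> \<le> liminf (\<lambda>m::nat. ennreal e)"
      proof (intro Liminf_mono always_eventually allI)
        fix m
        have "besov_norm \<phi> p q s (\<sigma> k - \<sigma> (m + M)) = ennreal (?N (\<sigma> k - \<sigma> (m + M)))"
          using minus[OF \<sigma> \<sigma>, of k "m + M"] by (simp add: besov_set_def besov_qnorm_def)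
        then show "besov_norm \<phi> p q s (\<sigma> k - \<sigma> (m + M)) \<le> ennreal e"
          using M by (simp add: ennreal_leI less_imp_le)
      qed
      also have "\<dots> = ennreal e" by (simp add: Liminf_const)
      finally show ?thesis .
    qed
    have "besov_norm \<phi> p q s (\<sigma> M1 - l) < \<infinity>" using close[OF M1, of M1] by (auto intro: le_less_trans)
    then have "\<sigma> M1 - l \<in> ?A" using tempered_minus_closed[OF t[OF \<sigma>] lt] by (simp add: besov_set_def)
    from minus[OF \<sigma>[of M1] this] have lA: "l \<in> ?A" by simp
    have "(\<lambda>k. ?N (\<sigma> k - l)) \<longlonglongrightarrow> 0"
    proof (rule LIMSEQ_I)
      fix e :: real assume e: "0 < e"
      then obtain M where M: "\<forall>k\<ge>M. \<forall>m\<ge>M. ?N (\<sigma> k - \<sigma> m) < e / 2" using cauchy[of "e / 2"] by auto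
      have "norm (?N (\<sigma> k - l) - 0) < e" if "M \<le> k" for k
      proof -
        have "?N (\<sigma> k - l) \<le> e / 2"
          unfolding besov_qnorm_def using e by (intro enn2real_leI close[OF M that]) auto
        then show ?thesis using e N0[of "\<sigma> k - l"] by simp
      qed
      then show "\<exists>no. \<forall>k\<ge>no. norm (?N (\<sigma> k - l) - 0) < e" by blast
    qed
    with lA show ?thesis by blast
  qed
  show ?thesis
    unfolding fun_scaling.quasi_banach_on_def
  proof (intro conjI)
    show "\<forall>\<sigma>::nat \<Rightarrow> 'n functional. range \<sigma> \<subseteq> ?A \<and> (\<forall>e>0. \<exists>M. \<forall>k\<ge>M. \<forall>m\<ge>M. ?N (\<sigma> k - \<sigma> m) < e) \<longrightarrow> (\<exists>l\<in>?A. (\<lambda>k. ?N (\<sigma> k - l)) \<longlonglongrightarrow> 0)"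
      using complete by (auto simp: image_subset_iff)
    show "\<exists>K. \<forall>x\<in>?A. \<forall>y\<in>?A. ?N (x + y) \<le> K * (?N x + ?N y)" using K(2) by blast
    have "?N 0 = 0" using z0 by (simp add: besov_qnorm_def)
    then show "\<forall>x\<in>?A. 0 \<le> ?N x \<and> (?N x = 0 \<longleftrightarrow> x = 0)" using N0 def0 by blast
  qed (use K(2) zA besov_set_cmult[OF p q] in blast)+
qed

text \<open>Both spaces embed continuously into the tempered distributions, so a distribution split
  into two parts tending to 0 vanishes on every test function: this is the separation hypothesis of
  \<open>quasi_banach_on_sum\<close>.\<close>

lemma compatible_besov_pair:
  assumes p: "0 < p0" "0 < p1" and q: "0 < q0" "0 < q1"
  shows "compatible (besov_pair \<phi> p0 q0 s0 p1 q1 s1)"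
proof -
  let ?P = "besov_pair \<phi> p0 q0 s0 p1 q1 s1"
  let ?A0 = "besov_set p0 q0 s0" and ?N0 = "besov_qnorm p0 q0 s0"
  let ?A1 = "besov_set p1 q1 s1" and ?N1 = "besov_qnorm p1 q1 s1"
  note s = normed_subspace_simps tempered_module_simps
  have ls: "linear_subspace (besov_space \<phi> p q s) tempered_module" if "0 < p" "0 < q" for p q s
    by (auto simp: linear_subspace_def besov_space_eq s besov_set_def)
  have "fun_scaling.quasi_banach_on {x + y | x y. x \<in> ?A0 \<and> y \<in> ?A1}
      (\<lambda>z. Inf {?N0 x + ?N1 y | x y. x \<in> ?A0 \<and> y \<in> ?A1 \<and> z = x + y})"
  proof (rule fun_scaling.quasi_banach_on_sum[OF besov_quasi_banach[OF p(1) q(1)] besov_quasi_banach[OF p(2) q(2)]])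
    fix x y :: "nat \<Rightarrow> 'n functional" and z
    assume x: "\<And>k. x k \<in> ?A0" and y: "\<And>k. y k \<in> ?A1" and z: "\<And>k. x k + y k = z"
      and x0: "(\<lambda>k. ?N0 (x k)) \<longlonglongrightarrow> 0" and y0: "(\<lambda>k. ?N1 (y k)) \<longlonglongrightarrow> 0"
    obtain C N where C: "0 \<le> C" "\<And>u g. u \<in> ?A0 \<Longrightarrow> g \<in> schwartz \<Longrightarrow> cmod (u g) \<le> C * ?N0 u * schwartz_seminorm N g"
      using besov_qnorm_embedding[OF p(1) q(1)] by blast
    obtain D M where D: "0 \<le> D" "\<And>u g. u \<in> ?A1 \<Longrightarrow> g \<in> schwartz \<Longrightarrow> cmod (u g) \<le> D * ?N1 u * schwartz_seminorm M g"
      using besov_qnorm_embedding[OF p(2) q(2)] by blast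
    show "z = 0"
    proof
      fix g
      show "z g = 0 g"
      proof (cases "g \<in> schwartz")
        case False
        then have "x 0 g = 0" "y 0 g = 0"
          using x[of 0] y[of 0] temperedD(1) by (auto simp: besov_set_def)
        then show ?thesis unfolding z[of 0, symmetric] by simp
      next
        case True
        have "(\<lambda>k. x k g) \<longlonglongrightarrow> 0"
        proof (rule Lim_null_comparison)
          show "\<forall>\<^sub>F k in sequentially. cmod (x k g) \<le> C * ?N0 (x k) * schwartz_seminorm N g"
            by (intro always_eventually allI C(2) x True)
          show "(\<lambda>k. C * ?N0 (x k) * schwartz_seminorm N g) \<longlonglongrightarrow> 0"
            by (intro tendsto_mult_left_zero tendsto_mult_right_zero x0)
        qed
        moreover have "(\<lambda>k. y k g) \<longlonglongrightarrow> 0"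
        proof (rule Lim_null_comparison)
          show "\<forall>\<^sub>F k in sequentially. cmod (y k g) \<le> D * ?N1 (y k) * schwartz_seminorm M g"
            by (intro always_eventually allI D(2) y True)
          show "(\<lambda>k. D * ?N1 (y k) * schwartz_seminorm M g) \<longlonglongrightarrow> 0"
            by (intro tendsto_mult_left_zero tendsto_mult_right_zero y0)
        qed
        ultimately have "(\<lambda>k. x k g + y k g) \<longlonglongrightarrow> 0 + 0" by (rule tendsto_add)
        moreover have "x k g + y k g = z g" for k unfolding z[of k, symmetric] by simp
        ultimately show ?thesis by (simp add: LIMSEQ_const_iff)
      qed
    qed
  qed
  from quasi_banach_normed_subspace[OF this] have "quasi_banach (sum_space ?P)"
    by (simp add: sum_space_def besov_pair_def besov_space_eq s)
  then show ?thesis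
    unfolding compatible_def
    using ls p q quasi_banach_normed_subspace[OF besov_quasi_banach]
    by (simp add: besov_pair_def module_tempered) (simp add: besov_space_eq)
qed

end

section \<open>Interpolation functors\<close>

text \<open>Transport of structure along a bijection of carriers. The zero is matched explicitly
  because it is a separate field of the record.\<close>

lemma module_iso:
  assumes X: "module complex_ring X" and bij: "bij_betw J (carrier X) (carrier Y)"
    and add: "\<And>x y. x \<in> carrier X \<Longrightarrow> y \<in> carrier X \<Longrightarrow> J (x \<oplus>\<^bsub>X\<^esub> y) = J x \<oplus>\<^bsub>Y\<^esub> J y"
    and smult: "\<And>c x. x \<in> carrier X \<Longrightarrow> J (c \<odot>\<^bsub>X\<^esub> x) = c \<odot>\<^bsub>Y\<^esub> J x"
    and zero: "\<zero>\<^bsub>Y\<^esub> = J \<zero>\<^bsub>X\<^esub>"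
  shows "module complex_ring Y"
    and "\<And>x y. x \<in> carrier X \<Longrightarrow> y \<in> carrier X \<Longrightarrow> J (x \<ominus>\<^bsub>X\<^esub> y) = J x \<ominus>\<^bsub>Y\<^esub> J y"
proof -
  interpret X: module complex_ring X by (rule X)
  have cY: "carrier Y = J ` carrier X" using bij by (simp add: bij_betw_def)
  have cR: "c \<in> carrier complex_ring" for c by (simp add: complex_ring_def)
  have sc: "c \<odot>\<^bsub>X\<^esub> x \<in> carrier X" if "x \<in> carrier X" for c x using X.smult_closed[OF cR that] .
  have ag: "abelian_group Y"
  proof (rule abelian_groupI)
    show "a \<oplus>\<^bsub>Y\<^esub> b \<in> carrier Y" if "a \<in> carrier Y" "b \<in> carrier Y" for a b
      using that unfolding cY by (auto simp flip: add)
    show "\<zero>\<^bsub>Y\<^esub> \<in> carrier Y" by (simp add: cY zero)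
    show "(a \<oplus>\<^bsub>Y\<^esub> b) \<oplus>\<^bsub>Y\<^esub> c = a \<oplus>\<^bsub>Y\<^esub> (b \<oplus>\<^bsub>Y\<^esub> c)" if "a \<in> carrier Y" "b \<in> carrier Y" "c \<in> carrier Y" for a b c
      using that unfolding cY by (auto simp add: X.a_assoc simp flip: add)
    show "a \<oplus>\<^bsub>Y\<^esub> b = b \<oplus>\<^bsub>Y\<^esub> a" if "a \<in> carrier Y" "b \<in> carrier Y" for a b
      using that unfolding cY by (auto simp add: X.a_comm simp flip: add)
    show "\<zero>\<^bsub>Y\<^esub> \<oplus>\<^bsub>Y\<^esub> a = a" if "a \<in> carrier Y" for a
      using that unfolding cY zero by (auto simp flip: add)
    show "\<exists>b\<in>carrier Y. b \<oplus>\<^bsub>Y\<^esub> a = \<zero>\<^bsub>Y\<^esub>" if "a \<in> carrier Y" for a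
    proof -
      obtain x where x: "x \<in> carrier X" "a = J x" using \<open>a \<in> carrier Y\<close> unfolding cY by blast
      then have "J (\<ominus>\<^bsub>X\<^esub> x) \<oplus>\<^bsub>Y\<^esub> a = \<zero>\<^bsub>Y\<^esub>" by (simp add: zero X.l_neg flip: add)
      moreover have "J (\<ominus>\<^bsub>X\<^esub> x) \<in> carrier Y" using x by (simp add: cY)
      ultimately show ?thesis by blast
    qed
  qed
  show "module complex_ring Y"
  proof (rule moduleI[OF cring_complex_ring ag])
    show "c \<odot>\<^bsub>Y\<^esub> a \<in> carrier Y" if "a \<in> carrier Y" for c a
      using that unfolding cY by (auto simp: sc simp flip: smult)
    show "(c \<oplus>\<^bsub>complex_ring\<^esub> d) \<odot>\<^bsub>Y\<^esub> a = c \<odot>\<^bsub>Y\<^esub> a \<oplus>\<^bsub>Y\<^esub> d \<odot>\<^bsub>Y\<^esub> a" if "a \<in> carrier Y" for c d a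
      using that unfolding cY by (auto simp: sc cR X.smult_l_distr simp flip: smult add)
    show "c \<odot>\<^bsub>Y\<^esub> (a \<oplus>\<^bsub>Y\<^esub> b) = c \<odot>\<^bsub>Y\<^esub> a \<oplus>\<^bsub>Y\<^esub> c \<odot>\<^bsub>Y\<^esub> b" if "a \<in> carrier Y" "b \<in> carrier Y" for c a b
      using that unfolding cY by (auto simp: sc cR X.smult_r_distr simp flip: smult add)
    show "(c \<otimes>\<^bsub>complex_ring\<^esub> d) \<odot>\<^bsub>Y\<^esub> a = c \<odot>\<^bsub>Y\<^esub> (d \<odot>\<^bsub>Y\<^esub> a)" if "a \<in> carrier Y" for c d a
      using that unfolding cY by (auto simp: sc cR X.smult_assoc1 simp flip: smult)
    show "\<one>\<^bsub>complex_ring\<^esub> \<odot>\<^bsub>Y\<^esub> a = a" if "a \<in> carrier Y" for a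
      using that unfolding cY by (auto simp flip: smult)
  qed
  show "J (x \<ominus>\<^bsub>X\<^esub> y) = J x \<ominus>\<^bsub>Y\<^esub> J y" if "x \<in> carrier X" "y \<in> carrier X" for x y
  proof -
    have "\<ominus>\<^bsub>Y\<^esub> J y = J (\<ominus>\<^bsub>X\<^esub> y)"
      by (rule abelian_group.minus_equality[OF ag])
        (use \<open>y \<in> carrier X\<close> in \<open>simp_all add: cY zero X.l_neg flip: add\<close>)
    then show ?thesis using that by (simp add: a_minus_def add)
  qed
qed

definition isometric_iso :: "('v \<Rightarrow> 'u) \<Rightarrow> 'v qspace \<Rightarrow> 'u qspace \<Rightarrow> bool" where
  "isometric_iso J X Y \<longleftrightarrow> bij_betw J (carrier X) (carrier Y) \<and>
     (\<forall>x\<in>carrier X. \<forall>y\<in>carrier X. J (x \<oplus>\<^bsub>X\<^esub> y) = J x \<oplus>\<^bsub>Y\<^esub> J y) \<and>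
     (\<forall>c. \<forall>x\<in>carrier X. J (c \<odot>\<^bsub>X\<^esub> x) = c \<odot>\<^bsub>Y\<^esub> J x) \<and> \<zero>\<^bsub>Y\<^esub> = J \<zero>\<^bsub>X\<^esub> \<and>
     (\<forall>x\<in>carrier X. qnorm Y (J x) = qnorm X x)"

lemma quasi_banach_iso:
  assumes X: "quasi_banach X" and J: "isometric_iso J X Y"
  shows "quasi_banach Y"
proof -
  have bij: "bij_betw J (carrier X) (carrier Y)"
    and add: "\<And>x y. x \<in> carrier X \<Longrightarrow> y \<in> carrier X \<Longrightarrow> J (x \<oplus>\<^bsub>X\<^esub> y) = J x \<oplus>\<^bsub>Y\<^esub> J y"
    and smult: "\<And>c x. x \<in> carrier X \<Longrightarrow> J (c \<odot>\<^bsub>X\<^esub> x) = c \<odot>\<^bsub>Y\<^esub> J x"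
    and zero: "\<zero>\<^bsub>Y\<^esub> = J \<zero>\<^bsub>X\<^esub>" and N: "\<And>x. x \<in> carrier X \<Longrightarrow> qnorm Y (J x) = qnorm X x"
    using J by (auto simp: isometric_iso_def)
  have cY: "carrier Y = J ` carrier X" and inj: "inj_on J (carrier X)" using bij by (auto simp: bij_betw_def)
  have mX: "module complex_ring X"
    and N0: "\<And>x. x \<in> carrier X \<Longrightarrow> 0 \<le> qnorm X x \<and> (qnorm X x = 0 \<longleftrightarrow> x = \<zero>\<^bsub>X\<^esub>)"
    and Nc: "\<And>c x. x \<in> carrier X \<Longrightarrow> qnorm X (c \<odot>\<^bsub>X\<^esub> x) = cmod c * qnorm X x"
    using X by (auto simp: quasi_banach_def)
  obtain K where K: "\<And>x y. x \<in> carrier X \<Longrightarrow> y \<in> carrier X \<Longrightarrow> qnorm X (x \<oplus>\<^bsub>X\<^esub> y) \<le> K * (qnorm X x + qnorm X y)"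
    using X unfolding quasi_banach_def by blast
  have complete: "\<forall>\<sigma>::nat \<Rightarrow> _. range \<sigma> \<subseteq> carrier X \<and> (\<forall>e>0. \<exists>M. \<forall>k\<ge>M. \<forall>m\<ge>M. qnorm X (\<sigma> k \<ominus>\<^bsub>X\<^esub> \<sigma> m) < e) \<longrightarrow>
        (\<exists>l\<in>carrier X. (\<lambda>k. qnorm X (\<sigma> k \<ominus>\<^bsub>X\<^esub> l)) \<longlonglongrightarrow> 0)"
    using X unfolding quasi_banach_def by (elim conjE)
  interpret X: module complex_ring X by (rule mX)
  have cR: "c \<in> carrier complex_ring" for c by (simp add: complex_ring_def)
  have sc: "c \<odot>\<^bsub>X\<^esub> x \<in> carrier X" if "x \<in> carrier X" for c x using X.smult_closed[OF cR that] .
  have minus: "J (x \<ominus>\<^bsub>X\<^esub> y) = J x \<ominus>\<^bsub>Y\<^esub> J y" if "x \<in> carrier X" "y \<in> carrier X" for x y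
    by (rule module_iso(2)[OF mX bij add smult zero that])
  show ?thesis
    unfolding quasi_banach_def
  proof (intro conjI)
    show "module complex_ring Y" by (rule module_iso(1)[OF mX bij add smult zero])
    show "\<forall>a\<in>carrier Y. 0 \<le> qnorm Y a \<and> (qnorm Y a = 0 \<longleftrightarrow> a = \<zero>\<^bsub>Y\<^esub>)"
      unfolding cY zero using N0 inj_on_eq_iff[OF inj] by (auto simp: N)
    show "\<forall>c. \<forall>a\<in>carrier Y. qnorm Y (c \<odot>\<^bsub>Y\<^esub> a) = cmod c * qnorm Y a"
      unfolding cY by (auto simp: N Nc sc simp flip: smult)
    show "\<exists>K. \<forall>a\<in>carrier Y. \<forall>b\<in>carrier Y. qnorm Y (a \<oplus>\<^bsub>Y\<^esub> b) \<le> K * (qnorm Y a + qnorm Y b)"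
      unfolding cY using K by (intro exI[of _ K]) (auto simp: N simp flip: add)
    show "\<forall>\<sigma>. range \<sigma> \<subseteq> carrier Y \<and> (\<forall>e>0. \<exists>M. \<forall>k\<ge>M. \<forall>m\<ge>M. qnorm Y (\<sigma> k \<ominus>\<^bsub>Y\<^esub> \<sigma> m) < e) \<longrightarrow>
        (\<exists>l\<in>carrier Y. (\<lambda>k. qnorm Y (\<sigma> k \<ominus>\<^bsub>Y\<^esub> l)) \<longlonglongrightarrow> 0)"
    proof (intro allI impI)
      fix \<sigma> :: "nat \<Rightarrow> _"
      assume a: "range \<sigma> \<subseteq> carrier Y \<and> (\<forall>e>0. \<exists>M. \<forall>k\<ge>M. \<forall>m\<ge>M. qnorm Y (\<sigma> k \<ominus>\<^bsub>Y\<^esub> \<sigma> m) < e)"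
      define \<tau> where "\<tau> k = inv_into (carrier X) J (\<sigma> k)" for k
      have \<sigma>: "\<sigma> k \<in> J ` carrier X" for k using a by (auto simp: cY)
      have \<tau>: "\<tau> k \<in> carrier X" "J (\<tau> k) = \<sigma> k" for k
        unfolding \<tau>_def using \<sigma>[of k] by (auto simp: inv_into_into f_inv_into_f)
      have e: "qnorm X (\<tau> k \<ominus>\<^bsub>X\<^esub> x) = qnorm Y (\<sigma> k \<ominus>\<^bsub>Y\<^esub> J x)" if "x \<in> carrier X" for k x
        using \<tau>[of k] that by (simp flip: N minus \<tau>(2))
      have "range \<tau> \<subseteq> carrier X \<and> (\<forall>e>0. \<exists>M. \<forall>k\<ge>M. \<forall>m\<ge>M. qnorm X (\<tau> k \<ominus>\<^bsub>X\<^esub> \<tau> m) < e)"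
        using a \<tau> by (auto simp: e)
      from mp[OF spec[OF complete] this] obtain l where "l \<in> carrier X" "(\<lambda>k. qnorm X (\<tau> k \<ominus>\<^bsub>X\<^esub> l)) \<longlonglongrightarrow> 0"
        by (elim bexE)
      then show "\<exists>l\<in>carrier Y. (\<lambda>k. qnorm Y (\<sigma> k \<ominus>\<^bsub>Y\<^esub> l)) \<longlonglongrightarrow> 0"
        by (intro bexI[of _ "J l"]) (simp_all add: e cY)
    qed
  qed
qed

lemma bounded_op_iso:
  assumes J: "isometric_iso J X X'" and T: "bounded_op X X T" and X: "module complex_ring X"
    and T': "\<And>x. x \<in> carrier X \<Longrightarrow> T' (J x) = J (T x)"
  shows "bounded_op X' X' T'"
proof -
  have add: "\<And>x y. x \<in> carrier X \<Longrightarrow> y \<in> carrier X \<Longrightarrow> J (x \<oplus>\<^bsub>X\<^esub> y) = J x \<oplus>\<^bsub>X'\<^esub> J y"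
    and smult: "\<And>c x. x \<in> carrier X \<Longrightarrow> J (c \<odot>\<^bsub>X\<^esub> x) = c \<odot>\<^bsub>X'\<^esub> J x"
    and N: "\<And>x. x \<in> carrier X \<Longrightarrow> qnorm X' (J x) = qnorm X x" and cX: "carrier X' = J ` carrier X"
    using J by (auto simp: isometric_iso_def bij_betw_def)
  interpret X: module complex_ring X by (rule X)
  have cR: "c \<in> carrier complex_ring" for c by (simp add: complex_ring_def)
  have sc: "c \<odot>\<^bsub>X\<^esub> x \<in> carrier X" if "x \<in> carrier X" for c x using X.smult_closed[OF cR that] .
  have Tc: "\<And>x. x \<in> carrier X \<Longrightarrow> T x \<in> carrier X"
    and Ta: "\<And>x y. x \<in> carrier X \<Longrightarrow> y \<in> carrier X \<Longrightarrow> T (x \<oplus>\<^bsub>X\<^esub> y) = T x \<oplus>\<^bsub>X\<^esub> T y"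
    and Ts: "\<And>c x. x \<in> carrier X \<Longrightarrow> T (c \<odot>\<^bsub>X\<^esub> x) = c \<odot>\<^bsub>X\<^esub> T x"
    using T by (auto simp: bounded_op_def)
  obtain C where C: "\<And>x. x \<in> carrier X \<Longrightarrow> qnorm X (T x) \<le> C * qnorm X x"
    using T unfolding bounded_op_def by blast
  show ?thesis
    unfolding bounded_op_def cX
  proof (intro conjI)
    show "T' \<in> J ` carrier X \<rightarrow> J ` carrier X" using T' Tc by auto
    show "\<forall>a\<in>J ` carrier X. \<forall>b\<in>J ` carrier X. T' (a \<oplus>\<^bsub>X'\<^esub> b) = T' a \<oplus>\<^bsub>X'\<^esub> T' b"
      using Ta Tc by (auto simp: T' simp flip: add)
    show "\<forall>c. \<forall>a\<in>J ` carrier X. T' (c \<odot>\<^bsub>X'\<^esub> a) = c \<odot>\<^bsub>X'\<^esub> T' a"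
      using Ts Tc by (auto simp: T' sc simp flip: smult)
    show "\<exists>C. \<forall>a\<in>J ` carrier X. qnorm X' (T' a) \<le> C * qnorm X' a"
      using C Tc by (intro exI[of _ C]) (auto simp: T' N)
  qed
qed

section \<open>Copies of spaces and pairs along an injection\<close>

lemma image_module_simps:
  assumes inj: "inj_on \<iota> (carrier V)"
  shows "carrier (image_module \<iota> V) = \<iota> ` carrier V" "\<zero>\<^bsub>image_module \<iota> V\<^esub> = \<iota> \<zero>\<^bsub>V\<^esub>"
    "x \<in> carrier V \<Longrightarrow> y \<in> carrier V \<Longrightarrow> \<iota> x \<oplus>\<^bsub>image_module \<iota> V\<^esub> \<iota> y = \<iota> (x \<oplus>\<^bsub>V\<^esub> y)"
    "x \<in> carrier V \<Longrightarrow> c \<odot>\<^bsub>image_module \<iota> V\<^esub> \<iota> x = \<iota> (c \<odot>\<^bsub>V\<^esub> x)"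
  using inj by (simp_all add: image_module_def Let_def)

lemma isometric_iso_image_space:
  assumes inj: "inj_on \<iota> (carrier X)"
  shows "isometric_iso \<iota> X (image_space \<iota> X)"
  using inj by (auto simp: isometric_iso_def image_space_def normed_subspace_simps image_module_simps bij_betw_def)

text \<open>Injectivity on the ambient space, not merely on each member, matches the decompositions
  of a vector with those of its image; the two infima are then taken over the same set of
  reals.\<close>

lemma isometric_iso_sum_space:
  assumes P: "compatible P" and inj: "inj_on \<iota> (carrier (ambient P))"
  shows "isometric_iso \<iota> (sum_space P) (sum_space (image_pair \<iota> P))"
proof -
  let ?V = "ambient P" and ?X = "space0 P" and ?Y = "space1 P" and ?P = "image_pair \<iota> P"
  have XV: "carrier ?X \<subseteq> carrier ?V" and YV: "carrier ?Y \<subseteq> carrier ?V" and V: "module complex_ring ?V"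
    using P by (auto simp: compatible_def linear_subspace_def)
  interpret V: module complex_ring ?V by (rule V)
  have SV: "carrier (sum_space P) \<subseteq> carrier ?V"
    using XV YV by (auto simp: sum_space_def normed_subspace_simps)
  have injX: "inj_on \<iota> (carrier ?X)" and injY: "inj_on \<iota> (carrier ?Y)" and injS: "inj_on \<iota> (carrier (sum_space P))"
    using inj XV YV SV inj_on_subset by blast+
  note im = image_module_simps[OF inj]
  have c: "carrier (sum_space ?P) = \<iota> ` carrier (sum_space P)"
  proof -
    have "carrier (sum_space ?P) = {a \<oplus>\<^bsub>image_module \<iota> ?V\<^esub> b | a b. a \<in> \<iota> ` carrier ?X \<and> b \<in> \<iota> ` carrier ?Y}"
      by (simp add: sum_space_def image_pair_def normed_subspace_simps image_space_def)
    also have "\<dots> = {\<iota> (x \<oplus>\<^bsub>?V\<^esub> y) | x y. x \<in> carrier ?X \<and> y \<in> carrier ?Y}"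
    proof (intro equalityI subsetI)
      fix z assume "z \<in> {a \<oplus>\<^bsub>image_module \<iota> ?V\<^esub> b | a b. a \<in> \<iota> ` carrier ?X \<and> b \<in> \<iota> ` carrier ?Y}"
      then obtain x y where "x \<in> carrier ?X" "y \<in> carrier ?Y" "z = \<iota> x \<oplus>\<^bsub>image_module \<iota> ?V\<^esub> \<iota> y" by blast
      then have "x \<in> carrier ?X" "y \<in> carrier ?Y" "z = \<iota> (x \<oplus>\<^bsub>?V\<^esub> y)" using im(3) XV YV by auto
      then show "z \<in> {\<iota> (x \<oplus>\<^bsub>?V\<^esub> y) | x y. x \<in> carrier ?X \<and> y \<in> carrier ?Y}" by blast
    next
      fix z assume "z \<in> {\<iota> (x \<oplus>\<^bsub>?V\<^esub> y) | x y. x \<in> carrier ?X \<and> y \<in> carrier ?Y}"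
      then obtain x y where xy: "x \<in> carrier ?X" "y \<in> carrier ?Y" "z = \<iota> (x \<oplus>\<^bsub>?V\<^esub> y)" by blast
      then have "x \<in> carrier ?V" "y \<in> carrier ?V" using XV YV by auto
      then have "z = \<iota> x \<oplus>\<^bsub>image_module \<iota> ?V\<^esub> \<iota> y" using xy(3) im(3) by simp
      then show "z \<in> {a \<oplus>\<^bsub>image_module \<iota> ?V\<^esub> b | a b. a \<in> \<iota> ` carrier ?X \<and> b \<in> \<iota> ` carrier ?Y}" using xy by blast
    qed
    also have "\<dots> = \<iota> ` carrier (sum_space P)"
      by (auto simp: sum_space_def normed_subspace_simps)
    finally show ?thesis .
  qed
  have n: "qnorm (sum_space ?P) (\<iota> z) = qnorm (sum_space P) z" if z: "z \<in> carrier (sum_space P)" for z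
  proof -
    have "{qnorm (space0 ?P) a + qnorm (space1 ?P) b | a b. a \<in> carrier (space0 ?P) \<and> b \<in> carrier (space1 ?P) \<and> \<iota> z = a \<oplus>\<^bsub>ambient ?P\<^esub> b}
        = {qnorm ?X x + qnorm ?Y y | x y. x \<in> carrier ?X \<and> y \<in> carrier ?Y \<and> z = x \<oplus>\<^bsub>?V\<^esub> y}" (is "?L = ?R")
    proof (intro equalityI subsetI)
      fix t assume "t \<in> ?L"
      then obtain a b where ab: "t = qnorm (space0 ?P) a + qnorm (space1 ?P) b" "a \<in> carrier (space0 ?P)" "b \<in> carrier (space1 ?P)" "\<iota> z = a \<oplus>\<^bsub>ambient ?P\<^esub> b"
        by blast
      from ab(2,3) obtain x y where x: "x \<in> carrier ?X" "a = \<iota> x" and y: "y \<in> carrier ?Y" "b = \<iota> y"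
        by (auto simp: image_pair_def image_space_def normed_subspace_simps)
      have V: "x \<in> carrier ?V" "y \<in> carrier ?V" "z \<in> carrier ?V" using x(1) y(1) z XV YV SV by auto
      have "\<iota> z = \<iota> (x \<oplus>\<^bsub>?V\<^esub> y)" using ab(4) x y V by (simp add: image_pair_def im)
      then have "z = x \<oplus>\<^bsub>?V\<^esub> y" using inj_onD[OF inj] V by simp
      moreover have "t = qnorm ?X x + qnorm ?Y y"
        using ab(1) x y injX injY by (simp add: image_pair_def image_space_def normed_subspace_simps)
      ultimately show "t \<in> ?R" using x(1) y(1) by blast
    next
      fix t assume "t \<in> ?R"
      then obtain x y where xy: "t = qnorm ?X x + qnorm ?Y y" "x \<in> carrier ?X" "y \<in> carrier ?Y" "z = x \<oplus>\<^bsub>?V\<^esub> y" by blast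
      have V: "x \<in> carrier ?V" "y \<in> carrier ?V" using xy XV YV by auto
      have "t = qnorm (space0 ?P) (\<iota> x) + qnorm (space1 ?P) (\<iota> y)" "\<iota> x \<in> carrier (space0 ?P)" "\<iota> y \<in> carrier (space1 ?P)"
        using xy injX injY by (simp_all add: image_pair_def image_space_def normed_subspace_simps)
      moreover have "\<iota> z = \<iota> x \<oplus>\<^bsub>ambient ?P\<^esub> \<iota> y" using xy(4) V by (simp add: image_pair_def im)
      ultimately show "t \<in> ?L" by blast
    qed
    then show ?thesis by (simp add: sum_space_def normed_subspace_simps)
  qed
  have o: "\<zero>\<^bsub>sum_space Q\<^esub> = \<zero>\<^bsub>ambient Q\<^esub>" "x \<oplus>\<^bsub>sum_space Q\<^esub> y = x \<oplus>\<^bsub>ambient Q\<^esub> y" "d \<odot>\<^bsub>sum_space Q\<^esub> x = d \<odot>\<^bsub>ambient Q\<^esub> x"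
    for Q :: "'z qpair" and x y d by (simp_all add: sum_space_def normed_subspace_simps)
  have a: "ambient ?P = image_module \<iota> ?V" by (simp add: image_pair_def)
  show ?thesis
    unfolding isometric_iso_def c o a
    using injS n SV by (auto simp: bij_betw_def im subset_iff)
qed

lemma compatible_image_pair:
  assumes P: "compatible P" and inj: "inj_on \<iota> (carrier (ambient P))"
  shows "compatible (image_pair \<iota> P)"
proof -
  let ?V = "ambient P"
  have V: "module complex_ring ?V" using P by (simp add: compatible_def)
  have mod: "module complex_ring (image_module \<iota> ?V)"
    by (rule module_iso(1)[OF V, where J=\<iota>]) (use inj in \<open>simp_all add: image_module_simps bij_betw_def\<close>)
  have sub: "quasi_banach (image_space \<iota> X) \<and> linear_subspace (image_space \<iota> X) (image_module \<iota> ?V)"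
    if X: "quasi_banach X" "linear_subspace X ?V" for X
  proof
    have XV: "carrier X \<subseteq> carrier ?V" using X(2) by (simp add: linear_subspace_def)
    have injX: "inj_on \<iota> (carrier X)" using inj XV by (rule inj_on_subset)
    show "quasi_banach (image_space \<iota> X)" by (rule quasi_banach_iso[OF X(1) isometric_iso_image_space[OF injX]])
    show "linear_subspace (image_space \<iota> X) (image_module \<iota> ?V)"
      using X(2) XV unfolding linear_subspace_def
      by (auto simp: image_space_def normed_subspace_simps image_module_simps[OF inj] image_module_simps[OF injX] subset_iff)
  qed
  have "quasi_banach (sum_space (image_pair \<iota> P))"
    using P by (intro quasi_banach_iso[OF _ isometric_iso_sum_space[OF P inj]]) (simp add: compatible_def)
  then show ?thesis
    using P sub[of "space0 P"] sub[of "space1 P"] mod by (simp add: compatible_def image_pair_def)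
qed

text \<open>An admissible operator becomes a morphism of the copied pair. The functor must send it
  to its restriction, which is thereby bounded on the functor's value; the equivalence of
  quasi-norms in \<open>same\<close> brings the bound back to the original space.\<close>

lemma interpolation_functor_bounded:
  assumes F: "interpolation_functor Fo Fm" and P: "compatible P" and inj: "inj_on \<iota> (carrier (ambient P))"
    and T: "admissible P P T" and XV: "carrier X \<subseteq> carrier (ambient P)" and N0: "\<And>x. 0 \<le> qnorm X x"
    and same: "same_space (image_space \<iota> X) (Fo (image_pair \<iota> P))"
  shows "\<exists>C. \<forall>x\<in>carrier X. T x \<in> carrier X \<and> qnorm X (T x) \<le> C * qnorm X x"
proof -
  let ?V = "ambient P" and ?P = "image_pair \<iota> P" and ?S = "sum_space P" and ?S' = "sum_space (image_pair \<iota> P)"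
  have P': "compatible ?P" by (rule compatible_image_pair[OF P inj])
  have mods: "module complex_ring ?S" "module complex_ring (space0 P)" "module complex_ring (space1 P)"
    using P by (auto simp: compatible_def quasi_banach_def)
  have sub: "carrier (space0 P) \<subseteq> carrier ?V" "carrier (space1 P) \<subseteq> carrier ?V" and V: "module complex_ring ?V"
    using P by (auto simp: compatible_def linear_subspace_def)
  interpret V: module complex_ring ?V by (rule V)
  have SV: "carrier ?S \<subseteq> carrier ?V" using sub by (auto simp: sum_space_def normed_subspace_simps)
  have inX: "inj_on \<iota> (carrier X)" using inj XV by (rule inj_on_subset)
  have zer: "\<zero>\<^bsub>space0 P\<^esub> = \<zero>\<^bsub>?V\<^esub>" "\<zero>\<^bsub>space1 P\<^esub> = \<zero>\<^bsub>?V\<^esub>"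
    using P by (auto simp: compatible_def linear_subspace_def)
  have z: "\<zero>\<^bsub>?V\<^esub> \<in> carrier (space0 P)" "\<zero>\<^bsub>?V\<^esub> \<in> carrier (space1 P)"
    using abelian_group.axioms(1)[OF module.axioms(2)[OF mods(2)]] abelian_group.axioms(1)[OF module.axioms(2)[OF mods(3)]]
      abelian_monoid.zero_closed zer by metis+
  \<comment> \<open>Both members contain the ambient zero and hence lie in the sum, the only place
    where the transported operator is known to follow \<open>T\<close>.\<close>
  have inS: "x \<in> carrier ?S" if "x \<in> carrier (space0 P) \<or> x \<in> carrier (space1 P)" for x
    using that
  proof
    assume x: "x \<in> carrier (space0 P)"
    then have "x = x \<oplus>\<^bsub>?V\<^esub> \<zero>\<^bsub>?V\<^esub>" using sub(1) V.r_zero by auto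
    then show ?thesis using x z(2) unfolding sum_space_def normed_subspace_simps by blast
  next
    assume x: "x \<in> carrier (space1 P)"
    then have "x = \<zero>\<^bsub>?V\<^esub> \<oplus>\<^bsub>?V\<^esub> x" using sub(2) V.l_zero by auto
    then show ?thesis using x z(1) unfolding sum_space_def normed_subspace_simps by blast
  qed
  have isoS: "isometric_iso \<iota> ?S ?S'" by (rule isometric_iso_sum_space[OF P inj])
  have cS': "carrier ?S' = \<iota> ` carrier ?S" using isoS by (simp add: isometric_iso_def bij_betw_def)
  \<comment> \<open>Restricting the domain makes the transported operator extensional, as membership
    in \<open>C2_hom\<close> demands.\<close>
  define T' where "T' = (\<lambda>a\<in>carrier ?S'. \<iota> (T (inv_into (carrier ?V) \<iota> a)))"
  have T': "T' (\<iota> x) = \<iota> (T x)" if "x \<in> carrier ?S" for x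
    using that SV inj by (auto simp: T'_def cS')
  have T'hom: "T' \<in> C2_hom ?P ?P"
    unfolding C2_hom_def admissible_def
  proof (intro CollectI conjI)
    show "T' \<in> extensional (carrier ?S')" by (simp add: T'_def)
    show "bounded_op ?S' ?S' T'"
    proof (rule bounded_op_iso[OF isoS])
      show "bounded_op ?S ?S T" using T by (simp add: admissible_def)
    qed (use mods T' in simp_all)
    show "bounded_op (space0 ?P) (space0 ?P) T'"
    proof (rule bounded_op_iso)
      show "isometric_iso \<iota> (space0 P) (space0 ?P)"
        unfolding image_pair_def using inj_on_subset[OF inj sub(1)] by (simp add: isometric_iso_image_space)
    qed (use T mods T' inS in \<open>simp_all add: admissible_def\<close>)
    show "bounded_op (space1 ?P) (space1 ?P) T'"
    proof (rule bounded_op_iso)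
      show "isometric_iso \<iota> (space1 P) (space1 ?P)"
        unfolding image_pair_def using inj_on_subset[OF inj sub(2)] by (simp add: isometric_iso_image_space)
    qed (use T mods T' inS in \<open>simp_all add: admissible_def\<close>)
  qed
  let ?F = "Fo ?P"
  have "Fm ?P ?P T' \<in> C1_hom ?F ?F" "Fm ?P ?P T' = restrict T' (carrier ?F)"
    using F P' T'hom unfolding interpolation_functor_def by blast+
  then have "bounded_op ?F ?F (restrict T' (carrier ?F))" by (simp add: C1_hom_def)
  then obtain C where C: "\<And>a. a \<in> carrier ?F \<Longrightarrow> T' a \<in> carrier ?F" "\<And>a. a \<in> carrier ?F \<Longrightarrow> qnorm ?F (T' a) \<le> C * qnorm ?F a"
    by (fastforce simp: bounded_op_def Pi_iff)
  have "\<forall>P. compatible P \<longrightarrow> quasi_banach (Fo P)"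
    using F unfolding interpolation_functor_def by (elim conjE)
  from mp[OF spec[OF this] P'] have qF: "quasi_banach ?F" .
  have "\<forall>P. compatible P \<longrightarrow> continuously_embedded (inter_space P) (Fo P) \<and> continuously_embedded (Fo P) (sum_space P)"
    using F unfolding interpolation_functor_def by (elim conjE)
  from mp[OF spec[OF this] P'] have FS: "carrier ?F \<subseteq> carrier ?S'"
    by (simp add: continuously_embedded_def linear_subspace_def)
  have F0: "0 \<le> qnorm ?F a" if "a \<in> carrier ?F" for a using qF that by (simp add: quasi_banach_def)
  have cF: "carrier ?F = \<iota> ` carrier X"
    using same by (auto simp: same_space_def continuously_embedded_def linear_subspace_def image_space_def normed_subspace_simps)
  have NI: "qnorm (image_space \<iota> X) (\<iota> x) = qnorm X x" if "x \<in> carrier X" for x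
    using that inX by (simp add: image_space_def normed_subspace_simps)
  obtain C1 where C1: "\<And>x. x \<in> carrier X \<Longrightarrow> qnorm ?F (\<iota> x) \<le> C1 * qnorm X x"
    using same NI unfolding same_space_def continuously_embedded_def by (fastforce simp: image_space_def normed_subspace_simps)
  obtain C2 where C2: "\<And>x. x \<in> carrier X \<Longrightarrow> qnorm X x \<le> C2 * qnorm ?F (\<iota> x)"
    using same NI unfolding same_space_def continuously_embedded_def cF by (fastforce simp: image_space_def normed_subspace_simps)
  have "T x \<in> carrier X \<and> qnorm X (T x) \<le> (\<bar>C2\<bar> * (\<bar>C\<bar> * \<bar>C1\<bar>)) * qnorm X x" if x: "x \<in> carrier X" for x
  proof
    have xV: "x \<in> carrier ?V" by (rule subsetD[OF XV x])
    \<comment> \<open>Embeddings are available only for the copies, so membership in the sum, and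
      afterwards membership of \<open>T x\<close> in the space, is established for images and pulled
      back by injectivity.\<close>
    have "\<iota> x \<in> carrier ?F" unfolding cF by (rule imageI[OF x])
    then have "\<iota> x \<in> \<iota> ` carrier ?S" using FS unfolding cS' by (rule rev_subsetD)
    then obtain z where z: "\<iota> x = \<iota> z" "z \<in> carrier ?S" by (rule imageE)
    have xS: "x \<in> carrier ?S" using z(2) unfolding inj_onD[OF inj z(1) xV subsetD[OF SV z(2)]] .
    have "T x \<in> carrier ?S" using T xS by (auto simp: admissible_def bounded_op_def)
    then have TV: "T x \<in> carrier ?V" using SV by blast
    have "\<iota> (T x) \<in> carrier ?F" using C(1)[of "\<iota> x"] x T'[OF xS] by (simp add: cF)
    then obtain y where y: "\<iota> (T x) = \<iota> y" "y \<in> carrier X" unfolding cF by (rule imageE)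
    show TX: "T x \<in> carrier X" using y(2) unfolding inj_onD[OF inj y(1) TV subsetD[OF XV y(2)]] .
    have "qnorm X (T x) \<le> C2 * qnorm ?F (\<iota> (T x))" by (rule C2[OF TX])
    also have "\<dots> \<le> \<bar>C2\<bar> * qnorm ?F (\<iota> (T x))"
      using F0 TX by (intro mult_right_mono) (auto simp: cF)
    also have "qnorm ?F (\<iota> (T x)) \<le> C * qnorm ?F (\<iota> x)"
      using C(2)[of "\<iota> x"] x T'[OF xS] by (simp add: cF)
    also have "\<dots> \<le> \<bar>C\<bar> * qnorm ?F (\<iota> x)" using F0 x by (intro mult_right_mono) (auto simp: cF)
    also have "qnorm ?F (\<iota> x) \<le> C1 * qnorm X x" by (rule C1[OF x])
    also have "\<dots> \<le> \<bar>C1\<bar> * qnorm X x" using N0 by (intro mult_right_mono) auto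
    finally show "qnorm X (T x) \<le> (\<bar>C2\<bar> * (\<bar>C\<bar> * \<bar>C1\<bar>)) * qnorm X x"
      by (simp add: mult_left_mono mult.assoc)
  qed
  then show ?thesis by blast
qed

section \<open>The shift operator\<close>

lemma Lp_norm_shift_le:
  fixes F :: "'a::euclidean_space \<Rightarrow> ennreal"
  assumes [measurable]: "F \<in> borel_measurable borel"
  shows "Lp_norm p lborel (\<lambda>x. F (x - v)) \<le> Lp_norm p lborel F"
proof (cases "p = \<infinity>")
  case True
  have "AE x in distr lborel borel ((+) (- v)). F x \<le> esssup lborel F"
    unfolding lborel_distr_plus using esssup_AE[of F lborel] by simp
  then have "AE x in lborel. F (x - v) \<le> esssup lborel F"
    by (subst (asm) AE_distr_iff) (simp_all add: add.commute)
  then show ?thesis using True by (simp add: Lp_norm_def esssup_I)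
next
  case False
  have "(\<integral>\<^sup>+x. ennpow (F x) r \<partial>lborel) = (\<integral>\<^sup>+x. ennpow (F (x - v)) r \<partial>lborel)" for r
    using lborel_nn_integral_affine[of 1 "\<lambda>x. ennpow (F x) r" "- v"] by simp
  then show ?thesis using False by (simp add: Lp_norm_def)
qed

text \<open>The polynomial factor is the price of translating by k + 2 units in a Schwartz seminorm,
  the geometric one the smallness of the frequency piece. Successive ratios tend to 1/2, hence are
  eventually below 3/4.\<close>

lemma summable_power_geometric: "summable (\<lambda>k. (1 + real (k + 2)) ^ N * (1 / 2) ^ k)"
proof -
  have "(\<lambda>k. (1 + inverse (real (Suc k))) ^ N) \<longlonglongrightarrow> (1 + 0) ^ N"
    by (intro tendsto_intros LIMSEQ_inverse_real_of_nat)
  then have "\<forall>\<^sub>F k in sequentially. (1 + inverse (real (Suc k))) ^ N < 3 / 2"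
    by (rule order_tendstoD(2)) simp
  then obtain M where M: "\<And>k. M \<le> k \<Longrightarrow> (1 + inverse (real (Suc k))) ^ N < 3 / 2"
    by (auto simp: eventually_sequentially)
  show ?thesis
  proof (rule summable_ratio_test[of "3 / 4" M])
    fix k assume k: "M \<le> k"
    have "1 + real (Suc k + 2) = (1 + inverse (real (Suc (k + 2)))) * (1 + real (k + 2))"
      by (simp add: field_simps)
    then have "(1 + real (Suc k + 2)) ^ N = (1 + inverse (real (Suc (k + 2)))) ^ N * (1 + real (k + 2)) ^ N"
      by (simp only: power_mult_distrib)
    also have "\<dots> \<le> 3 / 2 * (1 + real (k + 2)) ^ N"
      using M[of "k + 2"] k by (intro mult_right_mono) auto
    finally show "norm ((1 + real (Suc k + 2)) ^ N * (1 / 2) ^ Suc k) \<le> 3 / 4 * norm ((1 + real (k + 2)) ^ N * (1 / 2) ^ k)"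
      by (simp add: abs_mult)
  qed simp
qed

text \<open>The transform of \<open>\<phi> 0\<close> is 1 on an open set containing the closed unit
  ball, hence near \<open>e\<close>; its closed support lies in the open ball of radius 2, hence
  misses a neighbourhood of \<open>2 *\<^sub>R e\<close>.\<close>

lemma (in lp_family) frequency_window:
  assumes "norm (e :: real^'n) = 1"
  obtains \<delta> where "0 < \<delta>" "\<delta> \<le> 1 / 2"
    "\<And>\<zeta>. norm (\<zeta> - e) < \<delta> \<Longrightarrow> fourier (\<phi> 0) \<zeta> = 1 \<and> fourier (\<phi> 0) (2 *\<^sub>R \<zeta>) = 0"
proof -
  obtain U where U: "open U" "cball 0 1 \<subseteq> U" "\<And>\<xi>. \<xi> \<in> U \<Longrightarrow> fourier (\<phi> 0) \<xi> = 1"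
    using lp unfolding littlewood_paley_def by blast
  have "e \<in> U" using U(2) assms by auto
  with U(1) obtain d1 where d1: "0 < d1" "ball e d1 \<subseteq> U" by (rule openE)
  let ?Z = "closure {\<xi>. fourier (\<phi> 0) \<xi> \<noteq> 0}"
  have "?Z \<subseteq> ball 0 2" using lp by (simp add: littlewood_paley_def)
  then have "2 *\<^sub>R e \<in> - ?Z" using assms by auto
  with open_Compl[OF closed_closure] obtain d2 where d2: "0 < d2" "ball (2 *\<^sub>R e) d2 \<subseteq> - ?Z" by (rule openE)
  show ?thesis
  proof (rule that[of "min (1 / 2) (min d1 (d2 / 2))"])
    fix \<zeta> :: "real^'n" assume z: "norm (\<zeta> - e) < min (1 / 2) (min d1 (d2 / 2))"
    have "\<zeta> \<in> ball e d1" using z by (simp add: dist_norm norm_minus_commute)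
    moreover have "2 *\<^sub>R \<zeta> \<in> ball (2 *\<^sub>R e) d2"
    proof -
      have "dist (2 *\<^sub>R e) (2 *\<^sub>R \<zeta>) = 2 * norm (\<zeta> - e)"
        by (simp add: dist_norm norm_minus_commute flip: scaleR_diff_right)
      then show ?thesis using z by simp
    qed
    ultimately show "fourier (\<phi> 0) \<zeta> = 1 \<and> fourier (\<phi> 0) (2 *\<^sub>R \<zeta>) = 0"
      using d1 d2 U(3) closure_subset[of "{\<xi>. fourier (\<phi> 0) \<xi> \<noteq> 0}"] by blast
  qed (use d1 d2 in auto)
qed

locale lp_direction = lp_family \<phi> for \<phi> :: "nat \<Rightarrow> real^'n \<Rightarrow> complex" +
  fixes e :: "real^'n" and \<delta> :: real
  assumes e: "norm e = 1" and \<delta>: "0 < \<delta>" "\<delta> \<le> 1 / 2"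
    and window: "norm (\<zeta> - e) < \<delta> \<Longrightarrow> fourier (\<phi> 0) \<zeta> = 1 \<and> fourier (\<phi> 0) (2 *\<^sub>R \<zeta>) = 0"
begin

text \<open>The dilation squeezes the spectrum of \<open>\<phi> 0\<close>, contained in the ball of
  radius 2, into the window of radius \<open>\<delta>\<close>.\<close>

definition bump :: "real^'n \<Rightarrow> complex" where "bump = dil (\<delta> / 2) (\<phi> 0)"

text \<open>Modulation centres the spectrum at \<open>e\<close>, dilation carries it to 2^k times
  that place. Being dilates of one function, these multipliers are bounded uniformly in
  \<open>k\<close> by \<open>conv_Lp\<close>.\<close>

definition th :: "nat \<Rightarrow> real^'n \<Rightarrow> complex" where
  "th k = dil (2 ^ k) (\<lambda>x. exp (2 * pi * \<i> * complex_of_real (x \<bullet> e)) * bump x)"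

lemma bump_rapid: "rapid bump"
  unfolding bump_def using \<delta> by (intro rapid_dil phi_rapid) simp

lemma modulated_rapid: "rapid f \<Longrightarrow> rapid (\<lambda>x. exp (2 * pi * \<i> * complex_of_real (x \<bullet> v)) * f x)"
  by (rule rapid_mult_bounded[where B=1]) (auto intro!: continuous_intros)

lemma th_rapid: "rapid (th k)"
  unfolding th_def by (intro rapid_dil modulated_rapid bump_rapid) simp

lemma fourier_bump: "fourier bump \<xi> = fourier (\<phi> 0) ((2 / \<delta>) *\<^sub>R \<xi>)"
  unfolding bump_def using \<delta> by (subst fourier_dil[OF phi_rapid]) simp_all

lemma fourier_bump_zero: "\<delta> \<le> norm \<xi> \<Longrightarrow> fourier bump \<xi> = 0"
  unfolding fourier_bump by (rule fourier_phi_0_eq_0) (use \<delta> in \<open>simp add: field_simps\<close>)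

lemma fourier_bump_one: "norm \<xi> \<le> \<delta> / 2 \<Longrightarrow> fourier bump \<xi> = 1"
  unfolding fourier_bump by (rule fourier_phi_0_eq_1) (use \<delta> in \<open>simp add: field_simps\<close>)

lemma fourier_th: "fourier (th k) \<xi> = fourier bump ((1 / 2 ^ k) *\<^sub>R \<xi> - e)"
  unfolding th_def by (subst fourier_dil[OF modulated_rapid[OF bump_rapid]]) (simp, rule fourier_modulate)

lemma fourier_th_low: "2 * norm \<xi> \<le> 2 ^ k \<Longrightarrow> fourier (th k) \<xi> = 0"
proof -
  assume "2 * norm \<xi> \<le> 2 ^ k"
  then have "norm ((1 / 2 ^ k) *\<^sub>R \<xi>) \<le> 1 / 2" by (simp add: field_simps)
  then have "\<delta> \<le> norm ((1 / 2 ^ k) *\<^sub>R \<xi> - e)"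
    using norm_triangle_ineq2[of e "(1 / 2 ^ k) *\<^sub>R \<xi>"] e \<delta> unfolding norm_minus_commute[of e] by linarith
  then show ?thesis unfolding fourier_th by (rule fourier_bump_zero)
qed

text \<open>Since \<open>\<delta>\<close> is at most 1/2, points of the window have norm between 1/2
  and 3/2; for positive \<open>m\<close> the norm alone decides, and only \<open>m = 0\<close> needs
  the exact window.\<close>

lemma window_dyadic:
  assumes z: "norm (\<zeta> - e) < \<delta>"
  shows "fourier (\<phi> 0) ((1 / 2 ^ m) *\<^sub>R \<zeta>) = 1" "fourier (\<phi> 0) (2 ^ Suc m *\<^sub>R \<zeta>) = 0"
proof -
  have n: "1 / 2 \<le> norm \<zeta>" "norm \<zeta> \<le> 3 / 2"
    using norm_triangle_ineq2[of e \<zeta>] norm_triangle_ineq2[of \<zeta> e] z e \<delta> by (simp_all add: norm_minus_commute)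
  show "fourier (\<phi> 0) ((1 / 2 ^ m) *\<^sub>R \<zeta>) = 1"
  proof (cases m)
    case (Suc k)
    have "(1::real) \<le> 2 ^ k" by simp
    then have "norm \<zeta> \<le> 2 * 2 ^ k" using n(2) by linarith
    then show ?thesis using Suc by (intro fourier_phi_0_eq_1) (simp add: field_simps)
  qed (use window[OF z] in simp)
  show "fourier (\<phi> 0) (2 ^ Suc m *\<^sub>R \<zeta>) = 0"
  proof (cases m)
    case (Suc k)
    have "(1::real) * (1 / 2) \<le> 2 ^ k * norm \<zeta>" using n(1) by (intro mult_mono) auto
    then show ?thesis using Suc by (intro fourier_phi_0_eq_0) (simp add: mult_ac)
  qed (use window[OF z] in simp)
qed

lemma fourier_phi_window:
  assumes k: "1 \<le> k" and z: "norm ((1 / 2 ^ k) *\<^sub>R \<xi> - e) < \<delta>"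
  shows "fourier (\<phi> j) \<xi> = (if j = k then 1 else 0)"
proof -
  define \<zeta> where "\<zeta> = (1 / 2 ^ k) *\<^sub>R \<xi>"
  have z: "norm (\<zeta> - e) < \<delta>" using z by (simp add: \<zeta>_def)
  have xi: "\<xi> = 2 ^ k *\<^sub>R \<zeta>" by (simp add: \<zeta>_def)
  show ?thesis
  proof (cases "j = 0")
    case True
    obtain m where "k = Suc m" using k by (cases k) auto
    then show ?thesis using True window_dyadic(2)[OF z, of m] by (simp add: xi)
  next
    case False
    then have f: "fourier (\<phi> j) \<xi> = fourier (\<phi> 0) ((2 ^ k / 2 ^ j) *\<^sub>R \<zeta>) - fourier (\<phi> 0) ((2 * 2 ^ k / 2 ^ j) *\<^sub>R \<zeta>)"
      by (simp add: fourier_phi xi)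
    consider "j = k" | d where "j = k + Suc d" | d where "k = j + Suc d"
      using less_imp_Suc_add[of j k] less_imp_Suc_add[of k j] by fastforce
    then show ?thesis
    proof cases
      case 1
      then show ?thesis using window[OF z] unfolding f by simp
    next
      case 2
      have r: "(2 ^ k / 2 ^ j :: real) = 1 / 2 ^ Suc d" "(2 * 2 ^ k / 2 ^ j :: real) = 1 / 2 ^ d"
        by (simp_all add: 2 power_add)
      then show ?thesis unfolding f r window_dyadic(1)[OF z] using 2 by simp
    next
      case 3
      have r: "(2 ^ k / 2 ^ j :: real) = 2 ^ Suc d" "(2 * 2 ^ k / 2 ^ j :: real) = 2 ^ Suc (Suc d)"
        by (simp_all add: 3 power_add)
      then show ?thesis unfolding f r window_dyadic(2)[OF z] using 3 by simp
    qed
  qed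
qed

text \<open>Exact orthogonality: on the spectrum of the multiplier,
  \<open>fourier_phi_window\<close> leaves one member of the family, and it acts there as the
  identity.\<close>

lemma cnv_th_phi:
  assumes "1 \<le> k" shows "cnv (th k) (\<phi> j) = (if j = k then th k else (\<lambda>x. 0))"
proof (rule fourier_inject)
  fix \<xi> :: "real^'n"
  have "fourier (th k) \<xi> * fourier (\<phi> j) \<xi> = (if j = k then fourier (th k) \<xi> else 0)"
  proof (cases "norm ((1 / 2 ^ k) *\<^sub>R \<xi> - e) < \<delta>")
    case True
    then show ?thesis using fourier_phi_window[OF assms True] by simp
  next
    case False
    then show ?thesis by (simp add: fourier_th fourier_bump_zero)
  qed
  moreover have "fourier (\<lambda>x. 0) \<xi> = 0" by (simp add: fourier_def)
  ultimately show "fourier (cnv (th k) (\<phi> j)) \<xi> = fourier (if j = k then th k else (\<lambda>x. 0)) \<xi>"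
    by (simp add: fourier_cnv th_rapid phi_rapid)
qed (simp_all add: cnv_rapid th_rapid phi_rapid rapid_zero)

definition tht :: "nat \<Rightarrow> real^'n \<Rightarrow> complex" where "tht k w = th k (- w)"

text \<open>The offset 2 makes the spectrum of the multiplier start above frequency 2^(k+1), as the
  cutoff \<open>etat k\<close> in \<open>cnv_high_frequency\<close> requires. The reflected
  multiplier and the plus sign are those of the adjoint: on distributions this is translation by
  \<open>real (k + 2) *\<^sub>R e\<close>.\<close>

definition piece :: "nat \<Rightarrow> (real^'n \<Rightarrow> complex) \<Rightarrow> real^'n \<Rightarrow> complex" where
  "piece k g z = cnv (tht (k + 2)) g (z + real (k + 2) *\<^sub>R e)"

text \<open>The operator translates the frequency piece near \<open>2 ^ k *\<^sub>R e\<close> by \<open>k *\<^sub>R e\<close>; it is defined by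
  duality.\<close>

definition shift_op :: "'n functional \<Rightarrow> 'n functional" where
  "shift_op u g = (if g \<in> schwartz then \<Sum>k. u (piece k g) else 0)"

lemma tht_rapid: "rapid (tht k)"
  unfolding tht_def[abs_def] by (rule rapid_uminus[OF th_rapid])

lemma piece_schwartz: "g \<in> schwartz \<Longrightarrow> piece k g \<in> schwartz"
  unfolding piece_def[abs_def]
  using schwartz_shift[OF cnv_schwartz[OF tht_rapid], of g _ "- (real (k + 2) *\<^sub>R e)"] by simp

lemma piece_bound:
  obtains C where "0 < C"
    "\<And>k g. g \<in> schwartz \<Longrightarrow> schwartz_seminorm N (piece k g) \<le> C * ((1 + real (k + 2)) ^ N * (1 / 2) ^ k) * schwartz_seminorm (Suc N) g"
proof -
  obtain C where C: "0 < C"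
    "\<And>k g. g \<in> schwartz \<Longrightarrow> schwartz_seminorm N (\<lambda>x. g x - cnv (etat k) g x) \<le> C * (1 / 2) ^ k * schwartz_seminorm (Suc N) g"
    using etat_approx by blast
  let ?t = "\<lambda>x. exp (2 * pi * \<i> * complex_of_real (x \<bullet> e)) * bump x"
  define c where "c = (LINT y|lborel. (1 + norm y) ^ N * cmod (?t (- y)))"
  have c0: "0 \<le> c" unfolding c_def by (rule Bochner_Integration.integral_nonneg) simp
  have tht_eq: "tht k = dil (2 ^ k) (\<lambda>y. ?t (- y))" for k
    by (simp add: tht_def[abs_def] th_def dil_def[abs_def])
  have "schwartz_seminorm N (piece k g) \<le> ((c + 1) * C) * ((1 + real (k + 2)) ^ N * (1 / 2) ^ k) * schwartz_seminorm (Suc N) g"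
    if g: "g \<in> schwartz" for k g
  proof -
    let ?g = "\<lambda>x. g x - cnv (etat k) g x"
    have gs: "?g \<in> schwartz" by (intro schwartz_diff g cnv_schwartz etat_rapid)
    \<comment> \<open>The subtracted low-pass part is invisible to the multiplier, but what is left
      of \<open>g\<close> has size of order 2^-k.\<close>
    have eq: "cnv (tht (k + 2)) ?g = cnv (tht (k + 2)) g"
    proof (rule cnv_high_frequency[OF tht_rapid g])
      fix \<xi> :: "real^'n" assume "2 * norm \<xi> \<le> 2 ^ (k + 2)"
      then show "fourier (tht (k + 2)) \<xi> = 0"
        unfolding tht_def[abs_def] using fourier_th_low[of "- \<xi>" "k + 2"] by (simp add: fourier_uminus[OF th_rapid])
    qed
    have p: "piece k g = (\<lambda>z. cnv (tht (k + 2)) ?g (z - (- (real (k + 2) *\<^sub>R e))))"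
      unfolding eq by (simp add: piece_def[abs_def])
    have "schwartz_seminorm N (piece k g) \<le> (1 + norm (- (real (k + 2) *\<^sub>R e))) ^ N * schwartz_seminorm N (cnv (tht (k + 2)) ?g)"
      unfolding p by (intro schwartz_seminorm_shift cnv_schwartz tht_rapid gs)
    also have "norm (- (real (k + 2) *\<^sub>R e)) = real (k + 2)" using e by simp
    also have "schwartz_seminorm N (cnv (tht (k + 2)) ?g) \<le> (LINT y|lborel. (1 + norm y) ^ N * cmod (tht (k + 2) y)) * schwartz_seminorm N ?g"
      by (rule schwartz_seminorm_cnv[OF tht_rapid gs])
    also have "(LINT y|lborel. (1 + norm y) ^ N * cmod (tht (k + 2) y)) \<le> c"
      unfolding tht_eq c_def by (intro dil_integral_weight_le rapid_uminus modulated_rapid bump_rapid) (rule one_le_power, simp)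
    also have "schwartz_seminorm N ?g \<le> C * (1 / 2) ^ k * schwartz_seminorm (Suc N) g" by (rule C(2)[OF g])
    finally have "schwartz_seminorm N (piece k g) \<le> (1 + real (k + 2)) ^ N * (c * (C * (1 / 2) ^ k * schwartz_seminorm (Suc N) g))"
      using c0 schwartz_seminorm_nonneg[OF gs, of N] by (simp add: mult_left_mono mult_right_mono)
    also have "\<dots> \<le> (1 + real (k + 2)) ^ N * ((c + 1) * (C * (1 / 2) ^ k * schwartz_seminorm (Suc N) g))"
      using C(1) schwartz_seminorm_nonneg[OF g, of "Suc N"] by (intro mult_left_mono mult_right_mono) auto
    finally show ?thesis by (simp only: mult_ac)
  qed
  then show ?thesis using C(1) c0 by (intro that[of "(c + 1) * C"]) auto
qed

lemma piece_linear:
  "f \<in> schwartz \<Longrightarrow> g \<in> schwartz \<Longrightarrow> piece k (\<lambda>x. f x + g x) = (\<lambda>z. piece k f z + piece k g z)"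
  "piece k (\<lambda>x. c * f x) = (\<lambda>z. c * piece k f z)"
proof -
  assume f: "f \<in> schwartz" and g: "g \<in> schwartz"
  have i: "integrable lborel (\<lambda>y. tht (k + 2) y * h (x - y))" if "h \<in> schwartz" for h x
    using cnvr_integrable_schwartz[OF tht_rapid that, of "\<lambda>y. y"] by simp
  show "piece k (\<lambda>x. f x + g x) = (\<lambda>z. piece k f z + piece k g z)"
    unfolding piece_def[abs_def] cnv_def distrib_left
    by (intro ext Bochner_Integration.integral_add i f g)
next
  show "piece k (\<lambda>x. c * f x) = (\<lambda>z. c * piece k f z)"
    unfolding piece_def[abs_def] cnv_def mult.left_commute[of _ c] by (intro ext integral_mult_right_zero)
qed

text \<open>Absolute convergence with a bound by one fixed seminorm gives well-definedness and
  temperedness at once.\<close>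

lemma shift_op_summable:
  assumes u: "u \<in> tempered"
  obtains A N where "0 \<le> A"
    "\<And>g. g \<in> schwartz \<Longrightarrow> summable (\<lambda>k. u (piece k g)) \<and> cmod (\<Sum>k. u (piece k g)) \<le> A * schwartz_seminorm N g"
proof -
  obtain B N where B: "0 \<le> B" "\<And>f. f \<in> schwartz \<Longrightarrow> cmod (u f) \<le> B * schwartz_seminorm N f"
    using tempered_bound[OF u] by blast
  obtain C where C: "0 < C"
    "\<And>k g. g \<in> schwartz \<Longrightarrow> schwartz_seminorm N (piece k g) \<le> C * ((1 + real (k + 2)) ^ N * (1 / 2) ^ k) * schwartz_seminorm (Suc N) g"
    using piece_bound by blast
  let ?w = "\<lambda>k. (1 + real (k + 2)) ^ N * (1 / 2) ^ k"
  have w: "summable ?w" by (rule summable_power_geometric)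
  have w0: "0 \<le> suminf ?w" by (rule suminf_nonneg[OF w]) simp
  have "summable (\<lambda>k. u (piece k g)) \<and> cmod (\<Sum>k. u (piece k g)) \<le> (B * C * suminf ?w) * schwartz_seminorm (Suc N) g"
    if g: "g \<in> schwartz" for g
  proof -
    have le: "cmod (u (piece k g)) \<le> (B * C * schwartz_seminorm (Suc N) g) * ?w k" for k
      using order_trans[OF B(2)[OF piece_schwartz[OF g]] mult_left_mono[OF C(2)[OF g] B(1)], of k]
      by (simp add: mult_ac)
    have s: "summable (\<lambda>k. (B * C * schwartz_seminorm (Suc N) g) * ?w k)" by (rule summable_mult[OF w])
    have "cmod (\<Sum>k. u (piece k g)) \<le> (\<Sum>k. (B * C * schwartz_seminorm (Suc N) g) * ?w k)"
      by (rule norm_suminf_le[OF le s])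
    also have "\<dots> = (B * C * suminf ?w) * schwartz_seminorm (Suc N) g"
      by (subst suminf_mult[OF w]) (simp only: mult_ac)
    finally show ?thesis using summable_comparison_test'[OF s le] by blast
  qed
  then show ?thesis using B(1) C(1) w0 by (intro that[of "B * C * suminf ?w" "Suc N"]) auto
qed

lemma shift_op_tempered: "u \<in> tempered \<Longrightarrow> shift_op u \<in> tempered"
proof -
  assume u: "u \<in> tempered"
  obtain A N where A: "0 \<le> A"
    "\<And>g. g \<in> schwartz \<Longrightarrow> summable (\<lambda>k. u (piece k g)) \<and> cmod (\<Sum>k. u (piece k g)) \<le> A * schwartz_seminorm N g"
    by (rule shift_op_summable[OF u]) (rule that)
  show ?thesis
    unfolding tempered_def
  proof (intro CollectI conjI allI ballI impI)
    show "shift_op u f = 0" if "f \<notin> schwartz" for f using that by (simp add: shift_op_def)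
    show "shift_op u (\<lambda>x. f x + g x) = shift_op u f + shift_op u g" if f: "f \<in> schwartz" and g: "g \<in> schwartz" for f g
      using A(2)[OF f] A(2)[OF g] schwartz_add[OF f g] f g
      by (simp add: shift_op_def piece_linear(1) temperedD(2)[OF u piece_schwartz piece_schwartz] suminf_add)
    show "shift_op u (\<lambda>x. c * f x) = c * shift_op u f" if f: "f \<in> schwartz" for c f
      using A(2)[OF f] schwartz_cmult[OF f, of c] f
      by (simp add: shift_op_def piece_linear(2) temperedD(3)[OF u piece_schwartz] suminf_mult)
    have "\<forall>f\<in>schwartz. cmod (shift_op u f) \<le> A * schwartz_seminorm N f"
      using A(2) by (simp add: shift_op_def)
    then show "\<exists>C N. \<forall>f\<in>schwartz. cmod (shift_op u f) \<le> C * schwartz_seminorm N f" by blast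
  qed
qed

lemma shift_op_add:
  assumes u: "u \<in> tempered" and v: "v \<in> tempered"
  shows "shift_op (u + v) = shift_op u + shift_op v"
proof
  fix g
  show "shift_op (u + v) g = (shift_op u + shift_op v) g"
  proof (cases "g \<in> schwartz")
    case True
    have "summable (\<lambda>k. u (piece k g))" by (rule shift_op_summable[OF u]) (use True in blast)
    moreover have "summable (\<lambda>k. v (piece k g))" by (rule shift_op_summable[OF v]) (use True in blast)
    ultimately show ?thesis using True by (simp add: shift_op_def suminf_add)
  qed (simp add: shift_op_def)
qed

lemma shift_op_cmult:
  assumes u: "u \<in> tempered"
  shows "shift_op (\<lambda>f. c * u f) = (\<lambda>f. c * shift_op u f)"
proof
  fix g
  show "shift_op (\<lambda>f. c * u f) g = c * shift_op u g"
  proof (cases "g \<in> schwartz")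
    case True
    have "summable (\<lambda>k. u (piece k g))" by (rule shift_op_summable[OF u]) (use True in blast)
    then show ?thesis using True by (simp add: shift_op_def suminf_mult)
  qed (simp add: shift_op_def)
qed

text \<open>The defining series collapses by orthogonality, and duality turns the surviving term
  into a convolution evaluated at the translated point. Levels 0 and 1 belong to no piece and are
  annihilated.\<close>

lemma blk_shift_op:
  assumes u: "u \<in> tempered"
  shows "blk j (shift_op u) x = (if 2 \<le> j then LINT y|lborel. th j ((x - real j *\<^sub>R e) - y) * blk j u y else 0)"
proof -
  let ?G = "\<lambda>y. \<phi> j (x - y)"
  have G: "?G \<in> schwartz" by (rule schwartz_reflect[OF phi_schwartz])
  have pc: "piece k ?G = (\<lambda>z. cnv (th (k + 2)) (\<phi> j) (x - real (k + 2) *\<^sub>R e - z))" for k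
  proof
    fix z
    let ?y = "x - real (k + 2) *\<^sub>R e - z"
    have [measurable]: "th (k + 2) \<in> borel_measurable borel" "\<phi> j \<in> borel_measurable borel"
      by (simp_all add: rapid_measurable th_rapid phi_rapid)
    have "piece k ?G z = (LINT w|lborel. (\<lambda>w. th (k + 2) w * \<phi> j (?y - w)) (0 - w))"
      by (simp add: piece_def cnv_def tht_def algebra_simps)
    also have "\<dots> = (LINT w|lborel. th (k + 2) w * \<phi> j (?y - w))"
      by (rule lborel_integral_reflect) measurable
    finally show "piece k ?G z = cnv (th (k + 2)) (\<phi> j) ?y" by (simp add: cnv_def)
  qed
  have zero: "u (piece k ?G) = 0" if "k + 2 \<noteq> j" for k
    unfolding pc using that by (simp add: cnv_th_phi tempered_zero[OF u])
  have "blk j (shift_op u) x = (\<Sum>k. u (piece k ?G))"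
    using G by (simp add: convol_def shift_op_def)
  also have "\<dots> = (if 2 \<le> j then u (piece (j - 2) ?G) else 0)"
  proof (cases "2 \<le> j")
    case True
    have "(\<Sum>k. u (piece k ?G)) = (\<Sum>k\<in>{j - 2}. u (piece k ?G))"
      by (rule suminf_finite) (use zero True in auto)
    then show ?thesis using True by simp
  next
    case False
    then have "u (piece k ?G) = 0" for k using zero[of k] by simp
    then show ?thesis using False by simp
  qed
  finally have E: "blk j (shift_op u) x = (if 2 \<le> j then u (piece (j - 2) ?G) else 0)" .
  have I: "u (piece (j - 2) ?G) = (LINT y|lborel. th j ((x - real j *\<^sub>R e) - y) * blk j u y)" if "2 \<le> j"
  proof -
    let ?x = "x - real j *\<^sub>R e"
    have jj: "j - 2 + 2 = j" using that by simp
    have [measurable]: "th j \<in> borel_measurable borel" by (rule rapid_measurable[OF th_rapid])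
    have "piece (j - 2) ?G = (\<lambda>z. LINT y|lborel. th j (?x - y) * \<phi> j (y - z))"
    proof
      fix z
      have [measurable]: "(\<lambda>w. \<phi> j (?x - z - w)) \<in> borel_measurable borel"
        by (rule rapid_measurable[OF rapid_reflect[OF phi_rapid]])
      have "piece (j - 2) ?G z = (LINT w|lborel. th j w * \<phi> j (?x - z - w))"
        unfolding pc jj by (simp add: cnv_def)
      also have "\<dots> = (LINT y|lborel. th j (?x - y) * \<phi> j (?x - z - (?x - y)))"
        by (rule lborel_integral_reflect[symmetric]) measurable
      finally show "piece (j - 2) ?G z = (LINT y|lborel. th j (?x - y) * \<phi> j (y - z))" by simp
    qed
    then show ?thesis
      using tempered_convol_integral[OF u phi_schwartz rapid_reflect[OF th_rapid]] by simp
  qed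
  show ?thesis by (simp add: E I)
qed

text \<open>Level by level: \<open>conv_Lp\<close> bounds the multiplier uniformly, and translation
  by an amount depending on the level preserves each Lp quasi-norm.\<close>

lemma shift_op_besov:
  assumes p: "0 < p" and q: "0 < q"
  obtains C where "0 < C"
    "\<And>u. u \<in> tempered \<Longrightarrow> besov_norm \<phi> p q s (shift_op u) \<le> ennreal C * besov_norm \<phi> p q s u"
proof -
  let ?t = "\<lambda>x. exp (2 * pi * \<i> * complex_of_real (x \<bullet> e)) * bump x"
  have t: "rapid ?t" by (intro modulated_rapid bump_rapid)
  obtain C where C: "0 < C"
    "\<And>j u. u \<in> tempered \<Longrightarrow>
      Lp_norm p lborel (\<lambda>x. ennreal (cmod (LINT y|lborel. th j (x - y) * blk j u y)))
      \<le> ennreal C * Lp_norm p lborel (\<lambda>x. ennreal (cmod (blk j u x)))"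
    using conv_Lp[OF p t] unfolding th_def by blast
  have "besov_norm \<phi> p q s (shift_op u) \<le> ennreal C * besov_norm \<phi> p q s u" if u: "u \<in> tempered" for u
  proof (rule besov_norm_dominated[OF p q])
    fix j
    let ?F = "\<lambda>x. ennreal (cmod (LINT y|lborel. th j (x - y) * blk j u y))"
    have "(\<lambda>x. LINT y|lborel. th j (x - y) * blk j u y) \<in> borel_measurable borel"
      unfolding th_def by (rule conv_measurable[OF t u])
    then have Fm: "?F \<in> borel_measurable borel" by measurable
    have "Lp_norm p lborel (\<lambda>x. ennreal (cmod (blk j (shift_op u) x))) \<le> Lp_norm p lborel (\<lambda>x. ?F (x - real j *\<^sub>R e))"
    proof (rule Lp_norm_mono[OF p])
      show "(\<lambda>x. ennreal (cmod (blk j (shift_op u) x))) \<in> borel_measurable lborel"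
        by (rule blk_norm_measurable[OF shift_op_tempered[OF u]])
      show "ennreal (cmod (blk j (shift_op u) x)) \<le> ?F (x - real j *\<^sub>R e)" for x
        by (simp add: blk_shift_op[OF u])
    qed
    also have "\<dots> \<le> Lp_norm p lborel ?F" by (rule Lp_norm_shift_le[OF Fm])
    also have "\<dots> \<le> ennreal C * Lp_norm p lborel (\<lambda>x. ennreal (cmod (blk j u x)))" by (rule C(2)[OF u])
    finally show "Lp_norm p lborel (\<lambda>x. ennreal (cmod (blk j (shift_op u) x))) \<le> ennreal C * Lp_norm p lborel (\<lambda>x. ennreal (cmod (blk j u x)))" .
  qed
  then show ?thesis using C(1) that by blast
qed

lemma shift_op_besov_set:
  assumes p: "0 < p" and q: "0 < q"
  obtains C where "0 < C"
    "\<And>u. u \<in> besov_set p q s \<Longrightarrow> shift_op u \<in> besov_set p q s \<and> besov_qnorm p q s (shift_op u) \<le> C * besov_qnorm p q s u"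
proof -
  obtain C where C: "0 < C"
    "\<And>u. u \<in> tempered \<Longrightarrow> besov_norm \<phi> p q s (shift_op u) \<le> ennreal C * besov_norm \<phi> p q s u"
    by (rule shift_op_besov[OF p q]) (rule that)
  have "shift_op u \<in> besov_set p q s \<and> besov_qnorm p q s (shift_op u) \<le> C * besov_qnorm p q s u" if u: "u \<in> besov_set p q s" for u
  proof -
    have t: "u \<in> tempered" and fin: "besov_norm \<phi> p q s u < \<infinity>" using u by (auto simp: besov_set_def)
    have "ennreal C * besov_norm \<phi> p q s u = ennreal (C * besov_qnorm p q s u)"
      using fin C(1) by (simp add: besov_qnorm_def ennreal_mult)
    then have le: "besov_norm \<phi> p q s (shift_op u) \<le> ennreal (C * besov_qnorm p q s u)" using C(2)[OF t] by simp
    then have "besov_norm \<phi> p q s (shift_op u) < \<infinity>" by (rule le_less_trans) simp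
    moreover have "besov_qnorm p q s (shift_op u) \<le> C * besov_qnorm p q s u"
      unfolding besov_qnorm_def[of p q s "shift_op u"]
      by (rule enn2real_leI[OF _ le]) (use C(1) in \<open>simp add: besov_qnorm_def\<close>)
    ultimately show ?thesis using shift_op_tempered[OF t] by (simp add: besov_set_def)
  qed
  then show ?thesis using that C(1) by blast
qed

text \<open>Boundedness on the sum is inherited from the two members, because applying the operator
  to a decomposition gives a decomposition of the image.\<close>

lemma shift_op_admissible:
  assumes p: "0 < p0" "0 < p1" and q: "0 < q0" "0 < q1"
  shows "admissible (besov_pair \<phi> p0 q0 s0 p1 q1 s1) (besov_pair \<phi> p0 q0 s0 p1 q1 s1) shift_op"
proof -
  let ?P = "besov_pair \<phi> p0 q0 s0 p1 q1 s1"
  let ?A0 = "besov_set p0 q0 s0" and ?N0 = "besov_qnorm p0 q0 s0"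
  let ?A1 = "besov_set p1 q1 s1" and ?N1 = "besov_qnorm p1 q1 s1"
  note s = normed_subspace_simps tempered_module_simps
  have t: "u \<in> besov_set p q s \<Longrightarrow> u \<in> tempered" for u p q s by (simp add: besov_set_def)
  obtain C0 where C0: "0 < C0" "\<And>u. u \<in> ?A0 \<Longrightarrow> shift_op u \<in> ?A0 \<and> ?N0 (shift_op u) \<le> C0 * ?N0 u"
    by (rule shift_op_besov_set[OF p(1) q(1)]) (rule that)
  obtain C1 where C1: "0 < C1" "\<And>u. u \<in> ?A1 \<Longrightarrow> shift_op u \<in> ?A1 \<and> ?N1 (shift_op u) \<le> C1 * ?N1 u"
    by (rule shift_op_besov_set[OF p(2) q(2)]) (rule that)
  have b: "bounded_op (besov_space \<phi> p q s) (besov_space \<phi> p q s) shift_op" if pq: "0 < p" "0 < q" for p q s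
  proof -
    obtain C where "0 < C" and C: "\<And>u. u \<in> besov_set p q s \<Longrightarrow> shift_op u \<in> besov_set p q s \<and> besov_qnorm p q s (shift_op u) \<le> C * besov_qnorm p q s u"
      by (rule shift_op_besov_set[OF pq]) (rule that)
    show ?thesis
      unfolding bounded_op_def besov_space_eq s
    proof (intro conjI ballI allI)
      show "\<exists>C. \<forall>x\<in>besov_set p q s. besov_qnorm p q s (shift_op x) \<le> C * besov_qnorm p q s x" using C by blast
      show "shift_op \<in> besov_set p q s \<rightarrow> besov_set p q s" using C by (simp add: Pi_iff)
      show "shift_op (x + y) = shift_op x + shift_op y" if "x \<in> besov_set p q s" "y \<in> besov_set p q s" for x y
        using that by (intro shift_op_add t)
      show "shift_op (\<lambda>f. c * x f) = (\<lambda>f. c * shift_op x f)" if "x \<in> besov_set p q s" for c x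
        using that by (intro shift_op_cmult t)
    qed
  qed
  define A where "A = {x + y | x y. x \<in> ?A0 \<and> y \<in> ?A1}"
  define N where "N z = Inf {?N0 x + ?N1 y | x y. x \<in> ?A0 \<and> y \<in> ?A1 \<and> z = x + y}" for z
  have S: "sum_space ?P = normed_subspace tempered_module A N"
    by (simp add: sum_space_def besov_pair_def besov_space_eq s A_def N_def[abs_def])
  have tA: "z \<in> tempered" if "z \<in> A" for z
    using that tempered_add_closed t unfolding A_def by blast
  define C where "C = max C0 C1"
  have C: "0 < C" "C0 \<le> C" "C1 \<le> C" using C0(1) by (auto simp: C_def)
  have nn: "0 \<le> ?N0 x" "0 \<le> ?N1 x" for x by (simp_all add: besov_qnorm_def)
  have NT: "N (shift_op z) \<le> C * N z" if z: "z \<in> A" for z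
  proof -
    have "N (shift_op z) / C \<le> N z"
      unfolding N_def[of z]
    proof (rule cInf_greatest)
      show "{?N0 x + ?N1 y | x y. x \<in> ?A0 \<and> y \<in> ?A1 \<and> z = x + y} \<noteq> {}" using z unfolding A_def by blast
      fix r assume "r \<in> {?N0 x + ?N1 y | x y. x \<in> ?A0 \<and> y \<in> ?A1 \<and> z = x + y}"
      then obtain x y where xy: "r = ?N0 x + ?N1 y" "x \<in> ?A0" "y \<in> ?A1" "z = x + y" by blast
      have T: "shift_op z = shift_op x + shift_op y" using xy(2-4) by (simp add: shift_op_add t)
      have "N (shift_op z) \<le> ?N0 (shift_op x) + ?N1 (shift_op y)"
        unfolding N_def
      proof (rule cInf_lower)
        show "?N0 (shift_op x) + ?N1 (shift_op y) \<in> {?N0 x + ?N1 y | x y. x \<in> ?A0 \<and> y \<in> ?A1 \<and> shift_op z = x + y}"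
          using T C0(2)[OF xy(2)] C1(2)[OF xy(3)] by blast
        show "bdd_below {?N0 x + ?N1 y | x y. x \<in> ?A0 \<and> y \<in> ?A1 \<and> shift_op z = x + y}"
          by (rule bdd_belowI[of _ 0]) (use nn in \<open>auto intro: add_nonneg_nonneg\<close>)
      qed
      also have "\<dots> \<le> C0 * ?N0 x + C1 * ?N1 y" using C0(2)[OF xy(2)] C1(2)[OF xy(3)] by (intro add_mono) auto
      also have "\<dots> \<le> C * ?N0 x + C * ?N1 y" using C nn by (intro add_mono mult_right_mono) auto
      finally show "N (shift_op z) / C \<le> r" using C(1) xy(1) by (simp add: pos_divide_le_eq algebra_simps)
    qed
    then show ?thesis using C(1) by (simp add: pos_divide_le_eq mult.commute)
  qed
  have "bounded_op (sum_space ?P) (sum_space ?P) shift_op"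
    unfolding bounded_op_def S s
  proof (intro conjI ballI allI)
    have "shift_op z \<in> A" if "z \<in> A" for z
    proof -
      obtain x y where xy: "x \<in> ?A0" "y \<in> ?A1" "z = x + y" using \<open>z \<in> A\<close> unfolding A_def by blast
      have "shift_op z = shift_op x + shift_op y" using xy by (simp add: shift_op_add t)
      then show ?thesis using C0(2)[OF xy(1)] C1(2)[OF xy(2)] unfolding A_def by blast
    qed
    then show "shift_op \<in> A \<rightarrow> A" by blast
    show "\<exists>C. \<forall>x\<in>A. N (shift_op x) \<le> C * N x" using NT by blast
    show "shift_op (x + y) = shift_op x + shift_op y" if "x \<in> A" "y \<in> A" for x y
      using that by (intro shift_op_add tA)
    show "shift_op (\<lambda>f. c * x f) = (\<lambda>f. c * shift_op x f)" if "x \<in> A" for c x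
      using that by (intro shift_op_cmult tA)
  qed
  then show ?thesis using b p q by (simp add: admissible_def besov_pair_def)
qed

end

section \<open>Wave trains\<close>

definition reg :: "(real^'n \<Rightarrow> complex) \<Rightarrow> 'n functional" where
  "reg h g = (if g \<in> schwartz then LINT x|lborel. h x * g x else 0)"

lemma reg_tempered:
  assumes h: "rapid h" shows "reg h \<in> tempered"
proof -
  have i: "integrable lborel (\<lambda>x. h x * g x)" if g: "g \<in> schwartz" for g
  proof -
    have "continuous_on UNIV g" by (rule rapid_continuous[OF schwartz_rapid[OF g]])
    moreover obtain C where "\<And>x. cmod (g x) \<le> C" using rapid_bounded[OF schwartz_rapid[OF g]] by blast
    ultimately have "rapid (\<lambda>x. g x * h x)" by (intro rapid_mult_bounded[OF h])
    then show ?thesis by (simp add: mult.commute rapid_integrable)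
  qed
  have ih: "integrable lborel (\<lambda>x. cmod (h x))" using rapid_integrable[OF h] by (rule integrable_norm)
  have b: "cmod (reg h g) \<le> (LINT x|lborel. cmod (h x)) * schwartz_seminorm 0 g" if g: "g \<in> schwartz" for g
  proof -
    have "cmod (LINT x|lborel. h x * g x) \<le> (LINT x|lborel. cmod (h x) * schwartz_seminorm 0 g)"
    proof (rule cmod_integral_le)
      show "cmod (h x * g x) \<le> cmod (h x) * schwartz_seminorm 0 g" for x
        using schwartz_seminorm_ge[OF g, of "[]" 0 x] by (simp add: norm_mult mult_left_mono)
    qed (use ih in simp)
    then show ?thesis using g by (simp add: reg_def)
  qed
  show ?thesis
    unfolding tempered_def
  proof (intro CollectI conjI allI ballI impI)
    show "reg h (\<lambda>x. f x + g x) = reg h f + reg h g" if "f \<in> schwartz" "g \<in> schwartz" for f g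
      using that i schwartz_add[OF that] by (simp add: reg_def distrib_left)
    show "reg h (\<lambda>x. c * f x) = c * reg h f" if "f \<in> schwartz" for c f
      using that schwartz_cmult[OF that, of c] by (simp add: reg_def mult.left_commute)
    show "\<exists>C N. \<forall>f\<in>schwartz. cmod (reg h f) \<le> C * schwartz_seminorm N f" using b by blast
  qed (simp add: reg_def)
qed

lemma convol_reg:
  assumes "rapid h" "g \<in> schwartz" shows "convol g (reg h) = cnv g h"
proof
  fix x
  have "convol g (reg h) x = cnv h g x"
    using schwartz_reflect[OF assms(2), of x] by (simp add: convol_def reg_def cnv_def)
  then show "convol g (reg h) x = cnv g h x" using cnv_commute[OF assms(1) schwartz_rapid[OF assms(2)]] by simp
qed

text \<open>For a small exponent the decay of the function is used to a correspondingly high order,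
  at least (n + 2) / r.\<close>

lemma rapid_powr_le_wt:
  fixes f :: "real^'n \<Rightarrow> complex"
  assumes f: "rapid f" and r: "0 < r"
  obtains C where "0 < C" "\<And>x. cmod (f x) powr r \<le> C * wt x"
proof -
  obtain k :: nat where k: "(real CARD('n) + 2) / r \<le> real k" using real_arch_simple by blast
  obtain C where C: "0 < C" "\<And>x. (1 + norm x) ^ k * cmod (f x) \<le> C" by (rule rapid_bound[OF f, of k]) (rule that)
  have "cmod (f x) powr r \<le> C powr r * wt x" for x
  proof -
    have p: "0 < 1 + norm x" by simp
    have "cmod (f x) \<le> C * (1 + norm x) powr (- real k)"
      using C(2)[of x] p by (simp add: powr_minus powr_realpow field_simps)
    then have "cmod (f x) powr r \<le> (C * (1 + norm x) powr (- real k)) powr r"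
      using r by (intro powr_mono2) auto
    also have "\<dots> = C powr r * (1 + norm x) powr (- real k * r)"
      using C(1) by (simp add: powr_mult powr_powr)
    also have "\<dots> \<le> C powr r * (1 + norm x) powr (- (real DIM(real^'n) + 2))"
      using k r by (intro mult_left_mono powr_mono) (simp_all add: field_simps)
    finally show ?thesis by (simp only: wt_eq_powr)
  qed
  then show ?thesis using C(1) by (intro that[of "C powr r"]) auto
qed

text \<open>On each side of the zero of t + m, distinct indices have distinct values of the floor of
  |t + m|, so each half is a subsum of the full series; the factor 2 counts the halves.\<close>

lemma sum_inverse_square_shift_le:
  fixes I :: "nat set"
  assumes I: "finite I"
  shows "(\<Sum>m\<in>I. 1 / (1 + \<bar>t + real m\<bar>)\<^sup>2) \<le> 2 * (\<Sum>k. 1 / (1 + real k)\<^sup>2)"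
proof -
  have s: "summable (\<lambda>k. 1 / (1 + real k)\<^sup>2)"
    using inverse_power_summable[of 2, where 'a=real] summable_Suc_iff[of "\<lambda>k. inverse (real k ^ 2)"]
    by (simp add: inverse_eq_divide)
  have half: "(\<Sum>m\<in>K. 1 / (1 + \<bar>t + real m\<bar>)\<^sup>2) \<le> (\<Sum>k. 1 / (1 + real k)\<^sup>2)"
    if K: "finite K" and c: "c = 1 \<or> c = -1" and pos: "\<And>m. m \<in> K \<Longrightarrow> 0 \<le> c * (t + real m)" for K and c :: real
  proof -
    define g where "g m = nat \<lfloor>c * (t + real m)\<rfloor>" for m
    have fl: "\<lfloor>c * (t + real m)\<rfloor> = int (g m)" if "m \<in> K" for m using pos[OF that] by (simp add: g_def)
    have inj: "inj_on g K"
    proof (rule inj_onI)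
      fix m n assume mn: "m \<in> K" "n \<in> K" "g m = g n"
      have "\<lfloor>c * (t + real m)\<rfloor> = \<lfloor>c * (t + real n)\<rfloor>" using fl mn by simp
      then have "\<bar>c * (t + real m) - c * (t + real n)\<bar> < 1" by linarith
      then have "\<bar>real m - real n\<bar> < 1" using c by auto
      then show "m = n" by linarith
    qed
    have "(\<Sum>m\<in>K. 1 / (1 + \<bar>t + real m\<bar>)\<^sup>2) \<le> (\<Sum>m\<in>K. 1 / (1 + real (g m))\<^sup>2)"
    proof (rule sum_mono)
      fix m assume m: "m \<in> K"
      have "real (g m) \<le> c * (t + real m)" using fl[OF m] by linarith
      also have "\<dots> \<le> \<bar>t + real m\<bar>" using c by auto
      finally show "1 / (1 + \<bar>t + real m\<bar>)\<^sup>2 \<le> 1 / (1 + real (g m))\<^sup>2"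
        by (intro divide_left_mono power_mono) auto
    qed
    also have "\<dots> = (\<Sum>k\<in>g ` K. 1 / (1 + real k)\<^sup>2)" by (simp add: sum.reindex[OF inj])
    also have "\<dots> \<le> (\<Sum>k. 1 / (1 + real k)\<^sup>2)" by (rule sum_le_suminf[OF s]) (use K in auto)
    finally show ?thesis .
  qed
  let ?P = "{m\<in>I. 0 \<le> t + real m}" and ?N = "{m\<in>I. t + real m < 0}"
  have "(\<Sum>m\<in>I. 1 / (1 + \<bar>t + real m\<bar>)\<^sup>2) = (\<Sum>m\<in>?P \<union> ?N. 1 / (1 + \<bar>t + real m\<bar>)\<^sup>2)"
    by (rule sum.cong) auto
  also have "\<dots> = (\<Sum>m\<in>?P. 1 / (1 + \<bar>t + real m\<bar>)\<^sup>2) + (\<Sum>m\<in>?N. 1 / (1 + \<bar>t + real m\<bar>)\<^sup>2)"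
    by (rule sum.union_disjoint) (use I in auto)
  finally show ?thesis using half[of ?P 1] half[of ?N "-1"] I by auto
qed

lemma lq_norm_finite_sum:
  assumes q: "0 < q" "q \<noteq> \<infinity>" and I: "finite I" and f: "\<And>j. 0 \<le> f j"
  shows "lq_norm q (\<lambda>j. if j \<in> I then ennreal (f j) else 0) =
    ennreal ((\<Sum>j\<in>I. f j powr enn2real q) powr (1 / enn2real q))"
proof -
  have "(\<Sum>j. ennpow (if j \<in> I then ennreal (f j) else 0) (enn2real q)) =
      (\<Sum>j\<in>I. ennpow (if j \<in> I then ennreal (f j) else 0) (enn2real q))"
    by (rule suminf_finite[OF I]) simp
  also have "\<dots> = (\<Sum>j\<in>I. ennreal (f j powr enn2real q))"
    by (rule sum.cong) (simp_all add: ennpow_ennreal f)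
  also have "\<dots> = ennreal (\<Sum>j\<in>I. f j powr enn2real q)" by (rule sum_ennreal) simp
  finally show ?thesis using q by (simp add: lq_norm_def ennpow_ennreal sum_nonneg)
qed

lemma powr_growth_contradiction:
  fixes c K :: real
  assumes c: "0 < c" and ab: "\<beta> < \<alpha>" and le: "\<And>N::nat. 1 \<le> N \<Longrightarrow> c * real N powr \<alpha> \<le> K * real N powr \<beta>"
  shows False
proof -
  define M where "M = \<bar>K\<bar> / c + 1"
  have M: "1 \<le> M" using c by (simp add: M_def)
  obtain N :: nat where N: "M powr (1 / (\<alpha> - \<beta>)) < real N" using reals_Archimedean2 by blast
  have N0: "0 < real N" using N powr_ge_zero[of M "1 / (\<alpha> - \<beta>)"] by linarith
  have "M = (M powr (1 / (\<alpha> - \<beta>))) powr (\<alpha> - \<beta>)" using M ab by (simp add: powr_powr)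
  also have "\<dots> < real N powr (\<alpha> - \<beta>)" using N ab M by (intro powr_less_mono2) auto
  finally have *: "M < real N powr (\<alpha> - \<beta>)" .
  have "c * real N powr (\<alpha> - \<beta>) * real N powr \<beta> = c * real N powr \<alpha>"
    using N0 by (simp add: mult.assoc flip: powr_add)
  also have "\<dots> \<le> K * real N powr \<beta>" using N0 by (intro le) simp
  finally have "c * real N powr (\<alpha> - \<beta>) \<le> K" using N0 by simp
  moreover have "K < c * M" using c by (simp add: M_def distrib_left)
  moreover have "c * M < c * real N powr (\<alpha> - \<beta>)" using c * by simp
  ultimately show False by linarith
qed

text \<open>The Triebel-Lizorkin formula for an arbitrary sequence in place of the blocks, so that
  distributions whose blocks have the same moduli share one computation.\<close>

definition tl_norm :: "ennreal \<Rightarrow> ennreal \<Rightarrow> (nat \<Rightarrow> real^'n \<Rightarrow> ennreal) \<Rightarrow> ennreal" where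
  "tl_norm p q t =
     (if p = \<infinity> then
        (SUP (x, J)\<in>(UNIV :: (real^'n) set) \<times> (UNIV :: int set).
           ennreal (2 powr (real_of_int J * real CARD('n) / enn2real q)) *
           Lp_norm q (restrict_space lborel (ball x (2 powr - real_of_int J)))
             (\<lambda>y. lq_norm q (\<lambda>j. if max J 0 \<le> int j then t j y else 0)))
      else Lp_norm p lborel (\<lambda>x. lq_norm q (\<lambda>j. t j x)))"

lemma triebel_lizorkin_norm_eq: "triebel_lizorkin_norm \<phi> p q s f = tl_norm p q (lp_term \<phi> s f)"
  by (simp add: triebel_lizorkin_norm_def tl_norm_def)

context lp_direction
begin

text \<open>In contrast to \<open>th\<close>, the envelope is not dilated with the level. The
  spectrum still fits into the ever wider window at level \<open>j\<close>, and all waves have the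
  same modulus.\<close>

definition wave :: "nat \<Rightarrow> real^'n \<Rightarrow> complex" where
  "wave j x = exp (2 * pi * \<i> * complex_of_real (x \<bullet> (2 ^ j *\<^sub>R e))) * bump x"

lemma wave_rapid: "rapid (wave j)"
  unfolding wave_def[abs_def] by (rule modulated_rapid[OF bump_rapid])

lemma norm_wave: "cmod (wave j x) = cmod (bump x)"
  unfolding wave_def norm_mult cmod_exp_fourier by simp

lemma fourier_wave: "fourier (wave j) \<xi> = fourier bump (\<xi> - 2 ^ j *\<^sub>R e)"
  unfolding wave_def[abs_def] by (rule fourier_modulate)

text \<open>The spectrum has fixed width \<open>\<delta>\<close>; seen at scale 2^j it shrinks, and
  one halving, available from \<open>j = 1\<close> on, already puts it where the multiplier
  \<open>th j\<close> is identically 1.\<close>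

lemma fourier_wave_supp:
  assumes "1 \<le> j" "fourier (wave j) \<xi> \<noteq> 0"
  shows "norm ((1 / 2 ^ j) *\<^sub>R \<xi> - e) < \<delta>" "norm ((1 / 2 ^ j) *\<^sub>R \<xi> - e) \<le> \<delta> / 2"
proof -
  have "norm (\<xi> - 2 ^ j *\<^sub>R e) < \<delta>"
    using assms(2) fourier_bump_zero[of "\<xi> - 2 ^ j *\<^sub>R e"] unfolding fourier_wave by (rule_tac ccontr) simp
  moreover have "\<xi> - 2 ^ j *\<^sub>R e = 2 ^ j *\<^sub>R ((1 / 2 ^ j) *\<^sub>R \<xi> - e)" by (simp add: scaleR_diff_right)
  ultimately have 1: "2 ^ j * norm ((1 / 2 ^ j) *\<^sub>R \<xi> - e) < \<delta>" by simp
  have "(2::real) ^ 1 \<le> 2 ^ j" by (rule power_increasing) (use assms in auto)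
  then have "2 * norm ((1 / 2 ^ j) *\<^sub>R \<xi> - e) \<le> 2 ^ j * norm ((1 / 2 ^ j) *\<^sub>R \<xi> - e)"
    by (intro mult_right_mono) auto
  with 1 show 2: "norm ((1 / 2 ^ j) *\<^sub>R \<xi> - e) \<le> \<delta> / 2" by linarith
  then show "norm ((1 / 2 ^ j) *\<^sub>R \<xi> - e) < \<delta>" using \<delta> by linarith
qed

text \<open>The coefficients cancel the smoothness weights, so \<open>s\<close> disappears from the
  quasi-norm. The levels start at 2, the first one that the operator retains, and there are
  \<open>N\<close> of them.\<close>

definition train :: "real \<Rightarrow> nat \<Rightarrow> (nat \<Rightarrow> real^'n) \<Rightarrow> real^'n \<Rightarrow> complex" where
  "train s N a x = (\<Sum>m\<in>{2..<N + 2}. complex_of_real (2 powr - (real m * s)) * wave m (x - a m))"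

definition bumps :: "nat \<Rightarrow> (nat \<Rightarrow> real^'n) \<Rightarrow> nat \<Rightarrow> real^'n \<Rightarrow> ennreal" where
  "bumps N a m x = (if m \<in> {2..<N + 2} then ennreal (cmod (bump (x - a m))) else 0)"

lemma train_rapid: "rapid (train s N a)"
  unfolding train_def[abs_def] by (intro rapid_sum rapid_cmult rapid_shift wave_rapid)

lemma cnv_phi_train:
  "cnv (\<phi> j) (train s N a) =
    (\<lambda>x. if j \<in> {2..<N + 2} then complex_of_real (2 powr - (real j * s)) * wave j (x - a j) else 0)" (is "_ = ?W")
proof (rule fourier_inject)
  let ?w = "\<lambda>m x. wave m (x - a m)" and ?c = "\<lambda>m. complex_of_real (2 powr - (real m * s))"
  have w: "rapid (?w m)" for m by (intro rapid_shift wave_rapid)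
  show "rapid (cnv (\<phi> j) (train s N a))" by (intro cnv_rapid phi_rapid train_rapid)
  show "rapid ?W" using rapid_cmult[OF w] rapid_zero by (cases "j \<in> {2..<N + 2}") (simp_all only: if_True if_False)
  fix \<xi> :: "real^'n"
  have z: "fourier (\<phi> j) \<xi> * fourier (?w m) \<xi> = (if m = j then fourier (?w m) \<xi> else 0)" if "m \<in> {2..<N + 2}" for m
  proof (cases "fourier (wave m) \<xi> = 0")
    case False
    have m: "1 \<le> m" using that by simp
    show ?thesis using fourier_phi_window[OF m fourier_wave_supp(1)[OF m False], of j] by simp
  qed (auto simp: fourier_shift[OF wave_rapid])
  have "fourier (cnv (\<phi> j) (train s N a)) \<xi> = (\<Sum>m\<in>{2..<N + 2}. ?c m * (fourier (\<phi> j) \<xi> * fourier (?w m) \<xi>))"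
  proof -
    have "fourier (train s N a) \<xi> = (\<Sum>m\<in>{2..<N + 2}. fourier (\<lambda>x. ?c m * ?w m x) \<xi>)"
      unfolding train_def[abs_def] by (rule fourier_sum[OF rapid_cmult[OF w]])
    then show ?thesis
      unfolding fourier_cnv[OF phi_rapid train_rapid] by (simp only: fourier_cmult sum_distrib_left mult.left_commute)
  qed
  also have "\<dots> = (\<Sum>m\<in>{2..<N + 2}. if m = j then ?c m * fourier (?w m) \<xi> else 0)"
    by (rule sum.cong[OF refl]) (simp only: z split: if_split, simp)
  also have "\<dots> = (if j \<in> {2..<N + 2} then ?c j * fourier (?w j) \<xi> else 0)" by (rule sum.delta) simp
  also have "\<dots> = fourier ?W \<xi>"
    by (cases "j \<in> {2..<N + 2}") (simp_all only: if_True if_False fourier_cmult, simp add: fourier_def)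
  finally show "fourier (cnv (\<phi> j) (train s N a)) \<xi> = fourier ?W \<xi>" .
qed

text \<open>The multiplier equals 1 on the spectrum of the wave, so the operator does nothing to a
  wave except translate it.\<close>

lemma cnv_th_wave:
  assumes "1 \<le> j" shows "cnv (th j) (\<lambda>x. wave j (x - a)) = (\<lambda>x. wave j (x - a))"
proof (rule fourier_inject)
  have w: "rapid (\<lambda>x. wave j (x - a))" by (intro rapid_shift wave_rapid)
  show "rapid (cnv (th j) (\<lambda>x. wave j (x - a)))" by (intro cnv_rapid th_rapid w)
  show "rapid (\<lambda>x. wave j (x - a))" by (rule w)
  fix \<xi> :: "real^'n"
  have "fourier (th j) \<xi> * fourier (wave j) \<xi> = fourier (wave j) \<xi>"
  proof (cases "fourier (wave j) \<xi> = 0")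
    case False
    then show ?thesis
      using fourier_bump_one[OF fourier_wave_supp(2)[OF assms False]] by (simp add: fourier_th)
  qed simp
  then show "fourier (cnv (th j) (\<lambda>x. wave j (x - a))) \<xi> = fourier (\<lambda>x. wave j (x - a)) \<xi>"
    unfolding fourier_cnv[OF th_rapid w] fourier_shift[OF wave_rapid] by (subst mult.left_commute) (rule arg_cong)
qed

lemma blk_train:
  "blk j (reg (train s N a)) x = (if j \<in> {2..<N + 2} then complex_of_real (2 powr - (real j * s)) * wave j (x - a j) else 0)"
  unfolding convol_reg[OF train_rapid phi_schwartz] cnv_phi_train ..

lemma wave_term: "2 powr t * cmod (complex_of_real (2 powr - t) * wave m y) = cmod (bump y)"
  unfolding norm_mult norm_wave norm_of_real powr_minus by simp

lemma lp_term_train: "lp_term \<phi> s (reg (train s N a)) = bumps N a"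
proof (intro ext)
  fix m x
  show "lp_term \<phi> s (reg (train s N a)) m x = bumps N a m x"
    by (simp add: lp_term_def blk_train bumps_def wave_term)
qed

text \<open>With \<open>lp_term_train\<close>, this reduces the behaviour of the operator to moving
  the centres of identical bumps.\<close>

lemma lp_term_shift_train:
  "lp_term \<phi> s (shift_op (reg (train s N a))) = bumps N (\<lambda>m. a m + real m *\<^sub>R e)"
proof (intro ext)
  fix m x
  let ?c = "complex_of_real (2 powr - (real m * s))"
  have "blk m (shift_op (reg (train s N a))) x =
      (if m \<in> {2..<N + 2} then ?c * wave m (x - (a m + real m *\<^sub>R e)) else 0)"
  proof (cases "m \<in> {2..<N + 2}")
    case True
    then have m: "2 \<le> m" "1 \<le> m" by auto
    let ?x = "x - real m *\<^sub>R e" and ?w = "\<lambda>y. wave m (y - a m)"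
    have w: "rapid ?w" by (intro rapid_shift wave_rapid)
    have "blk m (shift_op (reg (train s N a))) x = (LINT y|lborel. ?c * (?w y * th m (?x - y)))"
      using True m unfolding blk_shift_op[OF reg_tempered[OF train_rapid]] blk_train by (simp add: mult_ac)
    also have "\<dots> = ?c * cnv ?w (th m) ?x" unfolding cnv_def by (rule integral_mult_right_zero)
    also have "cnv ?w (th m) ?x = cnv (th m) ?w ?x" by (rule cnv_commute[OF w th_rapid])
    also have "\<dots> = wave m (x - (a m + real m *\<^sub>R e))" unfolding cnv_th_wave[OF m(2)] by (simp add: algebra_simps)
    finally show ?thesis using True by simp
  next
    case False
    then show ?thesis unfolding blk_shift_op[OF reg_tempered[OF train_rapid]] blk_train by simp
  qed
  then show "lp_term \<phi> s (shift_op (reg (train s N a))) m x = bumps N (\<lambda>m. a m + real m *\<^sub>R e) m x"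
    by (simp add: lp_term_def bumps_def wave_term)
qed

lemma lq_norm_bumps:
  assumes "0 < q" "q \<noteq> \<infinity>"
  shows "lq_norm q (\<lambda>j. bumps N a j x) =
    ennreal ((\<Sum>j\<in>{2..<N + 2}. cmod (bump (x - a j)) powr enn2real q) powr (1 / enn2real q))"
  unfolding bumps_def by (rule lq_norm_finite_sum[OF assms]) simp_all

lemma lq_norm_gathered:
  assumes "0 < q" "q \<noteq> \<infinity>"
  shows "lq_norm q (\<lambda>j. bumps N (\<lambda>m. 0) j x) = ennreal (real N powr (1 / enn2real q) * cmod (bump x))"
proof -
  have "0 < enn2real q" using assms by (simp add: enn2real_positive_iff less_top)
  then show ?thesis unfolding lq_norm_bumps[OF assms] by (simp add: powr_mult powr_powr)
qed

text \<open>For \<open>q = \<infinity>\<close> the conventions make \<open>1 / enn2real q\<close>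
  equal to 0, and \<open>real N powr 0\<close> is 1 precisely because \<open>N\<close> is positive;
  the formula then reads correctly as a supremum.\<close>

lemma lq_norm_gathered_le:
  assumes "0 < q" "1 \<le> N"
  shows "lq_norm q (\<lambda>j. bumps N (\<lambda>m. 0) j x) \<le> ennreal (real N powr (1 / enn2real q) * cmod (bump x))"
proof (cases "q = \<infinity>")
  case True
  have "(SUP j. bumps N (\<lambda>m. 0) j x) \<le> ennreal (cmod (bump x))" by (rule SUP_least) (simp add: bumps_def)
  then show ?thesis using True assms(2) by (simp add: lq_norm_def)
next
  case False
  then show ?thesis using lq_norm_gathered[OF assms(1) False] by simp
qed

text \<open>The bump is not identically 0, since its transform is 1 at the origin, and it is
  continuous. The radius 1/2 makes translates of the ball by distinct multiples of \<open>e\<close>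
  disjoint.\<close>

lemma bump_mass:
  obtains z x0 where "0 < x0"
    "ennreal x0 \<le> (\<integral>\<^sup>+x. ennreal (cmod (bump x) powr P) * indicator (ball z (1 / 2)) x \<partial>lborel)"
proof -
  have "\<exists>z. bump z \<noteq> 0"
  proof (rule ccontr)
    assume "\<not> (\<exists>z. bump z \<noteq> 0)"
    then have "fourier bump 0 = 0" by (simp add: fourier_def)
    then show False using fourier_bump_one[of 0] \<delta> by simp
  qed
  then obtain z where z: "bump z \<noteq> 0" ..
  have "isCont (\<lambda>x. cmod (bump x) powr P) z"
    using rapid_continuous[OF bump_rapid, of UNIV] z by (intro continuous_intros) (auto simp: continuous_on_eq_continuous_at)
  then have "((\<lambda>x. cmod (bump x) powr P) \<longlongrightarrow> cmod (bump z) powr P) (nhds z)"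
    unfolding isCont_def using tendsto_at_iff_tendsto_nhds[of "\<lambda>x. cmod (bump x) powr P" z] by simp
  moreover have "cmod (bump z) powr P / 2 < cmod (bump z) powr P" using z by simp
  ultimately have "\<forall>\<^sub>F x in nhds z. cmod (bump z) powr P / 2 < cmod (bump x) powr P"
    by (rule order_tendstoD(1))
  then obtain d where d: "0 < d" "\<And>x. dist x z < d \<Longrightarrow> cmod (bump z) powr P / 2 < cmod (bump x) powr P"
    by (auto simp: eventually_nhds_metric)
  let ?d = "min d (1 / 2)" and ?k = "cmod (bump z) powr P / 2"
  have k: "0 < ?k" using z by simp
  have "ennreal (?k * measure lborel (ball z ?d)) = ennreal ?k * emeasure lborel (ball z ?d)"
  proof -
    have "emeasure lborel (ball z ?d) = ennreal (measure lborel (ball z ?d))"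
      using emeasure_lborel_ball_finite[of z ?d] by (intro emeasure_eq_ennreal_measure) auto
    then show ?thesis using k by (simp only: ennreal_mult measure_nonneg less_imp_le)
  qed
  also have "\<dots> = (\<integral>\<^sup>+x. ennreal ?k * indicator (ball z ?d) x \<partial>lborel)" by (simp add: nn_integral_cmult_indicator)
  also have "\<dots> \<le> (\<integral>\<^sup>+x. ennreal (cmod (bump x) powr P) * indicator (ball z (1 / 2)) x \<partial>lborel)"
  proof (rule nn_integral_mono)
    fix x
    show "ennreal ?k * indicator (ball z ?d) x \<le> ennreal (cmod (bump x) powr P) * indicator (ball z (1 / 2)) x"
      using d(2)[of x] by (auto simp: indicator_def dist_commute intro!: ennreal_leI less_imp_le)
  qed
  finally show ?thesis using k d(1) content_ball_pos[of ?d z] by (intro that[of "?k * measure lborel (ball z ?d)"]) auto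
qed

lemma bump_measurable [measurable]: "bump \<in> borel_measurable borel"
  by (rule rapid_measurable[OF bump_rapid])

lemma bump_powr_integral_finite:
  assumes "0 < r" obtains D where "0 < D" "(\<integral>\<^sup>+x. ennreal (cmod (bump x) powr r) \<partial>lborel) \<le> ennreal D"
proof -
  obtain C where C: "0 < C" "\<And>x. cmod (bump x) powr r \<le> C * wt x"
    by (rule rapid_powr_le_wt[OF bump_rapid assms]) (rule that)
  have "(\<integral>\<^sup>+x. ennreal (cmod (bump x) powr r) \<partial>lborel) \<le> (\<integral>\<^sup>+x. ennreal (C * wt (x::real^'n)) \<partial>lborel)"
    by (intro nn_integral_mono ennreal_leI C)
  also have "\<dots> = ennreal (LINT x|lborel. C * wt (x::real^'n))"
  proof (rule nn_integral_eq_integral)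
    show "integrable lborel (\<lambda>x. C * wt (x::real^'n))" by (intro integrable_mult_right wt_integrable)
    show "AE x in lborel. 0 \<le> C * wt (x::real^'n)" using C(1) by (intro AE_I2 mult_nonneg_nonneg) (simp_all add: wt_pos less_imp_le)
  qed
  also have "\<dots> \<le> ennreal (\<bar>LINT x|lborel. C * wt (x::real^'n)\<bar> + 1)" by (rule ennreal_leI) simp
  finally show ?thesis by (intro that[of "\<bar>LINT x|lborel. C * wt (x::real^'n)\<bar> + 1"]) auto
qed

end

section \<open>Triebel-Lizorkin norms of wave trains\<close>

lemma Lp_norm_integral_bounds:
  assumes p: "0 < p" "p \<noteq> \<infinity>" and I: "0 \<le> I"
  shows "(\<integral>\<^sup>+x. ennpow (g x) (enn2real p) \<partial>M) \<le> ennreal I \<Longrightarrow> Lp_norm p M g \<le> ennreal (I powr (1 / enn2real p))"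
    and "ennreal I \<le> (\<integral>\<^sup>+x. ennpow (g x) (enn2real p) \<partial>M) \<Longrightarrow> ennreal (I powr (1 / enn2real p)) \<le> Lp_norm p M g"
proof -
  have P: "0 < 1 / enn2real p" using p by (simp add: enn2real_positive_iff less_top)
  show "(\<integral>\<^sup>+x. ennpow (g x) (enn2real p) \<partial>M) \<le> ennreal I \<Longrightarrow> Lp_norm p M g \<le> ennreal (I powr (1 / enn2real p))"
    using ennpow_mono[OF _ P, of "\<integral>\<^sup>+x. ennpow (g x) (enn2real p) \<partial>M" "ennreal I"] p I by (simp add: Lp_norm_def ennpow_ennreal)
  show "ennreal I \<le> (\<integral>\<^sup>+x. ennpow (g x) (enn2real p) \<partial>M) \<Longrightarrow> ennreal (I powr (1 / enn2real p)) \<le> Lp_norm p M g"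
    using ennpow_mono[OF _ P, of "ennreal I" "\<integral>\<^sup>+x. ennpow (g x) (enn2real p) \<partial>M"] p I by (simp add: Lp_norm_def ennpow_ennreal)
qed

lemma enn2real_pos: "0 < p \<Longrightarrow> p \<noteq> \<infinity> \<Longrightarrow> 0 < enn2real p"
  by (simp add: enn2real_positive_iff less_top)

context lp_direction
begin

lemma ennpow_scaled_bump:
  assumes "0 < r" "0 \<le> k"
  shows "ennpow (ennreal (k * cmod (bump x))) r = ennreal (k powr r) * ennreal (cmod (bump x) powr r)"
proof -
  have "ennpow (ennreal (k * cmod (bump x))) r = ennreal (k powr r * cmod (bump x) powr r)"
    using assms by (simp add: ennpow_ennreal powr_mult)
  also have "\<dots> = ennreal (k powr r) * ennreal (cmod (bump x) powr r)" by (rule ennreal_mult) simp_all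
  finally show ?thesis .
qed

lemma tl_norm_gathered_upper:
  assumes p: "0 < p" "p \<noteq> \<infinity>" and q: "0 < q"
  obtains A where "0 < A"
    "\<And>N. 1 \<le> N \<Longrightarrow> tl_norm p q (bumps N (\<lambda>m. 0)) \<le> ennreal (A * real N powr (1 / enn2real q))"
proof -
  let ?P = "enn2real p"
  have P: "0 < ?P" by (rule enn2real_pos[OF p])
  obtain D where D: "0 < D" "(\<integral>\<^sup>+x. ennreal (cmod (bump x) powr ?P) \<partial>lborel) \<le> ennreal D"
    by (rule bump_powr_integral_finite[OF P]) (rule that)
  have "tl_norm p q (bumps N (\<lambda>m. 0)) \<le> ennreal (D powr (1 / ?P) * real N powr (1 / enn2real q))" if N: "1 \<le> N" for N
  proof -
    define k where "k = real N powr (1 / enn2real q)"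
    have k: "0 \<le> k" by (simp add: k_def)
    have "ennpow (lq_norm q (\<lambda>j. bumps N (\<lambda>m. 0) j x)) ?P \<le> ennreal (k powr ?P) * ennreal (cmod (bump x) powr ?P)" for x
      unfolding ennpow_scaled_bump[OF P k, symmetric] using lq_norm_gathered_le[OF q N, folded k_def] by (intro ennpow_mono P)
    then have "(\<integral>\<^sup>+x. ennpow (lq_norm q (\<lambda>j. bumps N (\<lambda>m. 0) j x)) ?P \<partial>lborel)
        \<le> (\<integral>\<^sup>+x. ennreal (k powr ?P) * ennreal (cmod (bump x) powr ?P) \<partial>lborel)"
      by (intro nn_integral_mono)
    also have "\<dots> = ennreal (k powr ?P) * (\<integral>\<^sup>+x. ennreal (cmod (bump x) powr ?P) \<partial>lborel)"
      by (rule nn_integral_cmult) measurable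
    also have "\<dots> \<le> ennreal (k powr ?P) * ennreal D" by (rule mult_left_mono[OF D(2)]) simp
    also have "\<dots> = ennreal (k powr ?P * D)" by (rule ennreal_mult[symmetric]) (use D in auto)
    finally have "Lp_norm p lborel (\<lambda>x. lq_norm q (\<lambda>j. bumps N (\<lambda>m. 0) j x)) \<le> ennreal ((k powr ?P * D) powr (1 / ?P))"
      by (intro Lp_norm_integral_bounds(1)[OF p]) (use D in auto)
    also have "(k powr ?P * D) powr (1 / ?P) = D powr (1 / ?P) * k"
      using P D(1) k by (simp add: powr_mult powr_powr)
    finally show ?thesis using p by (simp add: tl_norm_def k_def)
  qed
  then show ?thesis using D(1) by (intro that[of "D powr (1 / ?P)"]) auto
qed

lemma tl_norm_gathered_lower:
  assumes p: "0 < p" and q: "0 < q" "q \<noteq> \<infinity>"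
  obtains c where "0 < c"
    "\<And>N. ennreal (c * real N powr (1 / enn2real q)) \<le> tl_norm p q (bumps N (\<lambda>m. 0))"
proof -
  \<comment> \<open>The exponent of the outer integral: for \<open>p = \<infinity>\<close> the
    quasi-norm consists of local integrals with exponent \<open>q\<close>.\<close>
  define r where "r = (if p = \<infinity> then q else p)"
  have r: "0 < r" "r \<noteq> \<infinity>" using p q by (auto simp: r_def)
  let ?r = "enn2real r"
  have R: "0 < ?r" by (rule enn2real_pos[OF r])
  obtain z x0 where x0: "0 < x0"
    "ennreal x0 \<le> (\<integral>\<^sup>+x. ennreal (cmod (bump x) powr ?r) * indicator (ball z (1 / 2)) x \<partial>lborel)"
    by (rule bump_mass) (rule that)
  have [measurable]: "ball z (1 / 2) \<in> sets borel" by simp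
  have "ennreal (x0 powr (1 / ?r) * real N powr (1 / enn2real q)) \<le> tl_norm p q (bumps N (\<lambda>m. 0))" for N
  proof -
    define k where "k = real N powr (1 / enn2real q)"
    have k: "0 \<le> k" by (simp add: k_def)
    have lq: "lq_norm q (\<lambda>j. bumps N (\<lambda>m. 0) j x) = ennreal (k * cmod (bump x))" for x
      unfolding k_def by (rule lq_norm_gathered[OF q])
    have mass: "ennreal ((k powr ?r * x0) powr (1 / ?r)) \<le> Lp_norm r (restrict_space lborel S) (\<lambda>x. ennreal (k * cmod (bump x)))"
      if S: "ball z (1 / 2) \<subseteq> S" "S \<in> sets lborel" for S
    proof (rule Lp_norm_integral_bounds(2)[OF r])
      have "ennreal (k powr ?r * x0) = ennreal (k powr ?r) * ennreal x0" using x0 by (simp add: ennreal_mult)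
      also have "\<dots> \<le> ennreal (k powr ?r) * (\<integral>\<^sup>+x. ennreal (cmod (bump x) powr ?r) * indicator (ball z (1 / 2)) x \<partial>lborel)"
        by (rule mult_left_mono[OF x0(2)]) simp
      also have "\<dots> = (\<integral>\<^sup>+x. ennreal (k powr ?r) * (ennreal (cmod (bump x) powr ?r) * indicator (ball z (1 / 2)) x) \<partial>lborel)"
        by (rule nn_integral_cmult[symmetric]) measurable
      also have "\<dots> \<le> (\<integral>\<^sup>+x. ennpow (ennreal (k * cmod (bump x))) ?r * indicator S x \<partial>lborel)"
        unfolding ennpow_scaled_bump[OF R k]
        by (intro nn_integral_mono) (use S in \<open>auto simp: indicator_def\<close>)
      also have "\<dots> = (\<integral>\<^sup>+x. ennpow (ennreal (k * cmod (bump x))) ?r \<partial>restrict_space lborel S)"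
        using S(2) by (subst nn_integral_restrict_space) simp_all
      finally show "ennreal (k powr ?r * x0) \<le> (\<integral>\<^sup>+x. ennpow (ennreal (k * cmod (bump x))) ?r \<partial>restrict_space lborel S)" .
    qed (use x0 in simp)
    have kx: "(k powr ?r * x0) powr (1 / ?r) = x0 powr (1 / ?r) * k" using R x0(1) k by (simp add: powr_mult powr_powr)
    show ?thesis
    proof (cases "p = \<infinity>")
      case False
      then have "ennreal (x0 powr (1 / ?r) * k) \<le> tl_norm p q (bumps N (\<lambda>m. 0))"
        using mass[of UNIV, unfolded kx] by (simp add: tl_norm_def lq r_def Lp_norm_def nn_integral_restrict_space)
      then show ?thesis by (simp only: k_def)
    next
      case True
      have "ennreal (x0 powr (1 / ?r) * k) \<le> Lp_norm r (restrict_space lborel (ball z 1)) (\<lambda>x. ennreal (k * cmod (bump x)))"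
        using mass[of "ball z 1"] by (simp add: kx subset_ball)
      \<comment> \<open>The scale \<open>J = 0\<close> gives the unit ball, the normalizing factor
        1, and no restriction on the levels.\<close>
      also have "\<dots> = (case (z, 0) of (x, J) \<Rightarrow> ennreal (2 powr (real_of_int J * real CARD('n) / enn2real q)) *
           Lp_norm q (restrict_space lborel (ball x (2 powr - real_of_int J)))
             (\<lambda>y. lq_norm q (\<lambda>j. if max J 0 \<le> int j then bumps N (\<lambda>m. 0) j y else 0)))"
        using True by (simp add: lq r_def)
      also have "\<dots> \<le> tl_norm p q (bumps N (\<lambda>m. 0))"
        using True unfolding tl_norm_def by (simp only: if_True refl) (rule SUP_upper, simp)
      finally show ?thesis by (simp only: k_def)
    qed
  qed
  then show ?thesis using x0(1) by (intro that[of "x0 powr (1 / ?r)"]) auto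
qed

text \<open>Around each centre only the bump placed there is kept, and it is at most the inner
  quasi-norm. These regions are disjoint, so the integrals of p-th powers add up to \<open>N\<close>
  times a fixed mass.\<close>

lemma tl_norm_spread_lower:
  assumes p: "0 < p" "p \<noteq> \<infinity>" and q: "0 < q"
  obtains c where "0 < c"
    "\<And>N. ennreal (c * real N powr (1 / enn2real p)) \<le> tl_norm p q (bumps N (\<lambda>m. real m *\<^sub>R e))"
proof -
  let ?P = "enn2real p"
  have P: "0 < ?P" by (rule enn2real_pos[OF p])
  obtain z x0 where x0: "0 < x0"
    "ennreal x0 \<le> (\<integral>\<^sup>+x. ennreal (cmod (bump x) powr ?P) * indicator (ball z (1 / 2)) x \<partial>lborel)"
    by (rule bump_mass) (rule that)
  have [measurable]: "ball z (1 / 2) \<in> sets borel" by simp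
  define g where "g y = ennreal (cmod (bump y) powr ?P) * indicator (ball z (1 / 2)) y" for y
  have gm [measurable]: "g \<in> borel_measurable borel" unfolding g_def[abs_def] by measurable
  have "ennreal (x0 powr (1 / ?P) * real N powr (1 / ?P)) \<le> tl_norm p q (bumps N (\<lambda>m. real m *\<^sub>R e))" for N
  proof -
    let ?I = "{2..<N + 2}" and ?a = "\<lambda>m. real m *\<^sub>R e"
    have shift: "(\<integral>\<^sup>+x. g (x - ?a m) \<partial>lborel) = (\<integral>\<^sup>+x. g x \<partial>lborel)" for m
      using lborel_nn_integral_affine[of 1 g "- ?a m"] by simp
    have "ennreal (real N * x0) = (\<Sum>m\<in>?I. ennreal x0)" using x0(1) by (simp add: ennreal_mult ennreal_of_nat_eq_real_of_nat)
    also have "\<dots> \<le> (\<Sum>m\<in>?I. \<integral>\<^sup>+x. g (x - ?a m) \<partial>lborel)"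
      unfolding shift using x0(2) by (intro sum_mono) (simp add: g_def[abs_def])
    also have "\<dots> = (\<integral>\<^sup>+x. (\<Sum>m\<in>?I. g (x - ?a m)) \<partial>lborel)" by (rule nn_integral_sum[symmetric]) measurable
    also have "\<dots> \<le> (\<integral>\<^sup>+x. ennpow (lq_norm q (\<lambda>j. bumps N ?a j x)) ?P \<partial>lborel)"
    proof (rule nn_integral_mono)
      fix x
      show "(\<Sum>m\<in>?I. g (x - ?a m)) \<le> ennpow (lq_norm q (\<lambda>j. bumps N ?a j x)) ?P"
      proof (cases "\<exists>m0\<in>?I. x - ?a m0 \<in> ball z (1 / 2)")
        case True
        then obtain m0 where m0: "m0 \<in> ?I" "x - ?a m0 \<in> ball z (1 / 2)" by blast
        have "g (x - ?a m) = (if m = m0 then g (x - ?a m0) else 0)" for m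
        proof (cases "m = m0 \<or> x - ?a m \<notin> ball z (1 / 2)")
          case False
          then have "dist (x - ?a m) (x - ?a m0) < 1 / 2 + 1 / 2"
            using m0(2) dist_triangle_less_add[of "x - ?a m" z "1 / 2" "x - ?a m0" "1 / 2"] by (simp add: dist_commute)
          moreover have "dist (x - ?a m) (x - ?a m0) = \<bar>real m0 - real m\<bar>"
            using e by (simp add: dist_norm flip: scaleR_diff_left)
          ultimately have "m = m0" by linarith
          with False show ?thesis by simp
        qed (auto simp: g_def)
        then have "(\<Sum>m\<in>?I. g (x - ?a m)) = (\<Sum>m\<in>?I. if m = m0 then g (x - ?a m0) else 0)" by (intro sum.cong refl)
        also have "\<dots> = g (x - ?a m0)" using m0(1) by simp
        also have "\<dots> = ennpow (bumps N ?a m0 x) ?P" using m0 by (simp add: g_def bumps_def ennpow_ennreal)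
        also have "\<dots> \<le> ennpow (lq_norm q (\<lambda>j. bumps N ?a j x)) ?P" by (rule ennpow_mono[OF lq_norm_ge[OF q] P])
        finally show ?thesis .
      next
        case False
        then have "(\<Sum>m\<in>?I. g (x - ?a m)) = 0" by (intro sum.neutral) (simp add: g_def)
        then show ?thesis by simp
      qed
    qed
    finally have "ennreal ((real N * x0) powr (1 / ?P)) \<le> Lp_norm p lborel (\<lambda>x. lq_norm q (\<lambda>j. bumps N ?a j x))"
      by (intro Lp_norm_integral_bounds(2)[OF p]) (use x0 in auto)
    then show ?thesis using p(2) x0(1) by (simp add: tl_norm_def powr_mult mult.commute)
  qed
  then show ?thesis using x0(1) by (intro that[of "x0 powr (1 / ?P)"]) auto
qed

text \<open>Projecting onto the line spanned by \<open>e\<close> turns the decay of the bump into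
  inverse squares at unit-spaced points, whose sum is bounded wherever the points start.\<close>

lemma overlap_bound:
  assumes r: "0 < r"
  obtains B where "0 < B" "\<And>I x. finite I \<Longrightarrow> (\<Sum>m\<in>I. cmod (bump (x + real m *\<^sub>R e)) powr r) \<le> B"
proof -
  obtain C where C: "0 < C" "\<And>x. cmod (bump x) powr r \<le> C * wt x"
    by (rule rapid_powr_le_wt[OF bump_rapid r]) (rule that)
  let ?Z = "\<Sum>k. 1 / (1 + real k)\<^sup>2"
  have wt2: "wt y \<le> 1 / (1 + \<bar>y \<bullet> e\<bar>)\<^sup>2" for y :: "real^'n"
  proof -
    have "\<bar>y \<bullet> e\<bar> \<le> norm y" using Cauchy_Schwarz_ineq2[of y e] e by simp
    then have "(1 + \<bar>y \<bullet> e\<bar>)\<^sup>2 \<le> (1 + norm y)\<^sup>2" by (intro power_mono) auto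
    also have "\<dots> \<le> (1 + norm y) ^ (DIM(real^'n) + 2)" by (rule power_increasing) auto
    finally show ?thesis unfolding wt_def inverse_eq_divide by (intro divide_left_mono mult_pos_pos zero_less_power) auto
  qed
  have ee: "e \<bullet> e = 1" using e by (simp add: norm_eq_sqrt_inner)
  have main: "(\<Sum>m\<in>I. cmod (bump (x + real m *\<^sub>R e)) powr r) \<le> C * (2 * ?Z)" if I: "finite I" for I x
  proof -
    have "(\<Sum>m\<in>I. cmod (bump (x + real m *\<^sub>R e)) powr r) \<le> (\<Sum>m\<in>I. C * (1 / (1 + \<bar>x \<bullet> e + real m\<bar>)\<^sup>2))"
    proof (rule sum_mono)
      fix m
      have "cmod (bump (x + real m *\<^sub>R e)) powr r \<le> C * wt (x + real m *\<^sub>R e)" by (rule C(2))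
      also have "\<dots> \<le> C * (1 / (1 + \<bar>(x + real m *\<^sub>R e) \<bullet> e\<bar>)\<^sup>2)" by (rule mult_left_mono[OF wt2]) (use C in simp)
      finally show "cmod (bump (x + real m *\<^sub>R e)) powr r \<le> C * (1 / (1 + \<bar>x \<bullet> e + real m\<bar>)\<^sup>2)"
        by (simp add: inner_add_left ee)
    qed
    also have "\<dots> \<le> C * (2 * ?Z)"
      unfolding sum_distrib_left[symmetric] by (rule mult_left_mono[OF sum_inverse_square_shift_le[OF I]]) (use C in simp)
    finally show ?thesis .
  qed
  show ?thesis
  proof (rule that[of "max 1 (C * (2 * ?Z))"])
    fix I :: "nat set" and x
    assume "finite I"
    then show "(\<Sum>m\<in>I. cmod (bump (x + real m *\<^sub>R e)) powr r) \<le> max 1 (C * (2 * ?Z))"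
      using main by (intro max.coboundedI2)
  qed simp
qed

text \<open>The overlap bound controls the inner sum everywhere; integrating over a ball of radius
  2^-J contributes its volume, which the factor 2^(J n / q) cancels after the q-th root.\<close>

lemma tl_norm_spread_upper_infinite:
  assumes q: "0 < q" "q \<noteq> \<infinity>"
  obtains A where "0 < A" "\<And>N. tl_norm \<infinity> q (bumps N (\<lambda>m. - (real m *\<^sub>R e))) \<le> ennreal A"
proof -
  let ?r = "enn2real q"
  have r: "0 < ?r" by (rule enn2real_pos[OF q])
  obtain B where B: "0 < B" "\<And>I x. finite I \<Longrightarrow> (\<Sum>m\<in>I. cmod (bump (x + real m *\<^sub>R e)) powr ?r) \<le> B"
    by (rule overlap_bound[OF r]) (rule that)
  define V where "V = unit_ball_vol (real CARD('n))"
  have V: "0 < V" by (simp add: V_def)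
  have "tl_norm \<infinity> q (bumps N (\<lambda>m. - (real m *\<^sub>R e))) \<le> ennreal ((B * V) powr (1 / ?r))" for N
    unfolding tl_norm_def if_P[OF refl]
  proof (rule SUP_least, clarify)
    fix x :: "real^'n" and J :: int
    let ?R = "2 powr - real_of_int J" and ?I = "{j\<in>{2..<N + 2}. max J 0 \<le> int j}"
    let ?M = "restrict_space lborel (ball x ?R)"
    let ?f = "\<lambda>y. lq_norm q (\<lambda>j. if max J 0 \<le> int j then bumps N (\<lambda>m. - (real m *\<^sub>R e)) j y else 0)"
    have f: "ennpow (?f y) ?r \<le> ennreal B" for y
    proof -
      have "?f y = lq_norm q (\<lambda>j. if j \<in> ?I then ennreal (cmod (bump (y + real j *\<^sub>R e))) else 0)"
        by (rule arg_cong[of _ _ "lq_norm q"]) (auto simp: bumps_def)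
      also have "\<dots> = ennreal ((\<Sum>j\<in>?I. cmod (bump (y + real j *\<^sub>R e)) powr ?r) powr (1 / ?r))"
        by (rule lq_norm_finite_sum[OF q]) auto
      finally have "ennpow (?f y) ?r = ennreal (\<Sum>j\<in>?I. cmod (bump (y + real j *\<^sub>R e)) powr ?r)"
        using r by (simp add: ennpow_ennreal powr_powr sum_nonneg)
      also have "\<dots> \<le> ennreal B" by (intro ennreal_leI B(2)) simp
      finally show ?thesis .
    qed
    have c: "measure lborel (ball x ?R) = V * 2 powr (- real_of_int J * real CARD('n))"
      unfolding V_def by (subst content_ball) (simp_all add: powr_powr flip: powr_realpow)
    have "(\<integral>\<^sup>+y. ennpow (?f y) ?r \<partial>?M) \<le> (\<integral>\<^sup>+y. ennreal B \<partial>?M)" by (intro nn_integral_mono f)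
    also have "\<dots> = ennreal B * emeasure lborel (ball x ?R)" by (simp add: emeasure_restrict_space space_restrict_space)
    also have "emeasure lborel (ball x ?R) = ennreal (measure lborel (ball x ?R))"
      using emeasure_lborel_ball_finite[of x ?R] by (intro emeasure_eq_ennreal_measure) auto
    also have "ennreal B * \<dots> = ennreal (B * V * 2 powr (- real_of_int J * real CARD('n)))"
      unfolding c using B(1) V by (simp add: mult.assoc flip: ennreal_mult)
    finally have "Lp_norm q ?M ?f \<le> ennreal ((B * V * 2 powr (- real_of_int J * real CARD('n))) powr (1 / ?r))"
      by (intro Lp_norm_integral_bounds(1)[OF q]) (use B V in auto)
    also have "(B * V * 2 powr (- real_of_int J * real CARD('n))) powr (1 / ?r)
        = (B * V) powr (1 / ?r) * 2 powr (- (real_of_int J * real CARD('n) / ?r))"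
      using B(1) V by (simp add: powr_mult powr_powr)
    finally have "ennreal (2 powr (real_of_int J * real CARD('n) / ?r)) * Lp_norm q ?M ?f
        \<le> ennreal (2 powr (real_of_int J * real CARD('n) / ?r)) *
          ennreal ((B * V) powr (1 / ?r) * 2 powr (- (real_of_int J * real CARD('n) / ?r)))"
      by (rule mult_left_mono) simp
    also have "\<dots> = ennreal ((B * V) powr (1 / ?r))"
      by (subst ennreal_mult[symmetric]) (simp_all add: mult.left_commute flip: powr_add)
    finally show "ennreal (2 powr (real_of_int J * real CARD('n) / ?r)) * Lp_norm q ?M ?f \<le> ennreal ((B * V) powr (1 / ?r))" .
  qed
  then show ?thesis using B(1) V by (intro that[of "(B * V) powr (1 / ?r)"]) auto
qed

text \<open>Let S be the sum of the q-th powers of the bumps. As \<open>q < p\<close>, S^(p/q) is at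
  most B^(p/q - 1) S, where B is the overlap bound, and S integrates to \<open>N\<close> times the
  integral of one bump.\<close>

lemma tl_norm_spread_upper:
  assumes q: "0 < q" and qp: "q < p" and p: "p \<noteq> \<infinity>"
  obtains A where "0 < A"
    "\<And>N. tl_norm p q (bumps N (\<lambda>m. - (real m *\<^sub>R e))) \<le> ennreal (A * real N powr (1 / enn2real p))"
proof -
  let ?P = "enn2real p" and ?r = "enn2real q"
  have q': "q \<noteq> \<infinity>" using qp by auto
  have p': "0 < p" using q qp by (rule less_trans)
  have r: "0 < ?r" by (rule enn2real_pos[OF q q'])
  have P: "0 < ?P" by (rule enn2real_pos[OF p' p])
  have rP: "?r < ?P" using qp q' p by (cases p; cases q) (auto simp: ennreal_less_iff)
  obtain B where B: "0 < B" "\<And>I x. finite I \<Longrightarrow> (\<Sum>m\<in>I. cmod (bump (x + real m *\<^sub>R e)) powr ?r) \<le> B"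
    by (rule overlap_bound[OF r]) (rule that)
  obtain D where D: "0 < D" "(\<integral>\<^sup>+x. ennreal (cmod (bump x) powr ?r) \<partial>lborel) \<le> ennreal D"
    by (rule bump_powr_integral_finite[OF r]) (rule that)
  define B' where "B' = B powr (?P / ?r - 1)"
  have B': "0 < B'" using B(1) by (simp add: B'_def)
  have "tl_norm p q (bumps N (\<lambda>m. - (real m *\<^sub>R e))) \<le> ennreal ((B' * D) powr (1 / ?P) * real N powr (1 / ?P))" for N
  proof -
    let ?I = "{2..<N + 2}" and ?a = "\<lambda>m. - (real m *\<^sub>R e)"
    let ?b = "\<lambda>m x. cmod (bump (x + real m *\<^sub>R e)) powr ?r"
    have pt: "ennpow (lq_norm q (\<lambda>j. bumps N ?a j x)) ?P \<le> ennreal B' * (\<Sum>m\<in>?I. ennreal (?b m x))" for x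
    proof -
      define S where "S = (\<Sum>m\<in>?I. ?b m x)"
      have S: "0 \<le> S" "S \<le> B" unfolding S_def by (intro sum_nonneg B(2); simp)+
      have "ennpow (lq_norm q (\<lambda>j. bumps N ?a j x)) ?P = ennreal (S powr (?P / ?r))"
        unfolding lq_norm_bumps[OF q q'] using r by (simp add: S_def ennpow_ennreal powr_powr)
      also have "S powr (?P / ?r) = S powr (?P / ?r - 1) * S"
        using S(1) by (cases "S = 0") (simp_all add: powr_diff)
      also have "ennreal \<dots> \<le> ennreal (B' * S)"
        unfolding B'_def using S rP r by (intro ennreal_leI mult_right_mono powr_mono2) auto
      also have "\<dots> = ennreal B' * ennreal S" using B' S(1) by (simp add: ennreal_mult)
      also have "ennreal S = (\<Sum>m\<in>?I. ennreal (?b m x))" unfolding S_def by (rule sum_ennreal[symmetric]) simp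
      finally show ?thesis .
    qed
    have shift: "(\<integral>\<^sup>+x. ennreal (?b m x) \<partial>lborel) = (\<integral>\<^sup>+x. ennreal (cmod (bump x) powr ?r) \<partial>lborel)" for m
      using lborel_nn_integral_affine[of 1 "\<lambda>x. ennreal (cmod (bump x) powr ?r)" "real m *\<^sub>R e"] by (simp add: add.commute)
    have "(\<integral>\<^sup>+x. ennpow (lq_norm q (\<lambda>j. bumps N ?a j x)) ?P \<partial>lborel) \<le> (\<integral>\<^sup>+x. ennreal B' * (\<Sum>m\<in>?I. ennreal (?b m x)) \<partial>lborel)"
      by (intro nn_integral_mono pt)
    also have "\<dots> = ennreal B' * (\<integral>\<^sup>+x. (\<Sum>m\<in>?I. ennreal (?b m x)) \<partial>lborel)" by (rule nn_integral_cmult) measurable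
    also have "(\<integral>\<^sup>+x. (\<Sum>m\<in>?I. ennreal (?b m x)) \<partial>lborel) = (\<Sum>m\<in>?I. \<integral>\<^sup>+x. ennreal (?b m x) \<partial>lborel)"
      by (rule nn_integral_sum) measurable
    also have "\<dots> \<le> (\<Sum>m\<in>?I. ennreal D)" unfolding shift by (intro sum_mono D(2))
    also have "\<dots> = ennreal (real N * D)" using D(1) by (simp add: ennreal_mult ennreal_of_nat_eq_real_of_nat)
    also have "ennreal B' * \<dots> = ennreal (B' * D * real N)"
      using B' D(1) by (subst ennreal_mult[symmetric]) (auto simp: mult_ac)
    finally have "(\<integral>\<^sup>+x. ennpow (lq_norm q (\<lambda>j. bumps N ?a j x)) ?P \<partial>lborel) \<le> ennreal (B' * D * real N)"
      by (simp add: mult_left_mono)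
    then have "Lp_norm p lborel (\<lambda>x. lq_norm q (\<lambda>j. bumps N ?a j x)) \<le> ennreal ((B' * D * real N) powr (1 / ?P))"
      by (intro Lp_norm_integral_bounds(1)[OF p' p]) (use B' D in auto)
    then show ?thesis using p B' D(1) by (simp add: tl_norm_def powr_mult)
  qed
  then show ?thesis using B' D(1) by (intro that[of "(B' * D) powr (1 / ?P)"]) auto
qed

lemma shift_op_bound_transfer:
  assumes bd: "\<And>u. u \<in> carrier (triebel_lizorkin_space \<phi> p q s) \<Longrightarrow>
      shift_op u \<in> carrier (triebel_lizorkin_space \<phi> p q s) \<and>
      qnorm (triebel_lizorkin_space \<phi> p q s) (shift_op u) \<le> C * qnorm (triebel_lizorkin_space \<phi> p q s) u"
    and U: "tl_norm p q (bumps N a) \<le> ennreal U" "0 \<le> U"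
    and L: "ennreal L \<le> tl_norm p q (bumps N (\<lambda>m. a m + real m *\<^sub>R e))" "0 \<le> L"
  shows "L \<le> \<bar>C\<bar> * U"
proof -
  let ?u = "reg (train s N a)" and ?n = "triebel_lizorkin_norm \<phi> p q s"
  have n: "?n ?u = tl_norm p q (bumps N a)" "?n (shift_op ?u) = tl_norm p q (bumps N (\<lambda>m. a m + real m *\<^sub>R e))"
    by (simp_all only: triebel_lizorkin_norm_eq lp_term_train lp_term_shift_train)
  have "?n ?u < \<infinity>" unfolding n using U(1) by (rule le_less_trans) simp
  then have "?u \<in> carrier (triebel_lizorkin_space \<phi> p q s)"
    using reg_tempered[OF train_rapid] by (simp add: triebel_lizorkin_space_def normed_subspace_simps)
  from bd[OF this] have T: "?n (shift_op ?u) < \<infinity>" "enn2real (?n (shift_op ?u)) \<le> C * enn2real (?n ?u)"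
    by (simp_all add: triebel_lizorkin_space_def normed_subspace_simps)
  have "L = enn2real (ennreal L)" using L(2) by simp
  also have "\<dots> \<le> enn2real (?n (shift_op ?u))" using L(1) T(1) unfolding n by (intro enn2real_mono) auto
  also have "\<dots> \<le> C * enn2real (?n ?u)" by (rule T(2))
  also have "\<dots> \<le> \<bar>C\<bar> * enn2real (?n ?u)" by (intro mult_right_mono) auto
  also have "\<dots> \<le> \<bar>C\<bar> * U" unfolding n by (intro mult_left_mono enn2real_leI U) auto
  finally show ?thesis .
qed

text \<open>An infinite larger exponent is covered by the conventions that its real value is 0 and
  that division by 0 gives 0.\<close>

lemma inverse_exponent_less:
  assumes "0 < p" "p < q" shows "1 / enn2real q < 1 / enn2real p"
proof -
  have p: "p \<noteq> \<infinity>" using assms(2) by auto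
  have P: "0 < enn2real p" by (rule enn2real_pos[OF assms(1) p])
  show ?thesis
  proof (cases "q = \<infinity>")
    case False
    then have "enn2real p < enn2real q" using assms p by (cases p; cases q) (auto simp: ennreal_less_iff)
    then show ?thesis using P by (intro divide_strict_left_mono) auto
  qed (use P in simp)
qed

lemma shift_op_unbounded:
  assumes p: "0 < p" and q: "0 < q" and pq: "p \<noteq> q"
    and bd: "\<And>u. u \<in> carrier (triebel_lizorkin_space \<phi> p q s) \<Longrightarrow>
      shift_op u \<in> carrier (triebel_lizorkin_space \<phi> p q s) \<and>
      qnorm (triebel_lizorkin_space \<phi> p q s) (shift_op u) \<le> C * qnorm (triebel_lizorkin_space \<phi> p q s) u"
  shows False
proof (cases "p < q")
  case True
  then have p': "p \<noteq> \<infinity>" by auto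
  obtain A where A: "0 < A"
    "\<And>N. 1 \<le> N \<Longrightarrow> tl_norm p q (bumps N (\<lambda>m. 0)) \<le> ennreal (A * real N powr (1 / enn2real q))"
    by (rule tl_norm_gathered_upper[OF p p' q]) (rule that)
  obtain c where c: "0 < c"
    "\<And>N. ennreal (c * real N powr (1 / enn2real p)) \<le> tl_norm p q (bumps N (\<lambda>m. real m *\<^sub>R e))"
    by (rule tl_norm_spread_lower[OF p p' q]) (rule that)
  have "c * real N powr (1 / enn2real p) \<le> (\<bar>C\<bar> * A) * real N powr (1 / enn2real q)" if "1 \<le> N" for N
    using shift_op_bound_transfer[OF bd A(2)[OF that], of "c * real N powr (1 / enn2real p)"] c A(1)
    by (simp add: mult.assoc)
  then show False by (rule powr_growth_contradiction[OF c(1) inverse_exponent_less[OF p True]])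
next
  case False
  then have qp: "q < p" using pq by simp
  then have q': "q \<noteq> \<infinity>" by auto
  \<comment> \<open>For \<open>p = \<infinity>\<close> the exponent \<open>1 / enn2real p\<close> is
    0, so a bound independent of \<open>N\<close> already has the required form.\<close>
  obtain A where A: "0 < A"
    "\<And>N. 1 \<le> N \<Longrightarrow> tl_norm p q (bumps N (\<lambda>m. - (real m *\<^sub>R e))) \<le> ennreal (A * real N powr (1 / enn2real p))"
  proof (cases "p = \<infinity>")
    case True
    obtain A where "0 < A" "\<And>N. tl_norm \<infinity> q (bumps N (\<lambda>m. - (real m *\<^sub>R e))) \<le> ennreal A"
      by (rule tl_norm_spread_upper_infinite[OF q q']) (rule that)
    then show ?thesis using True by (intro that[of A]) auto
  next
    case False
    obtain A where "0 < A" "\<And>N. tl_norm p q (bumps N (\<lambda>m. - (real m *\<^sub>R e))) \<le> ennreal (A * real N powr (1 / enn2real p))"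
      by (rule tl_norm_spread_upper[OF q qp False]) (rule that)
    then show ?thesis by (intro that[of A]) auto
  qed
  obtain c where c: "0 < c"
    "\<And>N. ennreal (c * real N powr (1 / enn2real q)) \<le> tl_norm p q (bumps N (\<lambda>m. 0))"
    by (rule tl_norm_gathered_lower[OF p q q']) (rule that)
  have "c * real N powr (1 / enn2real q) \<le> (\<bar>C\<bar> * A) * real N powr (1 / enn2real p)" if "1 \<le> N" for N
    using shift_op_bound_transfer[OF bd A(2)[OF that], of "c * real N powr (1 / enn2real q)"] c A(1)
    by (simp add: mult.assoc)
  then show False by (rule powr_growth_contradiction[OF c(1) inverse_exponent_less[OF q qp]])
qed

end

theorem corollary2:
  fixes \<phi> :: "nat \<Rightarrow> real^'n \<Rightarrow> complex" and p q :: ennreal and s :: real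
    and \<iota> :: "'n functional \<Rightarrow> 'u"
  assumes "littlewood_paley \<phi>" and "0 < p" and "0 < q" and "p \<noteq> q"
    and "inj_on \<iota> tempered"
  shows "(\<nexists>Fo Fm p0 p1 q0 q1 s0 s1.
            interpolation_functor Fo Fm \<and> 0 < p0 \<and> 0 < p1 \<and> 0 < q0 \<and> 0 < q1 \<and>
            same_space (image_space \<iota> (triebel_lizorkin_space \<phi> p q s))
              (Fo (image_pair \<iota> (besov_pair \<phi> p0 q0 s0 p1 q1 s1)))) \<and>
         (\<nexists>p0 p1 q0 q1 s0 s1.
            0 < p0 \<and> 0 < p1 \<and> 0 < q0 \<and> 0 < q1 \<and>
            set_interpolation_space (triebel_lizorkin_space \<phi> p q s)
              (besov_pair \<phi> p0 q0 s0 p1 q1 s1))"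
proof -
  interpret lp_family \<phi> by (unfold_locales) (rule assms(1))
  \<comment> \<open>The index type is inhabited, which supplies a coordinate direction; this is
    where the dimension is at least 1.\<close>
  obtain i :: 'n where True by blast
  define e :: "real^'n" where "e = axis i 1"
  have e: "norm e = 1" by (simp add: e_def norm_axis_1)
  obtain \<delta> where d: "0 < \<delta>" "\<delta> \<le> 1 / 2"
    "\<And>\<zeta>. norm (\<zeta> - e) < \<delta> \<Longrightarrow> fourier (\<phi> 0) \<zeta> = 1 \<and> fourier (\<phi> 0) (2 *\<^sub>R \<zeta>) = 0"
    by (rule frequency_window[OF e]) (rule that)
  interpret lp_direction \<phi> e \<delta> by unfold_locales (use e d in auto)
  let ?X = "triebel_lizorkin_space \<phi> p q s"
  have sub: "carrier ?X \<subseteq> tempered" and nn: "0 \<le> qnorm ?X x" for x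
    by (auto simp: triebel_lizorkin_space_def normed_subspace_simps)
  show ?thesis
  proof (intro conjI notI; elim exE conjE)
    fix Fo Fm p0 p1 q0 q1 s0 s1
    assume F: "interpolation_functor Fo Fm" and pos: "0 < p0" "0 < p1" "0 < q0" "0 < q1"
      and same: "same_space (image_space \<iota> ?X) (Fo (image_pair \<iota> (besov_pair \<phi> p0 q0 s0 p1 q1 s1)))"
    let ?P = "besov_pair \<phi> p0 q0 s0 p1 q1 s1"
    have amb: "carrier (ambient ?P) = tempered" by (simp add: besov_pair_def tempered_module_def)
    have "\<exists>C. \<forall>x\<in>carrier ?X. shift_op x \<in> carrier ?X \<and> qnorm ?X (shift_op x) \<le> C * qnorm ?X x"
    proof (rule interpolation_functor_bounded[OF F])
      show "compatible ?P" by (rule compatible_besov_pair[OF pos])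
      show "admissible ?P ?P shift_op" by (rule shift_op_admissible[OF pos])
    qed (use assms(5) sub nn same in \<open>simp_all only: amb\<close>)
    then obtain C where "\<And>x. x \<in> carrier ?X \<Longrightarrow> shift_op x \<in> carrier ?X \<and> qnorm ?X (shift_op x) \<le> C * qnorm ?X x" by blast
    then show False by (rule shift_op_unbounded[OF assms(2-4)])
  next
    fix p0 p1 q0 q1 s0 s1
    assume pos: "0 < p0" "0 < p1" "0 < q0" "0 < q1"
      and set: "set_interpolation_space ?X (besov_pair \<phi> p0 q0 s0 p1 q1 s1)"
    let ?P = "besov_pair \<phi> p0 q0 s0 p1 q1 s1"
    have "\<forall>T. admissible ?P ?P T \<longrightarrow> bounded_op ?X ?X T" using set unfolding set_interpolation_space_def by (elim conjE)
    from mp[OF spec[OF this] shift_op_admissible[OF pos]] have b: "bounded_op ?X ?X shift_op" .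
    then obtain C where "\<And>x. x \<in> carrier ?X \<Longrightarrow> shift_op x \<in> carrier ?X \<and> qnorm ?X (shift_op x) \<le> C * qnorm ?X x"
      unfolding bounded_op_def Pi_iff by blast
    then show False by (rule shift_op_unbounded[OF assms(2-4)])
  qed
qed

end
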